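(* Let $A$ be an essentially regular algebra of dimension two that is not PI (does not satisfy a polynomial identity). If $M$ is a finite-dimensional simple $A$-module, then $M$ is $1$-dimensional.
   Context: $K$ is an algebraically closed field of characteristic zero, all algebras are $K$-algebras, and dimension of a module means $K$-dimension. An algebra $A=K\langle x_1,\dots,x_n\mid f_1,\dots,f_m\rangle$ is given by generators $x_i$, all of degree 1, and polynomial relations $f_j$. For a noncommutative polynomial $f$ of degree $\alpha$, its homogenization $\hat f$ is obtained by multiplying each monomial of degree $\beta\le\alpha$ occurring in $f$ by $x_0^{\alpha-\beta}$, where $x_0$ is a new central indeterminate. The homogenization $H(A)$ is the $K$-algebra on $x_0,x_1,\dots,x_n$ with relations $\hat f_1,\dots,\hat f_m$ and $x_0x_i-x_ix_0$ for all $i$. A connected graded algebra $B$ is (Artin–Schelter) regular of dimension $d$ if it has finite global dimension $d$, finite Gelfand–Kirillov dimension, and is AS-Gorenstein, i.e. $\operatorname{Ext}_B^i(K_B,B)$ is $0$ for $i\ne d$ and $\cong {}_BK$ for $i=d$, where $K_B=B/B_+$ is the trivial module. $A$ is essentially regular of dimension $d$ if $H(A)$ is regular of dimension $d+1$. Standing assumption: when $A$ is essentially regular, $x_0$ is not a zero divisor in $H(A)$. *)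

theory Defs
  imports
    "Jordan_Normal_Form.VS_Connect"
    "HOL-Algebra.QuotRing"
    "HOL-Library.Poly_Mapping"
    "HOL-Library.Extended_Nat"
    "HOL-Library.Extended_Real"
begin

hide_const (open) Modules.module_hom

text \<open>
  The ground field is a type \<open>'k\<close>, used as a ring record through \<^term>\<open>class_ring\<close>.
  Everything else lives on carrier sets.  A \<open>K\<close>-algebra is a record of type
  \<open>('k, 'a) module\<close> (a ring together with a scalar multiplication by \<open>'k\<close>); a module over a ring
  with elements of type \<open>'a\<close> is a record of type \<open>('a, 'm) module\<close> whose fields
  \<open>mult\<close> and \<open>one\<close> carry no information.
\<close>

section \<open>Modules over noncommutative rings\<close>

text \<open>The library locale \<^locale>\<open>module\<close> without its requirement that \<open>R\<close> be commutative.\<close>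

definition left_module :: "('a, 'r) ring_scheme \<Rightarrow> ('a, 'm, 's) module_scheme \<Rightarrow> bool" where
  "left_module R M \<longleftrightarrow> ring R \<and> abelian_group M \<and> Module.module_axioms R M"

text \<open>Right \<open>R\<close>-modules are represented as left modules over the opposite ring.\<close>

definition opp :: "('a, 'r) ring_scheme \<Rightarrow> ('a, 'r) ring_scheme" where
  "opp R = R\<lparr>mult := (\<lambda>x y. y \<otimes>\<^bsub>R\<^esub> x)\<rparr>"

definition regular_module :: "('a, 'r) ring_scheme \<Rightarrow> ('a, 'a) module" where
  "regular_module R = \<lparr>carrier = carrier R, mult = mult R, one = \<one>\<^bsub>R\<^esub>, zero = \<zero>\<^bsub>R\<^esub>,
     add = add R, smult = mult R\<rparr>"

definition quot_module :: "('a, 'm) module \<Rightarrow> 'm set \<Rightarrow> ('a, 'm set) module" where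
  "quot_module M N = \<lparr>carrier = a_rcosets\<^bsub>M\<^esub> N, mult = undefined, one = undefined, zero = N,
     add = set_add M, smult = (\<lambda>r X. \<Union>x\<in>X. N +>\<^bsub>M\<^esub> (r \<odot>\<^bsub>M\<^esub> x))\<rparr>"

definition module_iso :: "('a, 'r) ring_scheme \<Rightarrow> ('a, 'm) module \<Rightarrow> ('a, 'n) module \<Rightarrow> bool" where
  "module_iso R M N \<longleftrightarrow> (\<exists>f \<in> module_hom R M N. bij_betw f (carrier M) (carrier N))"

definition zero_module :: "('a, 'm) module \<Rightarrow> bool" where
  "zero_module M \<longleftrightarrow> carrier M = {\<zero>\<^bsub>M\<^esub>}"

definition simple_module :: "('a, 'r) ring_scheme \<Rightarrow> ('a, 'm) module \<Rightarrow> bool" where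
  "simple_module R M \<longleftrightarrow> left_module R M \<and> \<not> zero_module M \<and>
     (\<forall>N. Module.submodule N R M \<longrightarrow> N = {\<zero>\<^bsub>M\<^esub>} \<or> N = carrier M)"

section \<open>Projective resolutions and global dimension\<close>

text \<open>
  HOL cannot quantify over all modules of a ring inside a definition, so the quantifiers below range
  over the modules whose elements have type \<open>nat \<Rightarrow> 'a\<close>, where \<open>'a\<close> is the element type of the ring.
  If \<open>'a\<close> has at least two elements, this loses nothing: the type \<open>nat \<Rightarrow> 'a\<close> is infinite, so up
  to isomorphism it accommodates every module of cardinality at most that of \<open>nat \<Rightarrow> 'a\<close>, in
  particular every cyclic module, and for each module \<open>M\<close> it accommodates also the free module on
  the set of elements of \<open>M\<close>.  Hence every such module has a projective resolution by such modules,
  lifting against such modules is ordinary projectivity, and the supremum of the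
  projective dimensions is the ordinary global dimension, since the latter is attained on
  cyclic modules (Auslander).
\<close>

type_synonym 'a amod = "('a, nat \<Rightarrow> 'a) module"

definition projective :: "('a, 'r) ring_scheme \<Rightarrow> 'a amod \<Rightarrow> bool" where
  "projective R P \<longleftrightarrow> left_module R P \<and>
     (\<forall>(N :: 'a amod) (N' :: 'a amod) g f.
        left_module R N \<and> left_module R N' \<and>
        g \<in> module_hom R N N' \<and> g ` carrier N = carrier N' \<and> f \<in> module_hom R P N' \<longrightarrow>
        (\<exists>h \<in> module_hom R P N. \<forall>p \<in> carrier P. g (h p) = f p))"

text \<open>\<open>\<dots> \<rightarrow> P 2 \<rightarrow> P 1 \<rightarrow> P 0 \<rightarrow> M \<rightarrow> 0\<close> is exact, with \<open>d i : P (i + 1) \<rightarrow> P i\<close> and \<open>e : P 0 \<rightarrow> M\<close>.\<close>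

definition projective_resolution ::
  "('a, 'r) ring_scheme \<Rightarrow> ('a, 'm) module \<Rightarrow> (nat \<Rightarrow> 'a amod) \<Rightarrow>
   (nat \<Rightarrow> (nat \<Rightarrow> 'a) \<Rightarrow> (nat \<Rightarrow> 'a)) \<Rightarrow> ((nat \<Rightarrow> 'a) \<Rightarrow> 'm) \<Rightarrow> bool" where
  "projective_resolution R M P d e \<longleftrightarrow>
     (\<forall>i. projective R (P i)) \<and>
     (\<forall>i. d i \<in> module_hom R (P (Suc i)) (P i)) \<and>
     e \<in> module_hom R (P 0) M \<and>
     e ` carrier (P 0) = carrier M \<and>
     d 0 ` carrier (P 1) = {p \<in> carrier (P 0). e p = \<zero>\<^bsub>M\<^esub>} \<and>
     (\<forall>i. d (Suc i) ` carrier (P (Suc (Suc i))) = {p \<in> carrier (P (Suc i)). d i p = \<zero>\<^bsub>P i\<^esub>})"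

definition proj_dim :: "('a, 'r) ring_scheme \<Rightarrow> ('a, 'm) module \<Rightarrow> enat" where
  "proj_dim R M =
     Inf (enat ` {n. \<exists>P d e. projective_resolution R M P d e \<and> (\<forall>i>n. zero_module (P i))})"

definition left_gldim :: "('a, 'r) ring_scheme \<Rightarrow> enat" where
  "left_gldim R = Sup {proj_dim R M | M :: 'a amod. left_module R M}"

definition right_gldim :: "('a, 'r) ring_scheme \<Rightarrow> enat" where
  "right_gldim R = left_gldim (opp R)"

section \<open>The left modules \<open>Ext\<^sub>R\<^sup>i(M, R)\<close> for a right module \<open>M\<close>\<close>

text \<open>
  \<open>Hom\<^sub>R(P, R)\<close> for a right \<open>R\<close>-module \<open>P\<close>, a left \<open>R\<close>-module through the left multiplication of \<open>R\<close>
  on itself.  Homomorphisms are made extensional so that equality of elements is equality on \<open>P\<close>.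
\<close>

definition dual_module :: "('a, 'r) ring_scheme \<Rightarrow> ('a, 'p) module \<Rightarrow> ('a, 'p \<Rightarrow> 'a) module" where
  "dual_module R P = \<lparr>
     carrier = module_hom (opp R) P (regular_module (opp R)) \<inter> extensional (carrier P),
     mult = undefined, one = undefined,
     zero = (\<lambda>p \<in> carrier P. \<zero>\<^bsub>R\<^esub>),
     add = (\<lambda>f g. \<lambda>p \<in> carrier P. f p \<oplus>\<^bsub>R\<^esub> g p),
     smult = (\<lambda>r f. \<lambda>p \<in> carrier P. r \<otimes>\<^bsub>R\<^esub> f p)\<rparr>"

definition cocycles ::
  "('a, 'r) ring_scheme \<Rightarrow> (nat \<Rightarrow> ('a, 'p) module) \<Rightarrow> (nat \<Rightarrow> 'p \<Rightarrow> 'p) \<Rightarrow> nat \<Rightarrow> ('p \<Rightarrow> 'a) set" where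
  "cocycles R P d i =
     {f \<in> carrier (dual_module R (P i)). \<forall>p \<in> carrier (P (Suc i)). f (d i p) = \<zero>\<^bsub>R\<^esub>}"

definition coboundaries ::
  "('a, 'r) ring_scheme \<Rightarrow> (nat \<Rightarrow> ('a, 'p) module) \<Rightarrow> (nat \<Rightarrow> 'p \<Rightarrow> 'p) \<Rightarrow> nat \<Rightarrow> ('p \<Rightarrow> 'a) set" where
  "coboundaries R P d i = (case i of
       0 \<Rightarrow> {\<zero>\<^bsub>dual_module R (P 0)\<^esub>}
     | Suc j \<Rightarrow> (\<lambda>g. \<lambda>p \<in> carrier (P (Suc j)). g (d j p)) ` carrier (dual_module R (P j)))"

text \<open>As usual, \<open>Ext\<close> depends on the chosen projective resolution only up to isomorphism.\<close>

definition ext_ring ::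
  "('a, 'r) ring_scheme \<Rightarrow> ('a, 'm) module \<Rightarrow> nat \<Rightarrow> ('a, ((nat \<Rightarrow> 'a) \<Rightarrow> 'a) set) module" where
  "ext_ring R M i =
     (let (P, d, e) = (SOME (P, d, e). projective_resolution (opp R) M P d e)
      in quot_module ((dual_module R (P i))\<lparr>carrier := cocycles R P d i\<rparr>) (coboundaries R P d i))"

section \<open>Algebras\<close>

definition k_algebra :: "('k :: field, 'a) module \<Rightarrow> bool" where
  "k_algebra B \<longleftrightarrow> ring B \<and> vectorspace class_ring B \<and>
     (\<forall>c. \<forall>a \<in> carrier B. \<forall>b \<in> carrier B.
        (c \<odot>\<^bsub>B\<^esub> a) \<otimes>\<^bsub>B\<^esub> b = c \<odot>\<^bsub>B\<^esub> (a \<otimes>\<^bsub>B\<^esub> b) \<and> a \<otimes>\<^bsub>B\<^esub> (c \<odot>\<^bsub>B\<^esub> b) = c \<odot>\<^bsub>B\<^esub> (a \<otimes>\<^bsub>B\<^esub> b))"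

text \<open>The vector space underlying a module over an algebra.\<close>

definition restrict_scalars :: "('k :: field, 'a) module \<Rightarrow> ('a, 'm) module \<Rightarrow> ('k, 'm) module" where
  "restrict_scalars A M = \<lparr>carrier = carrier M, mult = mult M, one = \<one>\<^bsub>M\<^esub>, zero = \<zero>\<^bsub>M\<^esub>,
     add = add M, smult = (\<lambda>c m. (c \<odot>\<^bsub>A\<^esub> \<one>\<^bsub>A\<^esub>) \<odot>\<^bsub>M\<^esub> m)\<rparr>"

definition list_prod :: "('a, 'r) ring_scheme \<Rightarrow> 'a list \<Rightarrow> 'a" where
  "list_prod R xs = foldr (mult R) xs \<one>\<^bsub>R\<^esub>"

text \<open>For \<open>V\<close> the span of \<open>S\<close>, this is the dimension of \<open>K + V + V\<^sup>2 + \<dots> + V\<^sup>n\<close>.\<close>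

definition growth :: "('k :: field, 'a) module \<Rightarrow> 'a set \<Rightarrow> nat \<Rightarrow> nat" where
  "growth B S n = vectorspace.dim class_ring
     (B\<lparr>carrier := LinearCombinations.module.span class_ring B {list_prod B xs | xs. set xs \<subseteq> S \<and> length xs \<le> n}\<rparr>)"

definition GKdim :: "('k :: field, 'a) module \<Rightarrow> ereal" where
  "GKdim B = (SUP S \<in> {S. finite S \<and> S \<subseteq> carrier B}.
     limsup (\<lambda>n. ereal (log (real n) (real (growth B S n)))))"

section \<open>Artin--Schelter regular algebras\<close>

text \<open>The homogeneous decompositions of \<open>b\<close>, with respect to subspaces \<open>G 0, G 1, \<dots>\<close>.\<close>

definition decomposition :: "('k, 'a) module \<Rightarrow> (nat \<Rightarrow> 'a set) \<Rightarrow> 'a \<Rightarrow> (nat \<Rightarrow> 'a) \<Rightarrow> bool" where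
  "decomposition B G b c \<longleftrightarrow> (\<forall>i. c i \<in> G i) \<and> finite {i. c i \<noteq> \<zero>\<^bsub>B\<^esub>} \<and>
     b = (\<Oplus>\<^bsub>B\<^esub>i \<in> {i. c i \<noteq> \<zero>\<^bsub>B\<^esub>}. c i)"

definition connected_graded :: "('k :: field, 'a) module \<Rightarrow> (nat \<Rightarrow> 'a set) \<Rightarrow> bool" where
  "connected_graded B G \<longleftrightarrow> k_algebra B \<and>
     (\<forall>i. VectorSpace.subspace class_ring (G i) B) \<and>
     (\<forall>b \<in> carrier B. \<exists>!c. decomposition B G b c) \<and>
     (\<forall>i j. \<forall>a \<in> G i. \<forall>b \<in> G j. a \<otimes>\<^bsub>B\<^esub> b \<in> G (i + j)) \<and>
     G 0 = {c \<odot>\<^bsub>B\<^esub> \<one>\<^bsub>B\<^esub> | c. True} \<and> \<one>\<^bsub>B\<^esub> \<noteq> \<zero>\<^bsub>B\<^esub>"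

definition positive_part :: "('k, 'a) module \<Rightarrow> (nat \<Rightarrow> 'a set) \<Rightarrow> 'a set" where
  "positive_part B G = {b \<in> carrier B. \<exists>c. decomposition B G b c \<and> c 0 = \<zero>\<^bsub>B\<^esub>}"

definition left_trivial :: "('k, 'a) module \<Rightarrow> (nat \<Rightarrow> 'a set) \<Rightarrow> ('a, 'a set) module" where
  "left_trivial B G = quot_module (regular_module B) (positive_part B G)"

definition right_trivial :: "('k, 'a) module \<Rightarrow> (nat \<Rightarrow> 'a set) \<Rightarrow> ('a, 'a set) module" where
  "right_trivial B G = quot_module (regular_module (opp B)) (positive_part B G)"

definition AS_Gorenstein :: "nat \<Rightarrow> ('k, 'a) module \<Rightarrow> (nat \<Rightarrow> 'a set) \<Rightarrow> bool" where
  "AS_Gorenstein d B G \<longleftrightarrow>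
     (\<forall>i. i \<noteq> d \<longrightarrow> zero_module (ext_ring B (right_trivial B G) i)) \<and>
     module_iso B (ext_ring B (right_trivial B G) d) (left_trivial B G)"

text \<open>For a connected graded algebra the left and the right global dimension coincide.\<close>

definition AS_regular :: "nat \<Rightarrow> ('k :: field, 'a) module \<Rightarrow> (nat \<Rightarrow> 'a set) \<Rightarrow> bool" where
  "AS_regular d B G \<longleftrightarrow> connected_graded B G \<and>
     left_gldim B = enat d \<and> right_gldim B = enat d \<and>
     GKdim B < \<infinity> \<and> AS_Gorenstein d B G"

section \<open>Free algebras and presentations\<close>

text \<open>
  Noncommutative monomials.  The monoid is written additively because that is what the convolution
  product of \<^theory>\<open>HOL-Library.Poly_Mapping\<close> expects; the sum of two words is their concatenation.
\<close>

datatype 'v nc_word = NC_Word (letters: "'v list")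

instantiation nc_word :: (type) monoid_add
begin

definition zero_nc_word :: "'v nc_word" where "zero_nc_word = NC_Word []"

definition plus_nc_word :: "'v nc_word \<Rightarrow> 'v nc_word \<Rightarrow> 'v nc_word" where
  "plus_nc_word u w = NC_Word (letters u @ letters w)"

instance
  by standard (simp_all add: zero_nc_word_def plus_nc_word_def)

end

type_synonym ('v, 'k) nc_poly = "'v nc_word \<Rightarrow>\<^sub>0 'k"

definition nc_var :: "'v \<Rightarrow> ('v, 'k :: field) nc_poly" where
  "nc_var v = Poly_Mapping.single (NC_Word [v]) 1"

definition free_algebra :: "('k :: field, ('v, 'k) nc_poly) module" where
  "free_algebra = \<lparr>carrier = UNIV, mult = (*), one = 1, zero = 0, add = (+),
     smult = (\<lambda>c f. Poly_Mapping.single 0 c * f)\<rparr>"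

definition quot_algebra :: "('k, 'a) module \<Rightarrow> 'a set \<Rightarrow> ('k, 'a set) module" where
  "quot_algebra A I = \<lparr>carrier = carrier (A Quot I), mult = mult (A Quot I), one = \<one>\<^bsub>A Quot I\<^esub>,
     zero = \<zero>\<^bsub>A Quot I\<^esub>, add = add (A Quot I),
     smult = (\<lambda>c X. \<Union>x\<in>X. I +>\<^bsub>A\<^esub> (c \<odot>\<^bsub>A\<^esub> x))\<rparr>"

definition relation_ideal :: "('v, 'k :: field) nc_poly set \<Rightarrow> ('v, 'k) nc_poly set" where
  "relation_ideal F = Idl\<^bsub>free_algebra\<^esub> F"

definition presented_algebra ::
  "('v, 'k :: field) nc_poly set \<Rightarrow> ('k, ('v, 'k) nc_poly set) module" where
  "presented_algebra F = quot_algebra free_algebra (relation_ideal F)"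

definition homogeneous :: "nat \<Rightarrow> ('v, 'k :: field) nc_poly \<Rightarrow> bool" where
  "homogeneous n f \<longleftrightarrow> (\<forall>w \<in> Poly_Mapping.keys f. length (letters w) = n)"

text \<open>The grading of a presented algebra with all generators in degree one.\<close>

definition degree_part ::
  "('v, 'k :: field) nc_poly set \<Rightarrow> nat \<Rightarrow> ('v, 'k) nc_poly set set" where
  "degree_part F n = {relation_ideal F +>\<^bsub>free_algebra\<^esub> f | f. homogeneous n f}"

section \<open>Homogenization\<close>

text \<open>Over the variables \<open>'v option\<close>, \<^const>\<open>None\<close> is the new variable \<open>x\<^sub>0\<close>, and \<^term>\<open>Some v\<close> is the old
  variable \<open>v\<close>.\<close>

definition nc_degree :: "('v, 'k :: field) nc_poly \<Rightarrow> nat" where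
  "nc_degree f = Max (insert 0 ((\<lambda>w. length (letters w)) ` Poly_Mapping.keys f))"

definition homogenize :: "('v, 'k :: field) nc_poly \<Rightarrow> ('v option, 'k) nc_poly" where
  "homogenize f = (\<Sum>w \<in> Poly_Mapping.keys f.
     Poly_Mapping.single
       (NC_Word (replicate (nc_degree f - length (letters w)) None @ map Some (letters w)))
       (Poly_Mapping.lookup f w))"

definition hom_relations :: "('v, 'k :: field) nc_poly list \<Rightarrow> ('v option, 'k) nc_poly set" where
  "hom_relations fs = homogenize ` set fs \<union>
     {nc_var None * nc_var (Some v) - nc_var (Some v) * nc_var None | v. True}"

definition homogenization ::
  "('v, 'k :: field) nc_poly list \<Rightarrow> ('k, ('v option, 'k) nc_poly set) module" where
  "homogenization fs = presented_algebra (hom_relations fs)"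

definition hom_x0 :: "('v, 'k :: field) nc_poly list \<Rightarrow> ('v option, 'k) nc_poly set" where
  "hom_x0 fs = relation_ideal (hom_relations fs) +>\<^bsub>free_algebra\<^esub> nc_var None"

text \<open>Essential regularity of \<open>K\<langle>v | v \<in> 'v\<rangle> / (fs)\<close>; it is a property of the presentation.\<close>

definition essentially_regular :: "nat \<Rightarrow> ('v, 'k :: field) nc_poly list \<Rightarrow> bool" where
  "essentially_regular d fs \<longleftrightarrow>
     AS_regular (d + 1) (homogenization fs) (degree_part (hom_relations fs))"

definition non_zero_divisor :: "('a, 'r) ring_scheme \<Rightarrow> 'a \<Rightarrow> bool" where
  "non_zero_divisor R x \<longleftrightarrow>
     (\<forall>a \<in> carrier R. x \<otimes>\<^bsub>R\<^esub> a = \<zero>\<^bsub>R\<^esub> \<or> a \<otimes>\<^bsub>R\<^esub> x = \<zero>\<^bsub>R\<^esub> \<longrightarrow> a = \<zero>\<^bsub>R\<^esub>)"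

section \<open>Polynomial identities\<close>

definition nc_eval ::
  "('k :: field, 'a) module \<Rightarrow> ('v \<Rightarrow> 'a) \<Rightarrow> ('v, 'k) nc_poly \<Rightarrow> 'a" where
  "nc_eval A a f = (\<Oplus>\<^bsub>A\<^esub>w \<in> Poly_Mapping.keys f.
     Poly_Mapping.lookup f w \<odot>\<^bsub>A\<^esub> list_prod A (map a (letters w)))"

definition PI_algebra :: "('k :: field, 'a) module \<Rightarrow> bool" where
  "PI_algebra A \<longleftrightarrow> (\<exists>f :: (nat, 'k) nc_poly. f \<noteq> 0 \<and>
     (\<forall>a. range a \<subseteq> carrier A \<longrightarrow> nc_eval A a f = \<zero>\<^bsub>A\<^esub>))"

end

theory Submission
  imports
    Defs
    "HOL-Library.Function_Algebras"
    "HOL-Analysis.FPS_Convergence"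
    "HOL-Computational_Algebra.Fundamental_Theorem_Algebra"
    "HOL-Combinatorics.Permutations"
begin

text \<open>
  Let \<open>F\<close> be the free algebra and \<open>J\<close> the ideal generated by the top parts of the relations.  Since
  \<open>H(A)\<close> has global dimension three and \<open>x\<^sub>0\<close> is central and regular, the relation module of
  \<open>F/J = H(A)/(x\<^sub>0)\<close> is free on the top parts of a minimal set of relations.  This gives the
  Hilbert series \<open>1 / (1 - n t + \<Sum> t\<^sup>d)\<close>, the sum being over the degrees \<open>d\<close> of these relations.  As
  it has polynomial growth, the roots of the denominator lie on the unit circle, which leaves two
  cases: modulo linear relations, \<open>A\<close> has at most one generator, or it has two generators \<open>x\<close>, \<open>y\<close>
  and one quadratic relation, whose top part is not a square.  In the second case an
  affine change of variables turns the relation into \<open>y x = q x y + c\<close> or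
  \<open>y x = x y + e x\<^sup>2 + a x + b y + c\<close>.

  On a simple finite-dimensional module, the kernel of the normal element \<open>z = y x - x y\<close> is a submodule.
  If \<open>z\<close> acts injectively, then it shifts the eigenvalues of \<open>x\<close>, of which there are finitely many;
  this is only possible if \<open>q\<close> is a root of unity, and then \<open>A\<close> is finite over its centre, hence
  satisfies a standard identity.  So \<open>x\<close> and \<open>y\<close> commute on the module and act by scalars.
\<close>

text \<open>The usual route to the relation module of \<open>F/J\<close> is a change of rings:
  dividing by a central regular element lowers the global dimension. Something weaker suffices: over
  \<open>H(A)\<close>, a functional on the third syzygy of the trivial module that respects the
  augmentation lifts to a homomorphism into \<open>H(A)\<close>. A syzygy between top parts that is
  not trivial modulo \<open>J\<close> would give a functional whose lift forces \<open>x0\<close>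
  into the ideal of relations. Resolutions must stay inside one element type, so they are compared
  through stable retracts instead of the direct sums of Schanuel's lemma. A relation module is
  treated as \<open>I / I F+\<close>, with \<open>F+\<close> the augmentation ideal; as
  \<open>F+\<close> is free on the variables, membership in \<open>I F+\<close> is a condition on
  coordinates. A square is excluded as top part because the associativity of \<open>l l l\<close> is
  a syzygy that freeness forbids. Characteristic zero keeps shifted eigenvalues distinct and
  controls derivatives of minimal polynomials; algebraic closedness supplies eigenvectors and the
  linear factors of the quadratic form.\<close>

hide_const (open) Multiset.mult Polynomial.smult Modules.module_hom


section \<open>Noncommutative polynomials\<close>

definition nc_const :: "'k :: field \<Rightarrow> ('v, 'k) nc_poly" where
  "nc_const c = Poly_Mapping.single 0 c"

lemma nc_const_0 [simp]: "nc_const 0 = 0"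
  and nc_const_1 [simp]: "nc_const 1 = 1"
  and nc_const_add: "nc_const (a + b) = nc_const a + nc_const b"
  and nc_const_mult: "nc_const (a * b) = nc_const a * nc_const b"
  and nc_const_diff: "nc_const (a - b) = nc_const a - nc_const b"
  and nc_const_uminus: "nc_const (- a) = - nc_const a"
  by (simp_all add: nc_const_def single_add mult_single single_diff single_uminus)

lemma nc_const_numeral [simp]: "nc_const (numeral n) = numeral n"
  by (simp add: nc_const_def)

lemma nc_const_sum: "nc_const (sum f S) = (\<Sum>i\<in>S. nc_const (f i))"
  by (induction S rule: infinite_finite_induct) (simp_all add: nc_const_add)

lemma nc_word_add_letters: "letters (u + w) = letters u @ letters w" "letters 0 = []"
  by (simp_all add: plus_nc_word_def zero_nc_word_def)

lemma NC_Word_Nil: "NC_Word [] = 0"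
  by (simp add: zero_nc_word_def)

lemma NC_Word_append: "NC_Word (u @ w) = NC_Word u + NC_Word w"
  by (simp add: plus_nc_word_def)

lemma single_induct_right:
  assumes "\<And>c. P (nc_const c)" "\<And>f v. P f \<Longrightarrow> P (f * nc_var v)"
  shows "P (Poly_Mapping.single (NC_Word w) c)"
proof (induction w rule: rev_induct)
  case Nil
  then show ?case using assms(1) by (simp add: NC_Word_Nil nc_const_def)
next
  case (snoc v w)
  have "Poly_Mapping.single (NC_Word (w @ [v])) c = Poly_Mapping.single (NC_Word w) c * nc_var v"
    by (simp add: nc_var_def mult_single NC_Word_append)
  then show ?case using assms(2)[OF snoc] by simp
qed

lemma single_induct_left:
  assumes "\<And>c. P (nc_const c)" "\<And>f v. P f \<Longrightarrow> P (nc_var v * f)"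
  shows "P (Poly_Mapping.single (NC_Word w) c)"
proof (induction w)
  case Nil
  then show ?case using assms(1) by (simp add: NC_Word_Nil nc_const_def)
next
  case (Cons v w)
  have "Poly_Mapping.single (NC_Word (v # w)) c = nc_var v * Poly_Mapping.single (NC_Word w) c"
    using NC_Word_append[of "[v]" w] by (simp add: nc_var_def mult_single)
  then show ?case using assms(2)[OF Cons] by simp
qed

lemma poly_mapping_sum_single: "f = (\<Sum>w \<in> Poly_Mapping.keys f. Poly_Mapping.single w (Poly_Mapping.lookup f w))"
  by (rule poly_mapping_eqI)
    (auto simp: lookup_sum lookup_single when_def in_keys_iff sum.delta' if_distrib cong: if_cong)

text \<open>Words grow on the right here, the side on which \<open>rdiv\<close> strips a variable;
  the twin \<open>nc_poly_induct_left\<close> serves closure arguments for left ideals.\<close>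

lemma nc_poly_induct [case_names const var add]:
  assumes "\<And>c. P (nc_const c)" "\<And>f v. P f \<Longrightarrow> P (f * nc_var v)" "\<And>f g. P f \<Longrightarrow> P g \<Longrightarrow> P (f + g)"
  shows "P (f :: ('v, 'k :: field) nc_poly)"
proof -
  have "P (sum (\<lambda>w. Poly_Mapping.single w (Poly_Mapping.lookup f w)) S)" if "finite S" for S
    using that
  proof induction
    case empty
    then show ?case using assms(1)[of 0] by simp
  next
    case (insert w S)
    have "P (Poly_Mapping.single w (Poly_Mapping.lookup f w))"
      by (cases w) (metis single_induct_right[of P] assms(1,2))
    then show ?case using insert assms(3) by simp
  qed
  then show ?thesis using poly_mapping_sum_single[of f] by (metis finite_keys)
qed

lemma nc_poly_induct_left [case_names const var add]:
  assumes "\<And>c. P (nc_const c)" "\<And>f v. P f \<Longrightarrow> P (nc_var v * f)" "\<And>f g. P f \<Longrightarrow> P g \<Longrightarrow> P (f + g)"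
  shows "P (f :: ('v, 'k :: field) nc_poly)"
proof -
  have "P (sum (\<lambda>w. Poly_Mapping.single w (Poly_Mapping.lookup f w)) S)" if "finite S" for S
    using that
  proof induction
    case empty
    then show ?case using assms(1)[of 0] by simp
  next
    case (insert w S)
    have "P (Poly_Mapping.single w (Poly_Mapping.lookup f w))"
      by (cases w) (metis single_induct_left[of P] assms(1,2))
    then show ?case using insert assms(3) by simp
  qed
  then show ?thesis using poly_mapping_sum_single[of f] by (metis finite_keys)
qed

lemma lookup_mult_var:
  "Poly_Mapping.lookup (f * nc_var v) w =
     (if letters w \<noteq> [] \<and> last (letters w) = v then Poly_Mapping.lookup f (NC_Word (butlast (letters w))) else 0)"
proof -
  have *: "f * nc_var v = (\<Sum>u \<in> Poly_Mapping.keys f. Poly_Mapping.single (u + NC_Word [v]) (Poly_Mapping.lookup f u))"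
    by (subst poly_mapping_sum_single) (simp add: nc_var_def sum_distrib_right mult_single)
  show ?thesis
  proof (cases "letters w \<noteq> [] \<and> last (letters w) = v")
    case True
    then obtain u where u: "w = NC_Word (u @ [v])"
      by (metis append_butlast_last_id nc_word.collapse)
    have eq: "(x + NC_Word [v] = w) = (x = NC_Word u)" for x
      unfolding u by (cases x) (simp add: plus_nc_word_def)
    show ?thesis
      using True unfolding * lookup_sum lookup_single eq
      by (auto simp: u when_def in_keys_iff if_distrib cong: if_cong)
  next
    case False
    then have "x + NC_Word [v] \<noteq> w" for x
      by (metis nc_word.sel nc_word_add_letters(1) last_snoc snoc_eq_iff_butlast)
    then show ?thesis
      using False unfolding * lookup_sum lookup_single by auto
  qed
qed

lemma nc_const_mult_left: "Poly_Mapping.lookup (nc_const c * f) w = c * Poly_Mapping.lookup f w"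
  unfolding nc_const_def mult_map_scale_conv_mult[symmetric] by (simp add: Poly_Mapping.map.rep_eq when_def)

lemma nc_const_commute: "nc_const c * f = f * nc_const c"
proof (induction f rule: nc_poly_induct)
  case (const d)
  then show ?case by (metis nc_const_mult mult.commute)
next
  case (var f v)
  have "nc_const c * nc_var v = nc_var v * nc_const c"
    by (simp add: nc_const_def nc_var_def mult_single)
  then show ?case using var by (metis mult.assoc)
qed (simp add: distrib_left distrib_right)

definition const_coeff :: "('v, 'k :: field) nc_poly \<Rightarrow> 'k" where
  "const_coeff f = Poly_Mapping.lookup f 0"

lemma const_coeff_simps [simp]:
  "const_coeff 0 = 0" "const_coeff 1 = 1" "const_coeff (nc_const c) = c" "const_coeff (nc_var v) = 0"
  "const_coeff (f + g) = const_coeff f + const_coeff g" "const_coeff (f - g) = const_coeff f - const_coeff g"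
  "const_coeff (- f) = - const_coeff f" "const_coeff (f * nc_var v) = 0"
  by (simp_all add: const_coeff_def nc_const_def nc_var_def lookup_add lookup_minus lookup_single when_def
      zero_nc_word_def lookup_mult_var[unfolded nc_var_def zero_nc_word_def] lookup_one)

lemma const_coeff_mult [simp]: "const_coeff (f * g) = const_coeff f * const_coeff g"
proof (induction g rule: nc_poly_induct)
  case (const c)
  then show ?case
    by (metis const_coeff_def const_coeff_simps(3) nc_const_commute nc_const_mult_left mult.commute)
qed (simp_all add: mult.assoc[symmetric] distrib_left del: mult.assoc)

lemma const_coeff_sum [simp]: "const_coeff (sum f S) = (\<Sum>i\<in>S. const_coeff (f i))"
  by (induction S rule: infinite_finite_induct) simp_all

section \<open>Coordinates of the augmentation ideal\<close>

lemma inj_append_word: "inj (\<lambda>w. w + NC_Word u)"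
  by (rule injI) (metis append_same_eq nc_word.expand nc_word_add_letters(1))

text \<open>The augmentation ideal is a free left module on the variables, and \<open>rdiv v\<close>
  is the coordinate at \<open>v\<close>: it keeps the words that end in \<open>v\<close> and strips
  that letter.\<close>

definition rdiv :: "'v \<Rightarrow> ('v, 'k :: field) nc_poly \<Rightarrow> ('v, 'k) nc_poly" where
  "rdiv v f = Poly_Mapping.map_key (\<lambda>w. w + NC_Word [v]) f"

lemma lookup_rdiv: "Poly_Mapping.lookup (rdiv v f) w = Poly_Mapping.lookup f (w + NC_Word [v])"
  by (simp add: rdiv_def map_key.rep_eq inj_append_word)

lemma rdiv_simps [simp]: "rdiv v 0 = 0" "rdiv v (nc_const c) = 0" "rdiv v (f + g) = rdiv v f + rdiv v g"
  "rdiv v (f - g) = rdiv v f - rdiv v g" "rdiv v (- f) = - rdiv v f"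
  by (rule poly_mapping_eqI, simp add: lookup_rdiv lookup_add lookup_minus nc_const_def lookup_single when_def
      zero_nc_word_def plus_nc_word_def)+

lemma rdiv_mult_var: "rdiv v (f * nc_var u) = (if u = v then f else 0)"
  by (rule poly_mapping_eqI) (auto simp: lookup_rdiv lookup_mult_var nc_word_add_letters)

text \<open>The product rule of a Fox derivative: the last letter of a word of \<open>f * g\<close>
  comes from \<open>g\<close>, unless the part taken from \<open>g\<close> is empty, and then only
  the constant of \<open>g\<close> contributes.\<close>

lemma rdiv_mult: "rdiv v (f * g) = f * rdiv v g + rdiv v f * nc_const (const_coeff g)"
proof (induction g rule: nc_poly_induct)
  case (const c)
  have "rdiv v (f * nc_const c) = rdiv v f * nc_const c"
    by (rule poly_mapping_eqI) (simp add: lookup_rdiv nc_const_commute[symmetric] nc_const_mult_left)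
  then show ?case by simp
next
  case (var g u)
  then show ?case by (auto simp: mult.assoc[symmetric] rdiv_mult_var)
qed (simp add: algebra_simps nc_const_add)

lemma rdiv_sum [simp]: "rdiv v (sum f S) = (\<Sum>i\<in>S. rdiv v (f i))"
  by (induction S rule: infinite_finite_induct) simp_all

lemma rdiv_expansion:
  fixes f :: "('v :: finite, 'k :: field) nc_poly"
  shows "f = nc_const (const_coeff f) + (\<Sum>v\<in>UNIV. rdiv v f * nc_var v)"
proof (induction f rule: nc_poly_induct)
  case (var f u)
  have "(\<Sum>v\<in>UNIV. rdiv v (f * nc_var u) * nc_var v) = (\<Sum>v\<in>UNIV. if u = v then f * nc_var v else 0)"
    by (rule sum.cong) (auto simp: rdiv_mult_var)
  also have "\<dots> = f * nc_var u" by simp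
  finally show ?case by simp
next
  case (add f g)
  have "nc_const (const_coeff (f + g)) + (\<Sum>v\<in>UNIV. rdiv v (f + g) * nc_var v)
     = (nc_const (const_coeff f) + (\<Sum>v\<in>UNIV. rdiv v f * nc_var v))
      + (nc_const (const_coeff g) + (\<Sum>v\<in>UNIV. rdiv v g * nc_var v))"
    by (simp add: distrib_right sum.distrib nc_const_add)
  then show ?case unfolding add.IH[symmetric] by (rule sym)
qed simp

subsection \<open>Homogeneous components\<close>

definition hcomp :: "nat \<Rightarrow> ('v, 'k :: field) nc_poly \<Rightarrow> ('v, 'k) nc_poly" where
  "hcomp d f = Poly_Mapping.mapp (\<lambda>w c. if length (letters w) = d then c else 0) f"

lemma lookup_hcomp: "Poly_Mapping.lookup (hcomp d f) w = (if length (letters w) = d then Poly_Mapping.lookup f w else 0)"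
  by (simp add: hcomp_def lookup_mapp when_def in_keys_iff)

lemma hcomp_simps [simp]: "hcomp d 0 = 0" "hcomp d (f + g) = hcomp d f + hcomp d g"
  "hcomp d (f - g) = hcomp d f - hcomp d g" "hcomp d (- f) = - hcomp d f"
  by (rule poly_mapping_eqI, simp add: lookup_hcomp lookup_add lookup_minus)+

lemma hcomp_sum [simp]: "hcomp d (sum f S) = (\<Sum>i\<in>S. hcomp d (f i))"
  by (induction S rule: infinite_finite_induct) simp_all

lemma homogeneous_iff: "homogeneous d f \<longleftrightarrow> hcomp d f = f"
  unfolding homogeneous_def poly_mapping_eq_iff fun_eq_iff lookup_hcomp
  by (auto simp: in_keys_iff)

lemma homogeneous_lookup: "homogeneous d f \<longleftrightarrow> (\<forall>w. length (letters w) \<noteq> d \<longrightarrow> Poly_Mapping.lookup f w = 0)"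
  unfolding homogeneous_def by (auto simp: in_keys_iff)

lemma hcomp_of_homogeneous: "homogeneous e f \<Longrightarrow> hcomp d f = (if d = e then f else 0)"
  unfolding homogeneous_lookup by (auto intro!: poly_mapping_eqI simp: lookup_hcomp)

lemma homogeneous_hcomp [simp]: "homogeneous d (hcomp d f)"
  by (simp add: homogeneous_lookup lookup_hcomp)

lemma homogeneous_closed:
  "homogeneous d 0" "homogeneous d f \<Longrightarrow> homogeneous d g \<Longrightarrow> homogeneous d (f + g)"
  "homogeneous d f \<Longrightarrow> homogeneous d g \<Longrightarrow> homogeneous d (f - g)"
  "homogeneous d f \<Longrightarrow> homogeneous d (- f)"
  by (simp_all add: homogeneous_lookup lookup_add lookup_minus)

lemma homogeneous_sum: "(\<And>i. i \<in> S \<Longrightarrow> homogeneous d (f i)) \<Longrightarrow> homogeneous d (sum f S)"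
  by (induction S rule: infinite_finite_induct) (simp_all add: homogeneous_closed)

lemma homogeneous_const [simp]: "homogeneous 0 (nc_const c)" "homogeneous 0 1"
  by (simp_all add: homogeneous_lookup nc_const_def lookup_single when_def zero_nc_word_def lookup_one)

lemma homogeneous_var [simp]: "homogeneous (Suc 0) (nc_var v)"
  by (auto simp: homogeneous_lookup nc_var_def lookup_single when_def)

lemma hcomp_const: "hcomp d (nc_const c) = (if d = 0 then nc_const c else 0)"
  by (simp add: hcomp_of_homogeneous[OF homogeneous_const(1)])

lemma hcomp_0: "hcomp 0 f = nc_const (const_coeff f)"
  by (rule poly_mapping_eqI)
    (auto simp: lookup_hcomp nc_const_def const_coeff_def lookup_single when_def zero_nc_word_def nc_word.expand)

lemma hcomp_mult_var: "hcomp d (f * nc_var v) = (if d = 0 then 0 else hcomp (d - 1) f * nc_var v)"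
proof (rule poly_mapping_eqI)
  fix w
  show "Poly_Mapping.lookup (hcomp d (f * nc_var v)) w
      = Poly_Mapping.lookup (if d = 0 then 0 else hcomp (d - 1) f * nc_var v) w"
    by (cases "letters w" rule: rev_cases) (auto simp: lookup_hcomp lookup_mult_var)
qed

lemma hcomp_mult: "hcomp d (f * g) = (\<Sum>i\<le>d. hcomp i f * hcomp (d - i) g)"
proof (induction g arbitrary: d rule: nc_poly_induct)
  case (const c)
  have "(\<Sum>i\<le>d. hcomp i f * hcomp (d - i) (nc_const c)) = (\<Sum>i\<le>d. if i = d then hcomp i f * nc_const c else 0)"
    by (rule sum.cong) (auto simp: hcomp_const)
  moreover have "hcomp d (f * nc_const c) = hcomp d f * nc_const c"
    by (rule poly_mapping_eqI) (simp add: lookup_hcomp nc_const_commute[symmetric] nc_const_mult_left)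
  ultimately show ?case by simp
next
  case (var g v)
  show ?case
  proof (cases d)
    case 0
    then show ?thesis by (simp add: mult.assoc[symmetric] hcomp_mult_var)
  next
    case (Suc e)
    have "(\<Sum>i\<le>d. hcomp i f * hcomp (d - i) (g * nc_var v)) = (\<Sum>i\<le>e. hcomp i f * hcomp (d - i) (g * nc_var v))"
      by (simp add: Suc hcomp_mult_var)
    also have "\<dots> = (\<Sum>i\<le>e. hcomp i f * hcomp (e - i) g) * nc_var v"
      unfolding sum_distrib_right by (rule sum.cong) (auto simp: hcomp_mult_var Suc mult.assoc Suc_diff_le)
    finally show ?thesis
      using var[of e] by (simp add: mult.assoc[symmetric] hcomp_mult_var Suc)
  qed
qed (simp add: distrib_left sum.distrib)

lemma hcomp_mult_homogeneous_right:
  assumes "homogeneous e g"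
  shows "hcomp d (f * g) = (if e \<le> d then hcomp (d - e) f * g else 0)"
proof -
  have "hcomp d (f * g) = (\<Sum>i\<le>d. if i + e = d then hcomp i f * g else 0)"
    unfolding hcomp_mult by (rule sum.cong) (auto simp: hcomp_of_homogeneous[OF assms])
  also have "\<dots> = (\<Sum>i\<le>d. if i = d - e then (if e \<le> d then hcomp i f * g else 0) else 0)"
    by (rule sum.cong) auto
  finally show ?thesis by simp
qed

lemma hcomp_mult_homogeneous_left:
  assumes "homogeneous e f"
  shows "hcomp d (f * g) = (if e \<le> d then f * hcomp (d - e) g else 0)"
proof -
  have "hcomp d (f * g) = (\<Sum>i\<le>d. if i = e then f * hcomp (d - e) g else 0)"
    unfolding hcomp_mult by (rule sum.cong) (auto simp: hcomp_of_homogeneous[OF assms])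
  then show ?thesis by simp
qed

lemma homogeneous_mult: "homogeneous d f \<Longrightarrow> homogeneous e g \<Longrightarrow> homogeneous (d + e) (f * g)"
  by (simp add: homogeneous_iff hcomp_mult_homogeneous_right)

lemma hcomp_bound: "\<exists>N. \<forall>d\<ge>N. hcomp d f = 0"
proof (induction f rule: nc_poly_induct)
  case (const c)
  then show ?case by (auto simp: hcomp_const intro: exI[of _ 1])
next
  case (var f v)
  then obtain N where "\<forall>d\<ge>N. hcomp d f = 0" by blast
  then have "\<forall>d\<ge>Suc N. hcomp d (f * nc_var v) = 0" by (auto simp: hcomp_mult_var)
  then show ?case by blast
next
  case (add f g)
  then obtain N N' where "\<forall>d\<ge>N. hcomp d f = 0" "\<forall>d\<ge>N'. hcomp d g = 0" by blast
  then have "\<forall>d\<ge>max N N'. hcomp d (f + g) = 0" by simp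
  then show ?case by blast
qed

lemma sum_hcomp: assumes "\<And>d. d \<ge> N \<Longrightarrow> hcomp d f = 0" shows "f = (\<Sum>d<N. hcomp d f)"
proof (rule poly_mapping_eqI)
  fix w
  show "Poly_Mapping.lookup f w = Poly_Mapping.lookup (\<Sum>d<N. hcomp d f) w"
    using assms[of "length (letters w)"] lookup_hcomp[of "length (letters w)" f w]
    by (cases "length (letters w) < N") (simp_all add: lookup_sum lookup_hcomp)
qed

lemma hcomp_induct:
  assumes "P 0" "\<And>f g. P f \<Longrightarrow> P g \<Longrightarrow> P (f + g)" "\<And>d. P (hcomp d f)"
  shows "P f"
proof -
  obtain N where "\<And>d. d \<ge> N \<Longrightarrow> hcomp d f = 0" using hcomp_bound by blast
  then have "f = (\<Sum>d<N. hcomp d f)" by (rule sum_hcomp)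
  moreover have "P (\<Sum>d<N. hcomp d f)" using assms by (induction N) simp_all
  ultimately show ?thesis by simp
qed

subsection \<open>Substitution\<close>

definition nc_subst :: "('v \<Rightarrow> ('u, 'k) nc_poly) \<Rightarrow> ('v, 'k :: field) nc_poly \<Rightarrow> ('u, 'k) nc_poly" where
  "nc_subst \<theta> f = (\<Sum>w \<in> Poly_Mapping.keys f. nc_const (Poly_Mapping.lookup f w) * prod_list (map \<theta> (letters w)))"

lemma nc_subst_supset:
  assumes "finite S" "Poly_Mapping.keys f \<subseteq> S"
  shows "nc_subst \<theta> f = (\<Sum>w \<in> S. nc_const (Poly_Mapping.lookup f w) * prod_list (map \<theta> (letters w)))"
  unfolding nc_subst_def
  by (rule sum.mono_neutral_left) (use assms in \<open>auto simp: in_keys_iff\<close>)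

lemma nc_subst_add [simp]: "nc_subst \<theta> (f + g) = nc_subst \<theta> f + nc_subst \<theta> g"
proof -
  let ?S = "Poly_Mapping.keys f \<union> Poly_Mapping.keys g"
  have "nc_subst \<theta> (f + g) = (\<Sum>w \<in> ?S. nc_const (Poly_Mapping.lookup (f + g) w) * prod_list (map \<theta> (letters w)))"
    by (rule nc_subst_supset) (simp_all add: keys_add)
  also have "\<dots> = nc_subst \<theta> f + nc_subst \<theta> g"
    by (subst (1 2) nc_subst_supset[of ?S])
      (auto simp: lookup_add nc_const_add distrib_right sum.distrib)
  finally show ?thesis .
qed

lemma nc_subst_single:
  "nc_subst \<theta> (Poly_Mapping.single w c) = nc_const c * prod_list (map \<theta> (letters w))"
  by (subst nc_subst_supset[of "{w}"]) auto

lemma nc_subst_const [simp]: "nc_subst \<theta> (nc_const c) = nc_const c"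
  by (simp add: nc_const_def nc_subst_single[unfolded nc_const_def] nc_word_add_letters)

lemma nc_subst_var [simp]: "nc_subst \<theta> (nc_var v) = \<theta> v"
  by (simp add: nc_var_def nc_subst_single)

lemma nc_subst_0 [simp]: "nc_subst \<theta> 0 = 0"
  by (metis nc_const_0 nc_subst_const)

lemma nc_subst_1 [simp]: "nc_subst \<theta> 1 = 1"
  by (metis nc_const_1 nc_subst_const)

lemma nc_subst_uminus [simp]: "nc_subst \<theta> (- f) = - nc_subst \<theta> f"
  by (metis add.right_inverse eq_neg_iff_add_eq_0 nc_subst_0 nc_subst_add neg_eq_iff_add_eq_0)

lemma nc_subst_diff [simp]: "nc_subst \<theta> (f - g) = nc_subst \<theta> f - nc_subst \<theta> g"
  by (metis diff_conv_add_uminus nc_subst_add nc_subst_uminus)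

lemma nc_subst_sum [simp]: "nc_subst \<theta> (sum f S) = (\<Sum>i\<in>S. nc_subst \<theta> (f i))"
  by (induction S rule: infinite_finite_induct) simp_all

lemma nc_subst_const_mult: "nc_subst \<theta> (nc_const c * f) = nc_const c * nc_subst \<theta> f"
proof (cases "c = 0")
  case False
  then have "Poly_Mapping.keys (nc_const c * f) = Poly_Mapping.keys f"
    by (auto simp: in_keys_iff nc_const_mult_left)
  then show ?thesis
    by (simp add: nc_subst_def nc_const_mult_left nc_const_mult sum_distrib_left mult.assoc)
qed simp

lemma nc_subst_mult_var: "nc_subst \<theta> (f * nc_var v) = nc_subst \<theta> f * \<theta> v"
proof -
  have "f * nc_var v = (\<Sum>u \<in> Poly_Mapping.keys f. Poly_Mapping.single (u + NC_Word [v]) (Poly_Mapping.lookup f u))"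
    by (subst poly_mapping_sum_single) (simp add: nc_var_def sum_distrib_right mult_single)
  then have "nc_subst \<theta> (f * nc_var v)
      = (\<Sum>u \<in> Poly_Mapping.keys f. nc_subst \<theta> (Poly_Mapping.single (u + NC_Word [v]) (Poly_Mapping.lookup f u)))"
    by (simp only: nc_subst_sum)
  then show ?thesis
    by (simp add: nc_subst_single nc_word_add_letters sum_distrib_right mult.assoc) (simp add: nc_subst_def sum_distrib_right mult.assoc)
qed

lemma nc_subst_mult [simp]: "nc_subst \<theta> (f * g) = nc_subst \<theta> f * nc_subst \<theta> g"
proof (induction g rule: nc_poly_induct)
  case (const c)
  then show ?case by (metis nc_const_commute nc_subst_const nc_subst_const_mult)
next
  case (var g v)
  then show ?case by (simp add: mult.assoc[symmetric] nc_subst_mult_var del: mult.assoc)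
qed (simp add: distrib_left)

lemma nc_subst_power [simp]: "nc_subst \<theta> (f ^ n) = nc_subst \<theta> f ^ n"
  by (induction n) simp_all

lemma const_coeff_nc_subst: "(\<And>v. const_coeff (\<theta> v) = 0) \<Longrightarrow> const_coeff (nc_subst \<theta> f) = const_coeff f"
  by (induction f rule: nc_poly_induct) (simp_all add: nc_subst_mult_var del: nc_subst_mult)

lemma nc_subst_comp: "nc_subst \<theta> (nc_subst \<eta> f) = nc_subst (\<lambda>v. nc_subst \<theta> (\<eta> v)) f"
  by (induction f rule: nc_poly_induct) simp_all

lemma nc_subst_id [simp]: "nc_subst nc_var f = f"
  by (induction f rule: nc_poly_induct) simp_all

lemma hcomp_nc_subst:
  assumes "\<And>v. homogeneous (Suc 0) (\<theta> v)"
  shows "hcomp d (nc_subst \<theta> f) = nc_subst \<theta> (hcomp d f)"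
proof (induction f arbitrary: d rule: nc_poly_induct)
  case (var f v)
  then show ?case
    by (cases d) (simp_all add: hcomp_mult_homogeneous_right[OF assms] hcomp_mult_var)
qed (simp_all add: hcomp_const)

section \<open>Ideals and presented algebras\<close>

text \<open>The notion \<open>ideal\<close> for the free algebra, whose carrier is the whole type,
  restated with the type class operations; closure under negation comes from multiplication by
  \<open>-1\<close>.\<close>

definition two_sided_ideal :: "'r :: ring_1 set \<Rightarrow> bool" where
  "two_sided_ideal I \<longleftrightarrow> 0 \<in> I \<and> (\<forall>a\<in>I. \<forall>b\<in>I. a + b \<in> I) \<and> (\<forall>a\<in>I. \<forall>r. r * a \<in> I \<and> a * r \<in> I)"

lemma two_sided_idealD:
  assumes "two_sided_ideal I"
  shows "0 \<in> I" "a \<in> I \<Longrightarrow> b \<in> I \<Longrightarrow> a + b \<in> I" "a \<in> I \<Longrightarrow> r * a \<in> I" "a \<in> I \<Longrightarrow> a * r \<in> I"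
    "a \<in> I \<Longrightarrow> - a \<in> I" "a \<in> I \<Longrightarrow> b \<in> I \<Longrightarrow> a - b \<in> I"
proof -
  show "0 \<in> I" and 1: "\<And>a b. a \<in> I \<Longrightarrow> b \<in> I \<Longrightarrow> a + b \<in> I" and 2: "\<And>a r. a \<in> I \<Longrightarrow> r * a \<in> I" and "a \<in> I \<Longrightarrow> a * r \<in> I"
    using assms unfolding two_sided_ideal_def by blast+
  show 3: "a \<in> I \<Longrightarrow> - a \<in> I" for a using 2[of a "-1"] by simp
  show "a \<in> I \<Longrightarrow> b \<in> I \<Longrightarrow> a - b \<in> I" using 1[OF _ 3, of a b] by simp
qed

lemma two_sided_ideal_sum:
  "two_sided_ideal I \<Longrightarrow> (\<And>i. i \<in> S \<Longrightarrow> f i \<in> I) \<Longrightarrow> sum f S \<in> I"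
  by (induction S rule: infinite_finite_induct) (auto dest: two_sided_idealD)

lemma free_algebra_simps [simp]:
  "carrier free_algebra = UNIV" "mult free_algebra = (*)" "one free_algebra = 1" "zero free_algebra = 0"
  "add free_algebra = (+)" "smult free_algebra = (\<lambda>c f. nc_const c * f)"
  by (simp_all add: free_algebra_def nc_const_def)

lemma ring_free_algebra: "ring (free_algebra :: ('k :: field, ('v, 'k) nc_poly) module)"
proof -
  have "\<exists>y. y + x = 0" for x :: "('v, 'k) nc_poly" by (rule exI[of _ "- x"]) simp
  moreover have "\<exists>y. x + y = 0" for x :: "('v, 'k) nc_poly" by (rule exI[of _ "- x"]) simp
  ultimately show ?thesis
    by unfold_locales (auto simp: algebra_simps Units_def)
qed

lemma a_inv_free_algebra [simp]: "a_inv free_algebra f = - f"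
proof -
  interpret ring "free_algebra :: ('b, ('a, 'b) nc_poly) module" by (rule ring_free_algebra)
  show ?thesis by (rule minus_equality) simp_all
qed

lemma ideal_iff_two_sided_ideal:
  "ideal I (free_algebra :: ('k :: field, ('v, 'k) nc_poly) module) \<longleftrightarrow> two_sided_ideal I"
proof
  assume I: "ideal I (free_algebra :: ('k :: field, ('v, 'k) nc_poly) module)"
  interpret ideal I "free_algebra :: ('k, ('v, 'k) nc_poly) module" by fact
  show "two_sided_ideal I"
    unfolding two_sided_ideal_def
    using I_l_closed I_r_closed additive_subgroup.a_closed[OF is_additive_subgroup] additive_subgroup.zero_closed[OF is_additive_subgroup]
    by auto
next
  assume "two_sided_ideal I"
  note D = two_sided_idealD[OF this]
  show "ideal I (free_algebra :: ('k :: field, ('v, 'k) nc_poly) module)"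
  proof (rule idealI[OF ring_free_algebra])
    show "subgroup I (add_monoid (free_algebra :: ('k, ('v, 'k) nc_poly) module))"
    proof
      fix x assume "x \<in> I"
      moreover have "inv\<^bsub>add_monoid free_algebra\<^esub> x = - x"
        using a_inv_free_algebra[of x] by (simp add: a_inv_def)
      ultimately show "inv\<^bsub>add_monoid free_algebra\<^esub> x \<in> I" using D(5) by simp
    qed (auto intro: D)
  qed (auto intro: D)
qed

lemma two_sided_ideal_relation_ideal: "two_sided_ideal (relation_ideal F)"
  unfolding relation_ideal_def ideal_iff_two_sided_ideal[symmetric]
  by (rule ring.genideal_ideal[OF ring_free_algebra]) simp

lemmas relation_idealD = two_sided_idealD[OF two_sided_ideal_relation_ideal]

lemma relation_ideal_base: "f \<in> F \<Longrightarrow> f \<in> relation_ideal F"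
  unfolding relation_ideal_def using ring.genideal_self[OF ring_free_algebra, of F] by auto

lemma relation_ideal_least: "two_sided_ideal I \<Longrightarrow> F \<subseteq> I \<Longrightarrow> relation_ideal F \<subseteq> I"
  unfolding relation_ideal_def ideal_iff_two_sided_ideal[symmetric]
  by (rule ring.genideal_minimal[OF ring_free_algebra])

text \<open>The polynomials all of whose components lie in the ideal form an ideal, since a
  component of a product is a sum of products of components; it contains the homogeneous
  generators.\<close>

lemma relation_ideal_hcomp:
  assumes hom: "\<And>f. f \<in> F \<Longrightarrow> \<exists>d. homogeneous d f" and f: "f \<in> relation_ideal F"
  shows "hcomp d f \<in> relation_ideal F"
proof -
  let ?I = "{f. \<forall>d. hcomp d f \<in> relation_ideal F}"
  have "hcomp d (r * a) \<in> relation_ideal F" "hcomp d (a * r) \<in> relation_ideal F" if "a \<in> ?I" for a r d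
    unfolding hcomp_mult using that
    by (auto intro: two_sided_ideal_sum[OF two_sided_ideal_relation_ideal] relation_idealD(3) relation_idealD(4))
  then have "two_sided_ideal ?I"
    unfolding two_sided_ideal_def by (auto simp: relation_idealD(1,2))
  moreover have "F \<subseteq> ?I"
  proof
    fix g assume g: "g \<in> F"
    then obtain e where "homogeneous e g" using hom by blast
    then show "g \<in> ?I" using relation_ideal_base[OF g] by (simp add: hcomp_of_homogeneous relation_idealD(1))
  qed
  ultimately show ?thesis using relation_ideal_least[of ?I F] f by auto
qed

definition coset :: "('v, 'k :: field) nc_poly set \<Rightarrow> ('v, 'k) nc_poly \<Rightarrow> ('v, 'k) nc_poly set" where
  "coset F f = relation_ideal F +>\<^bsub>free_algebra\<^esub> f"

lemma coset_iff: "g \<in> coset F f \<longleftrightarrow> g - f \<in> relation_ideal F"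
proof -
  have "g \<in> coset F f \<longleftrightarrow> (\<exists>h\<in>relation_ideal F. g = h + f)"
    by (auto simp: coset_def a_r_coset_def')
  then show ?thesis by (metis add_diff_cancel diff_add_cancel)
qed

lemma coset_eq_iff: "coset F f = coset F g \<longleftrightarrow> f - g \<in> relation_ideal F"
proof
  assume "coset F f = coset F g"
  then show "f - g \<in> relation_ideal F" using coset_iff[of f F f] coset_iff[of f F g] relation_idealD(1) by auto
next
  assume a: "f - g \<in> relation_ideal F"
  have "h - f \<in> relation_ideal F \<longleftrightarrow> h - g \<in> relation_ideal F" for h
    using relation_idealD(2)[OF _ a, of "h - f"] relation_idealD(6)[OF _ a, of "h - g"] by auto
  then show "coset F f = coset F g" by (auto simp: coset_iff)
qed

lemma ideal_relation_ideal: "ideal (relation_ideal F) free_algebra"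
  by (simp add: ideal_iff_two_sided_ideal two_sided_ideal_relation_ideal)

text \<open>Turns arithmetic in the quotient into arithmetic of representatives, so that the later
  arguments can be about polynomials modulo \<open>relation_ideal F\<close>.\<close>

lemma presented_algebra_simps:
  "carrier (presented_algebra F) = range (coset F)"
  "mult (presented_algebra F) (coset F f) (coset F g) = coset F (f * g)"
  "one (presented_algebra F) = coset F 1"
  "zero (presented_algebra F) = coset F 0"
  "add (presented_algebra F) (coset F f) (coset F g) = coset F (f + g)"
  "smult (presented_algebra F) c (coset F f) = coset F (nc_const c * f)"
proof -
  interpret ideal "relation_ideal F" free_algebra by (rule ideal_relation_ideal)
  show "carrier (presented_algebra F) = range (coset F)"
    by (auto simp: presented_algebra_def quot_algebra_def FactRing_def A_RCOSETS_def' coset_def)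
  show "mult (presented_algebra F) (coset F f) (coset F g) = coset F (f * g)"
    using rcoset_mult_add[of f g] by (simp add: presented_algebra_def quot_algebra_def FactRing_def coset_def)
  show "one (presented_algebra F) = coset F 1"
    by (simp add: presented_algebra_def quot_algebra_def FactRing_def coset_def)
  show "zero (presented_algebra F) = coset F 0"
    using a_rcos_const[of 0] relation_idealD(1)[of F]
    by (simp add: presented_algebra_def quot_algebra_def FactRing_def coset_def)
  show "add (presented_algebra F) (coset F f) (coset F g) = coset F (f + g)"
    using a_rcos_sum[of f g] by (simp add: presented_algebra_def quot_algebra_def FactRing_def coset_def)
  have "coset F (nc_const c * x) = coset F (nc_const c * f)" if "x \<in> coset F f" for x
    using that relation_idealD(3)[of "x - f" F "nc_const c"] by (simp add: coset_iff coset_eq_iff algebra_simps)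
  moreover have "f \<in> coset F f" by (simp add: coset_iff relation_idealD(1))
  ultimately have "(\<Union>x\<in>coset F f. coset F (nc_const c * x)) = coset F (nc_const c * f)" by blast
  then show "smult (presented_algebra F) c (coset F f) = coset F (nc_const c * f)"
    by (simp add: presented_algebra_def quot_algebra_def flip: coset_def)
qed

lemma ring_presented_algebra: "ring (presented_algebra F)"
proof (rule ringI)
  show "abelian_group (presented_algebra F)"
  proof (rule abelian_groupI)
    fix x assume "x \<in> carrier (presented_algebra F)"
    then obtain f where "x = coset F f" by (auto simp: presented_algebra_simps)
    then have "coset F (- f) \<oplus>\<^bsub>presented_algebra F\<^esub> x = \<zero>\<^bsub>presented_algebra F\<^esub>"
      by (simp add: presented_algebra_simps)
    then show "\<exists>y\<in>carrier (presented_algebra F). y \<oplus>\<^bsub>presented_algebra F\<^esub> x = \<zero>\<^bsub>presented_algebra F\<^esub>"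
      by (auto simp: presented_algebra_simps)
  qed (auto simp: presented_algebra_simps add_ac)
  show "Group.monoid (presented_algebra F)"
    by (rule monoidI) (auto simp: presented_algebra_simps mult.assoc)
qed (auto simp: presented_algebra_simps distrib_left distrib_right)

lemma homogenization_simps:
  "homogenization fs = presented_algebra (hom_relations fs)"
  "hom_x0 fs = coset (hom_relations fs) (nc_var None)"
  by (simp_all add: homogenization_def hom_x0_def coset_def)

section \<open>Lifting maps from a third syzygy\<close>

lemma left_moduleD:
  assumes "left_module R M"
  shows "ring R" "abelian_group M"
    "\<And>r m. r \<in> carrier R \<Longrightarrow> m \<in> carrier M \<Longrightarrow> r \<odot>\<^bsub>M\<^esub> m \<in> carrier M"
    "\<And>r s m. r \<in> carrier R \<Longrightarrow> s \<in> carrier R \<Longrightarrow> m \<in> carrier M \<Longrightarrow> (r \<oplus>\<^bsub>R\<^esub> s) \<odot>\<^bsub>M\<^esub> m = r \<odot>\<^bsub>M\<^esub> m \<oplus>\<^bsub>M\<^esub> s \<odot>\<^bsub>M\<^esub> m"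
    "\<And>r m m'. r \<in> carrier R \<Longrightarrow> m \<in> carrier M \<Longrightarrow> m' \<in> carrier M \<Longrightarrow> r \<odot>\<^bsub>M\<^esub> (m \<oplus>\<^bsub>M\<^esub> m') = r \<odot>\<^bsub>M\<^esub> m \<oplus>\<^bsub>M\<^esub> r \<odot>\<^bsub>M\<^esub> m'"
    "\<And>r s m. r \<in> carrier R \<Longrightarrow> s \<in> carrier R \<Longrightarrow> m \<in> carrier M \<Longrightarrow> (r \<otimes>\<^bsub>R\<^esub> s) \<odot>\<^bsub>M\<^esub> m = r \<odot>\<^bsub>M\<^esub> (s \<odot>\<^bsub>M\<^esub> m)"
    "\<And>m. m \<in> carrier M \<Longrightarrow> \<one>\<^bsub>R\<^esub> \<odot>\<^bsub>M\<^esub> m = m"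
  using assms unfolding left_module_def Module.module_axioms_def by auto

lemma left_module_add:
  assumes "left_module R M"
  shows "\<zero>\<^bsub>M\<^esub> \<in> carrier M" "\<And>m m'. m \<in> carrier M \<Longrightarrow> m' \<in> carrier M \<Longrightarrow> m \<oplus>\<^bsub>M\<^esub> m' \<in> carrier M"
    "\<And>m. m \<in> carrier M \<Longrightarrow> \<zero>\<^bsub>M\<^esub> \<oplus>\<^bsub>M\<^esub> m = m" "\<And>m. m \<in> carrier M \<Longrightarrow> m \<oplus>\<^bsub>M\<^esub> \<zero>\<^bsub>M\<^esub> = m"
    "\<And>m m'. m \<in> carrier M \<Longrightarrow> m' \<in> carrier M \<Longrightarrow> m \<oplus>\<^bsub>M\<^esub> m' = m' \<oplus>\<^bsub>M\<^esub> m"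
    "\<And>m m' m''. m \<in> carrier M \<Longrightarrow> m' \<in> carrier M \<Longrightarrow> m'' \<in> carrier M \<Longrightarrow> (m \<oplus>\<^bsub>M\<^esub> m') \<oplus>\<^bsub>M\<^esub> m'' = m \<oplus>\<^bsub>M\<^esub> (m' \<oplus>\<^bsub>M\<^esub> m'')"
    "\<And>m m' m''. m \<in> carrier M \<Longrightarrow> m' \<in> carrier M \<Longrightarrow> m'' \<in> carrier M \<Longrightarrow> m \<oplus>\<^bsub>M\<^esub> (m' \<oplus>\<^bsub>M\<^esub> m'') = m' \<oplus>\<^bsub>M\<^esub> (m \<oplus>\<^bsub>M\<^esub> m'')"
  using left_moduleD(2)[OF assms] by (auto simp: abelian_group_def abelian_monoid.zero_closed abelian_monoid.a_closed
    abelian_monoid.l_zero abelian_monoid.r_zero abelian_monoid.a_comm abelian_monoid.a_assoc abelian_monoid.a_lcomm)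

lemma left_module_cancel:
  assumes "left_module R M" "m \<in> carrier M" "m' \<in> carrier M" "m \<oplus>\<^bsub>M\<^esub> m' = m" shows "m' = \<zero>\<^bsub>M\<^esub>"
proof -
  interpret abelian_group M using left_moduleD(2)[OF assms(1)] .
  have "m' = (\<ominus>\<^bsub>M\<^esub> m \<oplus>\<^bsub>M\<^esub> m) \<oplus>\<^bsub>M\<^esub> m'" using assms(2,3) by (simp add: l_neg)
  also have "\<dots> = \<ominus>\<^bsub>M\<^esub> m \<oplus>\<^bsub>M\<^esub> m" using assms(2-4) by (simp add: a_assoc)
  also have "\<dots> = \<zero>\<^bsub>M\<^esub>" using assms(2) by (simp add: l_neg)
  finally show ?thesis .
qed

text \<open>Differences in a module are written with this scalar, so that homomorphisms respect them
  by additivity and linearity alone.\<close>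

definition neg_one :: "('a, 'r) ring_scheme \<Rightarrow> 'a" where
  "neg_one R = \<ominus>\<^bsub>R\<^esub> \<one>\<^bsub>R\<^esub>"

lemma neg_one_closed: "ring R \<Longrightarrow> neg_one R \<in> carrier R"
  by (simp add: neg_one_def ring.ring_simprules)

lemma left_module_zero_smult:
  assumes M: "left_module R M" and m: "m \<in> carrier M" shows "\<zero>\<^bsub>R\<^esub> \<odot>\<^bsub>M\<^esub> m = \<zero>\<^bsub>M\<^esub>"
proof -
  interpret ring R using left_moduleD(1)[OF M] .
  have "\<zero>\<^bsub>R\<^esub> \<odot>\<^bsub>M\<^esub> m \<oplus>\<^bsub>M\<^esub> \<zero>\<^bsub>R\<^esub> \<odot>\<^bsub>M\<^esub> m = \<zero>\<^bsub>R\<^esub> \<odot>\<^bsub>M\<^esub> m"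
    using left_moduleD(4)[OF M, of "\<zero>\<^bsub>R\<^esub>" "\<zero>\<^bsub>R\<^esub>" m] m by simp
  then show ?thesis using left_module_cancel[OF M] left_moduleD(3)[OF M] m by (metis ring.ring_simprules(2)[OF left_moduleD(1)[OF M]])
qed

lemma left_module_neg:
  assumes M: "left_module R M" and m: "m \<in> carrier M"
  shows "m \<oplus>\<^bsub>M\<^esub> neg_one R \<odot>\<^bsub>M\<^esub> m = \<zero>\<^bsub>M\<^esub>" "neg_one R \<odot>\<^bsub>M\<^esub> m \<oplus>\<^bsub>M\<^esub> m = \<zero>\<^bsub>M\<^esub>" "neg_one R \<odot>\<^bsub>M\<^esub> m \<in> carrier M"
proof -
  interpret ring R using left_moduleD(1)[OF M] .
  show c: "neg_one R \<odot>\<^bsub>M\<^esub> m \<in> carrier M"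
    using left_moduleD(3)[OF M neg_one_closed[OF left_moduleD(1)[OF M]] m] .
  have "neg_one R \<oplus>\<^bsub>R\<^esub> \<one>\<^bsub>R\<^esub> = \<zero>\<^bsub>R\<^esub>" by (simp add: neg_one_def l_neg)
  then show 1: "neg_one R \<odot>\<^bsub>M\<^esub> m \<oplus>\<^bsub>M\<^esub> m = \<zero>\<^bsub>M\<^esub>"
    using left_moduleD(4)[OF M neg_one_closed[OF left_moduleD(1)[OF M]] one_closed m]
    by (simp add: left_moduleD(7)[OF M m] left_module_zero_smult[OF M m])
  show "m \<oplus>\<^bsub>M\<^esub> neg_one R \<odot>\<^bsub>M\<^esub> m = \<zero>\<^bsub>M\<^esub>"
    using 1 left_module_add(5)[OF M m c] by simp
qed

text \<open>Additive inverses are supplied by multiplication with \<open>neg_one R\<close>; this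
  works once the zero scalar acts as zero, which is why that law is among the premises.\<close>

lemma left_moduleI:
  assumes "ring R" "\<zero>\<^bsub>M\<^esub> \<in> carrier M"
    "\<And>m m'. m \<in> carrier M \<Longrightarrow> m' \<in> carrier M \<Longrightarrow> m \<oplus>\<^bsub>M\<^esub> m' \<in> carrier M"
    "\<And>m. m \<in> carrier M \<Longrightarrow> \<zero>\<^bsub>M\<^esub> \<oplus>\<^bsub>M\<^esub> m = m"
    "\<And>m m'. m \<in> carrier M \<Longrightarrow> m' \<in> carrier M \<Longrightarrow> m \<oplus>\<^bsub>M\<^esub> m' = m' \<oplus>\<^bsub>M\<^esub> m"
    "\<And>m m' m''. m \<in> carrier M \<Longrightarrow> m' \<in> carrier M \<Longrightarrow> m'' \<in> carrier M \<Longrightarrow> (m \<oplus>\<^bsub>M\<^esub> m') \<oplus>\<^bsub>M\<^esub> m'' = m \<oplus>\<^bsub>M\<^esub> (m' \<oplus>\<^bsub>M\<^esub> m'')"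
    "\<And>r m. r \<in> carrier R \<Longrightarrow> m \<in> carrier M \<Longrightarrow> r \<odot>\<^bsub>M\<^esub> m \<in> carrier M"
    "\<And>r s m. r \<in> carrier R \<Longrightarrow> s \<in> carrier R \<Longrightarrow> m \<in> carrier M \<Longrightarrow> (r \<oplus>\<^bsub>R\<^esub> s) \<odot>\<^bsub>M\<^esub> m = r \<odot>\<^bsub>M\<^esub> m \<oplus>\<^bsub>M\<^esub> s \<odot>\<^bsub>M\<^esub> m"
    "\<And>r m m'. r \<in> carrier R \<Longrightarrow> m \<in> carrier M \<Longrightarrow> m' \<in> carrier M \<Longrightarrow> r \<odot>\<^bsub>M\<^esub> (m \<oplus>\<^bsub>M\<^esub> m') = r \<odot>\<^bsub>M\<^esub> m \<oplus>\<^bsub>M\<^esub> r \<odot>\<^bsub>M\<^esub> m'"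
    "\<And>r s m. r \<in> carrier R \<Longrightarrow> s \<in> carrier R \<Longrightarrow> m \<in> carrier M \<Longrightarrow> (r \<otimes>\<^bsub>R\<^esub> s) \<odot>\<^bsub>M\<^esub> m = r \<odot>\<^bsub>M\<^esub> (s \<odot>\<^bsub>M\<^esub> m)"
    "\<And>m. m \<in> carrier M \<Longrightarrow> \<one>\<^bsub>R\<^esub> \<odot>\<^bsub>M\<^esub> m = m"
    "\<And>m. m \<in> carrier M \<Longrightarrow> \<zero>\<^bsub>R\<^esub> \<odot>\<^bsub>M\<^esub> m = \<zero>\<^bsub>M\<^esub>"
  shows "left_module R M"
proof -
  interpret ring R by fact
  have "abelian_group M"
  proof (rule abelian_groupI)
    fix m assume m: "m \<in> carrier M"
    have n: "neg_one R \<in> carrier R" by (rule neg_one_closed) unfold_locales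
    have "neg_one R \<oplus>\<^bsub>R\<^esub> \<one>\<^bsub>R\<^esub> = \<zero>\<^bsub>R\<^esub>" by (simp add: neg_one_def l_neg)
    then have "neg_one R \<odot>\<^bsub>M\<^esub> m \<oplus>\<^bsub>M\<^esub> m = \<zero>\<^bsub>M\<^esub>"
      using assms(8)[OF n one_closed m] assms(11,12)[OF m] by simp
    then show "\<exists>y\<in>carrier M. y \<oplus>\<^bsub>M\<^esub> m = \<zero>\<^bsub>M\<^esub>" using assms(7)[OF n m] by blast
  qed (use assms in auto)
  then show ?thesis
    unfolding left_module_def Module.module_axioms_def using assms by simp
qed

lemma left_module_sub:
  assumes M: "left_module R M" and N: "N \<subseteq> carrier M" "\<zero>\<^bsub>M\<^esub> \<in> N"
    "\<And>m m'. m \<in> N \<Longrightarrow> m' \<in> N \<Longrightarrow> m \<oplus>\<^bsub>M\<^esub> m' \<in> N" "\<And>r m. r \<in> carrier R \<Longrightarrow> m \<in> N \<Longrightarrow> r \<odot>\<^bsub>M\<^esub> m \<in> N"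
  shows "left_module R (M\<lparr>carrier := N\<rparr>)"
  by (rule left_moduleI)
    (use N left_moduleD[OF M] left_module_add[OF M] left_module_zero_smult[OF M] in \<open>auto simp: subset_iff\<close>)

lemma module_homD:
  assumes "f \<in> module_hom R M N"
  shows "\<And>m. m \<in> carrier M \<Longrightarrow> f m \<in> carrier N"
    "\<And>m m'. m \<in> carrier M \<Longrightarrow> m' \<in> carrier M \<Longrightarrow> f (m \<oplus>\<^bsub>M\<^esub> m') = f m \<oplus>\<^bsub>N\<^esub> f m'"
    "\<And>r m. r \<in> carrier R \<Longrightarrow> m \<in> carrier M \<Longrightarrow> f (r \<odot>\<^bsub>M\<^esub> m) = r \<odot>\<^bsub>N\<^esub> f m"
  using assms unfolding LinearCombinations.module_hom_def by auto

lemma module_homI: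
  assumes "\<And>m. m \<in> carrier M \<Longrightarrow> f m \<in> carrier N"
    "\<And>m m'. m \<in> carrier M \<Longrightarrow> m' \<in> carrier M \<Longrightarrow> f (m \<oplus>\<^bsub>M\<^esub> m') = f m \<oplus>\<^bsub>N\<^esub> f m'"
    "\<And>r m. r \<in> carrier R \<Longrightarrow> m \<in> carrier M \<Longrightarrow> f (r \<odot>\<^bsub>M\<^esub> m) = r \<odot>\<^bsub>N\<^esub> f m"
  shows "f \<in> module_hom R M N"
  using assms unfolding LinearCombinations.module_hom_def by auto

lemma module_hom_zero:
  assumes "left_module R M" "left_module R N" "f \<in> module_hom R M N" shows "f \<zero>\<^bsub>M\<^esub> = \<zero>\<^bsub>N\<^esub>"
proof -
  have z: "\<zero>\<^bsub>M\<^esub> \<in> carrier M" by (rule left_module_add(1)[OF assms(1)])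
  have "f \<zero>\<^bsub>M\<^esub> = f (\<zero>\<^bsub>R\<^esub> \<odot>\<^bsub>M\<^esub> \<zero>\<^bsub>M\<^esub>)" by (simp add: left_module_zero_smult[OF assms(1) z])
  also have "\<dots> = \<zero>\<^bsub>R\<^esub> \<odot>\<^bsub>N\<^esub> f \<zero>\<^bsub>M\<^esub>"
    using module_homD(3)[OF assms(3) _ z] left_moduleD(1)[OF assms(1)] by (simp add: ring.ring_simprules)
  also have "\<dots> = \<zero>\<^bsub>N\<^esub>" by (rule left_module_zero_smult[OF assms(2) module_homD(1)[OF assms(3) z]])
  finally show ?thesis .
qed

lemma module_hom_comp:
  assumes f: "f \<in> module_hom R M N" and g: "g \<in> module_hom R N L"
  shows "(\<lambda>m. g (f m)) \<in> module_hom R M L"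
  by (rule module_homI) (simp_all add: module_homD[OF f] module_homD[OF g])

text \<open>Multiplication by \<open>r\<close> is linear because \<open>r\<close> commutes with all
  scalars; the application is \<open>r = -1\<close>, which gives differences of
  homomorphisms.\<close>

lemma module_hom_combine:
  assumes L: "left_module R N" and f: "f \<in> module_hom R M N" and g: "g \<in> module_hom R M N"
    and r: "r \<in> carrier R" "\<And>s. s \<in> carrier R \<Longrightarrow> r \<otimes>\<^bsub>R\<^esub> s = s \<otimes>\<^bsub>R\<^esub> r"
  shows "(\<lambda>m. f m \<oplus>\<^bsub>N\<^esub> r \<odot>\<^bsub>N\<^esub> g m) \<in> module_hom R M N"
proof (rule module_homI)
  fix s m assume "s \<in> carrier R" "m \<in> carrier M"
  moreover from this have "r \<odot>\<^bsub>N\<^esub> (s \<odot>\<^bsub>N\<^esub> g m) = s \<odot>\<^bsub>N\<^esub> (r \<odot>\<^bsub>N\<^esub> g m)"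
    using r left_moduleD(6)[OF L] module_homD(1)[OF g] by metis
  ultimately show "f (s \<odot>\<^bsub>M\<^esub> m) \<oplus>\<^bsub>N\<^esub> r \<odot>\<^bsub>N\<^esub> g (s \<odot>\<^bsub>M\<^esub> m) = s \<odot>\<^bsub>N\<^esub> (f m \<oplus>\<^bsub>N\<^esub> r \<odot>\<^bsub>N\<^esub> g m)"
    using module_homD[OF f] module_homD[OF g] left_moduleD(3,5)[OF L] r(1) by auto
qed (use module_homD[OF f] module_homD[OF g] left_moduleD(3,5)[OF L] left_module_add[OF L] r(1) in auto)

lemma neg_one_commute: "ring R \<Longrightarrow> s \<in> carrier R \<Longrightarrow> neg_one R \<otimes>\<^bsub>R\<^esub> s = s \<otimes>\<^bsub>R\<^esub> neg_one R"
proof -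
  assume R: "ring R" and s: "s \<in> carrier R"
  interpret ring R by fact
  show ?thesis using s by (simp add: neg_one_def l_minus r_minus)
qed

lemma module_hom_diff:
  assumes L: "left_module R N" and f: "f \<in> module_hom R M N" and g: "g \<in> module_hom R M N"
  shows "(\<lambda>m. f m \<oplus>\<^bsub>N\<^esub> neg_one R \<odot>\<^bsub>N\<^esub> g m) \<in> module_hom R M N"
  by (rule module_hom_combine[OF assms neg_one_closed[OF left_moduleD(1)[OF L]] neg_one_commute[OF left_moduleD(1)[OF L]]])

lemma module_hom_sum:
  assumes L: "left_module R N" and f: "f \<in> module_hom R M N" and g: "g \<in> module_hom R M N"
  shows "(\<lambda>m. f m \<oplus>\<^bsub>N\<^esub> g m) \<in> module_hom R M N"
  by (rule module_homI) (use module_homD[OF f] module_homD[OF g] left_moduleD[OF L] left_module_add[OF L] in auto)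

definition ker_module :: "('a, 'm) module \<Rightarrow> ('m \<Rightarrow> 'n) \<Rightarrow> ('b, 'n) module \<Rightarrow> ('a, 'm) module" where
  "ker_module M f N = M\<lparr>carrier := {m \<in> carrier M. f m = \<zero>\<^bsub>N\<^esub>}\<rparr>"

lemma ker_module_simps [simp]:
  "carrier (ker_module M f N) = {m \<in> carrier M. f m = \<zero>\<^bsub>N\<^esub>}" "zero (ker_module M f N) = zero M"
  "add (ker_module M f N) = add M" "smult (ker_module M f N) = smult M"
  by (simp_all add: ker_module_def)

lemma left_module_smult_zero:
  assumes M: "left_module R M" and r: "r \<in> carrier R" shows "r \<odot>\<^bsub>M\<^esub> \<zero>\<^bsub>M\<^esub> = \<zero>\<^bsub>M\<^esub>"
  using left_moduleD(5)[OF M r left_module_add(1)[OF M] left_module_add(1)[OF M]]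
    left_module_cancel[OF M] left_moduleD(3)[OF M r left_module_add(1)[OF M]] left_module_add(3)[OF M left_module_add(1)[OF M]]
  by metis

lemma left_module_ker:
  assumes M: "left_module R M" and N: "left_module R N" and f: "f \<in> module_hom R M N"
  shows "left_module R (ker_module M f N)"
  unfolding ker_module_def
  by (rule left_module_sub[OF M])
    (use left_moduleD[OF M] left_module_add[OF M] left_module_add[OF N] module_homD[OF f] module_hom_zero[OF M N f]
      left_module_smult_zero[OF N] in auto)

lemma projective_left_module: "projective R P \<Longrightarrow> left_module R P"
  by (simp add: projective_def)

lemma projective_lift:
  assumes "projective R (P :: 'a amod)" "left_module R (N :: 'a amod)" "left_module R (N' :: 'a amod)"
    "g \<in> module_hom R N N'" "g ` carrier N = carrier N'" "f \<in> module_hom R P N'"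
  shows "\<exists>h \<in> module_hom R P N. \<forall>p \<in> carrier P. g (h p) = f p"
  using assms unfolding projective_def by blast

text \<open>The module \<open>M\<close> is a direct summand of \<open>N\<close> up to projective modules.\<close>

definition stable_retract :: "('a, 'r) ring_scheme \<Rightarrow> 'a amod \<Rightarrow> 'a amod \<Rightarrow> bool" where
  "stable_retract R M N \<longleftrightarrow> (\<exists>\<phi> \<in> module_hom R M N. \<exists>\<psi> \<in> module_hom R N M. \<exists>F :: 'a amod. projective R F \<and>
     (\<exists>a \<in> module_hom R M F. \<exists>b \<in> module_hom R F M. \<forall>m \<in> carrier M. \<psi> (\<phi> m) = m \<oplus>\<^bsub>M\<^esub> b (a m)))"

text \<open>A form of Schanuel's lemma without direct sums. Lift both maps to the projectives; on
  the kernels the composite differs from the identity by a map that extends to all of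
  \<open>F\<close>, hence by one that factors through the inclusion into \<open>F\<close>.\<close>

lemma stable_retract_syzygy:
  fixes M N F P :: "'a amod"
  assumes M: "left_module R M" and N: "left_module R N" and F: "projective R F" and P: "projective R P"
    and e: "e \<in> module_hom R F M" "e ` carrier F = carrier M"
    and e': "e' \<in> module_hom R P N" "e' ` carrier P = carrier N"
    and ret: "stable_retract R M N"
  shows "stable_retract R (ker_module F e M) (ker_module P e' N)"
proof -
  note LF = projective_left_module[OF F] note LP = projective_left_module[OF P]
  from ret obtain \<phi> \<psi> and G :: "'a amod" and a b where \<phi>: "\<phi> \<in> module_hom R M N" and \<psi>: "\<psi> \<in> module_hom R N M"
    and G: "projective R G" and a: "a \<in> module_hom R M G" and b: "b \<in> module_hom R G M"
    and eq: "\<And>m. m \<in> carrier M \<Longrightarrow> \<psi> (\<phi> m) = m \<oplus>\<^bsub>M\<^esub> b (a m)"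
    unfolding stable_retract_def by blast
  obtain \<phi>0 where \<phi>0: "\<phi>0 \<in> module_hom R F P" "\<And>p. p \<in> carrier F \<Longrightarrow> e' (\<phi>0 p) = \<phi> (e p)"
    using projective_lift[OF F LP N e' module_hom_comp[OF e(1) \<phi>]] by blast
  obtain \<psi>0 where \<psi>0: "\<psi>0 \<in> module_hom R P F" "\<And>p. p \<in> carrier P \<Longrightarrow> e (\<psi>0 p) = \<psi> (e' p)"
    using projective_lift[OF P LF M e module_hom_comp[OF e'(1) \<psi>]] by blast
  obtain b0 where b0: "b0 \<in> module_hom R G F" "\<And>p. p \<in> carrier G \<Longrightarrow> e (b0 p) = b p"
    using projective_lift[OF G LF M e b] by blast
  let ?S = "ker_module F e M" and ?Q = "ker_module P e' N"
  \<comment> \<open>The lifted composite minus the identity and minus a lift of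
    \<open>b (a (e x))\<close>. The last term makes \<open>e\<close> vanish on the image of
    \<theta>, and it is itself zero on the kernel of \<open>e\<close>.\<close>
  define \<theta> where "\<theta> = (\<lambda>x. \<psi>0 (\<phi>0 x) \<oplus>\<^bsub>F\<^esub> neg_one R \<odot>\<^bsub>F\<^esub> (x \<oplus>\<^bsub>F\<^esub> b0 (a (e x))))"
  have id: "(\<lambda>x. x) \<in> module_hom R F F" by (rule module_homI) auto
  have bae: "(\<lambda>x. x \<oplus>\<^bsub>F\<^esub> b0 (a (e x))) \<in> module_hom R F F"
    by (rule module_hom_sum[OF LF id module_hom_comp[OF module_hom_comp[OF e(1) a] b0(1)]])
  have \<theta>F: "\<theta> \<in> module_hom R F F"
    unfolding \<theta>_def by (rule module_hom_diff[OF LF module_hom_comp[OF \<phi>0(1) \<psi>0(1)] bae])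
  have "e (\<theta> x) = \<zero>\<^bsub>M\<^esub>" if x: "x \<in> carrier F" for x
  proof -
    have c: "b0 (a (e x)) \<in> carrier F" "a (e x) \<in> carrier G" "e x \<in> carrier M" "\<phi>0 x \<in> carrier P" "\<psi>0 (\<phi>0 x) \<in> carrier F"
      using x module_homD(1)[OF e(1)] module_homD(1)[OF a] module_homD(1)[OF b0(1)] module_homD(1)[OF \<phi>0(1)] module_homD(1)[OF \<psi>0(1)]
      by auto
    have "e (\<theta> x) = e (\<psi>0 (\<phi>0 x)) \<oplus>\<^bsub>M\<^esub> neg_one R \<odot>\<^bsub>M\<^esub> (e x \<oplus>\<^bsub>M\<^esub> e (b0 (a (e x))))"
      using c x module_homD[OF e(1)] left_module_add(2)[OF LF] left_module_neg(3)[OF LF] neg_one_closed[OF left_moduleD(1)[OF LF]]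
      by (simp add: \<theta>_def)
    also have "\<dots> = (e x \<oplus>\<^bsub>M\<^esub> b (a (e x))) \<oplus>\<^bsub>M\<^esub> neg_one R \<odot>\<^bsub>M\<^esub> (e x \<oplus>\<^bsub>M\<^esub> b (a (e x)))"
      using c x by (simp add: \<psi>0(2) \<phi>0(2) b0(2) eq)
    also have "\<dots> = \<zero>\<^bsub>M\<^esub>"
      using c left_module_neg(1)[OF M] left_module_add(2)[OF M] module_homD(1)[OF b] by simp
    finally show ?thesis .
  qed
  then have \<theta>: "\<theta> \<in> module_hom R F ?S"
    by (intro module_homI) (simp_all add: module_homD[OF \<theta>F])
  have \<phi>S: "\<phi>0 \<in> module_hom R ?S ?Q"
    by (intro module_homI) (auto simp: module_homD[OF \<phi>0(1)] \<phi>0(2) module_hom_zero[OF M N \<phi>])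
  have \<psi>S: "\<psi>0 \<in> module_hom R ?Q ?S"
    by (intro module_homI) (auto simp: module_homD[OF \<psi>0(1)] \<psi>0(2) module_hom_zero[OF N M \<psi>])
  have inc: "(\<lambda>x. x) \<in> module_hom R ?S F" by (rule module_homI) auto
  have "\<psi>0 (\<phi>0 x) = x \<oplus>\<^bsub>?S\<^esub> \<theta> x" if x: "x \<in> carrier ?S" for x
  proof -
    have LG: "left_module R G" using G by (rule projective_left_module)
    have xF: "x \<in> carrier F" and ex: "e x = \<zero>\<^bsub>M\<^esub>" using x by auto
    have "b0 (a (e x)) = \<zero>\<^bsub>F\<^esub>"
      using ex module_hom_zero[OF M LG a] module_hom_zero[OF LG LF b0(1)] by simp
    then have "\<theta> x = \<psi>0 (\<phi>0 x) \<oplus>\<^bsub>F\<^esub> neg_one R \<odot>\<^bsub>F\<^esub> x"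
      using left_module_add(4)[OF LF xF] by (simp add: \<theta>_def)
    moreover have "\<psi>0 (\<phi>0 x) \<in> carrier F" using xF module_homD(1)[OF \<phi>0(1)] module_homD(1)[OF \<psi>0(1)] by auto
    ultimately show ?thesis
      using left_module_add(7)[OF LF xF _ left_module_neg(3)[OF LF xF]] left_module_neg(1)[OF LF xF] left_module_add(4)[OF LF]
      by simp
  qed
  then show ?thesis
    unfolding stable_retract_def
    by (intro bexI[OF _ \<phi>S] bexI[OF _ \<psi>S] exI[of _ F] conjI F bexI[OF _ inc] bexI[OF _ \<theta>]) blast
qed

text \<open>A lift of \<open>f \<circ> \<psi>\<close>, precomposed with \<phi>, overshoots by
  \<open>f \<circ> b \<circ> a\<close>; this excess factors through a projective module and so lifts
  as well.\<close>

lemma stable_retract_lift: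
  fixes T Q X K :: "'a amod"
  assumes ret: "stable_retract R T Q" and T: "left_module R T" and X: "left_module R X" and K: "left_module R K"
    and g: "g \<in> module_hom R X K" "g ` carrier X = carrier K"
    and Q: "\<And>f. f \<in> module_hom R Q K \<Longrightarrow> \<exists>h \<in> module_hom R Q X. \<forall>q \<in> carrier Q. g (h q) = f q"
    and f: "f \<in> module_hom R T K"
  shows "\<exists>h \<in> module_hom R T X. \<forall>t \<in> carrier T. g (h t) = f t"
proof -
  from ret obtain \<phi> \<psi> and G :: "'a amod" and a b where \<phi>: "\<phi> \<in> module_hom R T Q" and \<psi>: "\<psi> \<in> module_hom R Q T"
    and G: "projective R G" and a: "a \<in> module_hom R T G" and b: "b \<in> module_hom R G T"
    and eq: "\<And>m. m \<in> carrier T \<Longrightarrow> \<psi> (\<phi> m) = m \<oplus>\<^bsub>T\<^esub> b (a m)"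
    unfolding stable_retract_def by blast
  obtain \<mu> where \<mu>: "\<mu> \<in> module_hom R Q X" "\<And>q. q \<in> carrier Q \<Longrightarrow> g (\<mu> q) = f (\<psi> q)"
    using Q[OF module_hom_comp[OF \<psi> f]] by blast
  obtain \<nu> where \<nu>: "\<nu> \<in> module_hom R G X" "\<And>p. p \<in> carrier G \<Longrightarrow> g (\<nu> p) = f (b p)"
    using projective_lift[OF G X K g module_hom_comp[OF b f]] by blast
  define h where "h = (\<lambda>t. \<mu> (\<phi> t) \<oplus>\<^bsub>X\<^esub> neg_one R \<odot>\<^bsub>X\<^esub> \<nu> (a t))"
  have "h \<in> module_hom R T X"
    unfolding h_def by (rule module_hom_diff[OF X module_hom_comp[OF \<phi> \<mu>(1)] module_hom_comp[OF a \<nu>(1)]])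
  moreover have "g (h t) = f t" if t: "t \<in> carrier T" for t
  proof -
    have c: "\<phi> t \<in> carrier Q" "\<mu> (\<phi> t) \<in> carrier X" "a t \<in> carrier G" "\<nu> (a t) \<in> carrier X" "b (a t) \<in> carrier T"
      "f t \<in> carrier K" "f (b (a t)) \<in> carrier K"
      using t module_homD(1)[OF \<phi>] module_homD(1)[OF \<mu>(1)] module_homD(1)[OF a] module_homD(1)[OF \<nu>(1)] module_homD(1)[OF b]
        module_homD(1)[OF f] by auto
    have "g (h t) = f (\<psi> (\<phi> t)) \<oplus>\<^bsub>K\<^esub> neg_one R \<odot>\<^bsub>K\<^esub> f (b (a t))"
      using c module_homD[OF g(1)] left_module_neg(3)[OF X] neg_one_closed[OF left_moduleD(1)[OF X]]
      by (simp add: h_def \<mu>(2) \<nu>(2))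
    also have "\<dots> = (f t \<oplus>\<^bsub>K\<^esub> f (b (a t))) \<oplus>\<^bsub>K\<^esub> neg_one R \<odot>\<^bsub>K\<^esub> f (b (a t))"
      using t c module_homD(2)[OF f] eq by simp
    also have "\<dots> = f t"
      using left_module_add(6)[OF K c(6,7) left_module_neg(3)[OF K c(7)]] left_module_neg(1)[OF K c(7)] left_module_add(4)[OF K c(6)]
      by simp
    finally show ?thesis .
  qed
  ultimately show ?thesis by blast
qed

subsection \<open>Free modules of finite rank\<close>

text \<open>Sums over an initial segment by recursion; they serve rings and modules alike, since
  both are ring records, and unfold without carrier conditions.\<close>

primrec nsum :: "('a, 'r) ring_scheme \<Rightarrow> (nat \<Rightarrow> 'a) \<Rightarrow> nat \<Rightarrow> 'a" where
  "nsum R g 0 = \<zero>\<^bsub>R\<^esub>"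
| "nsum R g (Suc n) = nsum R g n \<oplus>\<^bsub>R\<^esub> g n"

lemma nsum_cong: "(\<And>i. i < n \<Longrightarrow> g i = g' i) \<Longrightarrow> nsum R g n = nsum R g' n"
  by (induction n) auto

text \<open>Sequences that vanish from \<open>n\<close> on, so that the module has the element type
  over which \<open>projective\<close> and the resolutions range.\<close>

definition free_module :: "('a, 'r) ring_scheme \<Rightarrow> nat \<Rightarrow> 'a amod" where
  "free_module R n = \<lparr>carrier = {f. (\<forall>i<n. f i \<in> carrier R) \<and> (\<forall>i\<ge>n. f i = \<zero>\<^bsub>R\<^esub>)}, mult = undefined, one = undefined,
     zero = (\<lambda>_. \<zero>\<^bsub>R\<^esub>), add = (\<lambda>f g i. f i \<oplus>\<^bsub>R\<^esub> g i), smult = (\<lambda>r f i. r \<otimes>\<^bsub>R\<^esub> f i)\<rparr>"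

lemma free_module_simps:
  "f \<in> carrier (free_module R n) \<longleftrightarrow> (\<forall>i<n. f i \<in> carrier R) \<and> (\<forall>i\<ge>n. f i = \<zero>\<^bsub>R\<^esub>)"
  "zero (free_module R n) = (\<lambda>_. \<zero>\<^bsub>R\<^esub>)" "f \<oplus>\<^bsub>free_module R n\<^esub> g = (\<lambda>i. f i \<oplus>\<^bsub>R\<^esub> g i)"
  "r \<odot>\<^bsub>free_module R n\<^esub> f = (\<lambda>i. r \<otimes>\<^bsub>R\<^esub> f i)"
  by (simp_all add: free_module_def)

lemma free_module_closed:
  assumes "ring R" "f \<in> carrier (free_module R n)" shows "f i \<in> carrier R"
  using assms by (cases "i < n") (auto simp: free_module_simps ring.ring_simprules)

lemma left_module_free:
  assumes R: "ring R" shows "left_module R (free_module R n)"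
proof -
  interpret ring R by fact
  note c = free_module_closed[OF R, of _ n]
  show ?thesis
    by (rule left_moduleI[OF R]) (auto simp: free_module_simps(2-4) fun_eq_iff c l_distr r_distr m_assoc a_assoc a_comm a_lcomm, auto simp: free_module_simps(1))
qed

lemma nsum_closed: "left_module R M \<Longrightarrow> (\<And>i. i < n \<Longrightarrow> g i \<in> carrier M) \<Longrightarrow> nsum M g n \<in> carrier M"
  by (induction n) (auto simp: left_module_add)

lemma nsum_linear:
  assumes M: "left_module R M" and y: "\<And>i. i < n \<Longrightarrow> y i \<in> carrier M"
  shows "(\<lambda>f. nsum M (\<lambda>i. f i \<odot>\<^bsub>M\<^esub> y i) n) \<in> module_hom R (free_module R n) M"
proof -
  note R = left_moduleD(1)[OF M]
  interpret ring R by fact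
  note c = free_module_closed[OF R]
  have cl: "nsum M (\<lambda>i. f i \<odot>\<^bsub>M\<^esub> y i) k \<in> carrier M" if "f \<in> carrier (free_module R n)" "k \<le> n" for f k
    by (rule nsum_closed[OF M]) (use that c y left_moduleD(3)[OF M] in auto)
  show ?thesis
  proof (rule module_homI)
    fix f g assume f: "f \<in> carrier (free_module R n)" and g: "g \<in> carrier (free_module R n)"
    have "nsum M (\<lambda>i. (f i \<oplus>\<^bsub>R\<^esub> g i) \<odot>\<^bsub>M\<^esub> y i) k = nsum M (\<lambda>i. f i \<odot>\<^bsub>M\<^esub> y i) k \<oplus>\<^bsub>M\<^esub> nsum M (\<lambda>i. g i \<odot>\<^bsub>M\<^esub> y i) k" if "k \<le> n" for k
      using that
    proof (induction k)
      case (Suc k)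
      then show ?case
        using c[OF f] c[OF g] y[of k] cl[OF f, of k] cl[OF g, of k]
        by (simp add: left_moduleD[OF M] left_module_add[OF M])
    qed (simp add: left_module_add[OF M])
    then show "nsum M (\<lambda>i. (f \<oplus>\<^bsub>free_module R n\<^esub> g) i \<odot>\<^bsub>M\<^esub> y i) n
        = nsum M (\<lambda>i. f i \<odot>\<^bsub>M\<^esub> y i) n \<oplus>\<^bsub>M\<^esub> nsum M (\<lambda>i. g i \<odot>\<^bsub>M\<^esub> y i) n"
      by (simp add: free_module_simps)
  next
    fix r f assume r: "r \<in> carrier R" and f: "f \<in> carrier (free_module R n)"
    have "nsum M (\<lambda>i. (r \<otimes>\<^bsub>R\<^esub> f i) \<odot>\<^bsub>M\<^esub> y i) k = r \<odot>\<^bsub>M\<^esub> nsum M (\<lambda>i. f i \<odot>\<^bsub>M\<^esub> y i) k" if "k \<le> n" for k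
      using that
    proof (induction k)
      case (Suc k)
      then show ?case
        using c[OF f] r y[of k] cl[OF f, of k] by (simp add: left_moduleD[OF M] left_module_add[OF M])
    qed (simp add: left_module_smult_zero[OF M r])
    then show "nsum M (\<lambda>i. (r \<odot>\<^bsub>free_module R n\<^esub> f) i \<odot>\<^bsub>M\<^esub> y i) n = r \<odot>\<^bsub>M\<^esub> nsum M (\<lambda>i. f i \<odot>\<^bsub>M\<^esub> y i) n"
      by (simp add: free_module_simps)
  qed (use cl in auto)
qed

definition unit_vec :: "('a, 'r) ring_scheme \<Rightarrow> nat \<Rightarrow> nat \<Rightarrow> 'a" where
  "unit_vec R i = (\<lambda>j. if j = i then \<one>\<^bsub>R\<^esub> else \<zero>\<^bsub>R\<^esub>)"

lemma unit_vec_closed: "ring R \<Longrightarrow> i < n \<Longrightarrow> unit_vec R i \<in> carrier (free_module R n)"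
  by (auto simp: free_module_simps unit_vec_def ring.ring_simprules)

lemma hom_free_module:
  assumes M: "left_module R M" and f: "f \<in> module_hom R (free_module R n) M" and p: "p \<in> carrier (free_module R n)"
  shows "f p = nsum M (\<lambda>i. p i \<odot>\<^bsub>M\<^esub> f (unit_vec R i)) n"
proof -
  note R = left_moduleD(1)[OF M]
  interpret ring R by fact
  note c = free_module_closed[OF R]
  let ?t = "\<lambda>k i. if i < k then p i else \<zero>\<^bsub>R\<^esub>"
  have "?t k \<in> carrier (free_module R n) \<and> f (?t k) = nsum M (\<lambda>i. p i \<odot>\<^bsub>M\<^esub> f (unit_vec R i)) k" if "k \<le> n" for k
    using that
  proof (induction k)
    case 0
    then show ?case using module_hom_zero[OF left_module_free[OF R] M f] by (simp add: free_module_simps)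
  next
    case (Suc k)
    have "?t (Suc k) = ?t k \<oplus>\<^bsub>free_module R n\<^esub> p k \<odot>\<^bsub>free_module R n\<^esub> unit_vec R k"
      using c[OF p] by (auto simp: free_module_simps unit_vec_def fun_eq_iff less_Suc_eq)
    moreover have "p k \<odot>\<^bsub>free_module R n\<^esub> unit_vec R k \<in> carrier (free_module R n)"
      using left_moduleD(3)[OF left_module_free[OF R]] c[OF p] unit_vec_closed[OF R] Suc.prems by simp
    ultimately show ?case
      using Suc module_homD(2,3)[OF f] c[OF p] unit_vec_closed[OF R] left_module_add(2)[OF left_module_free[OF R]] by simp
  qed
  moreover have "?t n = p" using p by (auto simp: free_module_simps)
  ultimately show ?thesis by (metis (no_types, lifting) order_refl)
qed

lemma hom_nsum:
  assumes M: "left_module R M" and N: "left_module R N" and g: "g \<in> module_hom R M N" and y: "\<And>i. i < n \<Longrightarrow> y i \<in> carrier M"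
  shows "g (nsum M y n) = nsum N (\<lambda>i. g (y i)) n"
  using y by (induction n) (simp_all add: module_hom_zero[OF M N g] module_homD(2)[OF g] nsum_closed[OF M])

lemma projective_free:
  assumes R: "ring R" shows "projective R (free_module R n)"
  unfolding projective_def
proof (intro conjI allI impI)
  show "left_module R (free_module R n)" by (rule left_module_free[OF R])
  fix N N' :: "'a amod" and g f
  assume "left_module R N \<and> left_module R N' \<and> g \<in> module_hom R N N' \<and> g ` carrier N = carrier N' \<and>
    f \<in> module_hom R (free_module R n) N'"
  then have N: "left_module R N" and N': "left_module R N'" and g: "g \<in> module_hom R N N'" "g ` carrier N = carrier N'"
    and f: "f \<in> module_hom R (free_module R n) N'" by auto
  have "\<forall>i<n. \<exists>y\<in>carrier N. g y = f (unit_vec R i)"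
    using g(2) module_homD(1)[OF f] unit_vec_closed[OF R] by (metis imageE)
  then obtain y where y: "\<And>i. i < n \<Longrightarrow> y i \<in> carrier N" "\<And>i. i < n \<Longrightarrow> g (y i) = f (unit_vec R i)" by metis
  let ?h = "\<lambda>p. nsum N (\<lambda>i. p i \<odot>\<^bsub>N\<^esub> y i) n"
  have "g (?h p) = f p" if p: "p \<in> carrier (free_module R n)" for p
  proof -
    note c = free_module_closed[OF R p]
    have "g (?h p) = nsum N' (\<lambda>i. g (p i \<odot>\<^bsub>N\<^esub> y i)) n"
      by (rule hom_nsum[OF N N' g(1)]) (use c y left_moduleD(3)[OF N] in auto)
    also have "\<dots> = nsum N' (\<lambda>i. p i \<odot>\<^bsub>N'\<^esub> f (unit_vec R i)) n"
      by (rule nsum_cong) (use c y module_homD(3)[OF g(1)] in auto)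
    also have "\<dots> = f p" by (rule hom_free_module[OF N' f p, symmetric])
    finally show ?thesis .
  qed
  then show "\<exists>h\<in>module_hom R (free_module R n) N. \<forall>p\<in>carrier (free_module R n). g (h p) = f p"
    by (intro bexI[OF _ nsum_linear[OF N, of n y]]) (simp_all add: y(1))
qed

subsection \<open>The fourth term of a resolution\<close>

text \<open>A finite bound excludes the empty set of lengths, whose infimum is infinite, and a
  nonempty set of values in \<open>enat\<close> attains its infimum.\<close>

lemma proj_dim_le:
  assumes "proj_dim R M \<le> enat d"
  shows "\<exists>P dd e. projective_resolution R M P dd e \<and> (\<forall>i>d. zero_module (P i))"
proof -
  let ?S = "{n. \<exists>P dd e. projective_resolution R M P dd e \<and> (\<forall>i>n. zero_module (P i))}"
  have le: "Inf (enat ` ?S) \<le> enat d" using assms by (simp add: proj_dim_def)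
  then have ne: "enat ` ?S \<noteq> {}" by (metis Inf_empty enat_ord_code(5) infinity_ileE top_enat_def)
  have Inf_in: "Inf A \<in> A" if "A \<noteq> {}" for A :: "enat set"
    using that LeastI[of "\<lambda>x. x \<in> A"] by (auto simp: Inf_enat_def)
  have "Inf (enat ` ?S) \<in> enat ` ?S" by (rule Inf_in[OF ne])
  then obtain n where n: "n \<in> ?S" "Inf (enat ` ?S) = enat n" by (rule imageE)
  then have "n \<le> d" using le by simp
  then obtain P dd e where "projective_resolution R M P dd e" "\<forall>i>n. zero_module (P i)" using n(1) by blast
  then show ?thesis using \<open>n \<le> d\<close> by (metis le_less_trans)
qed

text \<open>Here \<epsilon> is an augmentation with the trivial module as its image,
  \<open>x\<close> and \<open>Y\<close> start a free resolution of that module, and \<open>T\<close>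
  is the third syzygy. In a resolution of length three the third syzygy is projective, so
  \<open>T\<close> is a stable retract of a projective module. Hence the map \<open>l\<close> from
  \<open>T\<close> to the trivial module lifts along \<epsilon> to a map \<open>h\<close> into the
  ring.\<close>

lemma third_syzygy_lift:
  fixes x :: "nat \<Rightarrow> 'a" and Y :: "nat \<Rightarrow> nat \<Rightarrow> 'a" and \<epsilon> :: "'a \<Rightarrow> 'a"
  assumes R: "ring R" and gldim: "left_gldim R \<le> enat 3"
    and \<epsilon>: "\<And>r. r \<in> carrier R \<Longrightarrow> \<epsilon> r \<in> carrier R" "\<And>r s. r \<in> carrier R \<Longrightarrow> s \<in> carrier R \<Longrightarrow> \<epsilon> (r \<oplus>\<^bsub>R\<^esub> s) = \<epsilon> r \<oplus>\<^bsub>R\<^esub> \<epsilon> s"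
      "\<And>r s. r \<in> carrier R \<Longrightarrow> s \<in> carrier R \<Longrightarrow> \<epsilon> (r \<otimes>\<^bsub>R\<^esub> s) = \<epsilon> r \<otimes>\<^bsub>R\<^esub> \<epsilon> s" "\<epsilon> \<one>\<^bsub>R\<^esub> = \<one>\<^bsub>R\<^esub>"
      "\<And>r. r \<in> carrier R \<Longrightarrow> \<epsilon> (\<epsilon> r) = \<epsilon> r"
    and x: "\<And>i. i < p \<Longrightarrow> x i \<in> carrier R" "\<And>i. i < p \<Longrightarrow> \<epsilon> (x i) = \<zero>\<^bsub>R\<^esub>"
      "\<And>r. r \<in> carrier R \<Longrightarrow> \<epsilon> r = \<zero>\<^bsub>R\<^esub> \<Longrightarrow> \<exists>a \<in> carrier (free_module R p). r = nsum R (\<lambda>i. a i \<otimes>\<^bsub>R\<^esub> x i) p"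
    and Y: "\<And>j. j < s \<Longrightarrow> Y j \<in> carrier (free_module R p)" "\<And>j. j < s \<Longrightarrow> nsum R (\<lambda>i. Y j i \<otimes>\<^bsub>R\<^esub> x i) p = \<zero>\<^bsub>R\<^esub>"
      "\<And>a. a \<in> carrier (free_module R p) \<Longrightarrow> nsum R (\<lambda>i. a i \<otimes>\<^bsub>R\<^esub> x i) p = \<zero>\<^bsub>R\<^esub> \<Longrightarrow>
         \<exists>b \<in> carrier (free_module R s). \<forall>i<p. a i = nsum R (\<lambda>j. b j \<otimes>\<^bsub>R\<^esub> Y j i) s"
    and T: "T = {b \<in> carrier (free_module R s). \<forall>i<p. nsum R (\<lambda>j. b j \<otimes>\<^bsub>R\<^esub> Y j i) s = \<zero>\<^bsub>R\<^esub>}"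
    and l: "\<And>b. b \<in> T \<Longrightarrow> l b \<in> carrier R" "\<And>b. b \<in> T \<Longrightarrow> \<epsilon> (l b) = l b"
      "\<And>b b'. b \<in> T \<Longrightarrow> b' \<in> T \<Longrightarrow> l (\<lambda>j. b j \<oplus>\<^bsub>R\<^esub> b' j) = l b \<oplus>\<^bsub>R\<^esub> l b'"
      "\<And>r b. r \<in> carrier R \<Longrightarrow> b \<in> T \<Longrightarrow> l (\<lambda>j. r \<otimes>\<^bsub>R\<^esub> b j) = \<epsilon> r \<otimes>\<^bsub>R\<^esub> l b"
  obtains h where "\<And>b. b \<in> T \<Longrightarrow> h b \<in> carrier R" "\<And>b. b \<in> T \<Longrightarrow> \<epsilon> (h b) = l b"
      "\<And>b b'. b \<in> T \<Longrightarrow> b' \<in> T \<Longrightarrow> h (\<lambda>j. b j \<oplus>\<^bsub>R\<^esub> b' j) = h b \<oplus>\<^bsub>R\<^esub> h b'"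
      "\<And>r b. r \<in> carrier R \<Longrightarrow> b \<in> T \<Longrightarrow> h (\<lambda>j. r \<otimes>\<^bsub>R\<^esub> b j) = r \<otimes>\<^bsub>R\<^esub> h b"
proof -
  interpret ring R by fact
  have \<epsilon>0: "\<epsilon> \<zero>\<^bsub>R\<^esub> = \<zero>\<^bsub>R\<^esub>"
    using \<epsilon>(2)[of "\<zero>\<^bsub>R\<^esub>" "\<zero>\<^bsub>R\<^esub>"] \<epsilon>(1)[of "\<zero>\<^bsub>R\<^esub>"] by (metis add.r_cancel_one' r_zero zero_closed)
  text \<open>The trivial module, with constant sequences as elements.\<close>
  define K :: "'a amod" where "K = \<lparr>carrier = {\<lambda>_. \<epsilon> r |r. r \<in> carrier R}, mult = undefined, one = undefined,
     zero = (\<lambda>_. \<zero>\<^bsub>R\<^esub>), add = (\<lambda>f g i. f i \<oplus>\<^bsub>R\<^esub> g i), smult = (\<lambda>r f i. \<epsilon> r \<otimes>\<^bsub>R\<^esub> f i)\<rparr>"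
  have Ks: "carrier K = {\<lambda>_. \<epsilon> r |r. r \<in> carrier R}" "\<zero>\<^bsub>K\<^esub> = (\<lambda>_. \<zero>\<^bsub>R\<^esub>)" "add K = (\<lambda>f g i. f i \<oplus>\<^bsub>R\<^esub> g i)"
    "smult K = (\<lambda>r f i. \<epsilon> r \<otimes>\<^bsub>R\<^esub> f i)" by (simp_all add: K_def)
  have LK: "left_module R K"
  proof (rule left_moduleI[OF R])
    show "\<zero>\<^bsub>K\<^esub> \<in> carrier K" using \<epsilon>0 by (auto simp: Ks fun_eq_iff intro!: exI[of _ "\<zero>\<^bsub>R\<^esub>"])
    show "\<And>m m'. m \<in> carrier K \<Longrightarrow> m' \<in> carrier K \<Longrightarrow> m \<oplus>\<^bsub>K\<^esub> m' \<in> carrier K"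
      by (auto simp: Ks \<epsilon>(2)[symmetric])
    show "\<And>r m. r \<in> carrier R \<Longrightarrow> m \<in> carrier K \<Longrightarrow> r \<odot>\<^bsub>K\<^esub> m \<in> carrier K"
      by (auto simp: Ks \<epsilon>(3)[symmetric])
  qed (auto simp: Ks \<epsilon> \<epsilon>0 l_distr r_distr m_assoc a_assoc a_comm a_lcomm)
  note LF = left_module_free[OF R]
  let ?F0 = "free_module R (Suc 0)" and ?F1 = "free_module R p" and ?F2 = "free_module R s"
  define g where "g = (\<lambda>f :: nat \<Rightarrow> 'a. \<lambda>_ :: nat. \<epsilon> (f 0))"
  have g: "g \<in> module_hom R ?F0 K"
    by (rule module_homI) (auto simp: g_def Ks free_module_simps \<epsilon>)
  have gs: "g ` carrier ?F0 = carrier K"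
  proof
    show "carrier K \<subseteq> g ` carrier ?F0"
    proof
      fix k assume "k \<in> carrier K"
      then obtain r where r: "r \<in> carrier R" "k = (\<lambda>_. \<epsilon> r)" by (auto simp: Ks)
      then show "k \<in> g ` carrier ?F0"
        by (auto simp: g_def free_module_simps intro!: image_eqI[of _ _ "\<lambda>i. if i = 0 then r else \<zero>\<^bsub>R\<^esub>"])
    qed
  qed (use module_homD(1)[OF g] in auto)
  let ?S1 = "ker_module ?F0 g K"
  have LS1: "left_module R ?S1" by (rule left_module_ker[OF LF LK g])
  \<comment> \<open>The free module of rank one consists of sequences too; its ring element sits at
    index 0.\<close>
  define X1 where "X1 = (\<lambda>i (j :: nat). if j = 0 then x i else \<zero>\<^bsub>R\<^esub>)"
  have X1: "X1 i \<in> carrier ?S1" if "i < p" for i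
    using that x(1,2) by (auto simp: X1_def free_module_simps g_def Ks)
  define d1 where "d1 = (\<lambda>a. nsum ?S1 (\<lambda>i. a i \<odot>\<^bsub>?S1\<^esub> X1 i) p)"
  have d1: "d1 \<in> module_hom R ?F1 ?S1" unfolding d1_def by (rule nsum_linear[OF LS1 X1])
  have nsum_fun: "nsum ?S1 f k = (\<lambda>j. nsum R (\<lambda>i. f i j) k)" for f k
    by (induction k) (simp_all add: free_module_simps)
  have nz: "nsum R (\<lambda>i. a i \<otimes>\<^bsub>R\<^esub> \<zero>\<^bsub>R\<^esub>) k = \<zero>\<^bsub>R\<^esub>" if "a \<in> carrier ?F1" for a k
    by (induction k) (simp_all add: free_module_closed[OF R that])
  have d1_eq: "d1 a = (\<lambda>j. if j = 0 then nsum R (\<lambda>i. a i \<otimes>\<^bsub>R\<^esub> x i) p else \<zero>\<^bsub>R\<^esub>)" if "a \<in> carrier ?F1" for a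
    using nz[OF that] by (auto simp: d1_def nsum_fun X1_def free_module_simps fun_eq_iff)
  have d1s: "d1 ` carrier ?F1 = carrier ?S1"
  proof
    show "carrier ?S1 \<subseteq> d1 ` carrier ?F1"
    proof
      fix f assume f: "f \<in> carrier ?S1"
      then have "f 0 \<in> carrier R" "\<epsilon> (f 0) = \<zero>\<^bsub>R\<^esub>" by (auto simp: free_module_simps g_def Ks fun_eq_iff)
      then obtain a where a: "a \<in> carrier ?F1" "f 0 = nsum R (\<lambda>i. a i \<otimes>\<^bsub>R\<^esub> x i) p" using x(3) by blast
      have "f = d1 a" using f a by (auto simp: d1_eq free_module_simps fun_eq_iff)
      then show "f \<in> d1 ` carrier ?F1" using a(1) by blast
    qed
  qed (use module_homD(1)[OF d1] in auto)
  let ?S2 = "ker_module ?F1 d1 ?S1"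
  have LS2: "left_module R ?S2" by (rule left_module_ker[OF LF LS1 d1])
  have Y2: "Y j \<in> carrier ?S2" if "j < s" for j
    using Y(1,2)[OF that] by (auto simp: d1_eq free_module_simps fun_eq_iff)
  define d2 where "d2 = (\<lambda>b. nsum ?S2 (\<lambda>j. b j \<odot>\<^bsub>?S2\<^esub> Y j) s)"
  have d2: "d2 \<in> module_hom R ?F2 ?S2" unfolding d2_def by (rule nsum_linear[OF LS2 Y2])
  have nsum_fun2: "nsum ?S2 f k = (\<lambda>i. nsum R (\<lambda>j. f j i) k)" for f k
    by (induction k) (simp_all add: free_module_simps)
  have d2_eq: "d2 b = (\<lambda>i. nsum R (\<lambda>j. b j \<otimes>\<^bsub>R\<^esub> Y j i) s)" for b
    by (simp add: d2_def nsum_fun2 free_module_simps)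
  have d2_0: "d2 b i = \<zero>\<^bsub>R\<^esub>" if "b \<in> carrier ?F2" "i \<ge> p" for b i
    using module_homD(1)[OF d2 that(1)] that(2) by (auto simp: free_module_simps)
  have d2s: "d2 ` carrier ?F2 = carrier ?S2"
  proof
    show "carrier ?S2 \<subseteq> d2 ` carrier ?F2"
    proof
      fix a assume a: "a \<in> carrier ?S2"
      then have aF: "a \<in> carrier ?F1" and "d1 a = (\<lambda>_. \<zero>\<^bsub>R\<^esub>)" by (auto simp: free_module_simps)
      then have "d1 a 0 = \<zero>\<^bsub>R\<^esub>" by simp
      then have "nsum R (\<lambda>i. a i \<otimes>\<^bsub>R\<^esub> x i) p = \<zero>\<^bsub>R\<^esub>" by (simp add: d1_eq[OF aF])
      then obtain b where b: "b \<in> carrier ?F2" "\<forall>i<p. a i = nsum R (\<lambda>j. b j \<otimes>\<^bsub>R\<^esub> Y j i) s" using Y(3)[OF aF] by blast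
      have "a i = d2 b i" for i
      proof (cases "i < p")
        case True
        then show ?thesis using b(2) by (simp add: d2_eq)
      next
        case False
        then show ?thesis using d2_0[OF b(1)] aF by (auto simp: free_module_simps)
      qed
      then show "a \<in> d2 ` carrier ?F2" using b(1) by blast
    qed
  qed (use module_homD(1)[OF d2] in auto)
  let ?T = "ker_module ?F2 d2 ?S2"
  have LT: "left_module R ?T" by (rule left_module_ker[OF LF LS2 d2])
  have Tc: "carrier ?T = T"
  proof -
    have "d2 b = (\<lambda>_. \<zero>\<^bsub>R\<^esub>) \<longleftrightarrow> (\<forall>i<p. nsum R (\<lambda>j. b j \<otimes>\<^bsub>R\<^esub> Y j i) s = \<zero>\<^bsub>R\<^esub>)" if "b \<in> carrier ?F2" for b
      using d2_0[OF that] by (auto simp: d2_eq fun_eq_iff not_less[symmetric])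
    then show ?thesis unfolding T by (auto simp: free_module_simps(2))
  qed
  text \<open>Comparison with a projective resolution of length three.\<close>
  have "proj_dim R K \<le> left_gldim R" unfolding left_gldim_def by (rule Sup_upper) (use LK in blast)
  then have "proj_dim R K \<le> enat 3" using gldim by (rule order_trans)
  then obtain P d e where res: "projective_resolution R K P d e" and zero: "\<forall>i>3. zero_module (P i)"
    using proj_dim_le by blast
  note res = res[unfolded projective_resolution_def]
  have P: "projective R (P i)" for i using res by blast
  note LP = projective_left_module[OF P]
  have dh: "d i \<in> module_hom R (P (Suc i)) (P i)" for i using res by blast
  have e: "e \<in> module_hom R (P 0) K" "e ` carrier (P 0) = carrier K" using res by auto
  have ex0: "d 0 ` carrier (P 1) = {p \<in> carrier (P 0). e p = \<zero>\<^bsub>K\<^esub>}" using res by blast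
  have ex: "d (Suc i) ` carrier (P (Suc (Suc i))) = {p \<in> carrier (P (Suc i)). d i p = \<zero>\<^bsub>P i\<^esub>}" for i using res by blast
  let ?Q1 = "ker_module (P 0) e K" let ?Q2 = "ker_module (P 1) (d 0) ?Q1" let ?Q3 = "ker_module (P 2) (d 1) ?Q2"
  have LQ1: "left_module R ?Q1" by (rule left_module_ker[OF LP LK e(1)])
  have h0: "d 0 \<in> module_hom R (P 1) ?Q1"
    using module_homD[OF dh[of 0]] ex0 by (intro module_homI) auto
  have s0: "d 0 ` carrier (P 1) = carrier ?Q1" using ex0 by simp
  have LQ2: "left_module R ?Q2" by (rule left_module_ker[OF LP LQ1 h0])
  have h1: "d 1 \<in> module_hom R (P 2) ?Q2"
    using module_homD[OF dh[of 1]] ex[of 0] by (intro module_homI) (auto simp: numeral_2_eq_2)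
  have s1: "d 1 ` carrier (P 2) = carrier ?Q2" using ex[of 0] by (simp add: numeral_2_eq_2)
  have LQ3: "left_module R ?Q3" by (rule left_module_ker[OF LP LQ2 h1])
  have h2: "d 2 \<in> module_hom R (P 3) ?Q3"
    using module_homD[OF dh[of 2]] ex[of 1] by (intro module_homI) (auto simp: numeral_2_eq_2 numeral_3_eq_3)
  have s2: "d 2 ` carrier (P 3) = carrier ?Q3" using ex[of 1] by (simp add: numeral_2_eq_2 numeral_3_eq_3)
  \<comment> \<open>Since \<open>P 4\<close> is zero, exactness makes \<open>d 2\<close> injective
    on \<open>P 3\<close>, so that \<open>?Q3\<close> is a copy of the projective module
    \<open>P 3\<close>.\<close>
  have "{p \<in> carrier (P 3). d 2 p = \<zero>\<^bsub>P 2\<^esub>} = d 3 ` carrier (P 4)"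
    using ex[of 2] by (simp add: numeral_2_eq_2 numeral_3_eq_3 eval_nat_numeral)
  also have "\<dots> = {\<zero>\<^bsub>P 3\<^esub>}"
    using zero module_hom_zero[OF LP LP dh[of 3]] by (simp add: zero_module_def)
  finally have ker2: "\<And>p. p \<in> carrier (P 3) \<Longrightarrow> d 2 p = \<zero>\<^bsub>P 2\<^esub> \<Longrightarrow> p = \<zero>\<^bsub>P 3\<^esub>" by blast
  have inj2: "inj_on (d 2) (carrier (P 3))"
  proof (rule inj_onI)
    fix p q assume p: "p \<in> carrier (P 3)" and q: "q \<in> carrier (P 3)" and eq: "d 2 p = d 2 q"
    have nq: "neg_one R \<odot>\<^bsub>P 3\<^esub> q \<in> carrier (P 3)" by (rule left_module_neg(3)[OF LP q])
    have "d 2 (p \<oplus>\<^bsub>P 3\<^esub> neg_one R \<odot>\<^bsub>P 3\<^esub> q) = d 2 q \<oplus>\<^bsub>?Q3\<^esub> neg_one R \<odot>\<^bsub>?Q3\<^esub> d 2 q"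
      using module_homD(2)[OF h2 p nq] module_homD(3)[OF h2 neg_one_closed[OF R] q] eq by simp
    also have "\<dots> = \<zero>\<^bsub>?Q3\<^esub>" by (rule left_module_neg(1)[OF LQ3 module_homD(1)[OF h2 q]])
    finally have "p \<oplus>\<^bsub>P 3\<^esub> neg_one R \<odot>\<^bsub>P 3\<^esub> q = \<zero>\<^bsub>P 3\<^esub>"
      using ker2[OF left_module_add(2)[OF LP p nq]] by simp
    then have "(p \<oplus>\<^bsub>P 3\<^esub> neg_one R \<odot>\<^bsub>P 3\<^esub> q) \<oplus>\<^bsub>P 3\<^esub> q = q" using left_module_add(3)[OF LP q] by simp
    then show "p = q"
      using left_module_add(6)[OF LP p nq q] left_module_neg(2)[OF LP q] left_module_add(4)[OF LP p] by simp
  qed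
  have id: "(\<lambda>k. k) \<in> module_hom R K K" by (rule module_homI) auto
  have z: "(\<lambda>k. \<zero>\<^bsub>K\<^esub>) \<in> module_hom R ?F0 K"
    by (rule module_homI) (use left_module_add[OF LK] left_module_smult_zero[OF LK] in auto)
  have z': "(\<lambda>k. \<zero>\<^bsub>?F0\<^esub>) \<in> module_hom R K ?F0"
    by (rule module_homI) (use left_module_add[OF LF[of "Suc 0"]] left_module_smult_zero[OF LF[of "Suc 0"]] in auto)
  \<comment> \<open>The comparison starts from the identity of \<open>K\<close>; the zero map
    through \<open>?F0\<close> serves as the projective part.\<close>
  have "stable_retract R K K"
    unfolding stable_retract_def
    by (intro bexI[OF _ id] exI[of _ ?F0] conjI projective_free[OF R] bexI[OF _ z'] bexI[OF _ z])
      (simp add: left_module_add(4)[OF LK])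
  then have "stable_retract R ?S1 ?Q1"
    by (rule stable_retract_syzygy[OF LK LK projective_free[OF R] P g gs e])
  then have "stable_retract R ?S2 ?Q2"
    by (rule stable_retract_syzygy[OF LS1 LQ1 projective_free[OF R] P d1 d1s h0 s0])
  then have ret: "stable_retract R ?T ?Q3"
    by (rule stable_retract_syzygy[OF LS2 LQ2 projective_free[OF R] P d2 d2s h1 s1])
  \<comment> \<open>The lifting property of \<open>P 3\<close> is carried over along the inverse of
    the bijection \<open>d 2\<close>.\<close>
  have Q3: "\<exists>h \<in> module_hom R ?Q3 ?F0. \<forall>q \<in> carrier ?Q3. g (h q) = f q" if f: "f \<in> module_hom R ?Q3 K" for f
  proof -
    obtain h where h: "h \<in> module_hom R (P 3) ?F0" "\<And>p. p \<in> carrier (P 3) \<Longrightarrow> g (h p) = f (d 2 p)"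
      using projective_lift[OF P LF LK g gs module_hom_comp[OF h2 f]] by blast
    let ?i = "inv_into (carrier (P 3)) (d 2)"
    have i1: "?i q \<in> carrier (P 3)" "d 2 (?i q) = q" if "q \<in> carrier ?Q3" for q
      using that s2 inv_into_into[of q "d 2" "carrier (P 3)"] f_inv_into_f[of q "d 2" "carrier (P 3)"] by auto
    have i2: "?i (d 2 p) = p" if "p \<in> carrier (P 3)" for p using inj2 that by simp
    have "?i \<in> module_hom R ?Q3 (P 3)"
    proof (rule module_homI)
      fix q q' assume "q \<in> carrier ?Q3" "q' \<in> carrier ?Q3"
      then show "?i (q \<oplus>\<^bsub>?Q3\<^esub> q') = ?i q \<oplus>\<^bsub>P 3\<^esub> ?i q'"
        using i1 i2 module_homD(2)[OF h2] left_module_add(2)[OF LP] by metis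
    next
      fix r q assume "r \<in> carrier R" "q \<in> carrier ?Q3"
      then show "?i (r \<odot>\<^bsub>?Q3\<^esub> q) = r \<odot>\<^bsub>P 3\<^esub> ?i q"
        using i1 i2 module_homD(3)[OF h2] left_moduleD(3)[OF LP] by metis
    qed (rule i1(1))
    then show ?thesis using module_hom_comp[OF _ h(1)] h(2) i1 by (intro bexI[of _ "\<lambda>q. h (?i q)"]) auto
  qed
  have lh: "(\<lambda>b _. l b) \<in> module_hom R ?T K"
  proof (rule module_homI)
    fix b assume "b \<in> carrier ?T"
    then have b: "b \<in> T" unfolding Tc .
    show "(\<lambda>_. l b) \<in> carrier K" using l(1,2)[OF b] by (auto simp: Ks intro!: exI[of _ "l b"])
    show "(\<lambda>_. l (r \<odot>\<^bsub>?T\<^esub> b)) = r \<odot>\<^bsub>K\<^esub> (\<lambda>_. l b)" if "r \<in> carrier R" for r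
      using l(4)[OF that b] by (simp add: Ks free_module_simps)
    fix b' assume "b' \<in> carrier ?T"
    then have b': "b' \<in> T" unfolding Tc .
    show "(\<lambda>_. l (b \<oplus>\<^bsub>?T\<^esub> b')) = (\<lambda>_. l b) \<oplus>\<^bsub>K\<^esub> (\<lambda>_. l b')"
      using l(3)[OF b b'] by (simp add: Ks free_module_simps)
  qed
  obtain h where h: "h \<in> module_hom R ?T ?F0" "\<And>t. t \<in> carrier ?T \<Longrightarrow> g (h t) = (\<lambda>_. l t)"
    using stable_retract_lift[OF ret LT LF LK g gs Q3 lh] by auto
  show thesis
  proof (rule that[of "\<lambda>b. h b 0"])
    fix b assume b: "b \<in> T"
    show "h b 0 \<in> carrier R" using module_homD(1)[OF h(1)] b free_module_closed[OF R] unfolding Tc by blast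
    show "\<epsilon> (h b 0) = l b" using h(2)[unfolded Tc, OF b] by (simp add: g_def fun_eq_iff)
    show "h (\<lambda>j. b j \<oplus>\<^bsub>R\<^esub> b' j) 0 = h b 0 \<oplus>\<^bsub>R\<^esub> h b' 0" if "b' \<in> T" for b'
      using module_homD(2)[OF h(1), unfolded Tc, OF b that] by (simp add: free_module_simps)
    show "h (\<lambda>j. r \<otimes>\<^bsub>R\<^esub> b j) 0 = r \<otimes>\<^bsub>R\<^esub> h b 0" if "r \<in> carrier R" for r
      using module_homD(3)[OF h(1), unfolded Tc, OF that b] by (simp add: free_module_simps)
  qed
qed

subsection \<open>Syzygies over a presented algebra\<close>

lemma nsum_coset: "nsum (presented_algebra Rel) (\<lambda>i. coset Rel (g i)) n = coset Rel (\<Sum>i<n. g i)"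
  by (induction n) (simp_all add: presented_algebra_simps)

definition rep :: "('v, 'k :: field) nc_poly set \<Rightarrow> ('v, 'k) nc_poly set \<Rightarrow> ('v, 'k) nc_poly" where
  "rep Rel X = (SOME f. coset Rel f = X)"

lemma coset_rep: "X \<in> carrier (presented_algebra Rel) \<Longrightarrow> coset Rel (rep Rel X) = X"
  unfolding rep_def presented_algebra_simps by (rule someI_ex) auto

lemma rep_coset: "rep Rel (coset Rel f) - f \<in> relation_ideal Rel"
proof -
  have "coset Rel f \<in> carrier (presented_algebra Rel)" by (simp add: presented_algebra_simps)
  then show ?thesis using coset_rep by (simp only: coset_eq_iff[symmetric])
qed

text \<open>The previous lifting lemma for representatives: families are indexed by any finite set
  \<open>S\<close>, and equations in the quotient become congruences modulo \<open>I\<close>. The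
  map \<open>h\<close> is therefore additive and linear only modulo \<open>I\<close>.\<close>

lemma presented_syzygy_lift:
  fixes Rel :: "('w :: finite, 'k :: field) nc_poly set" and Y :: "'j \<Rightarrow> 'w \<Rightarrow> ('w, 'k) nc_poly"
  defines "I \<equiv> relation_ideal Rel"
  assumes gldim: "left_gldim (presented_algebra Rel) \<le> enat 3"
    and I0: "\<And>f. f \<in> I \<Longrightarrow> const_coeff f = 0"
    and S: "finite S"
    and Y1: "\<And>j. j \<in> S \<Longrightarrow> (\<Sum>w\<in>UNIV. Y j w * nc_var w) \<in> I"
    and Y2: "\<And>a. (\<Sum>w\<in>UNIV. a w * nc_var w) \<in> I \<Longrightarrow> \<exists>b. \<forall>w. a w - (\<Sum>j\<in>S. b j * Y j w) \<in> I"
    and T: "T = {b. \<forall>w. (\<Sum>j\<in>S. b j * Y j w) \<in> I}"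
    and l1: "\<And>b b'. b \<in> T \<Longrightarrow> b' \<in> T \<Longrightarrow> l (\<lambda>j. b j + b' j) = l b + l b'"
    and l2: "\<And>r b. b \<in> T \<Longrightarrow> l (\<lambda>j. r * b j) = const_coeff r * l b"
    and l3: "\<And>b b'. b \<in> T \<Longrightarrow> b' \<in> T \<Longrightarrow> (\<And>j. j \<in> S \<Longrightarrow> b j - b' j \<in> I) \<Longrightarrow> l b = l b'"
  obtains h :: "('j \<Rightarrow> ('w, 'k) nc_poly) \<Rightarrow> ('w, 'k) nc_poly" where "\<And>b. b \<in> T \<Longrightarrow> const_coeff (h b) = l b"
    "\<And>b b'. b \<in> T \<Longrightarrow> b' \<in> T \<Longrightarrow> h (\<lambda>j. b j + b' j) - (h b + h b') \<in> I"
    "\<And>r b. b \<in> T \<Longrightarrow> h (\<lambda>j. r * b j) - r * h b \<in> I"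
    "\<And>b b'. b \<in> T \<Longrightarrow> b' \<in> T \<Longrightarrow> (\<And>j. j \<in> S \<Longrightarrow> b j - b' j \<in> I) \<Longrightarrow> h b - h b' \<in> I"
proof -
  let ?A = "presented_algebra Rel" let ?c = "coset Rel" let ?r = "rep Rel"
  note ID = relation_idealD[where F = Rel, folded I_def]
  note Isum = two_sided_ideal_sum[OF two_sided_ideal_relation_ideal[of Rel], folded I_def]
  note ceq = coset_eq_iff[of Rel, folded I_def]
  note As = presented_algebra_simps[of Rel]
  note rc = rep_coset[of Rel, folded I_def]
  have cc: "const_coeff f = const_coeff g" if "f - g \<in> I" for f g using I0[OF that] by simp
  define p where "p = card (UNIV :: 'w set)"
  define s where "s = card S"
  obtain e where e: "bij_betw e {..<p} (UNIV :: 'w set)"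
    using ex_bij_betw_nat_finite[of "UNIV :: 'w set"] unfolding p_def atLeast0LessThan by auto
  obtain e' where e': "bij_betw e' {..<s} S"
    using ex_bij_betw_nat_finite[OF S] unfolding s_def atLeast0LessThan by auto
  define i' where "i' = the_inv_into {..<s} e'"
  define ie where "ie = the_inv_into {..<p} e"
  have i'e: "i' (e' k) = k" if "k < s" for k
    using the_inv_into_f_f[OF bij_betw_imp_inj_on[OF e'], of k] that by (simp add: i'_def)
  have ei': "e' (i' j) = j" and i'l: "i' j < s" if "j \<in> S" for j
    using f_the_inv_into_f_bij_betw[OF e' that] bij_betw_apply[OF bij_betw_the_inv_into[OF e'] that]
    by (auto simp: i'_def)
  have iee: "ie (e k) = k" if "k < p" for k
    using the_inv_into_f_f[OF bij_betw_imp_inj_on[OF e], of k] that by (simp add: ie_def)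
  have eie: "e (ie w) = w" and iel: "ie w < p" for w
    using f_the_inv_into_f_bij_betw[OF e, of w] bij_betw_apply[OF bij_betw_the_inv_into[OF e], of w]
    by (auto simp: ie_def)
  have sumS: "(\<Sum>i<s. g (e' i)) = (\<Sum>j\<in>S. g j)" for g :: "'j \<Rightarrow> ('w, 'k) nc_poly"
    by (rule sum.reindex_bij_betw[OF e'])
  have sumW: "(\<Sum>i<p. g (e i)) = (\<Sum>w\<in>UNIV. g w)" for g :: "'w \<Rightarrow> ('w, 'k) nc_poly"
    by (rule sum.reindex_bij_betw[OF e])
  \<comment> \<open>The constant coefficient is well defined on cosets because the elements of
    \<open>I\<close> have none.\<close>
  define \<epsilon> where "\<epsilon> X = ?c (nc_const (const_coeff (?r X)))" for X
  have \<epsilon>c: "\<epsilon> (?c f) = ?c (nc_const (const_coeff f))" for f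
    using cc[OF rc[of f]] by (simp add: \<epsilon>_def)
  have c0: "?c f = ?c 0 \<longleftrightarrow> f \<in> I" for f using ceq[of f 0] by simp
  define x where "x i = ?c (nc_var (e i))" for i
  define YY where "YY k i = (if i < p then ?c (Y (e' k) (e i)) else ?c 0)" for k i
  let ?L = "\<lambda>n (a :: nat \<Rightarrow> ('w, 'k) nc_poly) i. if i < n then ?c (a i) else ?c 0"
  have Lc: "?L n a \<in> carrier (free_module ?A n)" for n a
    by (simp add: free_module_simps As)
  have ex_L: "\<exists>f. a = ?L n f" if "a \<in> carrier (free_module ?A n)" for a n
    using that by (intro exI[of _ "\<lambda>i. ?r (a i)"]) (auto simp: free_module_simps coset_rep As(4) fun_eq_iff)
  have nx: "nsum ?A (\<lambda>i. ?L p a i \<otimes>\<^bsub>?A\<^esub> x i) p = ?c (\<Sum>i<p. a i * nc_var (e i))" for a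
    unfolding nsum_coset[symmetric] by (rule nsum_cong) (simp add: x_def As)
  have ny: "nsum ?A (\<lambda>j. ?L s b j \<otimes>\<^bsub>?A\<^esub> YY j i) s = ?c (\<Sum>k<s. b k * Y (e' k) (e i))" if "i < p" for b i
    unfolding nsum_coset[symmetric] by (rule nsum_cong) (simp add: YY_def As that)
  define T' where "T' = {b \<in> carrier (free_module ?A s). \<forall>i<p. nsum ?A (\<lambda>j. b j \<otimes>\<^bsub>?A\<^esub> YY j i) s = \<zero>\<^bsub>?A\<^esub>}"
  \<comment> \<open>\<open>up\<close> turns a family of polynomials into a vector of cosets and
    \<open>dn\<close> chooses representatives; the two are inverse to each other up to congruence on
    \<open>S\<close>.\<close>
  define up where "up b = ?L s (\<lambda>k. b (e' k))" for b
  define dn where "dn X j = ?r (X (i' j))" for X :: "nat \<Rightarrow> ('w, 'k) nc_poly set" and j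
  have up_T: "up b \<in> T' \<longleftrightarrow> b \<in> T" for b
  proof -
    have "nsum ?A (\<lambda>j. up b j \<otimes>\<^bsub>?A\<^esub> YY j i) s = ?c (\<Sum>j\<in>S. b j * Y j (e i))" if "i < p" for i
      unfolding up_def ny[OF that] sumS[of "\<lambda>j. b j * Y j (e i)"] ..
    then have "up b \<in> T' \<longleftrightarrow> (\<forall>i<p. (\<Sum>j\<in>S. b j * Y j (e i)) \<in> I)"
      unfolding T'_def using Lc[of s "\<lambda>k. b (e' k)"] by (simp add: up_def As(4) c0)
    also have "\<dots> \<longleftrightarrow> b \<in> T" unfolding T using eie iel by (auto, metis)
    finally show ?thesis .
  qed
  have up_dn: "up (dn X) = X" if "X \<in> carrier (free_module ?A s)" for X
    using that by (auto simp: up_def dn_def i'e coset_rep free_module_simps fun_eq_iff As(4))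
  have dn_T: "dn X \<in> T" if "X \<in> T'" for X
    using that up_T[of "dn X"] up_dn[of X] by (simp add: T'_def)
  have dn_up: "dn (up b) j - b j \<in> I" if "j \<in> S" for b j
    using rc[of "b j"] that by (simp add: dn_def up_def i'l ei')
  have T_add: "(\<lambda>j. b j + b' j) \<in> T" if "b \<in> T" "b' \<in> T" for b b'
    using that ID(2) by (auto simp: T distrib_right sum.distrib)
  have T_mult: "(\<lambda>j. r * b j) \<in> T" if "b \<in> T" for b r
    using that ID(3) by (auto simp: T mult.assoc sum_distrib_left[symmetric])
  have dn_congI: "dn X j - b j \<in> I" if "X = up b" "j \<in> S" for X b j
    using dn_up that by simp
  define l' where "l' X = ?c (nc_const (l (dn X)))" for X
  have l'_up: "l' (up b) = ?c (nc_const (l b))" if "b \<in> T" for b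
    using l3[OF dn_T that dn_up] up_T that by (simp add: l'_def)
  have T'_up: "\<exists>b\<in>T. X = up b" if "X \<in> T'" for X
    using dn_T[OF that] up_dn[of X] that by (intro bexI[of _ "dn X"]) (auto simp: T'_def)
  have up_add: "(\<lambda>j. up b j \<oplus>\<^bsub>?A\<^esub> up b' j) = up (\<lambda>j. b j + b' j)" for b b'
    by (simp add: up_def As fun_eq_iff)
  have up_mult: "(\<lambda>j. ?c r \<otimes>\<^bsub>?A\<^esub> up b j) = up (\<lambda>j. r * b j)" for b r
    by (simp add: up_def As fun_eq_iff)
  obtain h where h: "\<And>b. b \<in> T' \<Longrightarrow> h b \<in> carrier ?A" "\<And>b. b \<in> T' \<Longrightarrow> \<epsilon> (h b) = l' b"
      "\<And>b b'. b \<in> T' \<Longrightarrow> b' \<in> T' \<Longrightarrow> h (\<lambda>j. b j \<oplus>\<^bsub>?A\<^esub> b' j) = h b \<oplus>\<^bsub>?A\<^esub> h b'"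
      "\<And>r b. r \<in> carrier ?A \<Longrightarrow> b \<in> T' \<Longrightarrow> h (\<lambda>j. r \<otimes>\<^bsub>?A\<^esub> b j) = r \<otimes>\<^bsub>?A\<^esub> h b"
  proof (rule third_syzygy_lift[OF ring_presented_algebra gldim, of \<epsilon> p x s YY T' l'])
    show "\<And>r. r \<in> carrier ?A \<Longrightarrow> \<epsilon> r \<in> carrier ?A" by (simp add: \<epsilon>_def As)
    show "\<And>r t. r \<in> carrier ?A \<Longrightarrow> t \<in> carrier ?A \<Longrightarrow> \<epsilon> (r \<oplus>\<^bsub>?A\<^esub> t) = \<epsilon> r \<oplus>\<^bsub>?A\<^esub> \<epsilon> t"
      by (auto simp: As \<epsilon>c nc_const_add)
    show "\<And>r t. r \<in> carrier ?A \<Longrightarrow> t \<in> carrier ?A \<Longrightarrow> \<epsilon> (r \<otimes>\<^bsub>?A\<^esub> t) = \<epsilon> r \<otimes>\<^bsub>?A\<^esub> \<epsilon> t"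
      by (auto simp: As \<epsilon>c nc_const_mult)
    show "\<epsilon> \<one>\<^bsub>?A\<^esub> = \<one>\<^bsub>?A\<^esub>" by (simp add: As \<epsilon>c)
    show "\<And>r. r \<in> carrier ?A \<Longrightarrow> \<epsilon> (\<epsilon> r) = \<epsilon> r" by (auto simp: As \<epsilon>c)
    show "\<And>i. i < p \<Longrightarrow> x i \<in> carrier ?A" by (simp add: x_def As)
    show "\<And>i. i < p \<Longrightarrow> \<epsilon> (x i) = \<zero>\<^bsub>?A\<^esub>" by (simp add: x_def \<epsilon>c As(4))
    show "\<exists>a\<in>carrier (free_module ?A p). X = nsum ?A (\<lambda>i. a i \<otimes>\<^bsub>?A\<^esub> x i) p" if X: "X \<in> carrier ?A" "\<epsilon> X = \<zero>\<^bsub>?A\<^esub>" for X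
    proof -
      obtain f where f: "X = ?c f" using X(1) by (auto simp: As)
      have "nc_const (const_coeff f) \<in> I" using X(2) by (simp add: f \<epsilon>c As(4) c0)
      then have "const_coeff f = 0" using I0 by fastforce
      then have "f = (\<Sum>w\<in>UNIV. rdiv w f * nc_var w)" using rdiv_expansion[of f] by simp
      then have "X = ?c (\<Sum>i<p. rdiv (e i) f * nc_var (e i))" using f sumW[of "\<lambda>w. rdiv w f * nc_var w"] by simp
      then show ?thesis using nx[of "\<lambda>i. rdiv (e i) f"] Lc[of p "\<lambda>i. rdiv (e i) f"] by (intro bexI) auto
    qed
    show "\<And>j. j < s \<Longrightarrow> YY j \<in> carrier (free_module ?A p)" by (simp add: YY_def free_module_simps As)
    show "nsum ?A (\<lambda>i. YY j i \<otimes>\<^bsub>?A\<^esub> x i) p = \<zero>\<^bsub>?A\<^esub>" if "j < s" for j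
    proof -
      have "nsum ?A (\<lambda>i. YY j i \<otimes>\<^bsub>?A\<^esub> x i) p = ?c (\<Sum>i<p. Y (e' j) (e i) * nc_var (e i))"
        unfolding YY_def by (rule nx)
      also have "\<dots> = ?c 0"
        unfolding sumW[of "\<lambda>w. Y (e' j) w * nc_var w"] c0 using Y1 bij_betw_apply[OF e'] that by simp
      finally show ?thesis by (simp add: As)
    qed
    show "\<exists>b\<in>carrier (free_module ?A s). \<forall>i<p. a i = nsum ?A (\<lambda>j. b j \<otimes>\<^bsub>?A\<^esub> YY j i) s"
      if a: "a \<in> carrier (free_module ?A p)" and az: "nsum ?A (\<lambda>i. a i \<otimes>\<^bsub>?A\<^esub> x i) p = \<zero>\<^bsub>?A\<^esub>" for a
    proof -
      obtain f where f: "a = ?L p f" using ex_L[OF a] by blast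
      have "(\<Sum>i<p. f i * nc_var (e i)) \<in> I" using az unfolding f nx by (simp add: As c0)
      also have "(\<Sum>i<p. f i * nc_var (e i)) = (\<Sum>i<p. f (ie (e i)) * nc_var (e i))"
        by (rule sum.cong) (simp_all add: iee)
      also have "\<dots> = (\<Sum>w\<in>UNIV. f (ie w) * nc_var w)" by (rule sumW[of "\<lambda>w. f (ie w) * nc_var w"])
      finally obtain b where b: "\<And>w. f (ie w) - (\<Sum>j\<in>S. b j * Y j w) \<in> I" using Y2[of "\<lambda>w. f (ie w)"] by blast
      show ?thesis
      proof (rule bexI[OF _ Lc[of s "\<lambda>k. b (e' k)"]], intro allI impI)
        fix i assume i: "i < p"
        have "a i = ?c (f (ie (e i)))" using i by (simp add: f iee)
        also have "\<dots> = ?c (\<Sum>j\<in>S. b j * Y j (e i))" unfolding ceq by (rule b)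
        also have "\<dots> = nsum ?A (\<lambda>j. ?L s (\<lambda>k. b (e' k)) j \<otimes>\<^bsub>?A\<^esub> YY j i) s"
          unfolding ny[OF i] sumS[of "\<lambda>j. b j * Y j (e i)"] ..
        finally show "a i = nsum ?A (\<lambda>j. ?L s (\<lambda>k. b (e' k)) j \<otimes>\<^bsub>?A\<^esub> YY j i) s" .
      qed
    qed
    show "T' = {b \<in> carrier (free_module ?A s). \<forall>i<p. nsum ?A (\<lambda>j. b j \<otimes>\<^bsub>?A\<^esub> YY j i) s = \<zero>\<^bsub>?A\<^esub>}"
      by (rule T'_def)
    show "\<And>b. b \<in> T' \<Longrightarrow> l' b \<in> carrier ?A" by (simp add: l'_def As)
    show "\<And>b. b \<in> T' \<Longrightarrow> \<epsilon> (l' b) = l' b" by (simp add: l'_def \<epsilon>c)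
    show "l' (\<lambda>j. X j \<oplus>\<^bsub>?A\<^esub> X' j) = l' X \<oplus>\<^bsub>?A\<^esub> l' X'" if X: "X \<in> T'" and X': "X' \<in> T'" for X X'
    proof -
      obtain b b' where b: "b \<in> T" "X = up b" "b' \<in> T" "X' = up b'" using T'_up X X' by blast
      show ?thesis unfolding b(2,4) up_add
        using b(1,3) T_add[OF b(1,3)] by (simp add: l'_up l1 As nc_const_add)
    qed
    show "l' (\<lambda>j. r \<otimes>\<^bsub>?A\<^esub> X j) = \<epsilon> r \<otimes>\<^bsub>?A\<^esub> l' X" if r: "r \<in> carrier ?A" and X: "X \<in> T'" for r X
    proof -
      obtain b where b: "b \<in> T" "X = up b" using T'_up X by blast
      obtain f where f: "r = ?c f" using r by (auto simp: As)
      show ?thesis unfolding b(2) f up_mult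
        using b(1) T_mult[OF b(1)] by (simp add: l'_up l2 As \<epsilon>c nc_const_mult)
    qed
  qed (erule that, assumption+)
  have hc: "?c (?r (h (up b))) = h (up b)" if "b \<in> T" for b
    using h(1)[of "up b"] that up_T by (simp add: coset_rep)
  show thesis
  proof (rule that[of "\<lambda>b. ?r (h (up b))"])
    fix b assume b: "b \<in> T"
    then have ub: "up b \<in> T'" by (simp add: up_T)
    have "?c (nc_const (const_coeff (?r (h (up b))))) = ?c (nc_const (l b))"
      using h(2)[OF ub] l'_up[OF b] by (simp add: \<epsilon>_def)
    then show "const_coeff (?r (h (up b))) = l b" using cc by (fastforce simp: ceq)
    show "?r (h (up (\<lambda>j. r * b j))) - r * ?r (h (up b)) \<in> I" for r
    proof -
      have "?c (?r (h (up (\<lambda>j. r * b j)))) = h (\<lambda>j. ?c r \<otimes>\<^bsub>?A\<^esub> up b j)" unfolding up_mult by (rule hc[OF T_mult[OF b]])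
      also have "\<dots> = ?c r \<otimes>\<^bsub>?A\<^esub> h (up b)" by (rule h(4)) (simp_all add: As ub)
      also have "\<dots> = ?c (r * ?r (h (up b)))" by (subst hc[OF b, symmetric]) (simp add: As)
      finally show ?thesis by (simp add: ceq)
    qed
    fix b' assume b': "b' \<in> T"
    show "?r (h (up (\<lambda>j. b j + b' j))) - (?r (h (up b)) + ?r (h (up b'))) \<in> I"
    proof -
      have "?c (?r (h (up (\<lambda>j. b j + b' j)))) = h (\<lambda>j. up b j \<oplus>\<^bsub>?A\<^esub> up b' j)" unfolding up_add by (rule hc[OF T_add[OF b b']])
      also have "\<dots> = h (up b) \<oplus>\<^bsub>?A\<^esub> h (up b')" by (rule h(3)) (simp_all add: up_T b b')
      also have "\<dots> = ?c (?r (h (up b)) + ?r (h (up b')))"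
        by (subst hc[OF b, symmetric], subst hc[OF b', symmetric]) (simp add: As)
      finally show ?thesis by (simp add: ceq)
    qed
    assume eq: "\<And>j. j \<in> S \<Longrightarrow> b j - b' j \<in> I"
    have "up b = up b'" using eq bij_betw_apply[OF e'] by (auto simp: up_def ceq fun_eq_iff)
    then show "?r (h (up b)) - ?r (h (up b')) \<in> I" by (simp add: ID(1))
  qed
qed

section \<open>Reduction modulo the central variable\<close>

definition top_part :: "('v, 'k :: field) nc_poly \<Rightarrow> ('v, 'k) nc_poly" where
  "top_part f = hcomp (nc_degree f) f"

definition drop_x0 :: "('v option, 'k :: field) nc_poly \<Rightarrow> ('v, 'k) nc_poly" where
  "drop_x0 = nc_subst (\<lambda>v. case v of None \<Rightarrow> 0 | Some u \<Rightarrow> nc_var u)"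

definition embed :: "('v, 'k :: field) nc_poly \<Rightarrow> ('v option, 'k) nc_poly" where
  "embed = nc_subst (\<lambda>v. nc_var (Some v))"

lemma drop_x0_simps [simp]:
  "drop_x0 0 = 0" "drop_x0 1 = 1" "drop_x0 (f + g) = drop_x0 f + drop_x0 g" "drop_x0 (f - g) = drop_x0 f - drop_x0 g"
  "drop_x0 (- f) = - drop_x0 f" "drop_x0 (f * g) = drop_x0 f * drop_x0 g" "drop_x0 (nc_const c) = nc_const c"
  "drop_x0 (sum F S) = (\<Sum>i\<in>S. drop_x0 (F i))" "drop_x0 (nc_var None) = 0" "drop_x0 (nc_var (Some v)) = nc_var v"
  by (simp_all add: drop_x0_def)

lemma drop_x0_embed [simp]: "drop_x0 (embed f) = f"
  by (simp add: drop_x0_def embed_def nc_subst_comp)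

lemma const_coeff_drop_x0 [simp]: "const_coeff (drop_x0 f) = const_coeff f"
  unfolding drop_x0_def by (rule const_coeff_nc_subst) (simp split: option.split)

lemma const_coeff_embed [simp]: "const_coeff (embed f) = const_coeff f"
  unfolding embed_def by (rule const_coeff_nc_subst) simp

lemma hcomp_drop_x0: "hcomp d (drop_x0 f) = drop_x0 (hcomp d f)"
  unfolding drop_x0_def by (rule hcomp_nc_subst) (simp add: homogeneous_closed split: option.split)

lemma rdiv_drop_x0: "drop_x0 (rdiv (Some v) f) = rdiv v (drop_x0 f)"
proof (induction f rule: nc_poly_induct)
  case (var f w)
  show ?case by (cases w) (simp_all add: rdiv_mult_var)
qed simp_all

lemma rdiv_hcomp: "rdiv v (hcomp (Suc d) f) = hcomp d (rdiv v f)"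
  by (rule poly_mapping_eqI) (simp add: lookup_rdiv lookup_hcomp nc_word_add_letters)

lemma single_eq_prod: "Poly_Mapping.single w c = nc_const c * prod_list (map nc_var (letters w))"
  using nc_subst_single[of nc_var w c] by simp

lemma length_le_nc_degree: "w \<in> Poly_Mapping.keys f \<Longrightarrow> length (letters w) \<le> nc_degree f"
  unfolding nc_degree_def by (rule Max_ge) auto

lemma homogeneous_homogenize: "homogeneous (nc_degree f) (homogenize f)"
  unfolding homogenize_def
  by (rule homogeneous_sum) (auto simp: homogeneous_lookup lookup_single when_def length_le_nc_degree)

lemma homogeneous_top_part [simp]: "homogeneous (nc_degree f) (top_part f)"
  by (simp add: top_part_def)

text \<open>A monomial receives a factor \<open>x0\<close> exactly when its degree is below
  \<open>nc_degree f\<close>, so only the terms of top degree survive.\<close>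

lemma drop_x0_homogenize:
  fixes f :: "('v, 'k :: field) nc_poly"
  shows "drop_x0 (homogenize f) = top_part f"
proof -
  have "drop_x0 (Poly_Mapping.single (NC_Word (replicate k None @ map Some ls)) c)
      = (if k = 0 then Poly_Mapping.single (NC_Word ls) c else 0)" for k and ls :: "'v list" and c :: 'k
    by (cases k) (simp_all add: drop_x0_def nc_subst_single comp_def, simp add: single_eq_prod)
  then have "drop_x0 (homogenize f) = (\<Sum>w \<in> Poly_Mapping.keys f.
      if nc_degree f - length (letters w) = 0 then Poly_Mapping.single w (Poly_Mapping.lookup f w) else 0)"
    by (simp add: homogenize_def cong: if_cong)
  also have "\<dots> = (\<Sum>w \<in> Poly_Mapping.keys f. hcomp (nc_degree f) (Poly_Mapping.single w (Poly_Mapping.lookup f w)))"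
    by (rule sum.cong)
      (auto intro!: poly_mapping_eqI simp: lookup_hcomp lookup_single when_def dest!: length_le_nc_degree)
  also have "\<dots> = hcomp (nc_degree f) f"
    by (subst (3) poly_mapping_sum_single) simp
  finally show ?thesis by (simp add: top_part_def)
qed

text \<open>Applied to left combinations of chosen relations plus \<open>ideal_plus I\<close>: an
  element of \<open>N\<close> followed by a variable already lies in \<open>I F+\<close>, so right
  multiples call for no further generators.\<close>

lemma two_sided_idealI_left:
  fixes N I :: "('v, 'k :: field) nc_poly set"
  assumes N: "0 \<in> N" "\<And>a b. a \<in> N \<Longrightarrow> b \<in> N \<Longrightarrow> a + b \<in> N" "\<And>r a. a \<in> N \<Longrightarrow> r * a \<in> N"
    and I: "two_sided_ideal I" "N \<subseteq> I" "\<And>i w. i \<in> I \<Longrightarrow> i * nc_var w \<in> N"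
  shows "two_sided_ideal N"
proof -
  have "a * r \<in> N" if "a \<in> N" for a r
  proof (induction r rule: nc_poly_induct)
    case (const c)
    show ?case using N(3)[OF that, of "nc_const c"] by (simp add: nc_const_commute)
  next
    case (var f v)
    then show ?case using I by (metis mult.assoc subsetD)
  qed (simp add: distrib_left N(2))
  then show ?thesis unfolding two_sided_ideal_def using N by blast
qed

text \<open>The product of \<open>I\<close> with the augmentation ideal.\<close>

definition ideal_plus :: "('v, 'k :: field) nc_poly set \<Rightarrow> ('v, 'k) nc_poly set" where
  "ideal_plus I = {z. const_coeff z = 0 \<and> (\<forall>v. rdiv v z \<in> I)}"

lemma ideal_plus_closed:
  assumes "two_sided_ideal I"
  shows "0 \<in> ideal_plus I" "a \<in> ideal_plus I \<Longrightarrow> b \<in> ideal_plus I \<Longrightarrow> a + b \<in> ideal_plus I"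
    "a \<in> ideal_plus I \<Longrightarrow> b \<in> ideal_plus I \<Longrightarrow> a - b \<in> ideal_plus I"
    "a \<in> ideal_plus I \<Longrightarrow> r * a \<in> ideal_plus I"
    "i \<in> I \<Longrightarrow> const_coeff r = 0 \<Longrightarrow> i * r \<in> ideal_plus I"
  using two_sided_idealD[OF assms] by (auto simp: ideal_plus_def rdiv_mult)

lemma ideal_plus_subset:
  fixes I :: "('v :: finite, 'k :: field) nc_poly set"
  assumes "two_sided_ideal I" shows "ideal_plus I \<subseteq> I"
proof
  fix z assume z: "z \<in> ideal_plus I"
  then have "z = (\<Sum>v\<in>UNIV. rdiv v z * nc_var v)" using rdiv_expansion[of z] by (simp add: ideal_plus_def)
  also have "\<dots> \<in> I"
    by (rule two_sided_ideal_sum[OF assms]) (use z two_sided_idealD(4)[OF assms] in \<open>auto simp: ideal_plus_def\<close>)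
  finally show "z \<in> I" .
qed

lemma ideal_plus_hcomp:
  assumes "\<And>i d. i \<in> I \<Longrightarrow> hcomp d i \<in> I" "0 \<in> I" "z \<in> ideal_plus I" shows "hcomp d z \<in> ideal_plus I"
proof (cases d)
  case 0
  then show ?thesis using assms(2,3) by (simp add: ideal_plus_def hcomp_0)
next
  case (Suc e)
  have "const_coeff (hcomp (Suc e) z) = 0" by (simp add: const_coeff_def lookup_hcomp nc_word_add_letters)
  then show ?thesis using assms by (simp add: ideal_plus_def Suc rdiv_hcomp)
qed

section \<open>The homogenization and its quotient by the central variable\<close>

locale central_homogenization =
  fixes fs :: "('v :: finite, 'k :: field) nc_poly list"
  assumes gldim: "left_gldim (homogenization fs) \<le> enat 3"
    and one_notin: "1 \<notin> relation_ideal (hom_relations fs)"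
    and regular: "\<And>a. nc_var None * a \<in> relation_ideal (hom_relations fs) \<Longrightarrow> a \<in> relation_ideal (hom_relations fs)"
begin

text \<open>\<open>I\<close> presents the homogenization on the variables \<open>'v option\<close>,
  while \<open>J\<close> presents its quotient by \<open>x0\<close> on the old variables.\<close>

definition I where "I = relation_ideal (hom_relations fs)"
definition J where "J = relation_ideal (top_part ` set fs)"
definition x0 :: "('v option, 'k) nc_poly" where "x0 = nc_var None"
definition u :: "'v \<Rightarrow> ('v option, 'k) nc_poly" where "u v = x0 * nc_var (Some v) - nc_var (Some v) * x0"

lemma ideal_I: "two_sided_ideal I" unfolding I_def by (rule two_sided_ideal_relation_ideal)
lemma ideal_J: "two_sided_ideal J" unfolding J_def by (rule two_sided_ideal_relation_ideal)
lemmas ID = two_sided_idealD[OF ideal_I]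
lemmas JD = two_sided_idealD[OF ideal_J]

lemma x0_simps [simp]: "drop_x0 x0 = 0" "const_coeff x0 = 0" "homogeneous (Suc 0) x0"
  by (simp_all add: x0_def)

lemma x0_regular: "x0 * a \<in> I \<Longrightarrow> a \<in> I" using regular by (simp add: x0_def I_def)

lemma homogeneous_u: "homogeneous (Suc (Suc 0)) (u v)"
  unfolding u_def x0_def
  using homogeneous_mult[OF homogeneous_var homogeneous_var] by (auto intro!: homogeneous_closed)

lemma u_in_I: "u v \<in> I"
  unfolding I_def u_def x0_def by (rule relation_ideal_base) (auto simp: hom_relations_def)

lemma homogenize_in_I: "f \<in> set fs \<Longrightarrow> homogenize f \<in> I"
  unfolding I_def by (rule relation_ideal_base) (auto simp: hom_relations_def)

lemma hcomp_I: "i \<in> I \<Longrightarrow> hcomp d i \<in> I"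
  unfolding I_def
proof (rule relation_ideal_hcomp)
  fix f assume "f \<in> hom_relations fs"
  then show "\<exists>d. homogeneous d f"
    using homogeneous_homogenize homogeneous_u unfolding hom_relations_def u_def x0_def by blast
qed

lemma hcomp_J: "j \<in> J \<Longrightarrow> hcomp d j \<in> J"
  unfolding J_def by (rule relation_ideal_hcomp) (auto intro: homogeneous_top_part)

text \<open>The component of degree zero of an element of the graded ideal \<open>I\<close> is a
  scalar in \<open>I\<close>; if it were nonzero, it would be a unit.\<close>

lemma const_coeff_I: assumes "i \<in> I" shows "const_coeff i = 0"
proof (rule ccontr)
  assume c: "const_coeff i \<noteq> 0"
  have "nc_const (const_coeff i) \<in> I" using hcomp_I[OF assms, of 0] by (simp add: hcomp_0)
  then have "nc_const (1 / const_coeff i) * nc_const (const_coeff i) \<in> I" by (rule ID(3))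
  then show False using c one_notin by (simp add: nc_const_mult[symmetric] I_def)
qed

lemma x0_commute: "x0 * f - f * x0 \<in> I"
proof (induction f rule: nc_poly_induct)
  case (const c)
  then show ?case by (simp add: nc_const_commute ID(1))
next
  case (var f w)
  have "x0 * nc_var w - nc_var w * x0 \<in> I"
    using u_in_I ID(1) by (cases w) (auto simp: u_def x0_def)
  then have "(x0 * f - f * x0) * nc_var w + f * (x0 * nc_var w - nc_var w * x0) \<in> I"
    using var ID by blast
  then show ?case by (simp add: algebra_simps)
next
  case (add f g)
  then show ?case using ID(2) by (fastforce simp: algebra_simps)
qed

lemma x0_regular': "a * x0 \<in> I \<Longrightarrow> a \<in> I"
  using ID(2)[OF x0_commute[of a], of "a * x0"] x0_regular by simp

lemma drop_x0_I: "i \<in> I \<Longrightarrow> drop_x0 i \<in> J"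
proof -
  have "two_sided_ideal {f. drop_x0 f \<in> J}"
    unfolding two_sided_ideal_def using JD by auto
  moreover have "hom_relations fs \<subseteq> {f. drop_x0 f \<in> J}"
    using JD(1) relation_ideal_base[of _ "top_part ` set fs"]
    by (auto simp: hom_relations_def drop_x0_homogenize J_def)
  ultimately show "i \<in> I \<Longrightarrow> drop_x0 i \<in> J"
    using relation_ideal_least[of "{f. drop_x0 f \<in> J}" "hom_relations fs"] by (auto simp: I_def)
qed

text \<open>The image of \<open>I\<close> under \<open>drop_x0\<close> is an ideal, because
  \<open>embed\<close> provides preimages of the multipliers, and it contains the top parts.
  Together with \<open>drop_x0_I\<close> this identifies \<open>J\<close> with that image.\<close>

lemma J_lift: "j \<in> J \<Longrightarrow> \<exists>i\<in>I. drop_x0 i = j"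
proof -
  have "two_sided_ideal (drop_x0 ` I)"
    unfolding two_sided_ideal_def
  proof (intro conjI ballI allI)
    show "0 \<in> drop_x0 ` I" using ID(1) by force
    fix a assume "a \<in> drop_x0 ` I"
    then obtain i where i: "i \<in> I" "a = drop_x0 i" by blast
    show "r * a \<in> drop_x0 ` I" for r
      by (rule image_eqI[of _ _ "embed r * i"]) (simp_all add: i ID(3))
    show "a * r \<in> drop_x0 ` I" for r
      by (rule image_eqI[of _ _ "i * embed r"]) (simp_all add: i ID(4))
    fix b assume "b \<in> drop_x0 ` I"
    then obtain i' where i': "i' \<in> I" "b = drop_x0 i'" by blast
    show "a + b \<in> drop_x0 ` I"
      by (rule image_eqI[of _ _ "i + i'"]) (simp_all add: i i' ID(2))
  qed
  moreover have "top_part ` set fs \<subseteq> drop_x0 ` I"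
  proof (rule image_subsetI)
    fix f assume "f \<in> set fs"
    then show "top_part f \<in> drop_x0 ` I"
      by (intro image_eqI[of _ _ "homogenize f"]) (simp_all add: drop_x0_homogenize homogenize_in_I)
  qed
  ultimately show "j \<in> J \<Longrightarrow> \<exists>i\<in>I. drop_x0 i = j"
    using relation_ideal_least[of "drop_x0 ` I" "top_part ` set fs"] by (auto simp: J_def)
qed

lemma const_coeff_J: "j \<in> J \<Longrightarrow> const_coeff j = 0"
  using J_lift const_coeff_I by fastforce

text \<open>Only commutators with \<open>x0\<close> are spent on moving \<open>x0\<close> to the
  front. The smaller ideal matters in \<open>I_generated\<close>, where the error has to be
  accounted for by the generators \<open>u v\<close>.\<close>

lemma drop_x0_expansion: "\<exists>e. f - embed (drop_x0 f) - x0 * e \<in> relation_ideal (range u)"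
proof (induction f rule: nc_poly_induct)
  case (const c)
  then show ?case by (intro exI[of _ 0]) (simp add: relation_idealD(1) embed_def)
next
  case (var f w)
  then obtain e where e: "f - embed (drop_x0 f) - x0 * e \<in> relation_ideal (range u)" by blast
  show ?case
  proof (cases w)
    case None
    have "x0 * g - g * x0 \<in> relation_ideal (range u)" for g
    proof (induction g rule: nc_poly_induct)
      case (const c)
      then show ?case by (simp add: nc_const_commute relation_idealD(1))
    next
      case (var g w')
      have "x0 * nc_var w' - nc_var w' * x0 \<in> relation_ideal (range u)"
        using relation_ideal_base[of "u _" "range u"] relation_idealD(1)[of "range u"]
        by (cases w') (auto simp: u_def x0_def)
      then have "(x0 * g - g * x0) * nc_var w' + g * (x0 * nc_var w' - nc_var w' * x0) \<in> relation_ideal (range u)"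
        using var relation_idealD by blast
      then show ?case by (simp add: algebra_simps)
    next
      case (add f g)
      then show ?case using relation_idealD(2) by (fastforce simp: algebra_simps)
    qed
    from relation_idealD(5)[OF this[of f]] show ?thesis
      by (intro exI[of _ f]) (simp add: None x0_def embed_def)
  next
    case (Some v)
    have "(f - embed (drop_x0 f) - x0 * e) * nc_var w \<in> relation_ideal (range u)" using e by (rule relation_idealD(4))
    then show ?thesis by (intro exI[of _ "e * nc_var w"]) (simp add: Some embed_def algebra_simps)
  qed
next
  case (add f g)
  then obtain e e' where "f - embed (drop_x0 f) - x0 * e \<in> relation_ideal (range u)"
    "g - embed (drop_x0 g) - x0 * e' \<in> relation_ideal (range u)" by blast
  from relation_idealD(2)[OF this] show ?case
    by (intro exI[of _ "e + e'"]) (simp add: embed_def algebra_simps)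
qed

text \<open>Taking the component of degree \<open>d\<close> makes the cofactor of \<open>x0\<close>
  homogeneous of degree \<open>d - 1\<close>, which drives the induction in
  \<open>I_generated\<close>.\<close>

lemma kernel_expansion:
  assumes "drop_x0 f = 0" "homogeneous d f"
  obtains e where "f - x0 * e \<in> relation_ideal (range u)" "d = 0 \<Longrightarrow> e = 0" "d > 0 \<Longrightarrow> homogeneous (d - 1) e"
proof -
  obtain e where e: "f - x0 * e \<in> relation_ideal (range u)"
    using drop_x0_expansion[of f] assms(1) by (auto simp: embed_def)
  have h: "hcomp d (f - x0 * e) \<in> relation_ideal (range u)"
    by (rule relation_ideal_hcomp[OF _ e]) (use homogeneous_u in auto)
  have *: "hcomp d (f - x0 * e) = f - (if Suc 0 \<le> d then x0 * hcomp (d - Suc 0) e else 0)"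
    using assms(2) by (simp add: hcomp_mult_homogeneous_left[OF x0_simps(3)] hcomp_of_homogeneous)
  show thesis
    by (rule that[of "if d = 0 then 0 else hcomp (d - 1) e"]) (use h * in \<open>auto split: if_splits\<close>)
qed

lemma range_u_subset: "relation_ideal (range u) \<subseteq> I"
  by (rule relation_ideal_least[OF ideal_I]) (auto simp: u_in_I)

end

section \<open>Minimal relations modulo the central variable\<close>

locale minimal_relations = central_homogenization fs for fs :: "('v :: finite, 'k :: field) nc_poly list" +
  fixes R :: "('v, 'k) nc_poly set"
  assumes R_subset: "R \<subseteq> set fs"
    and R_generate: "\<And>j. j \<in> J \<Longrightarrow> \<exists>b. j - (\<Sum>f\<in>R. b f * top_part f) \<in> ideal_plus J"
    and R_minimal: "\<And>g. g \<in> R \<Longrightarrow> \<not> (\<forall>j\<in>J. \<exists>b. j - (\<Sum>f\<in>R - {g}. b f * top_part f) \<in> ideal_plus J)"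
begin

lemma finite_R: "finite R" using R_subset by (rule finite_subset) simp

lemmas IP = ideal_plus_closed[OF ideal_I]
lemmas JP = ideal_plus_closed[OF ideal_J]

lemma hcomp_JP: "z \<in> ideal_plus J \<Longrightarrow> hcomp d z \<in> ideal_plus J"
  by (rule ideal_plus_hcomp) (auto simp: hcomp_J JD)

lemma hcomp_combination:
  "hcomp d (\<Sum>f\<in>R. b f * top_part f)
    = (\<Sum>f\<in>R. (if nc_degree f \<le> d then hcomp (d - nc_degree f) (b f) else 0) * top_part f)"
  unfolding hcomp_sum hcomp_mult_homogeneous_right[OF homogeneous_top_part] by (rule sum.cong) auto

lemma minimal_coeff:
  assumes b: "(\<Sum>f\<in>R. b f * top_part f) \<in> ideal_plus J" and g: "g \<in> R"
  shows "const_coeff (b g) = 0"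
proof (rule ccontr)
  assume c: "const_coeff (b g) \<noteq> 0"
  define d where "d = nc_degree g"
  define b' where "b' f = (if nc_degree f \<le> d then hcomp (d - nc_degree f) (b f) else 0)" for f
  have b'g: "b' g = nc_const (const_coeff (b g))" by (simp add: b'_def d_def hcomp_0)
  have "(\<Sum>f\<in>R. b' f * top_part f) \<in> ideal_plus J"
    unfolding b'_def hcomp_combination[symmetric] by (rule hcomp_JP[OF b])
  then have "nc_const (const_coeff (b g)) * top_part g + (\<Sum>f\<in>R - {g}. b' f * top_part f) \<in> ideal_plus J"
    by (simp add: sum.remove[OF finite_R g] b'g)
  then have z: "nc_const (1 / const_coeff (b g)) * (nc_const (const_coeff (b g)) * top_part g
      + (\<Sum>f\<in>R - {g}. b' f * top_part f)) \<in> ideal_plus J" by (rule JP(4))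
  define b2 where "b2 f = nc_const (1 / const_coeff (b g)) * b' f" for f
  have "nc_const (1 / const_coeff (b g)) * (nc_const (const_coeff (b g)) * top_part g + (\<Sum>f\<in>R - {g}. b' f * top_part f))
      = top_part g + (\<Sum>f\<in>R - {g}. b2 f * top_part f)"
    using c by (simp add: distrib_left mult.assoc[symmetric] nc_const_mult[symmetric] sum_distrib_left b2_def)
  with z have z': "top_part g + (\<Sum>f\<in>R - {g}. b2 f * top_part f) \<in> ideal_plus J" by simp
  have "\<exists>b. j - (\<Sum>f\<in>R - {g}. b f * top_part f) \<in> ideal_plus J" if j: "j \<in> J" for j
  proof -
    obtain a where a: "j - (\<Sum>f\<in>R. a f * top_part f) \<in> ideal_plus J" using R_generate[OF j] by blast
    have "(j - (\<Sum>f\<in>R. a f * top_part f)) + a g * (top_part g + (\<Sum>f\<in>R - {g}. b2 f * top_part f)) \<in> ideal_plus J"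
      by (rule JP(2)[OF a JP(4)[OF z']])
    also have "(j - (\<Sum>f\<in>R. a f * top_part f)) + a g * (top_part g + (\<Sum>f\<in>R - {g}. b2 f * top_part f))
        = j - (\<Sum>f\<in>R - {g}. (a f - a g * b2 f) * top_part f)"
      by (simp add: sum.remove[OF finite_R g] distrib_left sum_distrib_left left_diff_distrib sum_subtractf mult.assoc)
    finally show ?thesis by (rule exI[of _ "\<lambda>f. a f - a g * b2 f"])
  qed
  then show False using R_minimal[OF g] by blast
qed

lemma R_nonzero: assumes "g \<in> R" shows "top_part g \<noteq> 0"
proof
  assume z: "top_part g = 0"
  have "(\<Sum>f\<in>R. (if f = g then 1 else 0) * top_part f) = 0" by (rule sum.neutral) (simp add: z)
  then have "(\<Sum>f\<in>R. (if f = g then 1 else 0) * top_part f) \<in> ideal_plus J" using JP(1) by simp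
  from minimal_coeff[OF this assms] show False by simp
qed

text \<open>A relation of degree zero homogenizes to a scalar in \<open>I\<close>, which is zero;
  then its top part would vanish, against \<open>R_nonzero\<close>.\<close>

lemma R_degree: assumes "g \<in> R" shows "nc_degree g > 0"
proof (rule ccontr)
  assume "\<not> nc_degree g > 0"
  then have "homogenize g = nc_const (const_coeff (homogenize g))"
    using homogeneous_homogenize[of g] by (simp add: homogeneous_iff hcomp_0)
  then have "homogenize g = 0" using const_coeff_I[OF homogenize_in_I] R_subset assms by auto
  then show False using R_nonzero[OF assms] drop_x0_homogenize[of g] by simp
qed

lemma const_coeff_top_part [simp]: "g \<in> R \<Longrightarrow> const_coeff (top_part g) = 0"
  using R_degree[of g] by (simp add: top_part_def const_coeff_def lookup_hcomp nc_word_add_letters)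

lemma const_coeff_homogenize [simp]: "g \<in> R \<Longrightarrow> const_coeff (homogenize g) = 0"
  using const_coeff_I[OF homogenize_in_I] R_subset by auto

lemma const_coeff_u [simp]: "const_coeff (u v) = 0"
  using const_coeff_I[OF u_in_I] by auto

lemma top_part_in_J: "g \<in> R \<Longrightarrow> top_part g \<in> J"
  unfolding J_def using R_subset by (auto intro: relation_ideal_base)

text \<open>Lift an expression of \<open>drop_x0 i\<close> through the top parts in
  \<open>R\<close>. The difference to \<open>i\<close> is \<open>x0 * e\<close> up to commutators,
  and regularity of \<open>x0\<close> puts \<open>e\<close> into \<open>I\<close>, in smaller
  degree. So the relations outside \<open>R\<close> are redundant in the homogenization too.\<close>

lemma I_generated:
  assumes "i \<in> I"
  shows "\<exists>b c. i - ((\<Sum>f\<in>R. b f * homogenize f) + (\<Sum>v\<in>UNIV. c v * u v)) \<in> ideal_plus I"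
proof -
  define N where "N = {i. \<exists>b c. i - ((\<Sum>f\<in>R. b f * homogenize f) + (\<Sum>v\<in>UNIV. c v * u v)) \<in> ideal_plus I}"
  have N_base: "ideal_plus I \<subseteq> N"
  proof
    fix z assume "z \<in> ideal_plus I"
    then show "z \<in> N" unfolding N_def by (intro CollectI exI[of _ "\<lambda>_. 0"]) simp
  qed
  have N_add: "a + b \<in> N" if ab: "a \<in> N" "b \<in> N" for a b
  proof -
    obtain c d c' d' where
      "a - ((\<Sum>f\<in>R. c f * homogenize f) + (\<Sum>v\<in>UNIV. d v * u v)) \<in> ideal_plus I"
      "b - ((\<Sum>f\<in>R. c' f * homogenize f) + (\<Sum>v\<in>UNIV. d' v * u v)) \<in> ideal_plus I"
      using ab unfolding N_def mem_Collect_eq by blast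
    from IP(2)[OF this] show ?thesis
      unfolding N_def by (intro CollectI exI[of _ "\<lambda>f. c f + c' f"] exI[of _ "\<lambda>f. d f + d' f"])
        (simp add: distrib_right sum.distrib algebra_simps)
  qed
  have N_mult: "r * a \<in> N" if ab: "a \<in> N" for a r
  proof -
    obtain c d where "a - ((\<Sum>f\<in>R. c f * homogenize f) + (\<Sum>v\<in>UNIV. d v * u v)) \<in> ideal_plus I"
      using ab unfolding N_def mem_Collect_eq by blast
    from IP(4)[OF this, of r] show ?thesis
      unfolding N_def by (intro CollectI exI[of _ "\<lambda>f. r * c f"] exI[of _ "\<lambda>f. r * d f"])
        (simp add: right_diff_distrib distrib_left sum_distrib_left mult.assoc)
  qed
  have N_I: "N \<subseteq> I"
  proof
    fix a assume "a \<in> N"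
    then obtain c d where "a - ((\<Sum>f\<in>R. c f * homogenize f) + (\<Sum>v\<in>UNIV. d v * u v)) \<in> ideal_plus I"
      unfolding N_def mem_Collect_eq by blast
    then have 1: "a - ((\<Sum>f\<in>R. c f * homogenize f) + (\<Sum>v\<in>UNIV. d v * u v)) \<in> I"
      using ideal_plus_subset[OF ideal_I] by blast
    have "(\<Sum>f\<in>R. c f * homogenize f) + (\<Sum>v\<in>UNIV. d v * u v) \<in> I"
      using R_subset homogenize_in_I u_in_I by (intro ID(2) two_sided_ideal_sum[OF ideal_I] ID(3)) auto
    from ID(2)[OF 1 this] show "a \<in> I" by simp
  qed
  have N_ideal: "two_sided_ideal N"
    by (rule two_sided_idealI_left[OF _ N_add N_mult ideal_I N_I])
      (use N_base IP in \<open>auto simp: subset_iff\<close>)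
  have N_u: "u v \<in> N" for v
  proof -
    have "(\<Sum>v'\<in>UNIV. (if v' = v then 1 else 0) * u v') = (\<Sum>v'\<in>UNIV. if v' = v then u v else 0)"
      by (rule sum.cong) auto
    then have "u v - ((\<Sum>f\<in>R. 0 * homogenize f) + (\<Sum>v'\<in>UNIV. (if v' = v then 1 else 0) * u v')) \<in> ideal_plus I"
      using IP(1) by simp
    then show ?thesis unfolding N_def by (intro CollectI exI)
  qed
  have comm: "relation_ideal (range u) \<subseteq> N"
    by (rule relation_ideal_least[OF N_ideal]) (use N_u in auto)
  have N_hom: "homogenize f \<in> N" if "f \<in> R" for f
  proof -
    have "(\<Sum>f'\<in>R. (if f' = f then 1 else 0) * homogenize f') = (\<Sum>f'\<in>R. if f' = f then homogenize f else 0)"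
      by (rule sum.cong) auto
    then have "homogenize f - ((\<Sum>f'\<in>R. (if f' = f then 1 else 0) * homogenize f') + (\<Sum>v\<in>UNIV. 0 * u v)) \<in> ideal_plus I"
      using IP(1) that finite_R by simp
    then show ?thesis unfolding N_def by (intro CollectI exI)
  qed
  have "i \<in> I \<Longrightarrow> homogeneous d i \<Longrightarrow> i \<in> N" for d i
  proof (induction d arbitrary: i rule: less_induct)
    case (less d)
    obtain b where b: "drop_x0 i - (\<Sum>f\<in>R. b f * top_part f) \<in> ideal_plus J"
      using R_generate[OF drop_x0_I[OF less.prems(1)]] by blast
    define z where "z = drop_x0 i - (\<Sum>f\<in>R. b f * top_part f)"
    have zJ: "const_coeff z = 0" "rdiv v z \<in> J" for v using b unfolding z_def[symmetric] ideal_plus_def by auto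
    then have "\<forall>v. \<exists>j. j \<in> I \<and> drop_x0 j = rdiv v z" using J_lift by blast
    then obtain j where j: "\<And>v. j v \<in> I" "\<And>v. drop_x0 (j v) = rdiv v z" by metis
    \<comment> \<open>The error term \<open>z\<close> is lifted coordinate by coordinate, so its
      lift lies in \<open>I F+\<close>; below, only the component of degree \<open>d\<close> of
      \<open>n\<close> is subtracted from \<open>i\<close>.\<close>
    define n where "n = (\<Sum>f\<in>R. embed (b f) * homogenize f) + (\<Sum>v\<in>UNIV. j v * nc_var (Some v))"
    have "drop_x0 n = (\<Sum>f\<in>R. b f * top_part f) + (\<Sum>v\<in>UNIV. rdiv v z * nc_var v)"
      by (simp add: n_def drop_x0_homogenize j)
    also have "(\<Sum>v\<in>UNIV. rdiv v z * nc_var v) = z"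
      using rdiv_expansion[of z] zJ(1) by (simp only: nc_const_0 add_0_left)
    finally have drop_n: "drop_x0 n = drop_x0 i" by (simp add: z_def)
    have hn: "hcomp d n \<in> N"
      unfolding n_def hcomp_simps hcomp_sum hcomp_mult_homogeneous_right[OF homogeneous_homogenize] hcomp_mult_var
    proof (intro two_sided_idealD(2)[OF N_ideal] two_sided_ideal_sum[OF N_ideal])
      show "(if nc_degree f \<le> d then hcomp (d - nc_degree f) (embed (b f)) * homogenize f else 0) \<in> N" if "f \<in> R" for f
        using N_mult[OF N_hom[OF that]] two_sided_idealD(1)[OF N_ideal] by simp
      show "(if d = 0 then 0 else hcomp (d - 1) (j v) * nc_var (Some v)) \<in> N" for v
        using hcomp_I[OF j(1)] IP(5) N_base two_sided_idealD(1)[OF N_ideal] by (auto simp: subset_iff)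
    qed
    have dz: "drop_x0 (i - hcomp d n) = 0"
      using drop_n less.prems(2) by (simp add: hcomp_drop_x0[symmetric] homogeneous_iff) (metis hcomp_drop_x0)
    have hi: "homogeneous d (i - hcomp d n)" using less.prems(2) by (simp add: homogeneous_closed)
    obtain e where e: "i - hcomp d n - x0 * e \<in> relation_ideal (range u)" "d = 0 \<Longrightarrow> e = 0" "d > 0 \<Longrightarrow> homogeneous (d - 1) e"
      using kernel_expansion[OF dz hi] by metis
    have "x0 * e \<in> I"
    proof -
      have "i - hcomp d n \<in> I" using less.prems(1) hn N_I by (intro ID(6)) auto
      moreover have "i - hcomp d n - x0 * e \<in> I" using e(1) range_u_subset by blast
      ultimately have "(i - hcomp d n) - (i - hcomp d n - x0 * e) \<in> I" by (rule ID(6))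
      then show ?thesis by simp
    qed
    then have "e \<in> I" by (rule x0_regular)
    then have "e \<in> N"
      using less.IH[of "d - 1" e] e(2,3) two_sided_idealD(1)[OF N_ideal] by (cases "d = 0") auto
    then have "(i - hcomp d n - x0 * e) + (x0 * e + hcomp d n) \<in> N"
      using comm e(1) N_mult hn by (intro N_add) auto
    then show "i \<in> N" by (simp add: algebra_simps)
  qed
  from this[OF hcomp_I[OF assms] homogeneous_hcomp] have "hcomp d i \<in> N" for d .
  with two_sided_idealD(1)[OF N_ideal] N_add have "i \<in> N" by (rule hcomp_induct[of "\<lambda>f. f \<in> N"])
  then show ?thesis by (simp add: N_def)
qed

end

section \<open>Freeness of the relation module\<close>

lemma (in vector_space) separating_functional:
  fixes t :: 'b
  assumes "t \<notin> span G"
  obtains \<phi> :: "'b \<Rightarrow> 'a" where "\<And>x y. \<phi> (x + y) = \<phi> x + \<phi> y" "\<And>c x. \<phi> (scale c x) = c * \<phi> x"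
    "\<And>g. g \<in> span G \<Longrightarrow> \<phi> g = 0" "\<phi> t = 1"
proof -
  obtain B where B: "B \<subseteq> G" "independent B" "G \<subseteq> span B" using maximal_independent_subset by blast
  have spB: "span B = span G"
    using span_mono[OF B(1)] span_mono[OF B(3)] by (auto simp: span_span)
  have ind: "independent (insert t B)" using B(2) assms spB by (simp add: independent_insert)
  \<comment> \<open>The functional is the coordinate at \<open>t\<close> in a basis of the whole
    space that contains \<open>t\<close> and a basis of the span of \<open>G\<close>.\<close>
  define E where "E = extend_basis (insert t B)"
  have E: "independent E" "span E = UNIV" "insert t B \<subseteq> E"
    unfolding E_def using independent_extend_basis[OF ind] span_extend_basis[OF ind] extend_basis_superset[OF ind] by auto
  show thesis
  proof (rule that[of "\<lambda>x. representation E x t"])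
    show "representation E (x + y) t = representation E x t + representation E y t" for x y
      by (simp add: representation_add[OF E(1)] E(2))
    show "representation E (scale c x) t = c * representation E x t" for c x
      by (simp add: representation_scale[OF E(1)] E(2))
    show "representation E t t = 1" using representation_basis[OF E(1), of t] E(3) by simp
    show "representation E g t = 0" if "g \<in> span G" for g
    proof -
      have "representation E g = representation B g"
        by (rule representation_extend) (use E that spB in auto)
      moreover have "t \<notin> B" using assms spB span_base by blast
      ultimately show ?thesis using representation_ne_zero[of B g t] by metis
    qed
  qed
qed

context minimal_relations
begin

definition vec_scale :: "'k \<Rightarrow> (('v, 'k) nc_poly \<Rightarrow> ('v, 'k) nc_poly) \<Rightarrow> (('v, 'k) nc_poly \<Rightarrow> ('v, 'k) nc_poly)" where
  "vec_scale c t = (\<lambda>f. nc_const c * t f)"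

lemma vector_space_vec: "vector_space vec_scale"
  by unfold_locales (auto simp: vec_scale_def fun_eq_iff nc_const_add nc_const_mult algebra_simps)

text \<open>The syzygies of the relations modulo \<open>x0\<close>, and the span of \<open>J\<^sup>R\<close> and \<open>F\<^sub>+ syz\<close>.\<close>

definition syz :: "(('v, 'k) nc_poly \<Rightarrow> ('v, 'k) nc_poly) set" where
  "syz = {t. (\<forall>f. f \<notin> R \<longrightarrow> t f = 0) \<and> (\<Sum>f\<in>R. t f * top_part f) \<in> ideal_plus J}"

definition syz_gens :: "(('v, 'k) nc_poly \<Rightarrow> ('v, 'k) nc_poly) set" where
  "syz_gens = {t. (\<forall>f. f \<notin> R \<longrightarrow> t f = 0) \<and> (\<forall>f. t f \<in> J)} \<union> {(\<lambda>f. a * t f) |a t. const_coeff a = 0 \<and> t \<in> syz}"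

text \<open>The coordinate at \<open>f\<close> is shifted by the degree of \<open>f\<close>, so that
  the map from vectors to combinations of top parts preserves degrees.\<close>

definition vec_comp :: "nat \<Rightarrow> (('v, 'k) nc_poly \<Rightarrow> ('v, 'k) nc_poly) \<Rightarrow> (('v, 'k) nc_poly \<Rightarrow> ('v, 'k) nc_poly)" where
  "vec_comp d t = (\<lambda>f. if nc_degree f \<le> d then hcomp (d - nc_degree f) (t f) else 0)"

text \<open>In degree \<open>d\<close> a product \<open>a * t\<close> with
  \<open>const_coeff a = 0\<close> involves only components of \<open>t\<close> of smaller degree,
  and those lie in \<open>J\<close> by induction.\<close>

lemma syz_nakayama:
  assumes "syz \<subseteq> module.span vec_scale syz_gens" and t: "t \<in> syz"
  shows "t f \<in> J"
proof -
  interpret vs: vector_space vec_scale by (rule vector_space_vec)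
  have comp: "\<forall>t\<in>syz. \<forall>f. vec_comp d t f \<in> J" for d
  proof (induction d rule: less_induct)
    case (less d)
    have "\<forall>f. vec_comp d x f \<in> J" if "x \<in> vs.span syz_gens" for x
      using that
    proof (induction rule: vs.span_induct_alt)
      case base
      then show ?case by (simp add: vec_comp_def JD)
    next
      case (step c x y)
      have "vec_comp d x f \<in> J" for f
        using step(1) unfolding syz_gens_def
      proof
        assume "x \<in> {t. (\<forall>f. f \<notin> R \<longrightarrow> t f = 0) \<and> (\<forall>f. t f \<in> J)}"
        then show ?thesis using hcomp_J JD(1) by (simp add: vec_comp_def)
      next
        assume "x \<in> {(\<lambda>f. a * t f) |a t. const_coeff a = 0 \<and> t \<in> syz}"
        then obtain a t where at: "x = (\<lambda>f. a * t f)" "const_coeff a = 0" "t \<in> syz" by blast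
        show ?thesis
        proof (cases "nc_degree f \<le> d")
          case True
          have "hcomp i a * hcomp (d - nc_degree f - i) (t f) \<in> J" if i: "i \<le> d - nc_degree f" for i
          proof (cases "i = 0")
            case True
            then show ?thesis using at(2) by (simp add: hcomp_0 JD(1))
          next
            case False
            have "vec_comp (d - i) t f \<in> J" using less.IH[of "d - i"] at(3) False i True by auto
            moreover have "nc_degree f \<le> d - i" "d - i - nc_degree f = d - nc_degree f - i" using i True by arith+
            then have "vec_comp (d - i) t f = hcomp (d - nc_degree f - i) (t f)" by (simp add: vec_comp_def)
            ultimately show ?thesis using JD(3) by simp
          qed
          then have "hcomp (d - nc_degree f) (a * t f) \<in> J"
            unfolding hcomp_mult by (intro two_sided_ideal_sum[OF ideal_J]) auto
          then show ?thesis by (simp add: vec_comp_def at(1) True)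
        qed (simp add: vec_comp_def JD(1))
      qed
      then have "nc_const c * vec_comp d x f + vec_comp d y f \<in> J" for f using step(2) JD(2,3) by blast
      moreover have "vec_comp d (vec_scale c x + y) f = nc_const c * vec_comp d x f + vec_comp d y f" for f
        by (simp add: vec_comp_def vec_scale_def hcomp_mult_homogeneous_left[OF homogeneous_const(1)])
      ultimately show ?case by (simp only: simp_thms)
    qed
    then show ?case using assms(1) by blast
  qed
  show ?thesis
  proof (rule hcomp_induct[of "\<lambda>x. x \<in> J"])
    show "hcomp e (t f) \<in> J" for e
      using comp[of "e + nc_degree f", rule_format, OF t, of f] by (simp add: vec_comp_def)
  qed (use JD in auto)
qed

text \<open>Otherwise some syzygy \<open>t\<close> lies outside \<open>J^R + F+ syz\<close>, and a
  functional \<phi> takes the value 1 at \<open>t\<close> and 0 on that sum. It induces a map from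
  the third syzygy of the homogenization to the trivial module, which lifts to \<open>h\<close>. The
  syzygy \<open>x0 t\<close> also arises from the commutation of \<open>x0\<close> with the
  relations; comparing the values of \<open>h\<close> in degree one gives \<open>x0 = 0\<close> in
  the homogenization.\<close>

theorem relations_free:
  assumes b: "(\<Sum>f\<in>R. b f * top_part f) \<in> ideal_plus J" and g: "g \<in> R"
  shows "b g \<in> J"
proof (rule ccontr)
  assume bg: "b g \<notin> J"
  interpret vs: vector_space vec_scale by (rule vector_space_vec)
  define b0 where "b0 f = (if f \<in> R then b f else 0)" for f
  have "b0 \<in> syz" unfolding syz_def using b by (simp add: b0_def cong: sum.cong)
  moreover have "b0 g \<notin> J" using bg g by (simp add: b0_def)
  ultimately have "\<not> syz \<subseteq> vs.span syz_gens" using syz_nakayama by blast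
  then obtain t where t: "t \<in> syz" "t \<notin> vs.span syz_gens" by blast
  obtain \<phi> where \<phi>: "\<And>x y. \<phi> (x + y) = \<phi> x + \<phi> y" "\<And>c x. \<phi> (vec_scale c x) = c * \<phi> x"
    "\<And>x. x \<in> vs.span syz_gens \<Longrightarrow> \<phi> x = 0" "\<phi> t = 1" 
    by (rule vs.separating_functional[OF t(2)]) (erule that, assumption+)
  \<comment> \<open>The relations of the homogenization are of two kinds, homogenized relations and
    commutators with \<open>x0\<close>; \<open>Y\<close> holds their coordinates at the
    variables.\<close>
  define S :: "(('v, 'k) nc_poly + 'v) set" where "S = R <+> UNIV"
  define Y :: "('v, 'k) nc_poly + 'v \<Rightarrow> 'v option \<Rightarrow> ('v option, 'k) nc_poly" where
    "Y j w = (case j of Inl f \<Rightarrow> rdiv w (homogenize f) | Inr v \<Rightarrow> rdiv w (u v))" for j w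
  define T where "T = {b. \<forall>w. (\<Sum>j\<in>S. b j * Y j w) \<in> I}"
  have finS: "finite S" unfolding S_def using finite_R by simp
  have sumS: "(\<Sum>j\<in>S. q j) = (\<Sum>f\<in>R. q (Inl f)) + (\<Sum>v\<in>UNIV. q (Inr v))"
    for q :: "('v, 'k) nc_poly + 'v \<Rightarrow> ('v option, 'k) nc_poly"
    unfolding S_def by (simp add: sum.Plus finite_R comp_def)
  have Y_simps: "Y (Inl f) w = rdiv w (homogenize f)" "Y (Inr v) None = - nc_var (Some v)"
    "Y (Inr v) (Some v') = (if v = v' then x0 else 0)" for f w v v'
    by (simp_all add: Y_def u_def x0_def rdiv_mult_var)
  have rdiv_expand: "(\<Sum>w\<in>UNIV. rdiv w z * nc_var w) = z" if "const_coeff z = 0" for z :: "('v option, 'k) nc_poly"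
    using rdiv_expansion[of z] that by (metis nc_const_0 add_0_left)
  have sum_Y: "(\<Sum>w\<in>UNIV. Y j w * nc_var w) = (case j of Inl f \<Rightarrow> homogenize f | Inr v \<Rightarrow> u v)" if "j \<in> S" for j
    using that by (auto simp: Y_def S_def rdiv_expand)
  have Y1: "(\<Sum>w\<in>UNIV. Y j w * nc_var w) \<in> I" if "j \<in> S" for j
    unfolding sum_Y[OF that] using that R_subset homogenize_in_I u_in_I by (auto simp: S_def)
  have rdiv_sum_var: "rdiv w (\<Sum>w'\<in>UNIV. a w' * nc_var w') = a w" for a :: "'v option \<Rightarrow> ('v option, 'k) nc_poly" and w
  proof -
    have "rdiv w (\<Sum>w'\<in>UNIV. a w' * nc_var w') = (\<Sum>w'\<in>UNIV. if w' = w then a w' else 0)"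
      unfolding rdiv_sum rdiv_mult_var ..
    then show ?thesis by simp
  qed
  have Y2: "\<exists>b. \<forall>w. a w - (\<Sum>j\<in>S. b j * Y j w) \<in> I" if aI: "(\<Sum>w\<in>UNIV. a w * nc_var w) \<in> I" for a
  proof -
    obtain c d where cd: "(\<Sum>w\<in>UNIV. a w * nc_var w) - ((\<Sum>f\<in>R. c f * homogenize f) + (\<Sum>v\<in>UNIV. d v * u v)) \<in> ideal_plus I"
      using I_generated[OF aI] by blast
    have "a w - (\<Sum>j\<in>S. case_sum c d j * Y j w) \<in> I" for w
    proof -
      have "rdiv w ((\<Sum>w\<in>UNIV. a w * nc_var w) - ((\<Sum>f\<in>R. c f * homogenize f) + (\<Sum>v\<in>UNIV. d v * u v))) \<in> I"
        using cd unfolding ideal_plus_def by blast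
      also have "rdiv w ((\<Sum>w\<in>UNIV. a w * nc_var w) - ((\<Sum>f\<in>R. c f * homogenize f) + (\<Sum>v\<in>UNIV. d v * u v)))
          = a w - ((\<Sum>f\<in>R. c f * rdiv w (homogenize f)) + (\<Sum>v\<in>UNIV. d v * rdiv w (u v)))"
        unfolding rdiv_simps rdiv_sum_var unfolding rdiv_sum rdiv_mult by simp
      finally show ?thesis by (simp add: sumS Y_def)
    qed
    then show ?thesis by blast
  qed
  have sum_expand: "(\<Sum>w\<in>UNIV. (\<Sum>j\<in>S. b j * Y j w) * nc_var w) \<in> I" for b
  proof -
    have "(\<Sum>w\<in>UNIV. (\<Sum>j\<in>S. b j * Y j w) * nc_var w) = (\<Sum>j\<in>S. b j * (\<Sum>w\<in>UNIV. Y j w * nc_var w))"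
      unfolding sum_distrib_right sum_distrib_left by (subst sum.swap) (simp add: mult.assoc)
    also have "\<dots> \<in> I" by (rule two_sided_ideal_sum[OF ideal_I]) (rule ID(3)[OF Y1])
    finally show ?thesis .
  qed
  \<comment> \<open>The coordinate at \<open>x0\<close> takes care of itself: the sum of all
    coordinates times their variables is in \<open>I\<close>, and \<open>x0\<close> may be cancelled
    on the right.\<close>
  have T_Some: "b \<in> T" if some: "\<And>v. (\<Sum>j\<in>S. b j * Y j (Some v)) \<in> I" for b
  proof -
    have eq: "(\<Sum>w\<in>UNIV. (\<Sum>j\<in>S. b j * Y j w) * nc_var w)
        = (\<Sum>j\<in>S. b j * Y j None) * x0 + (\<Sum>v\<in>UNIV. (\<Sum>j\<in>S. b j * Y j (Some v)) * nc_var (Some v))"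
      by (simp add: UNIV_option_conv sum.reindex x0_def)
    have "(\<Sum>v\<in>UNIV. (\<Sum>j\<in>S. b j * Y j (Some v)) * nc_var (Some v)) \<in> I"
      by (rule two_sided_ideal_sum[OF ideal_I]) (rule ID(4)[OF some])
    from ID(6)[OF sum_expand[of b] this] have "(\<Sum>j\<in>S. b j * Y j None) * x0 \<in> I" unfolding eq by simp
    then have "(\<Sum>j\<in>S. b j * Y j None) \<in> I" by (rule x0_regular')
    then have "(\<Sum>j\<in>S. b j * Y j w) \<in> I" for w using some by (cases w) auto
    then show ?thesis by (simp add: T_def)
  qed
  have sum_Some: "(\<Sum>j\<in>S. b j * Y j (Some v)) = (\<Sum>f\<in>R. b (Inl f) * rdiv (Some v) (homogenize f)) + b (Inr v) * x0" for b v
    by (simp add: sumS Y_simps if_distrib cong: if_cong)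
  define red where "red b f = (if f \<in> R then drop_x0 (b (Inl f)) else 0)" for b :: "('v, 'k) nc_poly + 'v \<Rightarrow> ('v option, 'k) nc_poly" and f
  have red_syz: "red b \<in> syz" if b: "b \<in> T" for b
  proof -
    have "rdiv v (\<Sum>f\<in>R. red b f * top_part f) \<in> J" for v
    proof -
      have "(\<Sum>j\<in>S. b j * Y j (Some v)) \<in> I" using b by (simp add: T_def)
      then have "drop_x0 (\<Sum>j\<in>S. b j * Y j (Some v)) \<in> J" by (rule drop_x0_I)
      then show ?thesis
        by (simp add: sum_Some rdiv_drop_x0 drop_x0_homogenize rdiv_mult red_def)
    qed
    then show ?thesis by (simp add: syz_def ideal_plus_def red_def)
  qed
  define l where "l b = \<phi> (red b)" for b
  have l1: "l (\<lambda>j. b j + b' j) = l b + l b'" for b b'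
  proof -
    have "red (\<lambda>j. b j + b' j) = red b + red b'" by (simp add: red_def fun_eq_iff)
    then show ?thesis by (simp add: l_def \<phi>(1))
  qed
  \<comment> \<open>The part of \<open>r\<close> without constant term sends the reduced syzygy into
    \<open>F+ syz\<close>, where \<phi> vanishes.\<close>
  have l2: "l (\<lambda>j. r * b j) = const_coeff r * l b" if b: "b \<in> T" for r b
  proof -
    have eq: "red (\<lambda>j. r * b j) = vec_scale (const_coeff r) (red b) + (\<lambda>f. (drop_x0 r - nc_const (const_coeff r)) * red b f)"
      by (simp add: red_def fun_eq_iff vec_scale_def algebra_simps)
    have "(\<lambda>f. (drop_x0 r - nc_const (const_coeff r)) * red b f) \<in> syz_gens"
      unfolding syz_gens_def using red_syz[OF b] by (intro UnI2 CollectI exI conjI) auto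
    then show ?thesis by (simp add: l_def eq \<phi> vs.span_base)
  qed
  have l3: "l b = l b'" if "\<And>j. j \<in> S \<Longrightarrow> b j - b' j \<in> I" for b b'
  proof -
    have "(red b - red b') f \<in> J" for f
    proof (cases "f \<in> R")
      case True
      then have "drop_x0 (b (Inl f) - b' (Inl f)) \<in> J" by (intro drop_x0_I that) (auto simp: S_def)
      then show ?thesis using True by (simp add: red_def)
    qed (simp add: red_def JD(1))
    then have "red b - red b' \<in> syz_gens"
      unfolding syz_gens_def by (intro UnI1 CollectI conjI allI impI) (simp_all add: red_def)
    then have 0: "\<phi> (red b - red b') = 0" by (rule \<phi>(3)[OF vs.span_base])
    have "\<phi> (red b) = \<phi> ((red b - red b') + red b')" by (simp only: diff_add_cancel)
    also have "\<dots> = \<phi> (red b')" unfolding \<phi>(1) 0 by simp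
    finally show ?thesis by (simp add: l_def)
  qed
  obtain h where h: "\<And>b. b \<in> T \<Longrightarrow> const_coeff (h b) = l b"
    "\<And>b b'. b \<in> T \<Longrightarrow> b' \<in> T \<Longrightarrow> h (\<lambda>j. b j + b' j) - (h b + h b') \<in> I"
    "\<And>r b. b \<in> T \<Longrightarrow> h (\<lambda>j. r * b j) - r * h b \<in> I"
    "\<And>b b'. b \<in> T \<Longrightarrow> b' \<in> T \<Longrightarrow> (\<And>j. j \<in> S \<Longrightarrow> b j - b' j \<in> I) \<Longrightarrow> h b - h b' \<in> I"
  proof (rule presented_syzygy_lift[OF gldim[unfolded homogenization_def], folded I_def, of S Y T l])
    show "const_coeff f = 0" if "f \<in> I" for f using that by (rule const_coeff_I)
    show "finite S" by (rule finS)
    show "(\<Sum>w\<in>UNIV. Y j w * nc_var w) \<in> I" if "j \<in> S" for j using that by (rule Y1)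
    show "\<exists>b. \<forall>w. a w - (\<Sum>j\<in>S. b j * Y j w) \<in> I" if "(\<Sum>w\<in>UNIV. a w * nc_var w) \<in> I" for a
      using that by (rule Y2)
    show "T = {b. \<forall>w. (\<Sum>j\<in>S. b j * Y j w) \<in> I}" by (rule T_def)
    show "l (\<lambda>j. b j + b' j) = l b + l b'" for b b' by (rule l1)
    show "l (\<lambda>j. r * b j) = const_coeff r * l b" if "b \<in> T" for r b using that by (rule l2)
    show "l b = l b'" if "\<And>j. j \<in> S \<Longrightarrow> b j - b' j \<in> I" for b b' using that by (rule l3)
    fix h assume "\<And>b. b \<in> T \<Longrightarrow> const_coeff (h b) = l b"
      "\<And>b b'. b \<in> T \<Longrightarrow> b' \<in> T \<Longrightarrow> h (\<lambda>j. b j + b' j) - (h b + h b') \<in> I"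
      "\<And>r b. b \<in> T \<Longrightarrow> h (\<lambda>j. r * b j) - r * h b \<in> I"
      "\<And>b b'. b \<in> T \<Longrightarrow> b' \<in> T \<Longrightarrow> (\<And>j. j \<in> S \<Longrightarrow> b j - b' j \<in> I) \<Longrightarrow> h b - h b' \<in> I"
    then show thesis by (rule that)
  qed
  have T_add: "(\<lambda>j. b j + b' j) \<in> T" if "b \<in> T" "b' \<in> T" for b b'
    using that ID(2) by (simp add: T_def distrib_right sum.distrib)
  have T_mult: "(\<lambda>j. r * b j) \<in> T" if "b \<in> T" for b r
    using that ID(3) by (simp add: T_def mult.assoc sum_distrib_left[symmetric])
  text \<open>The syzygies \<open>x0 \<cdot> f - f \<cdot> x0\<close>.\<close>
  define X :: "('v, 'k) nc_poly \<Rightarrow> ('v, 'k) nc_poly + 'v \<Rightarrow> ('v option, 'k) nc_poly" where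
    "X f j = (case j of Inl f' \<Rightarrow> if f' = f then x0 else 0 | Inr v \<Rightarrow> - rdiv (Some v) (homogenize f))" for f j
  have X_T: "X f \<in> T" if f: "f \<in> R" for f
  proof (rule T_Some)
    fix v
    have "(\<Sum>f'\<in>R. X f (Inl f') * rdiv (Some v) (homogenize f')) = (\<Sum>f'\<in>R. if f' = f then x0 * rdiv (Some v) (homogenize f) else 0)"
      by (rule sum.cong) (auto simp: X_def)
    also have "\<dots> = x0 * rdiv (Some v) (homogenize f)" using finite_R f by simp
    finally show "(\<Sum>j\<in>S. X f j * Y j (Some v)) \<in> I"
      using x0_commute[of "rdiv (Some v) (homogenize f)"] by (simp add: sum_Some X_def)
  qed
  text \<open>A lift of \<open>t\<close> to a syzygy over the homogenization.\<close>
  have "\<exists>e. (\<Sum>f\<in>R. embed (t f) * rdiv (Some v) (homogenize f)) - e * x0 \<in> I" for v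
  proof -
    let ?y = "\<Sum>f\<in>R. embed (t f) * rdiv (Some v) (homogenize f)"
    have "drop_x0 ?y = rdiv v (\<Sum>f\<in>R. t f * top_part f)"
      by (simp add: rdiv_drop_x0 drop_x0_homogenize rdiv_mult)
    also have "\<dots> \<in> J" using t(1) by (simp add: syz_def ideal_plus_def)
    finally obtain i where i: "i \<in> I" "drop_x0 i = drop_x0 ?y" using J_lift by blast
    obtain e where "(?y - i) - embed (drop_x0 (?y - i)) - x0 * e \<in> relation_ideal (range u)"
      using drop_x0_expansion by blast
    then have e: "?y - i - x0 * e \<in> I" using i(2) range_u_subset by (auto simp: embed_def)
    have "(?y - i - x0 * e) + i + (x0 * e - e * x0) \<in> I"
      using e i(1) x0_commute ID(2) by blast
    then show ?thesis by (intro exI[of _ e]) (simp add: algebra_simps)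
  qed
  then have "\<exists>e. \<forall>v. (\<Sum>f\<in>R. embed (t f) * rdiv (Some v) (homogenize f)) - e v * x0 \<in> I"
    by (intro choice allI)
  then obtain e where e: "\<And>v. (\<Sum>f\<in>R. embed (t f) * rdiv (Some v) (homogenize f)) - e v * x0 \<in> I" by blast
  define tt where "tt j = (case j of Inl f \<Rightarrow> embed (t f) | Inr v \<Rightarrow> - e v)" for j
  have tt_T: "tt \<in> T" by (rule T_Some) (use e in \<open>simp add: sum_Some tt_def\<close>)
  have "red tt = t" using t(1) by (auto simp: red_def tt_def syz_def fun_eq_iff)
  then have "const_coeff (h tt) = 1" using h(1)[OF tt_T] by (simp add: l_def \<phi>(4))
  \<comment> \<open>\<open>Z R\<close> will agree with \<open>x0 * tt\<close> modulo
    \<open>I\<close> in every coordinate. Its image under \<open>h\<close> is computed by induction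
    on the set of relations, since \<open>h\<close> is additive only modulo
    \<open>I\<close>.\<close>
  define Z where "Z A j = (\<Sum>f\<in>A. embed (t f) * X f j)" for A j
  have Z: "Z A \<in> T \<and> h (Z A) - (\<Sum>f\<in>A. embed (t f) * h (X f)) \<in> I" if "finite A" "A \<subseteq> R" for A
    using that
  proof (induction A)
    case empty
    have "Z {} = (\<lambda>j. 0 * tt j)" by (simp add: Z_def fun_eq_iff)
    then show ?case using T_mult[OF tt_T, of 0] h(3)[OF tt_T, of 0] by simp
  next
    case (insert f A)
    then have IH: "Z A \<in> T" "h (Z A) - (\<Sum>f\<in>A. embed (t f) * h (X f)) \<in> I" and f: "f \<in> R" by auto
    have eq: "Z (insert f A) = (\<lambda>j. embed (t f) * X f j + Z A j)" using insert by (simp add: Z_def fun_eq_iff)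
    have 1: "(\<lambda>j. embed (t f) * X f j) \<in> T" by (rule T_mult[OF X_T[OF f]])
    have "(h (Z (insert f A)) - (h (\<lambda>j. embed (t f) * X f j) + h (Z A)))
        + ((h (\<lambda>j. embed (t f) * X f j) - embed (t f) * h (X f)) + (h (Z A) - (\<Sum>f\<in>A. embed (t f) * h (X f)))) \<in> I"
      unfolding eq by (intro ID(2) h(2)[OF 1 IH(1)] h(3)[OF X_T[OF f]] IH(2))
    then show ?case using T_add[OF 1 IH(1)] insert by (simp add: eq algebra_simps)
  qed
  have ZR: "Z R \<in> T" "h (Z R) - (\<Sum>f\<in>R. embed (t f) * h (X f)) \<in> I" using Z[OF finite_R] by auto
  have x0T: "(\<lambda>j. x0 * tt j) \<in> T" by (rule T_mult[OF tt_T])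
  have cong_R: "x0 * tt (Inl f) - Z R (Inl f) \<in> I" if f: "f \<in> R" for f
  proof -
    have "Z R (Inl f) = (\<Sum>f'\<in>R. if f' = f then embed (t f) * x0 else 0)"
      unfolding Z_def X_def by (rule sum.cong) auto
    also have "\<dots> = embed (t f) * x0" using f finite_R by simp
    finally show ?thesis by (simp add: tt_def x0_commute)
  qed
  \<comment> \<open>At a commutator coordinate two members of \<open>T\<close> are compared: the
    relation coordinates agree already, and what remains is a multiple of \<open>x0\<close>, which
    can be cancelled.\<close>
  have cong_S: "x0 * tt j - Z R j \<in> I" if "j \<in> S" for j
  proof (cases j)
    case (Inl f)
    then show ?thesis using that cong_R by (auto simp: S_def)
  next
    case (Inr v)
    have "(\<Sum>j\<in>S. (x0 * tt j) * Y j (Some v)) \<in> I" "(\<Sum>j\<in>S. Z R j * Y j (Some v)) \<in> I"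
      using x0T ZR(1) by (auto simp: T_def)
    from ID(6)[OF this] have "(\<Sum>f\<in>R. (x0 * tt (Inl f) - Z R (Inl f)) * rdiv (Some v) (homogenize f)) + (x0 * tt (Inr v) - Z R (Inr v)) * x0 \<in> I"
      unfolding sum_Some by (simp add: sum_subtractf algebra_simps)
    moreover have "(\<Sum>f\<in>R. (x0 * tt (Inl f) - Z R (Inl f)) * rdiv (Some v) (homogenize f)) \<in> I"
      by (rule two_sided_ideal_sum[OF ideal_I]) (rule ID(4)[OF cong_R])
    ultimately have "(x0 * tt (Inr v) - Z R (Inr v)) * x0 \<in> I" using ID(6) by fastforce
    then show ?thesis using x0_regular' Inr by simp
  qed
  have "(h (\<lambda>j. x0 * tt j) - h (Z R)) + (h (Z R) - (\<Sum>f\<in>R. embed (t f) * h (X f))) - (h (\<lambda>j. x0 * tt j) - x0 * h tt) \<in> I"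
    by (rule ID(6)[OF ID(2)[OF h(4)[OF x0T ZR(1) cong_S] ZR(2)] h(3)[OF tt_T]])
  then have "x0 * h tt - (\<Sum>f\<in>R. embed (t f) * h (X f)) \<in> I" by (simp add: algebra_simps)
  \<comment> \<open>Degree one tells the two sides apart: \<open>h tt\<close> has constant
    coefficient 1, but in \<open>embed (t f) * h (X f)\<close> both factors have constant
    coefficient 0.\<close>
  then have "hcomp (Suc 0) (x0 * h tt - (\<Sum>f\<in>R. embed (t f) * h (X f))) \<in> I" by (rule hcomp_I)
  moreover have "hcomp (Suc 0) (x0 * h tt) = x0"
    using \<open>const_coeff (h tt) = 1\<close> by (simp add: hcomp_mult_homogeneous_left[OF x0_simps(3)] hcomp_0)
  moreover have "hcomp (Suc 0) (embed (t f) * h (X f)) = 0" if f: "f \<in> R" for f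
  proof -
    have "red (X f) = vec_scale 0 t" by (auto simp: red_def X_def fun_eq_iff vec_scale_def)
    then have "const_coeff (h (X f)) = 0" using h(1)[OF X_T[OF f]] \<phi>(2)[of 0 t] by (simp add: l_def)
    moreover have "const_coeff (t f) = 0" using minimal_coeff[OF _ f] t(1) by (simp add: syz_def)
    ultimately show ?thesis by (simp add: hcomp_mult hcomp_0)
  qed
  ultimately have "x0 * 1 \<in> I" by simp
  then have "1 \<in> I" by (rule x0_regular)
  then show False using one_notin by (simp add: I_def)
qed

end

section \<open>The Hilbert series\<close>

lemma nontrivial_kernel:
  fixes a :: "'i \<Rightarrow> 'j \<Rightarrow> 'k :: field"
  assumes "finite Y" "finite X" "card Y < card X"
  shows "\<exists>c. (\<exists>i\<in>X. c i \<noteq> 0) \<and> (\<forall>j\<in>Y. (\<Sum>i\<in>X. c i * a i j) = 0)"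
  using assms
proof (induction Y arbitrary: X a rule: finite_induct)
  case empty
  then obtain i where "i \<in> X" by fastforce
  then show ?case by (intro exI[of _ "\<lambda>_. 1"]) auto
next
  case (insert j Y)
  show ?case
  proof (cases "\<forall>i\<in>X. a i j = 0")
    case True
    have "card Y < card X" using insert by simp
    from insert.IH[OF insert.prems(1) this, of a] obtain c
      where "\<exists>i\<in>X. c i \<noteq> 0" "\<forall>j\<in>Y. (\<Sum>i\<in>X. c i * a i j) = 0" by blast
    then show ?thesis using True by (intro exI[of _ c]) auto
  next
    case False
    then obtain p where p: "p \<in> X" "a p j \<noteq> 0" by blast
    \<comment> \<open>One step of Gaussian elimination: the pivot row \<open>p\<close> clears the
      column \<open>j\<close> in all other rows.\<close>
    let ?X = "X - {p}" and ?a = "\<lambda>i k. a i k - a i j / a p j * a p k"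
    have "card Y < card ?X" using insert p by (simp add: card_Diff_singleton)
    from insert.IH[OF _ this, of ?a] insert.prems(1) obtain c
      where c: "\<exists>i\<in>?X. c i \<noteq> 0" "\<forall>k\<in>Y. (\<Sum>i\<in>?X. c i * ?a i k) = 0" by auto
    define s where "s = - (\<Sum>i\<in>?X. c i * (a i j / a p j))"
    define c' where "c' i = (if i = p then s else c i)" for i
    have sum: "(\<Sum>i\<in>X. c' i * a i k) = s * a p k + (\<Sum>i\<in>?X. c i * a i k)" for k
      by (simp add: sum.remove[OF insert.prems(1) p(1)] c'_def)
    have "(\<Sum>i\<in>X. c' i * a i k) = 0" if "k \<in> insert j Y" for k
    proof -
      have "(\<Sum>i\<in>?X. c i * ?a i k) = (\<Sum>i\<in>X. c' i * a i k)"
        unfolding sum s_def by (simp add: right_diff_distrib sum_subtractf sum_distrib_right mult.assoc)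
      then show ?thesis using c(2) that p(2) by (cases "k = j") auto
    qed
    moreover have "\<exists>i\<in>X. c' i \<noteq> 0" using c(1) by (auto simp: c'_def)
    ultimately show ?thesis by blast
  qed
qed

definition indep_mod :: "('v, 'k :: field) nc_poly set \<Rightarrow> 'i set \<Rightarrow> ('i \<Rightarrow> ('v, 'k) nc_poly) \<Rightarrow> bool" where
  "indep_mod W X g \<longleftrightarrow> (\<forall>c. (\<Sum>i\<in>X. nc_const (c i) * g i) \<in> W \<longrightarrow> (\<forall>i\<in>X. c i = 0))"

lemma indep_modD: "indep_mod W X g \<Longrightarrow> (\<Sum>i\<in>X. nc_const (c i) * g i) \<in> W \<Longrightarrow> i \<in> X \<Longrightarrow> c i = 0"
  by (simp add: indep_mod_def)

definition spans_mod :: "('v, 'k :: field) nc_poly set \<Rightarrow> ('v, 'k) nc_poly set \<Rightarrow> 'i set \<Rightarrow> ('i \<Rightarrow> ('v, 'k) nc_poly) \<Rightarrow> bool" where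
  "spans_mod W V X g \<longleftrightarrow> (\<forall>f\<in>V. \<exists>c. f - (\<Sum>i\<in>X. nc_const (c i) * g i) \<in> W)"

definition left_ideal :: "'r :: ring_1 set \<Rightarrow> bool" where
  "left_ideal W \<longleftrightarrow> 0 \<in> W \<and> (\<forall>a\<in>W. \<forall>b\<in>W. a + b \<in> W) \<and> (\<forall>a\<in>W. \<forall>r. r * a \<in> W)"

lemma left_idealD:
  assumes "left_ideal W"
  shows "0 \<in> W" "a \<in> W \<Longrightarrow> b \<in> W \<Longrightarrow> a + b \<in> W" "a \<in> W \<Longrightarrow> r * a \<in> W" "a \<in> W \<Longrightarrow> - a \<in> W"
    "a \<in> W \<Longrightarrow> b \<in> W \<Longrightarrow> a - b \<in> W"
proof -
  show "0 \<in> W" and 1: "\<And>a b. a \<in> W \<Longrightarrow> b \<in> W \<Longrightarrow> a + b \<in> W" and 2: "\<And>a r. a \<in> W \<Longrightarrow> r * a \<in> W"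
    using assms unfolding left_ideal_def by blast+
  show 3: "a \<in> W \<Longrightarrow> - a \<in> W" for a using 2[of a "-1"] by simp
  show "a \<in> W \<Longrightarrow> b \<in> W \<Longrightarrow> a - b \<in> W" using 1[OF _ 3, of a b] by simp
qed

lemma left_ideal_sum: "left_ideal W \<Longrightarrow> (\<And>i. i \<in> S \<Longrightarrow> f i \<in> W) \<Longrightarrow> sum f S \<in> W"
  by (induction S rule: infinite_finite_induct) (auto dest: left_idealD)

lemma two_sided_ideal_left: "two_sided_ideal I \<Longrightarrow> left_ideal I"
  by (simp add: two_sided_ideal_def left_ideal_def)

text \<open>A comparison of dimensions in \<open>V / W\<close> that forms no quotient space: with
  fewer spanning than independent elements, the matrix of coordinates has a nontrivial kernel, which
  is a forbidden dependency.\<close>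

lemma card_indep_le_spans:
  assumes W: "left_ideal W" and fin: "finite X" "finite Y"
    and X: "indep_mod W X g" "\<And>i. i \<in> X \<Longrightarrow> g i \<in> V" and Y: "spans_mod W V Y h"
  shows "card X \<le> card Y"
proof (rule ccontr)
  assume "\<not> card X \<le> card Y"
  then have lt: "card Y < card X" by simp
  have "\<forall>i\<in>X. \<exists>c. g i - (\<Sum>j\<in>Y. nc_const (c j) * h j) \<in> W"
    using X(2) Y unfolding spans_mod_def by blast
  then obtain a where a: "\<And>i. i \<in> X \<Longrightarrow> g i - (\<Sum>j\<in>Y. nc_const (a i j) * h j) \<in> W" by metis
  obtain c where c: "\<exists>i\<in>X. c i \<noteq> 0" "\<forall>j\<in>Y. (\<Sum>i\<in>X. c i * a i j) = 0"
    using nontrivial_kernel[OF fin(2,1) lt, of a] by blast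
  have "(\<Sum>i\<in>X. nc_const (c i) * (g i - (\<Sum>j\<in>Y. nc_const (a i j) * h j))) \<in> W"
    by (rule left_ideal_sum[OF W]) (rule left_idealD(3)[OF W a])
  also have "(\<Sum>i\<in>X. nc_const (c i) * (g i - (\<Sum>j\<in>Y. nc_const (a i j) * h j)))
      = (\<Sum>i\<in>X. nc_const (c i) * g i) - (\<Sum>i\<in>X. \<Sum>j\<in>Y. nc_const (c i * a i j) * h j)"
    by (simp add: right_diff_distrib sum_subtractf sum_distrib_left mult.assoc[symmetric] nc_const_mult)
  also have "(\<Sum>i\<in>X. \<Sum>j\<in>Y. nc_const (c i * a i j) * h j) = (\<Sum>j\<in>Y. nc_const (\<Sum>i\<in>X. c i * a i j) * h j)"
    by (subst sum.swap) (simp add: sum_distrib_right nc_const_sum)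
  also have "\<dots> = 0" using c(2) by simp
  finally have "(\<Sum>i\<in>X. nc_const (c i) * g i) \<in> W" by simp
  then show False using X(1) c(1) unfolding indep_mod_def by blast
qed

definition monom_word :: "'v list \<Rightarrow> ('v, 'k :: field) nc_poly" where
  "monom_word w = Poly_Mapping.single (NC_Word w) 1"

lemma homogeneous_monom_word: "homogeneous (length w) (monom_word w)"
  by (auto simp: homogeneous_lookup monom_word_def lookup_single when_def)

lemma finite_words: "finite {w :: 'v :: finite list. length w = d}"
  using finite_lists_length_eq[of "UNIV :: 'v set" d] by simp

lemma homogeneous_expansion:
  fixes f :: "('v :: finite, 'k :: field) nc_poly"
  assumes "homogeneous d f"
  shows "f = (\<Sum>w | length w = d. nc_const (Poly_Mapping.lookup f (NC_Word w)) * monom_word w)"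
proof (rule poly_mapping_eqI)
  fix u
  have "Poly_Mapping.lookup (\<Sum>w | length w = d. nc_const (Poly_Mapping.lookup f (NC_Word w)) * monom_word w) u
      = (\<Sum>w | length w = d. if w = letters u then Poly_Mapping.lookup f u else 0)"
    unfolding lookup_sum
    by (rule sum.cong) (auto simp: nc_const_mult_left monom_word_def lookup_single when_def)
  then show "Poly_Mapping.lookup f u = Poly_Mapping.lookup (\<Sum>w | length w = d. nc_const (Poly_Mapping.lookup f (NC_Word w)) * monom_word w) u"
    using assms by (simp add: finite_words homogeneous_lookup)
qed

text \<open>Take an independent set of words of largest size; every other word of length
  \<open>d\<close> then depends on it modulo \<open>J\<close>.\<close>

lemma normal_words_exist:
  fixes J :: "('v :: finite, 'k :: field) nc_poly set"
  assumes J: "left_ideal J"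
  shows "\<exists>N \<subseteq> {w. length w = d}. indep_mod J N monom_word \<and> spans_mod J {f. homogeneous d f} N monom_word"
proof -
  let ?P = "\<lambda>N. N \<subseteq> {w :: 'v list. length w = d} \<and> indep_mod J N monom_word"
  have P0: "?P {}" by (simp add: indep_mod_def)
  have bound: "\<forall>N. ?P N \<longrightarrow> card N < Suc (card {w :: 'v list. length w = d})"
    by (intro allI impI le_imp_less_Suc card_mono finite_words) auto
  have "\<exists>N. ?P N \<and> (\<forall>N'. ?P N' \<longrightarrow> card N' \<le> card N)"
    by (rule Lattices_Big.ex_has_greatest_nat[of ?P, OF P0 bound])
  then obtain N where N: "?P N" and max: "\<forall>N'. ?P N' \<longrightarrow> card N' \<le> card N"
    by (elim exE) (erule conjE, rule that, assumption+)
  have finN: "finite N" using N finite_words finite_subset by blast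
  have red: "\<exists>c. monom_word w - (\<Sum>i\<in>N. nc_const (c i) * monom_word i) \<in> J" if w: "length w = d" for w
  proof (cases "w \<in> N")
    case True
    have "(\<Sum>i\<in>N. nc_const (if i = w then 1 else 0) * monom_word i) = (\<Sum>i\<in>N. if i = w then monom_word w else 0)"
      by (rule sum.cong) auto
    also have "\<dots> = monom_word w" using True finN by simp
    finally have e: "(\<Sum>i\<in>N. nc_const (if i = w then 1 else 0) * monom_word i) = monom_word w" .
    have "monom_word w - (\<Sum>i\<in>N. nc_const (if i = w then 1 else 0) * monom_word i) \<in> J"
      unfolding e by (simp add: left_idealD(1)[OF J])
    then show ?thesis by (rule exI[of _ "\<lambda>i. if i = w then 1 else 0"])
  next
    case False
    then have "\<not> ?P (insert w N)" using max[rule_format, of "insert w N"] finN by fastforce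
    then obtain c where c: "(\<Sum>i\<in>insert w N. nc_const (c i) * monom_word i) \<in> J" "\<exists>i\<in>insert w N. c i \<noteq> 0"
      using N w unfolding indep_mod_def by auto
    have c': "nc_const (c w) * monom_word w + (\<Sum>i\<in>N. nc_const (c i) * monom_word i) \<in> J" using c(1) False finN by simp
    have "c w \<noteq> 0"
    proof
      assume "c w = 0"
      then have "(\<Sum>i\<in>N. nc_const (c i) * monom_word i) \<in> J" using c' by simp
      then show False using N c(2) \<open>c w = 0\<close> unfolding indep_mod_def by auto
    qed
    then have "nc_const (1 / c w) * (nc_const (c w) * monom_word w + (\<Sum>i\<in>N. nc_const (c i) * monom_word i))
       = monom_word w - (\<Sum>i\<in>N. nc_const (- (c i / c w)) * monom_word i)"
      by (simp add: distrib_left sum_distrib_left mult.assoc[symmetric] nc_const_mult[symmetric] nc_const_uminus sum_negf)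
    then have "monom_word w - (\<Sum>i\<in>N. nc_const (- (c i / c w)) * monom_word i) \<in> J"
      using left_idealD(3)[OF J c', of "nc_const (1 / c w)"] by (simp only:)
    then show ?thesis by (rule exI[of _ "\<lambda>i. - (c i / c w)"])
  qed
  then have "\<forall>w. \<exists>c. length w = d \<longrightarrow> monom_word w - (\<Sum>i\<in>N. nc_const (c i) * monom_word i) \<in> J" by blast
  then have "\<exists>c. \<forall>w. length w = d \<longrightarrow> monom_word w - (\<Sum>i\<in>N. nc_const (c w i) * monom_word i) \<in> J" by (rule choice)
  then obtain c where c: "\<And>w. length w = d \<Longrightarrow> monom_word w - (\<Sum>i\<in>N. nc_const (c w i) * monom_word i) \<in> J" by blast
  have "\<exists>e. f - (\<Sum>i\<in>N. nc_const (e i) * monom_word i) \<in> J" if f: "homogeneous d f" for f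
  proof -
    define a where "a w = Poly_Mapping.lookup f (NC_Word w)" for w
    have "(\<Sum>w | length w = d. nc_const (a w) * (monom_word w - (\<Sum>i\<in>N. nc_const (c w i) * monom_word i))) \<in> J"
      by (rule left_ideal_sum[OF J]) (use c left_idealD(3)[OF J] in auto)
    also have "(\<Sum>w | length w = d. nc_const (a w) * (monom_word w - (\<Sum>i\<in>N. nc_const (c w i) * monom_word i)))
      = f - (\<Sum>w | length w = d. \<Sum>i\<in>N. nc_const (a w * c w i) * monom_word i)"
      unfolding right_diff_distrib sum_subtractf homogeneous_expansion[OF f, folded a_def, symmetric]
      by (simp add: sum_distrib_left mult.assoc[symmetric] nc_const_mult)
    also have "(\<Sum>w | length w = d. \<Sum>i\<in>N. nc_const (a w * c w i) * monom_word i)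
      = (\<Sum>i\<in>N. nc_const (\<Sum>w | length w = d. a w * c w i) * monom_word i)"
      by (subst sum.swap) (simp add: sum_distrib_right nc_const_sum)
    finally show ?thesis by (rule exI[of _ "\<lambda>i. \<Sum>w | length w = d. a w * c w i"])
  qed
  then show ?thesis using N unfolding spans_mod_def by blast
qed

section \<open>The Hilbert function of the quotient\<close>

context minimal_relations
begin

definition normal_words :: "nat \<Rightarrow> 'v list set" where
  "normal_words d = (SOME N. N \<subseteq> {w. length w = d} \<and> indep_mod J N monom_word \<and> spans_mod J {f. homogeneous d f} N monom_word)"

lemma normal_words:
  "normal_words d \<subseteq> {w. length w = d}" "indep_mod J (normal_words d) monom_word"
  "spans_mod J {f. homogeneous d f} (normal_words d) monom_word"
  unfolding normal_words_def
  using someI_ex[OF normal_words_exist[OF two_sided_ideal_left[OF ideal_J], of d, unfolded Bex_def]]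
  by (auto simp: Pow_def)

lemma finite_normal_words: "finite (normal_words d)"
  using normal_words(1) finite_words finite_subset by blast

text \<open>The dimension of the component of degree \<open>d\<close> of \<open>F/J\<close>, of
  which the normal words form a basis.\<close>

definition hilbert :: "nat \<Rightarrow> nat" where "hilbert d = card (normal_words d)"

lemma hilbert_0: "hilbert 0 = 1"
proof -
  have "normal_words 0 \<noteq> {}"
  proof
    assume "normal_words 0 = {}"
    then have "1 \<in> J" using normal_words(3)[of 0] homogeneous_const(2) by (auto simp: spans_mod_def)
    then show False using const_coeff_J by fastforce
  qed
  moreover have "normal_words 0 \<subseteq> {[]}" using normal_words(1)[of 0] by auto
  ultimately have "normal_words 0 = {[]}" by blast
  then show ?thesis by (simp add: hilbert_def)
qed

lemma left_ideal_plus: "left_ideal (ideal_plus J)"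
  using JP by (auto simp: left_ideal_def)

text \<open>Both sides are the dimension of the component of degree \<open>d\<close> of
  \<open>F / J F+\<close>. Since \<open>F+\<close> is free on the variables,
  \<open>F+ / J F+\<close> is a sum of copies of \<open>F/J\<close>, one for each variable. It is
  also an extension of a part of \<open>F/J\<close> by \<open>J / J F+\<close>, which is free on the
  top parts in \<open>R\<close>. For \<open>d > 0\<close> the passage from \<open>F+\<close> to
  \<open>F\<close> changes nothing.\<close>

theorem hilbert_recurrence:
  assumes d: "d > 0"
  shows "card (UNIV :: 'v set) * hilbert (d - 1) = hilbert d + (\<Sum>f\<in>R. if nc_degree f \<le> d then hilbert (d - nc_degree f) else 0)"
proof -
  let ?V = "{f :: ('v, 'k) nc_poly. homogeneous d f}"
  note N = normal_words
  define R' where "R' = {f\<in>R. nc_degree f \<le> d}"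
  have finR': "finite R'" using finite_R by (simp add: R'_def)
  define X1 :: "('v \<times> 'v list) set" where "X1 = UNIV \<times> normal_words (d - 1)"
  define g1 :: "'v \<times> 'v list \<Rightarrow> ('v, 'k) nc_poly" where "g1 = (\<lambda>(v, w). monom_word w * nc_var v)"
  define X2 where "X2 = Sigma R' (\<lambda>f. normal_words (d - nc_degree f)) <+> normal_words d"
  define g2 :: "(('v, 'k) nc_poly \<times> 'v list) + 'v list \<Rightarrow> ('v, 'k) nc_poly" where
    "g2 = case_sum (\<lambda>(f, w). monom_word w * top_part f) monom_word"
  have fin: "finite X1" "finite X2"
    unfolding X1_def X2_def using finite_normal_words finR' by auto
  have sum1: "(\<Sum>i\<in>X1. nc_const (c i) * g1 i) = (\<Sum>v\<in>UNIV. (\<Sum>w\<in>normal_words (d - 1). nc_const (c (v, w)) * monom_word w) * nc_var v)" for c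
    unfolding X1_def g1_def
    by (simp add: sum.cartesian_product' sum_distrib_right mult.assoc split_def) 
  have sum2: "(\<Sum>i\<in>X2. nc_const (c i) * g2 i)
      = (\<Sum>f\<in>R'. (\<Sum>w\<in>normal_words (d - nc_degree f). nc_const (c (Inl (f, w))) * monom_word w) * top_part f)
        + (\<Sum>w\<in>normal_words d. nc_const (c (Inr w)) * monom_word w)" for c
    unfolding X2_def g2_def
    by (subst sum.Plus) (simp_all add: finite_normal_words finR' sum_distrib_right mult.assoc sum.Sigma split_def)
  have hd: "Suc (d - 1) = d" using d by simp
  have V1: "g1 i \<in> ?V" if "i \<in> X1" for i
  proof -
    obtain v w where i: "i = (v, w)" "w \<in> normal_words (d - 1)" using \<open>i \<in> X1\<close> by (auto simp: X1_def)
    then have "length w = d - 1" using N(1)[of "d - 1"] by blast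
    then show ?thesis using homogeneous_mult[OF homogeneous_monom_word[of w] homogeneous_var[of v]] hd by (simp add: g1_def i)
  qed
  have V2: "g2 i \<in> ?V" if "i \<in> X2" for i
  proof (cases i)
    case (Inl p)
    then obtain f w where "i = Inl (f, w)" "f \<in> R'" "w \<in> normal_words (d - nc_degree f)"
      using \<open>i \<in> X2\<close> by (cases p) (auto simp: X2_def)
    moreover from this have "length w + nc_degree f = d" using N(1)[of "d - nc_degree f"] by (auto simp: R'_def)
    ultimately show ?thesis using homogeneous_mult[OF homogeneous_monom_word[of w] homogeneous_top_part[of f]] by (simp add: g2_def)
  next
    case (Inr w)
    then show ?thesis using that N(1)[of d] homogeneous_monom_word[of w] by (auto simp: X2_def g2_def)
  qed
  have ind1: "indep_mod (ideal_plus J) X1 g1"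
    unfolding indep_mod_def sum1
  proof (intro allI impI ballI)
    fix c i assume a: "(\<Sum>v\<in>UNIV. (\<Sum>w\<in>normal_words (d - 1). nc_const (c (v, w)) * monom_word w) * nc_var v) \<in> ideal_plus J" and i: "i \<in> X1"
    obtain v w where vw: "i = (v, w)" "w \<in> normal_words (d - 1)" using i by (auto simp: X1_def)
    have "rdiv v (\<Sum>v\<in>UNIV. (\<Sum>w\<in>normal_words (d - 1). nc_const (c (v, w)) * monom_word w) * nc_var v) \<in> J"
      using a unfolding ideal_plus_def by blast
    then have "(\<Sum>w\<in>normal_words (d - 1). nc_const (c (v, w)) * monom_word w) \<in> J"
      unfolding rdiv_sum rdiv_mult_var by simp
    from indep_modD[OF N(2) this vw(2)] show "c i = 0" by (simp add: vw(1))
  qed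
  \<comment> \<open>Modulo \<open>J\<close> only the normal words of length \<open>d\<close> are
    left, so their coefficients vanish; \<open>relations_free\<close> then puts the coefficients of
    the top parts into \<open>J\<close>.\<close>
  have ind2: "indep_mod (ideal_plus J) X2 g2"
    unfolding indep_mod_def sum2
  proof (intro allI impI ballI)
    fix c :: "(('v, 'k) nc_poly \<times> 'v list) + 'v list \<Rightarrow> 'k" and i
    define b where "b f = (\<Sum>w\<in>normal_words (d - nc_degree f). nc_const (c (Inl (f, w))) * monom_word w)" for f
    define e where "e = (\<Sum>w\<in>normal_words d. nc_const (c (Inr w)) * monom_word w)"
    assume "(\<Sum>f\<in>R'. (\<Sum>w\<in>normal_words (d - nc_degree f). nc_const (c (Inl (f, w))) * monom_word w) * top_part f)
        + (\<Sum>w\<in>normal_words d. nc_const (c (Inr w)) * monom_word w) \<in> ideal_plus J" and i: "i \<in> X2"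
    then have a: "(\<Sum>f\<in>R'. b f * top_part f) + e \<in> ideal_plus J" by (simp add: b_def e_def)
    have "(\<Sum>f\<in>R'. b f * top_part f) \<in> J"
      by (rule two_sided_ideal_sum[OF ideal_J]) (use top_part_in_J JD(3) in \<open>auto simp: R'_def\<close>)
    from JD(6)[OF subsetD[OF ideal_plus_subset[OF ideal_J] a] this] have "e \<in> J" by simp
    then have e0: "\<forall>w\<in>normal_words d. c (Inr w) = 0" using indep_modD[OF N(2)] unfolding e_def by auto
    then have "e = 0" unfolding e_def by simp
    then have "(\<Sum>f\<in>R'. b f * top_part f) \<in> ideal_plus J" using a by simp
    also have "(\<Sum>f\<in>R'. b f * top_part f) = (\<Sum>f\<in>R. (if nc_degree f \<le> d then b f else 0) * top_part f)"
      by (rule sum.mono_neutral_cong_left) (auto simp: R'_def finite_R)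
    finally have bJ: "b f \<in> J" if "f \<in> R'" for f
      using relations_free[of "\<lambda>f. if nc_degree f \<le> d then b f else 0" f] that by (simp add: R'_def)
    have "c (Inl (f, w)) = 0" if "f \<in> R'" "w \<in> normal_words (d - nc_degree f)" for f w
      using indep_modD[OF N(2) bJ[OF that(1), unfolded b_def] that(2)] .
    then show "c i = 0" using i e0 by (auto simp: X2_def)
  qed
  have sp1: "spans_mod (ideal_plus J) ?V X1 g1"
    unfolding spans_mod_def sum1
  proof
    fix f assume "f \<in> ?V"
    then have f: "homogeneous d f" by simp
    have "homogeneous (d - 1) (rdiv v f)" for v
      using f rdiv_hcomp[of v "d - 1" f] hd by (simp add: homogeneous_iff)
    then have "\<forall>v. \<exists>c. rdiv v f - (\<Sum>w\<in>normal_words (d - 1). nc_const (c w) * monom_word w) \<in> J"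
      using N(3)[of "d - 1"] unfolding spans_mod_def by blast
    then have "\<exists>c. \<forall>v. rdiv v f - (\<Sum>w\<in>normal_words (d - 1). nc_const (c v w) * monom_word w) \<in> J" by (rule choice)
    then obtain c where c: "\<And>v. rdiv v f - (\<Sum>w\<in>normal_words (d - 1). nc_const (c v w) * monom_word w) \<in> J" by blast
    have "const_coeff f = 0" using f d by (simp add: const_coeff_def homogeneous_lookup nc_word_add_letters)
    then have "f - (\<Sum>v\<in>UNIV. (\<Sum>w\<in>normal_words (d - 1). nc_const (c v w) * monom_word w) * nc_var v) \<in> ideal_plus J"
      using c by (auto simp: ideal_plus_def rdiv_mult_var simp del: rdiv_simps(3) ) 
    then show "\<exists>c. f - (\<Sum>v\<in>UNIV. (\<Sum>w\<in>normal_words (d - 1). nc_const (c (v, w)) * monom_word w) * nc_var v) \<in> ideal_plus J"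
      by (intro exI[of _ "\<lambda>(v, w). c v w"]) simp
  qed
  have sp2: "spans_mod (ideal_plus J) ?V X2 g2"
    unfolding spans_mod_def sum2
  proof
    fix f assume "f \<in> ?V"
    then have f: "homogeneous d f" by simp
    obtain e where e: "f - (\<Sum>w\<in>normal_words d. nc_const (e w) * monom_word w) \<in> J"
      using N(3)[of d] f unfolding spans_mod_def by blast
    define j where "j = f - (\<Sum>w\<in>normal_words d. nc_const (e w) * monom_word w)"
    have "homogeneous d (\<Sum>w\<in>normal_words d. nc_const (e w) * monom_word w)"
      using N(1)[of d] homogeneous_mult[OF homogeneous_const(1) homogeneous_monom_word] by (intro homogeneous_sum) fastforce
    then have hj: "hcomp d j = j" using f by (simp add: j_def homogeneous_iff)
    obtain b where b: "j - (\<Sum>f\<in>R. b f * top_part f) \<in> ideal_plus J" using R_generate[OF e] by (auto simp: j_def)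
    define b' where "b' f = hcomp (d - nc_degree f) (b f)" for f
    have "j - (\<Sum>f\<in>R. (if nc_degree f \<le> d then b' f else 0) * top_part f) \<in> ideal_plus J"
      using hcomp_JP[OF b, of d] unfolding hcomp_simps hcomp_combination hj b'_def .
    also have "(\<Sum>f\<in>R. (if nc_degree f \<le> d then b' f else 0) * top_part f) = (\<Sum>f\<in>R'. b' f * top_part f)"
      by (rule sum.mono_neutral_cong_right) (auto simp: R'_def finite_R)
    finally have b': "j - (\<Sum>f\<in>R'. b' f * top_part f) \<in> ideal_plus J" .
    have "\<forall>f. \<exists>c. b' f - (\<Sum>w\<in>normal_words (d - nc_degree f). nc_const (c w) * monom_word w) \<in> J"
      using N(3) homogeneous_hcomp unfolding spans_mod_def b'_def by blast
    then have "\<exists>c. \<forall>f. b' f - (\<Sum>w\<in>normal_words (d - nc_degree f). nc_const (c f w) * monom_word w) \<in> J" by (rule choice)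
    then obtain c where c: "\<And>f. b' f - (\<Sum>w\<in>normal_words (d - nc_degree f). nc_const (c f w) * monom_word w) \<in> J" by blast
    have "(\<Sum>f\<in>R'. (b' f - (\<Sum>w\<in>normal_words (d - nc_degree f). nc_const (c f w) * monom_word w)) * top_part f) \<in> ideal_plus J"
      by (rule left_ideal_sum[OF left_ideal_plus]) (rule JP(5)[OF c], simp add: R'_def)
    from JP(2)[OF b' this] have "f - ((\<Sum>f\<in>R'. (\<Sum>w\<in>normal_words (d - nc_degree f). nc_const (c f w) * monom_word w) * top_part f)
        + (\<Sum>w\<in>normal_words d. nc_const (e w) * monom_word w)) \<in> ideal_plus J"
      by (simp add: left_diff_distrib sum_subtractf j_def algebra_simps)
    then show "\<exists>c. f - ((\<Sum>f\<in>R'. (\<Sum>w\<in>normal_words (d - nc_degree f). nc_const (c (Inl (f, w))) * monom_word w) * top_part f)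
        + (\<Sum>w\<in>normal_words d. nc_const (c (Inr w)) * monom_word w)) \<in> ideal_plus J"
      by (intro exI[of _ "case_sum (\<lambda>(f, w). c f w) e"]) simp
  qed
  have "card X1 = card X2"
    using card_indep_le_spans[OF left_ideal_plus fin ind1 V1 sp2] card_indep_le_spans[OF left_ideal_plus fin(2,1) ind2 V2 sp1]
    by simp
  moreover have "card X1 = card (UNIV :: 'v set) * hilbert (d - 1)" by (simp add: X1_def card_cartesian_product hilbert_def)
  moreover have "card X2 = (\<Sum>f\<in>R'. hilbert (d - nc_degree f)) + hilbert d"
    unfolding X2_def using finR' finite_normal_words by (simp add: card_Plus hilbert_def)
  moreover have "(\<Sum>f\<in>R'. hilbert (d - nc_degree f)) = (\<Sum>f\<in>R. if nc_degree f \<le> d then hilbert (d - nc_degree f) else 0)"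
    by (rule sum.mono_neutral_cong_left) (auto simp: R'_def finite_R)
  ultimately show ?thesis by simp
qed

end

section \<open>Polynomial growth and the roots of the denominator\<close>

lemma summable_polynomial_growth:
  fixes b :: "nat \<Rightarrow> nat" and z :: complex
  assumes b: "\<And>d. d \<ge> D \<Longrightarrow> real (b d) \<le> real d ^ K" and z: "norm z < 1"
  shows "summable (\<lambda>d. of_nat (b d) * z ^ d)"
proof -
  \<comment> \<open>Writing \<open>norm z\<close> as \<open>y ^ Suc K\<close> gives each of the
    \<open>K\<close> factors \<open>d\<close> its own \<open>y ^ d\<close>, which keeps it bounded,
    and leaves one \<open>y ^ d\<close> for a geometric series.\<close>
  define y where "y = root (Suc K) (norm z)"
  have y3: "y ^ Suc K = norm z" unfolding y_def by (rule real_root_pow_pos2) auto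
  have y: "y \<ge> 0" "y < 1" using z by (simp_all add: y_def)
  have "(\<lambda>n. of_nat n * y ^ n) \<longlonglongrightarrow> 0" by (rule powser_times_n_limit_0) (use y in simp)
  then have "Bseq (\<lambda>n. of_nat n * y ^ n)" by (rule convergent_imp_Bseq[OF convergentI])
  then obtain M where M: "\<And>n. norm (of_nat n * y ^ n) \<le> M" using Bseq_def by metis
  have "summable (\<lambda>d. M ^ K * y ^ d)" by (rule summable_mult) (simp add: summable_geometric y)
  then show ?thesis
  proof (rule summable_comparison_test'[where N = D])
    fix d assume "d \<ge> D"
    have "norm (of_nat (b d) * z ^ d) = real (b d) * (y ^ Suc K) ^ d"
      by (simp only: norm_mult norm_power y3 norm_of_nat)
    also have "\<dots> \<le> real d ^ K * (y ^ Suc K) ^ d" using b[OF \<open>d \<ge> D\<close>] y by (intro mult_right_mono) auto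
    also have "\<dots> = (real d * y ^ d) ^ K * y ^ d"
      by (simp add: power_mult_distrib power_mult[symmetric] power_add mult.commute mult.left_commute)
    also have "\<dots> \<le> M ^ K * y ^ d" using M[of d] y by (intro mult_right_mono power_mono) auto
    finally show "norm (of_nat (b d) * z ^ d) \<le> M ^ K * y ^ d" .
  qed
qed

text \<open>All roots have modulus at least one, while \<open>L\<close> times the product of their
  moduli is one; so \<open>L\<close> and every modulus equal one. Inverting a root is then
  conjugation, which permutes the roots of a real polynomial.\<close>

lemma self_reciprocal:
  fixes p :: "complex poly"
  assumes real: "\<And>i. coeff p i \<in> \<real>" and p0: "coeff p 0 = 1" and lead: "lead_coeff p = of_real L" "L \<ge> 1"
    and roots: "\<And>z. norm z < 1 \<Longrightarrow> poly p z \<noteq> 0"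
  shows "reflect_poly p = p" "L = 1"
proof -
  obtain x where x: "Polynomial.smult (lead_coeff p) (\<Prod>i<degree p. [:- x i, 1:]) = p" by (rule complex_poly_decompose')
  let ?D = "degree p"
  have pz: "poly p z = of_real L * (\<Prod>i<?D. z - x i)" for z
    by (subst x[symmetric]) (simp add: lead poly_prod algebra_simps)
  have "poly p (x i) = 0" if "i < ?D" for i
    unfolding pz using that by (intro mult_eq_0_iff[THEN iffD2] disjI2 prod_zero) auto
  then have ge: "norm (x i) \<ge> 1" if "i < ?D" for i using roots that by force
  have "poly p 0 = 1" using p0 by (simp add: poly_0_coeff_0)
  then have prod: "of_real L * (\<Prod>i<?D. - x i) = 1" by (simp add: pz)
  then have "norm (of_real L * (\<Prod>i<?D. - x i)) = 1" by simp
  then have n1: "L * (\<Prod>i<?D. norm (x i)) = 1" using lead(2) by (simp add: norm_mult prod_norm[symmetric])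
  have Pge: "(\<Prod>i\<in>A. norm (x i)) \<ge> 1" if "A \<subseteq> {..<?D}" for A using that ge by (intro prod_ge_1) auto
  have PL: "(\<Prod>i<?D. norm (x i)) \<le> 1"
    using mult_right_mono[OF lead(2), of "\<Prod>i<?D. norm (x i)"] Pge[OF order_refl] n1 by simp
  then have "(\<Prod>i<?D. norm (x i)) = 1" using Pge[OF order_refl] by (rule antisym)
  then show "L = 1" using n1 by simp
  have one: "norm (x i) = 1" if "i < ?D" for i
  proof -
    have "(\<Prod>i<?D. norm (x i)) = norm (x i) * (\<Prod>j\<in>{..<?D} - {i}. norm (x j))"
      using that by (simp add: prod.remove)
    moreover have "norm (x i) * 1 \<le> norm (x i) * (\<Prod>j\<in>{..<?D} - {i}. norm (x j))"
      by (rule mult_left_mono[OF Pge]) auto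
    ultimately show ?thesis using PL ge[OF that] by linarith
  qed
  have inv: "x i * cnj (x i) = 1" if "i < ?D" for i
    using one[OF that] by (simp add: complex_norm_square[symmetric])
  have P1: "(\<Prod>i<?D. - x i) = 1" using prod \<open>L = 1\<close> by simp
  have "poly (reflect_poly p) z = poly p z" if z: "z \<noteq> 0" for z
  proof -
    have "poly (reflect_poly p) z = z ^ ?D * (\<Prod>i<?D. inverse z - x i)"
      using z \<open>L = 1\<close> by (simp add: poly_reflect_poly_nz pz)
    also have "\<dots> = (\<Prod>i<?D. z * (inverse z - x i))" by (simp add: prod.distrib)
    also have "\<dots> = (\<Prod>i<?D. - x i * (z - cnj (x i)))"
      by (rule prod.cong) (use z inv in \<open>auto simp: algebra_simps\<close>)
    also have "\<dots> = cnj (\<Prod>i<?D. cnj z - x i)" unfolding prod.distrib P1 by simp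
    also have "\<dots> = cnj (poly p (cnj z))" by (simp add: pz \<open>L = 1\<close>)
    also have "\<dots> = poly p z" by (simp add: poly_cnj_real[OF real, symmetric])
    finally show ?thesis .
  qed
  \<comment> \<open>The factor \<open>[:0, 1:]\<close> covers the point 0, where the values have not
    been compared.\<close>
  then have "poly ([:0, 1:] * reflect_poly p) z = poly ([:0, 1:] * p) z" for z by (cases "z = 0") auto
  then have "[:0, 1:] * reflect_poly p = [:0, 1:] * p" 
    unfolding poly_eq_poly_eq_iff[symmetric] by (rule ext)
  then show "reflect_poly p = p" by simp
qed

text \<open>The recurrence says that \<open>p\<close> times the series of \<open>b\<close> is 1. The
  series converges in the open unit disc, so \<open>p\<close> has no root there and is
  self-reciprocal. Its linear coefficient is \<open>- b 1\<close>, and all later coefficients count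
  relations; this sign pattern is symmetric only in degree two.\<close>

theorem hilbert_series_dichotomy:
  fixes b :: "nat \<Rightarrow> nat" and deg :: "'f \<Rightarrow> nat" and n :: nat
  assumes R: "finite R" "\<And>f. f \<in> R \<Longrightarrow> deg f > 0"
    and b0: "b 0 = 1"
    and rec: "\<And>d. d > 0 \<Longrightarrow> n * b (d - 1) = b d + (\<Sum>f\<in>R. if deg f \<le> d then b (d - deg f) else 0)"
    and growth: "\<And>d. d \<ge> D0 \<Longrightarrow> real (b d) \<le> real d ^ K"
  shows "b 1 \<le> 1 \<or> (b 1 = 2 \<and> (\<exists>g\<in>R. deg g = 2 \<and> (\<forall>f\<in>R. f \<noteq> g \<longrightarrow> deg f = 1)))"
proof (rule ccontr)
  assume contr: "\<not> ?thesis"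
  then have b1: "b 1 \<ge> 2" by simp
  define p :: "complex poly" where "p = 1 - monom (of_nat n) 1 + (\<Sum>f\<in>R. monom 1 (deg f))"
  define r where "r i = card {f\<in>R. deg f = i}" for i
  have cp: "coeff p i = (if i = 0 then 1 else 0) - (if i = 1 then of_nat n else 0) + of_nat (r i)" for i
    using R(1) by (simp add: p_def coeff_sum r_def sum.If_cases Int_def)
  have r0: "r 0 = 0" using R by (auto simp: r_def)
  have "n = b 1 + (\<Sum>f\<in>R. if deg f = 1 then 1 else 0)"
    using rec[of 1] b0 R(2) by (simp add: le_Suc_eq cong: sum.cong) (auto intro!: sum.cong dest: R(2))
  then have nb: "n = b 1 + r 1" using R(1) by (simp add: r_def sum.If_cases Int_def)
  have c0: "coeff p 0 = 1" and c1: "coeff p 1 = - of_nat (b 1)" and c2: "\<And>i. i \<ge> 2 \<Longrightarrow> coeff p i = of_nat (r i)"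
    by (simp_all add: cp r0 nb)
  define H :: "complex fps" where "H = Abs_fps (\<lambda>d. of_nat (b d))"
  have "fps_of_poly p * H = 1"
  proof (rule fps_ext)
    fix d
    have eq: "fps_of_poly p * H = H - of_nat n * (fps_X ^ 1 * H) + (\<Sum>f\<in>R. fps_X ^ deg f * H)"
      by (simp add: p_def fps_of_poly_add fps_of_poly_diff fps_of_poly_sum fps_of_poly_monom algebra_simps sum_distrib_left sum_distrib_right fps_of_nat)
    show "fps_nth (fps_of_poly p * H) d = fps_nth 1 d"
    proof (cases "d = 0")
      case True
      have "(\<Sum>f\<in>R. fps_nth (fps_X ^ deg f * H) 0) = 0"
        by (rule sum.neutral) (use R(2) in \<open>simp add: fps_X_power_mult_nth\<close>)
      then show ?thesis unfolding eq by (simp add: True fps_sum_nth H_def b0 fps_X_power_mult_nth fps_of_nat[symmetric])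
    next
      case False
      have "fps_nth (fps_of_poly p * H) d = of_nat (b d) - of_nat (n * b (d - 1)) + of_nat (\<Sum>f\<in>R. if deg f \<le> d then b (d - deg f) else 0)"
        unfolding eq using False
        by (simp add: fps_sum_nth H_def fps_X_power_mult_nth fps_of_nat[symmetric] not_less if_distrib[of of_nat] cong: if_cong)
          (auto intro!: sum.cong)
      also have "\<dots> = 0" using rec[of d] False by (simp add: of_nat_mult[symmetric] del: of_nat_mult)
      finally show ?thesis using False by simp
    qed
  qed
  have roots: "poly p z \<noteq> 0" if z: "norm z < 1" for z
  proof
    assume pz: "poly p z = 0"
    obtain t where t: "norm z < t" "t < 1" using z dense by blast
    have t0: "0 \<le> t" using t norm_ge_zero[of z] by linarith
    have "summable (\<lambda>d. of_nat (b d) * (of_real t :: complex) ^ d)"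
      by (rule summable_polynomial_growth[OF growth]) (use t t0 in auto)
    then have "conv_radius (fps_nth H) \<ge> norm (of_real t :: complex)"
      by (intro conv_radius_geI) (simp add: H_def)
    moreover have "ereal (norm z) < ereal (norm (of_real t :: complex))" using t norm_ge_zero[of z] by simp
    ultimately have "ereal (norm z) < fps_conv_radius H" unfolding fps_conv_radius_def by (rule less_le_trans[rotated])
    then have "eval_fps (fps_of_poly p * H) z = eval_fps (fps_of_poly p) z * eval_fps H z"
      by (intro eval_fps_mult) auto
    then show False unfolding \<open>fps_of_poly p * H = 1\<close> by (simp add: pz)
  qed
  have real: "coeff p i \<in> \<real>" for i by (simp add: cp)
  have rdeg: "r i = 0" if "i > degree p" for i
  proof -
    have "i \<noteq> 1" using that c1 b1 coeff_eq_0[OF that] by auto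
    then show ?thesis using coeff_eq_0[OF that] c0 r0 c2[of i] by (cases "i = 0") auto
  qed
  have D1: "degree p \<ge> 1" using c1 b1 by (intro le_degree) auto
  \<comment> \<open>A linear denominator would have the root \<open>1 / b 1\<close>, which lies
    inside the disc.\<close>
  have D2: "degree p \<ge> 2"
  proof (rule ccontr)
    assume "\<not> degree p \<ge> 2"
    then have "degree p = 1" using D1 by simp
    then have "poly p z = 1 - of_nat (b 1) * z" for z by (simp add: poly_altdef c0 c1[simplified])
    then have "poly p (1 / of_nat (b 1)) = 0" using b1 by simp
    moreover have "norm (1 / of_nat (b 1) :: complex) < 1" using b1 by (simp add: norm_divide)
    ultimately show False using roots by blast
  qed
  have lc: "lead_coeff p = of_real (real (r (degree p)))" using c2[OF D2] by simp
  have "lead_coeff p \<noteq> 0" using D1 by auto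
  then have r1: "real (r (degree p)) \<ge> 1" using lc by (cases "r (degree p)") auto
  note sr = self_reciprocal[OF real c0 lc r1 roots]
  \<comment> \<open>The negative coefficient of degree one reappears just below the top; above
    degree two that place belongs to a count of relations.\<close>
  have "coeff p (degree p - 1) = coeff p 1"
    using arg_cong[OF sr(1), of "\<lambda>q. coeff q 1"] D1 by (simp add: coeff_reflect_poly)
  have deg2: "degree p = 2"
  proof (rule ccontr)
    assume "degree p \<noteq> 2"
    then have "coeff p (degree p - 1) = of_nat (r (degree p - 1))" using D2 by (intro c2) simp
    then have "of_nat (r (degree p - 1) + b 1) = (0 :: complex)"
      using \<open>coeff p (degree p - 1) = coeff p 1\<close> c1 by simp
    then show False using b1 unfolding of_nat_eq_0_iff by simp
  qed
  have r2: "r 2 = 1" using sr(2) by (simp add: deg2)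
  then obtain g where g: "{f\<in>R. deg f = 2} = {g}" unfolding r_def by (auto simp: card_1_singleton_iff)
  have others: "deg f = 1" if "f \<in> R" "f \<noteq> g" for f
  proof (rule ccontr)
    assume "deg f \<noteq> 1"
    moreover have "deg f \<noteq> 2" using that g by auto
    ultimately have "deg f > degree p" using R(2)[OF that(1)] deg2 by linarith
    then have "r (deg f) = 0" by (rule rdeg)
    then show False using that(1) R(1) by (auto simp: r_def)
  qed
  have gR: "g \<in> R" "deg g = 2" using g by blast+
  have b3: "b 1 \<ge> 3" using contr b1 others gR by fastforce
  have pe: "poly p z = 1 - of_nat (b 1) * z + z ^ 2" for z
    using r2 by (simp add: poly_altdef deg2 c0 c1[simplified] c2 numeral_2_eq_2)
  \<comment> \<open>The value at 0 is 1, and the value at 1 is \<open>2 - b 1\<close>, which is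
    negative for \<open>b 1 \<ge> 3\<close>.\<close>
  have "\<exists>x>0. x < 1 \<and> poly [:1, - real (b 1), 1:] x = 0"
    using b3 by (intro poly_IVT_neg) auto
  then obtain x where x: "x > 0" "x < 1" "1 - real (b 1) * x + x ^ 2 = 0"
    by (auto simp: power2_eq_square algebra_simps)
  have "poly p (of_real x) = of_real (1 - real (b 1) * x + x ^ 2)" by (simp add: pe)
  then have "poly p (of_real x) = 0" unfolding x(3) by simp
  then show False using roots[of "of_real x"] x(1,2) by simp
qed

definition nc_scale :: "'k :: field \<Rightarrow> ('v, 'k) nc_poly \<Rightarrow> ('v, 'k) nc_poly" where
  "nc_scale c f = nc_const c * f"

text \<open>Rewrite rules that collect scalars in front of the noncommutative monomials.\<close>

lemma nc_scale_simps:
  "nc_const c * f = nc_scale c f" "f * nc_const c = nc_scale c f"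
  "nc_scale c f * g = nc_scale c (f * g)" "f * nc_scale c g = nc_scale c (f * g)"
  "nc_scale c (nc_scale d f) = nc_scale (c * d) f" "nc_scale c (f + g) = nc_scale c f + nc_scale c g"
  "nc_scale c (f - g) = nc_scale c f - nc_scale c g" "nc_scale c (- f) = - nc_scale c f" "nc_scale c 0 = 0"
  "nc_scale 0 f = 0" "nc_scale 1 f = f" "nc_scale c (nc_const d) = nc_const (c * d)"
  "nc_scale (c + d) f = nc_scale c f + nc_scale d f" "nc_scale (c - d) f = nc_scale c f - nc_scale d f"
  "nc_scale (- c) f = - nc_scale c f"
proof -
  show "nc_const c * f = nc_scale c f" by (simp add: nc_scale_def)
  show "f * nc_const c = nc_scale c f" by (simp add: nc_scale_def nc_const_commute)
  show "nc_scale c f * g = nc_scale c (f * g)" by (simp add: nc_scale_def mult.assoc)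
  show "f * nc_scale c g = nc_scale c (f * g)"
    unfolding nc_scale_def by (metis nc_const_commute mult.assoc)
qed (simp_all add: nc_scale_def nc_const_mult nc_const_add nc_const_diff nc_const_uminus algebra_simps)

section \<open>Growth of the homogenization\<close>

lemma list_prod_coset:
  "list_prod (presented_algebra Rel) (map (\<lambda>v. coset Rel (g v)) w) = coset Rel (prod_list (map g w))"
  by (induction w) (simp_all add: list_prod_def presented_algebra_simps)

lemma finsum_coset:
  "finite S \<Longrightarrow> (\<Oplus>\<^bsub>presented_algebra Rel\<^esub>i\<in>S. coset Rel (g i)) = coset Rel (\<Sum>i\<in>S. g i)"
proof (induction S rule: finite_induct)
  case empty
  interpret ring "presented_algebra Rel" by (rule ring_presented_algebra)
  show ?case by (simp add: presented_algebra_simps)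
next
  case (insert i S)
  interpret ring "presented_algebra Rel" by (rule ring_presented_algebra)
  have "(\<lambda>i. coset Rel (g i)) \<in> S \<rightarrow> carrier (presented_algebra Rel)" by (auto simp: presented_algebra_simps(1))
  moreover have "coset Rel (g i) \<in> carrier (presented_algebra Rel)" by (simp add: presented_algebra_simps(1))
  ultimately show ?case using insert by (simp add: finsum_insert presented_algebra_simps)
qed

text \<open>\<open>growth\<close> is a dimension in the span as a space of its own, so spans and
  independence have to be carried over from \<open>B\<close> to that subspace.\<close>

lemma card_le_growth:
  fixes B :: "('k :: field, 'a) module"
  assumes vs: "vectorspace class_ring B" and S: "finite S"
    and carr: "\<And>xs. set xs \<subseteq> S \<Longrightarrow> list_prod B xs \<in> carrier B"
    and U: "U \<subseteq> {list_prod B xs | xs. set xs \<subseteq> S \<and> length xs \<le> n}" and li: "\<not> module.lin_dep class_ring B U"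
  shows "card U \<le> growth B S n"
proof -
  interpret V: vectorspace class_ring B by fact
  let ?X = "{list_prod B xs | xs. set xs \<subseteq> S \<and> length xs \<le> n}"
  have X: "?X \<subseteq> carrier B" using carr by blast
  have "?X = list_prod B ` {xs. set xs \<subseteq> S \<and> length xs \<le> n}" by blast
  then have finX: "finite ?X" using finite_lists_length_le[OF S] by simp
  have sub: "VectorSpace.subspace class_ring (V.span ?X) B" by (rule V.span_is_subspace[OF X])
  interpret W: vectorspace class_ring "V.vs (V.span ?X)" by (rule V.subspace_is_vs[OF sub])
  have subm: "submodule class_ring (V.span ?X) B" using sub by (rule V.is_module)
  have XW: "?X \<subseteq> V.span ?X" by (rule V.in_own_span[OF X])
  have gen: "W.span ?X = V.span ?X" by (rule V.span_li_not_depend(1)[OF XW subm])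
  have "W.fin_dim" unfolding W.fin_dim_def by (rule exI[of _ ?X]) (use finX XW gen in simp)
  moreover have "U \<subseteq> V.span ?X" using U XW by (rule order_trans)
  moreover have "\<not> W.lin_dep U" using li V.span_li_not_depend(2)[OF \<open>U \<subseteq> V.span ?X\<close> subm] by simp
  ultimately have "card U \<le> W.dim" using W.li_le_dim(2)[of U] by simp
  then show ?thesis by (simp add: growth_def)
qed

text \<open>Any integer above the dimension can serve as the exponent \<open>K\<close>, because the
  logarithms to the base \<open>n\<close> eventually stay below it.\<close>

lemma GKdim_growth:
  fixes B :: "('k :: field, 'a) module"
  assumes "GKdim B < \<infinity>" "finite S" "S \<subseteq> carrier B"
  shows "\<exists>K D. \<forall>n\<ge>D. real (growth B S n) \<le> real n ^ K"
proof -
  have "limsup (\<lambda>n. ereal (log (real n) (real (growth B S n)))) \<le> GKdim B"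
    unfolding GKdim_def by (rule SUP_upper) (use assms in simp)
  moreover obtain K :: nat where "GKdim B < ereal (real K)" using assms(1) less_PInf_Ex_of_nat by auto
  ultimately have "limsup (\<lambda>n. ereal (log (real n) (real (growth B S n)))) < ereal (real K)" by (rule le_less_trans)
  then have "\<forall>\<^sub>F n in sequentially. ereal (log (real n) (real (growth B S n))) < ereal (real K)" by (rule Limsup_lessD)
  then obtain D where D: "\<And>n. n \<ge> D \<Longrightarrow> log (real n) (real (growth B S n)) < real K"
    unfolding eventually_sequentially by auto
  \<comment> \<open>The bound 2 keeps the base of the logarithm above one.\<close>
  have "real (growth B S n) \<le> real n ^ K" if n: "n \<ge> max D 2" for n
  proof (cases "growth B S n = 0")
    case False
    then have "real (growth B S n) < real n powr real K"
      using D[of n] n by (subst log_less_iff[symmetric]) auto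
    then show ?thesis using n by (simp add: powr_realpow)
  qed simp
  then show ?thesis by blast
qed

context minimal_relations
begin

text \<open>Normal words remain independent in the homogenization: \<open>drop_x0\<close> sends a
  dependency there to one modulo \<open>J\<close>.\<close>

lemma hilbert_le_growth:
  assumes "k_algebra (homogenization fs)"
  shows "hilbert d \<le> growth (homogenization fs) (range (\<lambda>v. coset (hom_relations fs) (nc_var v))) d"
proof -
  let ?B = "presented_algebra (hom_relations fs)" let ?c = "coset (hom_relations fs)"
  let ?U = "(\<lambda>w. ?c (embed (monom_word w))) ` normal_words d"
  have vs: "vectorspace class_ring ?B" using assms by (simp add: k_algebra_def homogenization_simps)
  interpret V: vectorspace class_ring ?B by (rule vs)
  have indep: "c w = 0" if "(\<Sum>w\<in>normal_words d. nc_const (c w) * embed (monom_word w)) \<in> I" "w \<in> normal_words d" for c w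
    using drop_x0_I[OF that(1)] indep_modD[OF normal_words(2) _ that(2)] by simp
  have inj: "inj_on (\<lambda>w. ?c (embed (monom_word w))) (normal_words d)"
  proof (rule inj_onI, rule ccontr)
    fix w w' assume w: "w \<in> normal_words d" "w' \<in> normal_words d" "w \<noteq> w'"
    assume "?c (embed (monom_word w)) = ?c (embed (monom_word w'))"
    then have m: "embed (monom_word w) - embed (monom_word w') \<in> I" by (simp add: coset_eq_iff I_def)
    let ?c' = "\<lambda>i. if i = w then 1 else if i = w' then -1 else (0 :: 'k)"
    have "(\<Sum>i\<in>normal_words d. nc_const (?c' i) * embed (monom_word i))
        = (\<Sum>i\<in>normal_words d. (if i = w then embed (monom_word w) else 0) + (if i = w' then - embed (monom_word w') else 0))"
      using w(3) by (intro sum.cong) (auto simp: nc_const_uminus)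
    also have "\<dots> = embed (monom_word w) - embed (monom_word w')"
      using w finite_normal_words by (simp add: sum.distrib)
    finally have "(\<Sum>i\<in>normal_words d. nc_const (?c' i) * embed (monom_word i)) \<in> I" using m by (simp only:)
    from indep[OF this w(1)] show False by simp
  qed
  have prod: "list_prod ?B (map (\<lambda>v. ?c (nc_var v)) (map Some w)) = ?c (embed (monom_word w))" for w
    using single_eq_prod[of "NC_Word w" 1] unfolding list_prod_coset
    by (simp add: monom_word_def embed_def nc_subst_single comp_def)
  have carr: "list_prod ?B xs \<in> carrier ?B" if "set xs \<subseteq> range (\<lambda>v. ?c (nc_var v))" for xs
    using that by (induction xs) (auto simp: list_prod_def presented_algebra_simps)
  have "\<not> V.lin_dep ?U"
  proof (rule V.finite_lin_indpt2)
    show "finite ?U" using finite_normal_words by simp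
    show "?U \<subseteq> carrier ?B" by (auto simp: presented_algebra_simps)
    fix a assume "V.lincomb a ?U = \<zero>\<^bsub>?B\<^esub>"
    moreover have "V.lincomb a ?U = (\<Oplus>\<^bsub>?B\<^esub>w\<in>normal_words d. ?c (nc_const (a (?c (embed (monom_word w)))) * embed (monom_word w)))"
      unfolding V.lincomb_def by (subst V.finsum_reindex[OF _ inj]) (auto simp: presented_algebra_simps)
    ultimately have "(\<Sum>w\<in>normal_words d. nc_const (a (?c (embed (monom_word w)))) * embed (monom_word w)) \<in> I"
      using finite_normal_words coset_eq_iff[of "hom_relations fs" _ 0] by (simp add: finsum_coset presented_algebra_simps(4) I_def)
    from indep[OF this] show "\<forall>v\<in>?U. a v = \<zero>\<^bsub>class_ring\<^esub>" by auto
  qed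
  moreover have "?U \<subseteq> {list_prod ?B xs | xs. set xs \<subseteq> range (\<lambda>v. ?c (nc_var v)) \<and> length xs \<le> d}"
  proof
    fix z assume "z \<in> ?U"
    then obtain w where w: "w \<in> normal_words d" "z = list_prod ?B (map (\<lambda>v. ?c (nc_var v)) (map Some w))" using prod by auto
    then have "length w = d" using normal_words(1) by blast
    then show "z \<in> {list_prod ?B xs | xs. set xs \<subseteq> range (\<lambda>v. ?c (nc_var v)) \<and> length xs \<le> d}"
      using w(2) by (intro CollectI exI[of _ "map (\<lambda>v. ?c (nc_var v)) (map Some w)"]) auto
  qed
  ultimately have "card ?U \<le> growth ?B (range (\<lambda>v. ?c (nc_var v))) d"
    by (intro card_le_growth[OF vs _ carr]) auto
  then show ?thesis by (simp add: card_image[OF inj] hilbert_def homogenization_simps)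
qed

theorem hilbert_dichotomy:
  assumes "k_algebra (homogenization fs)" "GKdim (homogenization fs) < \<infinity>"
  shows "hilbert 1 \<le> 1 \<or> (hilbert 1 = 2 \<and> (\<exists>g\<in>R. nc_degree g = 2 \<and> (\<forall>f\<in>R. f \<noteq> g \<longrightarrow> nc_degree f = 1)))"
proof -
  let ?S = "range (\<lambda>v. coset (hom_relations fs) (nc_var v))"
  have "?S \<subseteq> carrier (homogenization fs)" by (auto simp: homogenization_simps presented_algebra_simps)
  then obtain K D where KD: "\<forall>d\<ge>D. real (growth (homogenization fs) ?S d) \<le> real d ^ K"
    using GKdim_growth[OF assms(2), of ?S] by auto
  have growth: "real (hilbert d) \<le> real d ^ K" if "d \<ge> D" for d
    using KD[rule_format, OF that] hilbert_le_growth[OF assms(1), of d] by linarith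
  show ?thesis
    by (rule hilbert_series_dichotomy[OF finite_R R_degree hilbert_0 hilbert_recurrence growth])
qed

subsection \<open>The relations of the dehomogenized algebra\<close>

definition IA where "IA = relation_ideal (set fs)"

lemma ideal_IA: "two_sided_ideal IA" unfolding IA_def by (rule two_sided_ideal_relation_ideal)
lemmas AD = two_sided_idealD[OF ideal_IA]

lemma R_in_IA: "f \<in> R \<Longrightarrow> f \<in> IA" unfolding IA_def using R_subset by (auto intro: relation_ideal_base)

lemma hcomp_above_degree: "d > nc_degree f \<Longrightarrow> hcomp d f = 0"
  by (rule poly_mapping_eqI) (use length_le_nc_degree in_keys_iff in \<open>fastforce simp: lookup_hcomp\<close>)

lemma linear_relation:
  assumes "f \<in> R" "nc_degree f = 1" shows "\<exists>c. top_part f - nc_const c \<in> IA"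
proof -
  have "f = (\<Sum>d<2. hcomp d f)" 
    by (rule sum_hcomp, rule hcomp_above_degree) (use assms in simp)
  then have "f = nc_const (const_coeff f) + top_part f" using assms(2) by (simp add: numeral_2_eq_2 hcomp_0 top_part_def)
  then have "top_part f - nc_const (- const_coeff f) = f" by (simp add: nc_const_uminus) (metis add.commute)
  then have "top_part f - nc_const (- const_coeff f) \<in> IA" using R_in_IA[OF assms(1)] by (simp only:)
  then show ?thesis by (rule exI)
qed

text \<open>\<open>J\<close> contains no scalars, so \<open>J F+\<close> has no component of degree
  one, and the congruence in \<open>R_generate\<close> becomes an equation there.\<close>

lemma J_degree_one:
  assumes j: "j \<in> J" "homogeneous 1 j"
  shows "\<exists>k. j = (\<Sum>f\<in>{f\<in>R. nc_degree f = 1}. nc_const (k f) * top_part f)"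
proof -
  obtain b where b: "j - (\<Sum>f\<in>R. b f * top_part f) \<in> ideal_plus J" using R_generate[OF j(1)] by blast
  define z where "z = hcomp 1 (j - (\<Sum>f\<in>R. b f * top_part f))"
  have z: "z \<in> ideal_plus J" unfolding z_def by (rule hcomp_JP[OF b])
  have "rdiv v z = 0" for v
  proof -
    obtain q where "rdiv v z = hcomp 0 q" unfolding z_def One_nat_def rdiv_hcomp by blast
    then have q: "rdiv v z = nc_const (const_coeff q)" by (simp add: hcomp_0)
    have "const_coeff (rdiv v z) = 0" using z const_coeff_J by (simp add: ideal_plus_def)
    then show ?thesis unfolding q by simp
  qed
  then have "z = 0" using rdiv_expansion[of z] z by (simp add: ideal_plus_def)
  then have "j = (\<Sum>f\<in>R. (if nc_degree f \<le> 1 then hcomp (1 - nc_degree f) (b f) else 0) * top_part f)"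
    using j(2) unfolding z_def hcomp_simps hcomp_combination homogeneous_iff by simp
  also have "\<dots> = (\<Sum>f\<in>{f\<in>R. nc_degree f = 1}. nc_const (const_coeff (b f)) * top_part f)"
  proof (rule sum.mono_neutral_cong_right)
    show "\<forall>i\<in>R - {f \<in> R. nc_degree f = 1}. (if nc_degree i \<le> 1 then hcomp (1 - nc_degree i) (b i) else 0) * top_part i = 0"
    proof
      fix i assume "i \<in> R - {f \<in> R. nc_degree f = 1}"
      then have "nc_degree i > 1" using R_degree[of i] by auto
      then show "(if nc_degree i \<le> 1 then hcomp (1 - nc_degree i) (b i) else 0) * top_part i = 0" by simp
    qed
  qed (simp_all add: finite_R hcomp_0 subset_iff)
  finally show ?thesis by (rule exI[of _ "\<lambda>f. const_coeff (b f)"])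
qed

lemma J_degree_one_const:
  assumes j: "j \<in> J" "homogeneous 1 j" shows "\<exists>c. j - nc_const c \<in> IA"
proof -
  obtain k where k: "j = (\<Sum>f\<in>{f\<in>R. nc_degree f = 1}. nc_const (k f) * top_part f)" using J_degree_one[OF j] by blast
  have "\<forall>f. \<exists>c. f \<in> R \<and> nc_degree f = 1 \<longrightarrow> top_part f - nc_const c \<in> IA" using linear_relation by blast
  then have "\<exists>c. \<forall>f. f \<in> R \<and> nc_degree f = 1 \<longrightarrow> top_part f - nc_const (c f) \<in> IA" by (rule choice)
  then obtain c where c: "\<And>f. f \<in> R \<Longrightarrow> nc_degree f = 1 \<Longrightarrow> top_part f - nc_const (c f) \<in> IA" by blast
  have "(\<Sum>f\<in>{f\<in>R. nc_degree f = 1}. nc_const (k f) * (top_part f - nc_const (c f))) \<in> IA"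
    by (rule two_sided_ideal_sum[OF ideal_IA]) (use c AD(3) in auto)
  also have "(\<Sum>f\<in>{f\<in>R. nc_degree f = 1}. nc_const (k f) * (top_part f - nc_const (c f)))
     = j - nc_const (\<Sum>f\<in>{f\<in>R. nc_degree f = 1}. k f * c f)"
    by (simp add: k right_diff_distrib sum_subtractf nc_const_mult nc_const_sum)
  finally show ?thesis by (rule exI)
qed

lemma linear_case:
  assumes "hilbert 1 \<le> 1"
  obtains y where "\<And>v. \<exists>a c. nc_var v - (nc_const a * y + nc_const c) \<in> IA"
proof -
  have sp: "\<exists>c. nc_var v - (\<Sum>w\<in>normal_words 1. nc_const (c w) * monom_word w) \<in> J" for v
    using normal_words(3)[of 1] homogeneous_var[of v] by (simp add: spans_mod_def)
  have "\<exists>y :: ('v, 'k) nc_poly. homogeneous 1 y \<and> (\<forall>v. \<exists>a. nc_var v - nc_const a * y \<in> J)"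
  proof (cases "normal_words 1 = {}")
    case True
    \<comment> \<open>No variable survives modulo \<open>J\<close>, and \<open>y = 0\<close>
      serves.\<close>
    then show ?thesis using sp by (intro exI[of _ 0]) (simp add: homogeneous_closed)
  next
    case False
    then have "card (normal_words 1) = 1" using assms finite_normal_words[of 1] by (simp add: hilbert_def le_Suc_eq)
    then obtain w where w: "normal_words 1 = {w}" by (auto simp: card_1_singleton_iff)
    then have "length w = 1" using normal_words(1)[of 1] by auto
    moreover have "\<exists>a. nc_var v - nc_const a * monom_word w \<in> J" for v
      using sp[of v] unfolding w by auto
    ultimately show ?thesis using homogeneous_monom_word[of w] by (intro exI[of _ "monom_word w"]) auto
  qed
  then obtain y :: "('v, 'k) nc_poly" where y: "homogeneous 1 y" "\<And>v. \<exists>a. nc_var v - nc_const a * y \<in> J" by blast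
  have "\<exists>a c. nc_var v - (nc_const a * y + nc_const c) \<in> IA" for v
  proof -
    obtain a where a: "nc_var v - nc_const a * y \<in> J" using y(2) by blast
    have "homogeneous 1 (nc_var v - nc_const a * y)"
      using homogeneous_mult[OF homogeneous_const(1) y(1)] by (intro homogeneous_closed) auto
    from J_degree_one_const[OF a this] show ?thesis by (auto simp: algebra_simps intro!: exI[of _ a])
  qed
  then show thesis by (rule that)
qed

end

lemma nc_scale_sum: "nc_scale (sum c S) f = (\<Sum>i\<in>S. nc_scale (c i) f)" "nc_scale d (sum g S) = (\<Sum>i\<in>S. nc_scale d (g i))"
  by (simp_all add: nc_scale_def nc_const_sum sum_distrib_left sum_distrib_right)

context minimal_relations
begin

text \<open>Each variable is a linear form \<open>L v\<close> in the two normal words plus an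
  element \<open>j v\<close> of \<open>J\<close> that is a scalar in \<open>A\<close>. Substitution
  turns the quadratic relation into one in \<open>x\<close> and \<open>y\<close>. If its quadratic
  part were the square of \<open>l\<close>, multiplying by \<open>l\<close> would produce a syzygy
  that freeness and minimality exclude.\<close>

theorem quadratic_case:
  assumes h2: "hilbert 1 = 2" and g: "g \<in> R" "nc_degree g = 2" "\<And>f. f \<in> R \<Longrightarrow> f \<noteq> g \<Longrightarrow> nc_degree f = 1"
  obtains x y :: "('v, 'k) nc_poly" and \<alpha> \<beta> \<gamma> \<delta> l m c where
    "\<And>v. \<exists>a b c. nc_var v - (nc_scale a x + nc_scale b y + nc_const c) \<in> IA"
    "nc_scale \<alpha> (x * x) + nc_scale \<beta> (x * y) + nc_scale \<gamma> (y * x) + nc_scale \<delta> (y * y)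
      + (nc_scale l x + nc_scale m y + nc_const c) \<in> IA"
    "\<not> (\<exists>s t. \<alpha> = s * s \<and> \<beta> = s * t \<and> \<gamma> = t * s \<and> \<delta> = t * t)"
proof -
  define R1 where "R1 = {f\<in>R. nc_degree f = 1}"
  have R1: "R = insert g R1" "g \<notin> R1" "finite R1" using g finite_R by (auto simp: R1_def)
  obtain p q where pq: "normal_words 1 = {p, q}" "p \<noteq> q" using h2 unfolding hilbert_def card_2_iff by blast
  have len: "length p = 1" "length q = 1" using normal_words(1)[of 1] unfolding pq by auto
  define x y :: "('v, 'k) nc_poly" where "x = monom_word p" and "y = monom_word q"
  have hx: "homogeneous 1 x" "homogeneous 1 y" using homogeneous_monom_word[of p] homogeneous_monom_word[of q] len by (simp_all add: x_def y_def)
  have hs: "homogeneous d (nc_scale c f)" if "homogeneous d f" for c d and f :: "('v, 'k) nc_poly"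
    using homogeneous_mult[OF homogeneous_const(1) that] by (simp add: nc_scale_def)
  have cc1: "const_coeff f = 0" if "homogeneous 1 f" for f :: "('v, 'k) nc_poly"
    using that by (simp add: const_coeff_def homogeneous_lookup nc_word_add_letters)
  have "\<exists>a b. nc_var v - (nc_scale a x + nc_scale b y) \<in> J" for v
  proof -
    have "\<exists>c. nc_var v - (\<Sum>w\<in>normal_words 1. nc_const (c w) * monom_word w) \<in> J"
      using normal_words(3)[of 1] homogeneous_var[of v] by (simp add: spans_mod_def)
    then obtain c where "nc_var v - (\<Sum>w\<in>normal_words 1. nc_const (c w) * monom_word w) \<in> J" by blast
    then show ?thesis using pq(2) unfolding pq(1) by (auto simp: x_def y_def nc_scale_def)
  qed
  then obtain a b where ab: "\<And>v. nc_var v - (nc_scale (a v) x + nc_scale (b v) y) \<in> J" by metis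
  define L where "L v = nc_scale (a v) x + nc_scale (b v) y" for v
  define j where "j v = nc_var v - L v" for v
  have jJ: "j v \<in> J" for v using ab by (simp add: j_def L_def)
  have hL: "homogeneous 1 (L v)" for v unfolding L_def by (intro homogeneous_closed hs hx)
  have hj: "homogeneous 1 (j v)" for v unfolding j_def using hL homogeneous_var[of v] by (intro homogeneous_closed) auto
  have var: "nc_var v = L v + j v" for v by (simp add: j_def)
  have "\<exists>k. j v = (\<Sum>f\<in>R1. nc_const (k f) * top_part f)" for v using J_degree_one[OF jJ hj] by (simp add: R1_def)
  then obtain k where k: "\<And>v. j v = (\<Sum>f\<in>R1. nc_const (k v f) * top_part f)" by metis
  obtain cj where cj: "\<And>v. j v - nc_const (cj v) \<in> IA" using J_degree_one_const[OF jJ hj] by metis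
  define G where "G = top_part g"
  have hG: "hcomp 2 G = G" using homogeneous_top_part[of g] by (simp add: G_def g homogeneous_iff)
  have h1G: "hcomp 1 (rdiv v G) = rdiv v G" for v using rdiv_hcomp[of v 1 G] hG by (simp add: numeral_2_eq_2)
  have h0G: "rdiv w (rdiv v G) = nc_const (const_coeff (rdiv w (rdiv v G)))" for v w
    using rdiv_hcomp[of w 0 "rdiv v G"] h1G[of v] by (simp add: hcomp_0)
  \<comment> \<open>The matrix of the quadratic form \<open>G\<close>: \<open>mm v w\<close> is the
    coefficient of the word with letters \<open>w\<close>, \<open>v\<close>, since the last letter
    is stripped first.\<close>
  define mm where "mm v w = const_coeff (rdiv w (rdiv v G))" for v w
  have rG: "rdiv v G = (\<Sum>w\<in>UNIV. nc_scale (mm v w) (nc_var w))" for v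
  proof -
    have "const_coeff (rdiv v G) = 0" by (rule cc1) (simp add: homogeneous_iff h1G del: One_nat_def)
    then have "rdiv v G = (\<Sum>w\<in>UNIV. rdiv w (rdiv v G) * nc_var w)" using rdiv_expansion[of "rdiv v G"] by simp
    also have "\<dots> = (\<Sum>w\<in>UNIV. nc_scale (mm v w) (nc_var w))"
      by (rule sum.cong[OF refl]) (subst h0G, simp add: mm_def nc_scale_def)
    finally show ?thesis .
  qed
  define P where "P v = (\<Sum>w\<in>UNIV. nc_scale (mm v w) (L w))" for v
  define z where "z v = (\<Sum>w\<in>UNIV. nc_scale (mm v w) (j w))" for v
  have rG': "rdiv v G = P v + z v" for v
    unfolding rG P_def z_def by (simp add: var nc_scale_simps sum.distrib)
  have zJ: "z v \<in> J" for v
    unfolding z_def nc_scale_def by (rule two_sided_ideal_sum[OF ideal_J]) (rule JD(3)[OF jJ])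
  have GJ: "G \<in> J" using top_part_in_J[OF g(1)] by (simp add: G_def)
  \<comment> \<open>\<open>Q\<close> is what \<open>G\<close> becomes when the variables are
    replaced by their linear forms; the two error sums have a right factor \<open>j v\<close> and a
    left factor \<open>z v\<close> from \<open>J\<close>.\<close>
  define Q where "Q = (\<Sum>v\<in>UNIV. P v * L v)"
  have "const_coeff G = 0" using g(1) by (simp add: G_def)
  then have "G = (\<Sum>v\<in>UNIV. rdiv v G * nc_var v)" using rdiv_expansion[of G] by simp
  also have "\<dots> = (\<Sum>v\<in>UNIV. P v * L v + P v * j v + z v * nc_var v)"
    unfolding rG' by (rule sum.cong) (simp_all add: distrib_right distrib_left var)
  finally have G: "G = Q + (\<Sum>v\<in>UNIV. P v * j v) + (\<Sum>v\<in>UNIV. z v * nc_var v)"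
    by (simp add: Q_def sum.distrib)
  define A B where "A v = (\<Sum>w\<in>UNIV. mm v w * a w)" and "B v = (\<Sum>w\<in>UNIV. mm v w * b w)" for v
  have P: "P v = nc_scale (A v) x + nc_scale (B v) y" for v
    by (simp add: P_def L_def A_def B_def nc_scale_simps(5,6) sum.distrib nc_scale_sum(1))
  define \<alpha> \<beta> \<gamma> \<delta> where "\<alpha> = (\<Sum>v\<in>UNIV. A v * a v)" and "\<beta> = (\<Sum>v\<in>UNIV. A v * b v)"
    and "\<gamma> = (\<Sum>v\<in>UNIV. B v * a v)" and "\<delta> = (\<Sum>v\<in>UNIV. B v * b v)"
  have Q: "Q = nc_scale \<alpha> (x * x) + nc_scale \<beta> (x * y) + nc_scale \<gamma> (y * x) + nc_scale \<delta> (y * y)"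
    by (simp add: Q_def P L_def \<alpha>_def \<beta>_def \<gamma>_def \<delta>_def nc_scale_sum(1) distrib_left distrib_right nc_scale_simps(3-6) sum.distrib add_ac mult.commute)
  define e where "e v = (\<Sum>w\<in>UNIV. mm v w * cj w)" for v
  define n where "n v = const_coeff (rdiv v (hcomp 1 g))" for v
  have ze: "z v - nc_const (e v) \<in> IA" for v
  proof -
    have "(\<Sum>w\<in>UNIV. nc_const (mm v w) * (j w - nc_const (cj w))) \<in> IA"
      by (rule two_sided_ideal_sum[OF ideal_IA]) (rule AD(3)[OF cj])
    also have "(\<Sum>w\<in>UNIV. nc_const (mm v w) * (j w - nc_const (cj w))) = z v - nc_const (e v)"
      by (simp add: z_def e_def nc_const_sum nc_scale_def right_diff_distrib sum_subtractf nc_const_mult)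
    finally show ?thesis .
  qed
  have g1: "hcomp 1 g = (\<Sum>v\<in>UNIV. nc_const (n v) * nc_var v)"
  proof -
    have r: "rdiv v (hcomp 1 g) = nc_const (n v)" for v
        using rdiv_hcomp[of v 0 g] by (simp add: n_def hcomp_0)
    have c0: "const_coeff (hcomp 1 g) = 0" by (rule cc1) (rule homogeneous_hcomp)
    have "hcomp 1 g = nc_const (const_coeff (hcomp 1 g)) + (\<Sum>v\<in>UNIV. rdiv v (hcomp 1 g) * nc_var v)"
      by (rule rdiv_expansion)
    also have "\<dots> = (\<Sum>v\<in>UNIV. nc_const (n v) * nc_var v)" by (simp only: r c0 nc_const_0 add_0_left)
    finally show ?thesis .
  qed
  have "g = (\<Sum>d<3. hcomp d g)" by (rule sum_hcomp, rule hcomp_above_degree) (use g in simp)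
  then have g_split: "g = nc_const (const_coeff g) + hcomp 1 g + G"
    by (simp add: eval_nat_numeral hcomp_0 G_def top_part_def g(2))
  \<comment> \<open>The affine remainder, in which every \<open>j v\<close> and \<open>z v\<close>
    has been replaced by its scalar \<open>cj v\<close> or \<open>e v\<close> in
    \<open>A\<close>.\<close>
  define E where "E = (\<Sum>v\<in>UNIV. nc_scale (cj v) (P v) + nc_scale (e v) (L v) + nc_const (e v * cj v) + nc_scale (n v) (L v) + nc_const (n v * cj v))"
  have "(\<Sum>v\<in>UNIV. P v * (j v - nc_const (cj v)) + (z v - nc_const (e v)) * nc_var v
      + nc_const (e v) * (j v - nc_const (cj v)) + nc_const (n v) * (j v - nc_const (cj v))) \<in> IA"
    by (rule two_sided_ideal_sum[OF ideal_IA]) (intro AD(2) AD(3)[OF cj] AD(4)[OF ze])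
  also have "(\<Sum>v\<in>UNIV. P v * (j v - nc_const (cj v)) + (z v - nc_const (e v)) * nc_var v
      + nc_const (e v) * (j v - nc_const (cj v)) + nc_const (n v) * (j v - nc_const (cj v)))
    = (\<Sum>v\<in>UNIV. P v * j v + z v * nc_var v + nc_const (n v) * nc_var v
        - (nc_scale (cj v) (P v) + nc_scale (e v) (L v) + nc_const (e v * cj v) + nc_scale (n v) (L v) + nc_const (n v * cj v)))"
    by (rule sum.cong[OF refl]) (simp add: var nc_scale_simps algebra_simps)
  also have "\<dots> = (G - Q) + hcomp 1 g - E"
    unfolding g1 by (simp add: sum_subtractf sum.distrib E_def G add_ac)
  finally have "(G - Q) + hcomp 1 g - E \<in> IA" .
  from AD(6)[OF R_in_IA[OF g(1)] this] have mem: "Q + (E + nc_const (const_coeff g)) \<in> IA"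
    by (subst (asm) g_split) (simp add: algebra_simps)
  have "\<exists>l m c. E + nc_const (const_coeff g) = nc_scale l x + nc_scale m y + nc_const c"
    by (rule exI[of _ "\<Sum>v\<in>UNIV. cj v * A v + e v * a v + n v * a v"], rule exI[of _ "\<Sum>v\<in>UNIV. cj v * B v + e v * b v + n v * b v"],
        rule exI[of _ "(\<Sum>v\<in>UNIV. e v * cj v + n v * cj v) + const_coeff g"])
      (simp add: E_def P L_def nc_scale_sum(1) sum.distrib nc_scale_simps(5,6,13) nc_const_add nc_const_sum add_ac)
  then obtain l m c where lmc: "Q + (nc_scale l x + nc_scale m y + nc_const c) \<in> IA" using mem by auto
  show thesis
  proof (rule that[of x y \<alpha> \<beta> \<gamma> \<delta> l m c])
    show "\<exists>a b c. nc_var v - (nc_scale a x + nc_scale b y + nc_const c) \<in> IA" for v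
      using cj[of v] by (intro exI[of _ "a v"] exI[of _ "b v"] exI[of _ "cj v"]) (simp add: j_def L_def algebra_simps)
    show "nc_scale \<alpha> (x * x) + nc_scale \<beta> (x * y) + nc_scale \<gamma> (y * x) + nc_scale \<delta> (y * y)
      + (nc_scale l x + nc_scale m y + nc_const c) \<in> IA" using lmc by (simp only: Q)
    show "\<not> (\<exists>s t. \<alpha> = s * s \<and> \<beta> = s * t \<and> \<gamma> = t * s \<and> \<delta> = t * t)"
    proof
      assume "\<exists>s t. \<alpha> = s * s \<and> \<beta> = s * t \<and> \<gamma> = t * s \<and> \<delta> = t * t"
      then obtain s t where st: "\<alpha> = s * s" "\<beta> = s * t" "\<gamma> = t * s" "\<delta> = t * t" by blast
      define l where "l = nc_scale s x + nc_scale t y"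
      have Ql: "Q = l * l" by (simp add: Q st l_def nc_scale_simps(3-6) distrib_left distrib_right add_ac mult.commute)
      have l0: "const_coeff l = 0" unfolding l_def by (intro cc1 homogeneous_closed hs hx)
      have zx: "(\<Sum>v\<in>UNIV. r * z v * nc_var v) \<in> ideal_plus J" for r
        by (rule left_ideal_sum[OF left_ideal_plus]) (rule JP(5)[OF JD(3)[OF zJ]], simp)
      have PJ: "(\<Sum>v\<in>UNIV. P v * j v) \<in> J" by (rule two_sided_ideal_sum[OF ideal_J]) (rule JD(3)[OF jJ])
      have "(\<Sum>v\<in>UNIV. z v * nc_var v) \<in> J" by (rule two_sided_ideal_sum[OF ideal_J]) (rule JD(4)[OF zJ])
      from JD(6)[OF JD(6)[OF GJ PJ] this] have ll: "l * l \<in> J" by (simp add: G Ql)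
      have Pk: "(\<Sum>f\<in>R1. (\<Sum>v\<in>UNIV. r * P v * nc_const (k v f)) * top_part f) = (\<Sum>v\<in>UNIV. r * P v * j v)" for r
        unfolding k sum_distrib_left sum_distrib_right by (subst sum.swap) (simp add: mult.assoc)
      \<comment> \<open>With coefficient \<open>r\<close> at \<open>g\<close>, the other
        coefficients are chosen to cancel the sum over \<open>P v * j v\<close>, since each
        \<open>j v\<close> is a combination of top parts of linear relations.\<close>
      have sumR: "(\<Sum>f\<in>R. (if f = g then r else - (\<Sum>v\<in>UNIV. r * P v * nc_const (k v f))) * top_part f)
          = r * l * l + (\<Sum>v\<in>UNIV. r * z v * nc_var v)" for r
      proof -
        have "(\<Sum>f\<in>R. (if f = g then r else - (\<Sum>v\<in>UNIV. r * P v * nc_const (k v f))) * top_part f)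
          = r * G + (\<Sum>f\<in>R1. - (\<Sum>v\<in>UNIV. r * P v * nc_const (k v f)) * top_part f)"
          unfolding R1(1) using R1(2,3) by (simp add: G_def) (rule sum.cong, auto)
        also have "\<dots> = r * G - (\<Sum>v\<in>UNIV. r * P v * j v)"
          unfolding Pk[symmetric] by (simp add: sum_negf)
        also have "\<dots> = r * l * l + (\<Sum>v\<in>UNIV. r * z v * nc_var v)"
          by (subst G) (simp add: Ql distrib_left sum_distrib_left mult.assoc)
        finally show ?thesis .
      qed
      \<comment> \<open>As \<open>l * l\<close> is in \<open>J\<close>, the choice
        \<open>r = l\<close> gives an element of \<open>J F+\<close>, and freeness puts
        \<open>l\<close> into \<open>J\<close>. Then \<open>r = 1\<close> gives one as well, with
        coefficient 1 at \<open>g\<close>, which contradicts minimality.\<close>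
      have "l * l * l + (\<Sum>v\<in>UNIV. l * z v * nc_var v) \<in> ideal_plus J"
        by (rule JP(2)[OF JP(5)[OF ll l0] zx])
      then have "(if g = g then l else - (\<Sum>v\<in>UNIV. l * P v * nc_const (k v g))) \<in> J"
        unfolding sumR[symmetric] by (rule relations_free[OF _ g(1)])
      then have "l \<in> J" by simp
      from JP(5)[OF this l0] have "1 * l * l \<in> ideal_plus J" by simp
      from JP(2)[OF this zx[of 1]] have "const_coeff (if g = g then 1 else - (\<Sum>v\<in>UNIV. 1 * P v * nc_const (k v g))) = 0"
        unfolding sumR[symmetric] by (rule minimal_coeff[OF _ g(1)])
      then show False by simp
    qed
  qed
qed

end

section \<open>Normal forms of quadratic relations\<close>

definition affine_generators :: "('v, 'k :: field) nc_poly set \<Rightarrow> ('v, 'k) nc_poly \<Rightarrow> ('v, 'k) nc_poly \<Rightarrow> bool" where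
  "affine_generators I x y \<longleftrightarrow> (\<forall>v. \<exists>a b c. nc_var v - (nc_scale a x + nc_scale b y + nc_const c) \<in> I)"

lemma affine_generators_change:
  assumes gen: "affine_generators I x y" and x: "x = nc_scale p X + nc_scale q Y + nc_const r"
    and y: "y = nc_scale p' X + nc_scale q' Y + nc_const r'"
  shows "affine_generators I X Y"
  unfolding affine_generators_def
proof
  fix v
  obtain a b c where v: "nc_var v - (nc_scale a x + nc_scale b y + nc_const c) \<in> I"
    using gen unfolding affine_generators_def by blast
  have "nc_scale a x + nc_scale b y + nc_const c
      = nc_scale (a * p + b * p') X + nc_scale (a * q + b * q') Y + nc_const (a * r + b * r' + c)"
    by (simp add: x y nc_scale_simps nc_const_add algebra_simps)
  with v show "\<exists>a b c. nc_var v - (nc_scale a X + nc_scale b Y + nc_const c) \<in> I" by metis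
qed

lemma affine_generators_swap: "affine_generators I x y \<Longrightarrow> affine_generators I y x"
  by (rule affine_generators_change[where p = 0 and q = 1 and r = 0 and p' = 1 and q' = 0 and r' = 0])
    (simp_all add: nc_scale_simps)

text \<open>The first alternative is the relation of quantum planes and quantum Weyl algebras; the
  second includes those of the polynomial ring, the Weyl algebra, the enveloping algebras of the Lie
  algebras of dimension two, and the Jordan plane.\<close>

definition skew_normal_form :: "('v, 'k :: field) nc_poly set \<Rightarrow> bool" where
  "skew_normal_form I \<longleftrightarrow> (\<exists>x y. affine_generators I x y \<and>
    ((\<exists>q c. q \<noteq> 1 \<and> y * x - nc_scale q (x * y) - nc_const c \<in> I) \<or>
     (\<exists>e a b c. y * x - x * y - (nc_scale e (x * x) + nc_scale a x + nc_scale b y + nc_const c) \<in> I)))"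

text \<open>If the coefficients of \<open>x * y\<close> and \<open>y * x\<close> are opposite, the
  second form appears at once with \<open>e = 0\<close>; otherwise a translation of both generators
  absorbs the linear terms. When \<open>y * x\<close> is absent, the generators are
  interchanged.\<close>

lemma normal_form_mixed:
  assumes I: "two_sided_ideal I" and gen: "affine_generators I x y"
    and rel: "nc_scale b (x * y) + nc_scale c (y * x) + nc_scale l x + nc_scale m y + nc_const n \<in> I" and bc: "b \<noteq> 0 \<or> c \<noteq> 0"
  shows "skew_normal_form I"
proof -
  note D = two_sided_idealD[OF I]
  have main: "skew_normal_form I" if gen: "affine_generators I x y"
    and rel: "nc_scale b (x * y) + nc_scale c (y * x) + nc_scale l x + nc_scale m y + nc_const n \<in> I" and c: "c \<noteq> 0"
    for x y b c l m n
  proof (cases "- b / c = 1")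
    case True
    then have "- b = c" using c by (simp add: field_simps)
    then have b: "b = - c" by (metis minus_minus)
    have "nc_const (1 / c) * (nc_scale b (x * y) + nc_scale c (y * x) + nc_scale l x + nc_scale m y + nc_const n) \<in> I" by (rule D(3)[OF rel])
    also have "nc_const (1 / c) * (nc_scale b (x * y) + nc_scale c (y * x) + nc_scale l x + nc_scale m y + nc_const n)
      = y * x - x * y - (nc_scale 0 (x * x) + nc_scale (- l / c) x + nc_scale (- m / c) y + nc_const (- n / c))"
      using c by (simp add: b nc_scale_simps nc_const_uminus)
    finally show ?thesis using gen unfolding skew_normal_form_def by blast
  next
    case False
    define q where "q = - b / c"
    \<comment> \<open>Expanding \<open>(y - t) (x - s) - q (x - s) (y - t)\<close> gives the linear
      terms \<open>- (1 - q) t x - (1 - q) s y\<close>; the two constants are solved from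
      these.\<close>
    define s where "s = - m / c / (1 - q)"
    define t where "t = - l / c / (1 - q)"
    have q: "1 - q \<noteq> 0" using False by (metis q_def right_minus_eq)
    have "nc_const (1 / c) * (nc_scale b (x * y) + nc_scale c (y * x) + nc_scale l x + nc_scale m y + nc_const n) \<in> I" by (rule D(3)[OF rel])
    also have "nc_const (1 / c) * (nc_scale b (x * y) + nc_scale c (y * x) + nc_scale l x + nc_scale m y + nc_const n)
      = y * x - nc_scale q (x * y) - nc_scale ((1 - q) * t) x - nc_scale ((1 - q) * s) y + nc_const (n / c)"
      using c q by (simp add: s_def t_def nc_scale_simps) (simp add: q_def nc_scale_simps)
    also have "\<dots> = (y - nc_const t) * (x - nc_const s) - nc_scale q ((x - nc_const s) * (y - nc_const t))
        - nc_const ((1 - q) * s * t - n / c)"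
      by (simp add: nc_scale_simps nc_const_diff nc_const_add algebra_simps)
    finally have "(y - nc_const t) * (x - nc_const s) - nc_scale q ((x - nc_const s) * (y - nc_const t))
        - nc_const ((1 - q) * s * t - n / c) \<in> I" .
    moreover have "affine_generators I (x - nc_const s) (y - nc_const t)"
      by (rule affine_generators_change[OF gen, where p = 1 and q = 0 and r = s and p' = 0 and q' = 1 and r' = t])
        (simp_all add: nc_scale_simps)
    ultimately show ?thesis using q unfolding skew_normal_form_def by (metis diff_self)
  qed
  show ?thesis
  proof (cases "c = 0")
    case True
    have "nc_scale c (y * x) + nc_scale b (x * y) + nc_scale m y + nc_scale l x + nc_const n \<in> I" using rel by (simp add: add_ac)
    then show ?thesis using main[OF affine_generators_swap[OF gen]] bc True by blast
  qed (use main[OF gen rel] in blast)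
qed

text \<open>The commutative image of the quadratic part is \<alpha> times
  \<open>(x - r y) (x - r' y)\<close>. For distinct roots the two linear factors are new generators
  in which no squares occur. For a double root, \<alpha> times the square of \<open>X\<close> and a
  multiple \<kappa> of a commutator remain, and \<kappa> = 0 would be the excluded square.\<close>

lemma normal_form_square:
  fixes I :: "('v, 'k :: {alg_closed_field, field_char_0}) nc_poly set"
  assumes I: "two_sided_ideal I" and gen: "affine_generators I x y"
    and rel: "nc_scale \<alpha> (x * x) + nc_scale \<beta> (x * y) + nc_scale \<gamma> (y * x) + nc_scale \<delta> (y * y)
      + (nc_scale l x + nc_scale m y + nc_const n) \<in> I"
    and nonsquare: "\<not> (\<exists>s t. \<alpha> = s * s \<and> \<beta> = s * t \<and> \<gamma> = t * s \<and> \<delta> = t * t)" and \<alpha>: "\<alpha> \<noteq> 0"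
  shows "skew_normal_form I"
proof -
  note D = two_sided_idealD[OF I]
  have "\<exists>r. poly [:\<delta>, \<beta> + \<gamma>, \<alpha>:] r = 0" by (rule alg_closed_imp_poly_has_root) (use \<alpha> in simp)
  then obtain r where r: "\<delta> + r * (\<beta> + \<gamma> + r * \<alpha>) = 0" by auto
  define r' where "r' = - (\<beta> + \<gamma>) / \<alpha> - r"
  have sum: "\<beta> + \<gamma> = - \<alpha> * (r + r')" using \<alpha> by (simp add: r'_def field_simps)
  then have \<gamma>: "\<gamma> = - \<alpha> * (r + r') - \<beta>" by (simp add: eq_diff_eq add.commute)
  have prod: "\<delta> = \<alpha> * r * r'"
  proof -
    have "\<alpha> * r * r' = - r * (\<beta> + \<gamma> + r * \<alpha>)" using \<alpha> by (simp add: r'_def field_simps)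
    moreover have "\<delta> = - (r * (\<beta> + \<gamma> + r * \<alpha>))" using r by (simp only: eq_neg_iff_add_eq_0)
    ultimately show ?thesis by simp
  qed
  show ?thesis
  proof (cases "r = r'")
    case False
    define X where "X = x - nc_scale r y"
    define Y where "Y = x - nc_scale r' y"
    \<comment> \<open>The terms \<open>x * x\<close> force the coefficients of \<open>X * Y\<close>
      and \<open>Y * X\<close> to add up to \<alpha>; comparing the terms \<open>x * y\<close> then
      fixes \<open>b\<close>. The constant \<open>p\<close> is found in the same way from the linear
      terms.\<close>
    define b where "b = (\<beta> + r * \<alpha>) / (r - r')"
    define p where "p = - (m + r' * l) / (r - r')"
    have lin: "nc_scale u X + nc_scale w Y = nc_scale (u + w) x + nc_scale (- (r * u + r' * w)) y" for u w
      by (simp add: X_def Y_def nc_scale_simps algebra_simps)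
    have quad: "nc_scale b (X * Y) + nc_scale (\<alpha> - b) (Y * X) = nc_scale \<alpha> (x * x)
       + nc_scale ((r - r') * b - r * \<alpha>) (x * y) + nc_scale (- (r - r') * b - r' * \<alpha>) (y * x) + nc_scale (\<alpha> * r * r') (y * y)"
      by (simp add: X_def Y_def nc_scale_simps algebra_simps)
    have b: "(r - r') * b = \<beta> + r * \<alpha>" using False by (simp add: b_def)
    then have "- (r - r') * b = - (\<beta> + r * \<alpha>)" by (simp only: minus_mult_left[symmetric])
    then have "- (r - r') * b - r' * \<alpha> = \<gamma>" unfolding \<gamma> by (simp add: algebra_simps)
    moreover have "(r - r') * b - r * \<alpha> = \<beta>" by (simp add: b)
    ultimately have quad': "nc_scale b (X * Y) + nc_scale (\<alpha> - b) (Y * X)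
        = nc_scale \<alpha> (x * x) + nc_scale \<beta> (x * y) + nc_scale \<gamma> (y * x) + nc_scale \<delta> (y * y)"
      using quad by (simp only: prod)
    have "- (r * p + r' * (l - p)) = m"
    proof -
      have "(r - r') * p = - (m + r' * l)" using False by (simp add: p_def)
      then show ?thesis by (simp add: algebra_simps)
    qed
    then have lin': "nc_scale p X + nc_scale (l - p) Y = nc_scale l x + nc_scale m y" unfolding lin by simp
    have "nc_scale b (X * Y) + nc_scale (\<alpha> - b) (Y * X) + nc_scale p X + nc_scale (l - p) Y + nc_const n
       = (nc_scale b (X * Y) + nc_scale (\<alpha> - b) (Y * X)) + ((nc_scale p X + nc_scale (l - p) Y) + nc_const n)"
      by (simp only: add.assoc)
    also have "\<dots> \<in> I" unfolding quad' lin' by (rule rel)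
    finally have XY: "nc_scale b (X * Y) + nc_scale (\<alpha> - b) (Y * X) + nc_scale p X + nc_scale (l - p) Y + nc_const n \<in> I" .
    have "affine_generators I X Y"
    proof (rule affine_generators_change[OF gen])
      have key: "- b / d + a / d = 1 \<and> a * (- 1 / d) + b * (1 / d) = - 1" if "d \<noteq> 0" "a = b + d" for a b d :: 'k
        using that by (simp add: field_simps)
      have one: "- r' / (r - r') + r / (r - r') = 1" "r * (- 1 / (r - r')) + r' * (1 / (r - r')) = - 1"
        using key[of "r - r'" r r'] False by simp_all
      have "r * (- r' / (r - r')) + r' * (r / (r - r')) = 0" by (simp add: mult.commute)
      then show "x = nc_scale (- r' / (r - r')) X + nc_scale (r / (r - r')) Y + nc_const 0"
        unfolding lin one(1) by (simp add: nc_scale_simps)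
      show "y = nc_scale (- 1 / (r - r')) X + nc_scale (1 / (r - r')) Y + nc_const 0"
        unfolding lin one(2) by (simp add: nc_scale_simps)
    qed
    from normal_form_mixed[OF I this XY] show ?thesis using \<alpha> by (cases "b = 0") auto
  next
    case True
    define X where "X = x - nc_scale r y"
    define \<kappa> where "\<kappa> = \<beta> + \<alpha> * r"
    have \<gamma>: "\<gamma> = - \<kappa> - \<alpha> * r" unfolding \<gamma> True \<kappa>_def by (simp add: algebra_simps)
    have \<beta>: "\<beta> = \<kappa> - \<alpha> * r" by (simp add: \<kappa>_def)
    have "\<kappa> \<noteq> 0"
    proof
      assume \<kappa>: "\<kappa> = 0"
      \<comment> \<open>A square root of \<alpha>; it exhibits the quadratic part as the square of
        \<open>s x - s r y\<close>.\<close>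
      have "\<exists>s. poly [:- \<alpha>, 0, 1:] s = 0" by (rule alg_closed_imp_poly_has_root) simp
      then obtain s where s: "\<alpha> = s * s" by (auto simp: algebra_simps)
      have "\<beta> = s * (- s * r)" "\<gamma> = (- s * r) * s" "\<delta> = (- s * r) * (- s * r)"
        using \<kappa> \<gamma> prod True s by (simp_all add: \<kappa>_def eq_neg_iff_add_eq_0 mult_ac)
      then show False using nonsquare s by blast
    qed
    have "nc_const (1 / \<kappa>) * (nc_scale \<alpha> (x * x) + nc_scale \<beta> (x * y) + nc_scale \<gamma> (y * x) + nc_scale \<delta> (y * y)
      + (nc_scale l x + nc_scale m y + nc_const n)) \<in> I" by (rule D(3)[OF rel])
    also have "nc_scale \<alpha> (x * x) + nc_scale \<beta> (x * y) + nc_scale \<gamma> (y * x) + nc_scale \<delta> (y * y)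
      + (nc_scale l x + nc_scale m y + nc_const n)
      = nc_scale \<alpha> (X * X) + nc_scale \<kappa> (X * y) - nc_scale \<kappa> (y * X) + nc_scale l X + nc_scale (m + l * r) y + nc_const n"
      unfolding \<beta> \<gamma> prod True[symmetric] by (simp add: X_def nc_scale_simps algebra_simps)
    finally have "nc_const (1 / \<kappa>) * (nc_scale \<alpha> (X * X) + nc_scale \<kappa> (X * y) - nc_scale \<kappa> (y * X) + nc_scale l X + nc_scale (m + l * r) y + nc_const n) \<in> I" .
    from D(5)[OF this] have "y * X - X * y - (nc_scale (\<alpha> / \<kappa>) (X * X) + nc_scale (l / \<kappa>) X + nc_scale ((m + l * r) / \<kappa>) y + nc_const (n / \<kappa>)) \<in> I"
      using \<open>\<kappa> \<noteq> 0\<close> by (simp add: nc_scale_simps(1,5-8,11,12) add_divide_distrib algebra_simps)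
    moreover have "affine_generators I X y"
      by (rule affine_generators_change[OF gen, where p = 1 and q = r and r = 0 and p' = 0 and q' = 1 and r' = 0])
        (simp_all add: X_def nc_scale_simps)
    ultimately show ?thesis unfolding skew_normal_form_def by blast
  qed
qed

lemma normal_form:
  fixes I :: "('v, 'k :: {alg_closed_field, field_char_0}) nc_poly set"
  assumes I: "two_sided_ideal I" and gen: "affine_generators I x y"
    and rel: "nc_scale \<alpha> (x * x) + nc_scale \<beta> (x * y) + nc_scale \<gamma> (y * x) + nc_scale \<delta> (y * y)
      + (nc_scale l x + nc_scale m y + nc_const n) \<in> I"
    and nonsquare: "\<not> (\<exists>s t. \<alpha> = s * s \<and> \<beta> = s * t \<and> \<gamma> = t * s \<and> \<delta> = t * t)"
  shows "skew_normal_form I"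
proof (cases "\<alpha> = 0")
  case False
  then show ?thesis using normal_form_square[OF I gen rel nonsquare] by blast
next
  case \<alpha>: True
  show ?thesis
  proof (cases "\<delta> = 0")
    case True
    have "\<beta> \<noteq> 0 \<or> \<gamma> \<noteq> 0" using nonsquare \<alpha> True by auto
    then show ?thesis using rel \<alpha> True by (intro normal_form_mixed[OF I gen, of \<beta> \<gamma> l m n]) (simp_all add: nc_scale_simps(10) add_ac)
  next
    case False
    have "nc_scale \<delta> (y * y) + nc_scale \<gamma> (y * x) + nc_scale \<beta> (x * y) + nc_scale \<alpha> (x * x)
      + (nc_scale m y + nc_scale l x + nc_const n) \<in> I" using rel by (simp add: add_ac)
    from normal_form_square[OF I affine_generators_swap[OF gen] this] show ?thesis using nonsquare False by (metis mult.commute)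
  qed
qed

section \<open>Simple modules\<close>

text \<open>Horner evaluation at a noncommutative element. The coefficients are central scalars, so
  evaluation at a single element is multiplicative.\<close>

definition pev :: "'k :: field poly \<Rightarrow> ('v, 'k) nc_poly \<Rightarrow> ('v, 'k) nc_poly" where
  "pev p a = fold_coeffs (\<lambda>c r. nc_const c + a * r) p 0"

lemma pev_0 [simp]: "pev 0 a = 0"
  by (simp add: pev_def)

lemma pev_pCons [simp]: "pev (pCons c p) a = nc_const c + a * pev p a"
  by (cases "p = 0 \<and> c = 0") (auto simp: pev_def)

lemma pev_add: "pev (p + q) a = pev p a + pev q a"
proof (induction p arbitrary: q)
  case (pCons c p)
  then show ?case by (cases q) (simp add: nc_const_add distrib_left add_ac)
qed simp

lemma pev_smult: "pev (Polynomial.smult c p) a = nc_scale c (pev p a)"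
  by (induction p) (simp_all add: nc_scale_simps)

lemma pev_mult: "pev (p * q) a = pev p a * pev q a"
  by (induction p) (simp_all add: pev_add pev_smult distrib_right mult.assoc nc_scale_simps)

lemma pev_commute: "a * z = z * a \<Longrightarrow> pev p a * z = z * pev p a"
proof (induction p)
  case (pCons c p)
  have "a * (pev p a * z) = z * (a * pev p a)" using pCons by (metis mult.assoc)
  then show ?case by (simp add: distrib_left distrib_right mult.assoc nc_scale_simps)
qed simp

text \<open>The simple module is \<open>F/L\<close> for a maximal left ideal \<open>L\<close>: a
  vector is a polynomial, and membership in \<open>L\<close> says that it is zero. Finite dimension
  appears as the existence of annihilating polynomials.\<close>

locale simple_quotient =
  fixes L :: "('v, 'k :: {alg_closed_field, field_char_0}) nc_poly set"
  assumes left: "left_ideal L" and proper: "1 \<notin> L"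
    and maximal: "\<And>N. left_ideal N \<Longrightarrow> L \<subseteq> N \<Longrightarrow> N = L \<or> N = UNIV"
    and finite_dim: "\<And>a. \<exists>m :: 'k poly. m \<noteq> 0 \<and> (\<forall>f. pev m a * f \<in> L)"
begin

lemmas LD = left_idealD[OF left]

lemma LD_scale: "f \<in> L \<Longrightarrow> nc_scale c f \<in> L"
  unfolding nc_scale_def by (rule LD(3))

lemma scale_in_L: "nc_scale c f \<in> L \<Longrightarrow> c \<noteq> 0 \<Longrightarrow> f \<in> L"
  using LD_scale[of "nc_scale c f" "1 / c"] by (simp add: nc_scale_simps)

definition ann where "ann = {r. \<forall>f. r * f \<in> L}"

lemma ideal_ann: "two_sided_ideal ann"
  unfolding two_sided_ideal_def ann_def using LD by (auto simp: distrib_right mult.assoc)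

lemmas AnnD = two_sided_idealD[OF ideal_ann]

lemma ann_L: "r \<in> ann \<Longrightarrow> r * f \<in> L" by (simp add: ann_def)

text \<open>Strip linear factors from the annihilating polynomial until the next one kills a nonzero
  vector.\<close>

lemma eigenvector:
  assumes "m \<noteq> 0" "pev m a * f \<in> L" "f \<notin> L"
  shows "\<exists>lam h. h \<notin> L \<and> (a - nc_const lam) * h \<in> L"
  using assms
proof (induction "degree m" arbitrary: m)
  case 0
  then obtain c where c: "m = [:c:]" "c \<noteq> 0" by (metis degree_eq_zeroE pCons_0_0)
  then have "nc_scale c f \<in> L" using 0 by (simp add: nc_scale_simps)
  then show ?case using scale_in_L c(2) 0 by blast
next
  case (Suc n)
  obtain lam where "poly m lam = 0" using alg_closed_imp_poly_has_root[of m] Suc(2) by auto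
  then obtain m' where m': "m = [:- lam, 1:] * m'" by (metis dvdE poly_eq_0_iff_dvd)
  then have m0: "m' \<noteq> 0" using Suc.prems by auto
  have "degree m = Suc (degree m')" unfolding m' using m0 by (subst degree_mult_eq) auto
  then have dm: "n = degree m'" using Suc(2) by simp
  have eq: "pev m a * f = (a - nc_const lam) * (pev m' a * f)"
    unfolding m' pev_mult by (simp add: nc_const_uminus mult.assoc)
  show ?case
  proof (cases "pev m' a * f \<in> L")
    case True
    then show ?thesis using Suc.hyps(1)[OF dm m0] Suc.prems(3) by blast
  next
    case False
    then show ?thesis using Suc.prems(2) eq by metis
  qed
qed

lemma eigenvector_exists: "\<exists>lam h. h \<notin> L \<and> (a - nc_const lam) * h \<in> L"
proof -
  obtain m :: "'k poly" where "m \<noteq> 0" "pev m a * 1 \<in> L" using finite_dim by blast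
  then show ?thesis using eigenvector proper by blast
qed

lemma pev_eigen: "(a - nc_const lam) * h \<in> L \<Longrightarrow> pev p a * h - nc_scale (poly p lam) h \<in> L"
proof (induction p)
  case 0
  then show ?case using LD(1) by (simp add: nc_scale_simps)
next
  case (pCons c p)
  have "a * (pev p a * h - nc_scale (poly p lam) h) + nc_scale (poly p lam) ((a - nc_const lam) * h) \<in> L"
    by (rule LD(2)[OF LD(3)[OF pCons.IH[OF pCons.prems]] LD_scale[OF pCons.prems]])
  then show ?case by (simp add: nc_scale_simps algebra_simps)
qed

lemma finite_eigenvalues: "finite {lam. \<exists>h. h \<notin> L \<and> (a - nc_const lam) * h \<in> L}"
proof -
  obtain m :: "'k poly" where m: "m \<noteq> 0" "\<And>f. pev m a * f \<in> L" using finite_dim by blast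
  have "{lam. \<exists>h. h \<notin> L \<and> (a - nc_const lam) * h \<in> L} \<subseteq> {lam. poly m lam = 0}"
  proof safe
    fix lam h assume h: "h \<notin> L" "(a - nc_const lam) * h \<in> L"
    from LD(5)[OF m(2)[of h] pev_eigen[OF h(2), of m]] have "nc_scale (poly m lam) h \<in> L" by simp
    then show "poly m lam = 0" using scale_in_L h(1) by blast
  qed
  then show ?thesis using poly_roots_finite[OF m(1)] finite_subset by blast
qed

text \<open>Nonzero vectors \<open>h k\<close> would be eigenvectors for infinitely many
  eigenvalues, so the sequence has to pass from nonzero to zero at some step. It is applied to the
  powers of an element that moves eigenvalues.\<close>

lemma eventually_zero:
  assumes h: "\<And>k. (a - nc_const (lam k)) * h k \<in> L" and inj: "inj lam" and h0: "h 0 \<notin> L"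
  obtains k where "h k \<notin> L" "h (Suc k) \<in> L"
proof -
  have "\<exists>k. h k \<in> L"
  proof (rule ccontr)
    assume "\<nexists>k. h k \<in> L"
    then have "range lam \<subseteq> {lam. \<exists>h. h \<notin> L \<and> (a - nc_const lam) * h \<in> L}" using h by blast
    then have "finite (range lam)" using finite_eigenvalues finite_subset by blast
    then show False using inj finite_imageD by blast
  qed
  then obtain n where n: "h n \<in> L" ..
  have "\<exists>k. h k \<notin> L \<and> h (Suc k) \<in> L" using n
  proof (induction n)
    case (Suc n)
    then show ?case by (cases "h n \<in> L") auto
  qed (use h0 in simp)
  then show thesis using that by blast
qed

lemma left_ideal_generatorsI:
  assumes gen: "affine_generators ann x y" and N: "L \<subseteq> N" "\<And>f g. f \<in> N \<Longrightarrow> g \<in> N \<Longrightarrow> f + g \<in> N" "\<And>c f. f \<in> N \<Longrightarrow> nc_scale c f \<in> N"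
    "\<And>f. f \<in> N \<Longrightarrow> x * f \<in> N" "\<And>f. f \<in> N \<Longrightarrow> y * f \<in> N"
  shows "left_ideal N"
proof -
  have "r * f \<in> N" if f: "f \<in> N" for r f
  proof (induction r rule: nc_poly_induct_left)
    case (const c)
    then show ?case using N(3)[OF f] by (simp add: nc_scale_simps)
  next
    case (var r v)
    obtain a b c where abc: "nc_var v - (nc_scale a x + nc_scale b y + nc_const c) \<in> ann" using gen unfolding affine_generators_def by blast
    have "(nc_var v - (nc_scale a x + nc_scale b y + nc_const c)) * (r * f)
      + (nc_scale a (x * (r * f)) + nc_scale b (y * (r * f)) + nc_scale c (r * f)) \<in> N"
      by (intro N(2) N(3) N(4) N(5) subsetD[OF N(1) ann_L[OF abc]] var)
    then show ?case by (simp add: nc_scale_simps algebra_simps)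
  next
    case (add r r')
    then show ?case by (simp add: distrib_right N(2))
  qed
  then show ?thesis using N LD(1) by (auto simp: left_ideal_def)
qed

text \<open>The kernel of \<open>z\<close> on \<open>F/L\<close> is a submodule once
  \<open>x\<close> and \<open>y\<close> preserve it; being nonzero, it is the whole simple
  module.\<close>

lemma kernel_all:
  assumes gen: "affine_generators ann x y" and h: "h \<notin> L" "z * h \<in> L"
    and x: "\<And>f. z * f \<in> L \<Longrightarrow> z * (x * f) \<in> L" and y: "\<And>f. z * f \<in> L \<Longrightarrow> z * (y * f) \<in> L"
  shows "z \<in> ann"
proof -
  let ?N = "{f. z * f \<in> L}"
  have "left_ideal ?N"
    by (rule left_ideal_generatorsI[OF gen]) (auto simp: LD distrib_left nc_scale_simps(4) LD_scale x y)
  moreover have "L \<subseteq> ?N" using LD(3) by blast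
  ultimately have "?N = UNIV" using maximal h by blast
  then show ?thesis by (auto simp: ann_def)
qed

text \<open>Schur's lemma by hand: an eigenspace of \<open>x\<close> or of \<open>y\<close> is
  preserved by both generators and is therefore everything.\<close>

lemma commuting_imp_scalar:
  assumes gen: "affine_generators ann x y" and comm: "y * x - x * y \<in> ann"
  shows "\<exists>c. f - nc_const c \<in> L"
proof -
  have sc: "\<exists>lam. t - nc_const lam \<in> ann" if t: "t * x - x * t \<in> ann" "t * y - y * t \<in> ann" for t
  proof -
    obtain lam h where h: "h \<notin> L" "(t - nc_const lam) * h \<in> L" using eigenvector_exists by blast
    have "(t - nc_const lam) * (s * f) \<in> L" if s: "t * s - s * t \<in> ann" and f: "(t - nc_const lam) * f \<in> L" for s f
    proof -
      have "(t * s - s * t) * f + s * ((t - nc_const lam) * f) \<in> L" by (intro LD(2) LD(3) ann_L s f)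
      then show ?thesis by (simp add: nc_scale_simps algebra_simps)
    qed
    then have "t - nc_const lam \<in> ann" using t by (intro kernel_all[OF gen h]) auto
    then show ?thesis by blast
  qed
  have "x * y - y * x \<in> ann" using AnnD(5)[OF comm] by simp
  then obtain lx where lx: "x - nc_const lx \<in> ann" using sc[of x] AnnD(1) by auto
  obtain ly where ly: "y - nc_const ly \<in> ann" using sc[of y] comm AnnD(1) by auto
  have var: "\<exists>c. nc_var v - nc_const c \<in> ann" for v
  proof -
    obtain a b c where abc: "nc_var v - (nc_scale a x + nc_scale b y + nc_const c) \<in> ann" using gen unfolding affine_generators_def by blast
    have "(nc_var v - (nc_scale a x + nc_scale b y + nc_const c)) + nc_const a * (x - nc_const lx) + nc_const b * (y - nc_const ly) \<in> ann"
      by (intro AnnD(2) AnnD(3) abc lx ly)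
    then show ?thesis by (intro exI[of _ "a * lx + b * ly + c"]) (simp add: nc_scale_simps nc_const_add algebra_simps)
  qed
  have "\<exists>c. f - nc_const c \<in> ann"
  proof (induction f rule: nc_poly_induct)
    case (const c)
    then show ?case using AnnD(1) by (intro exI[of _ c]) simp
  next
    case (var f v)
    then obtain c d where "f - nc_const c \<in> ann" "nc_var v - nc_const d \<in> ann" using \<open>\<And>v. \<exists>c. nc_var v - nc_const c \<in> ann\<close> by blast
    then have "(f - nc_const c) * nc_var v + nc_const c * (nc_var v - nc_const d) \<in> ann" by (intro AnnD(2) AnnD(3) AnnD(4))
    then show ?case by (intro exI[of _ "c * d"]) (simp add: nc_scale_simps algebra_simps)
  next
    case (add f g)
    then obtain c d where "f - nc_const c \<in> ann" "g - nc_const d \<in> ann" by blast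
    from AnnD(2)[OF this] show ?case by (intro exI[of _ "c + d"]) (simp add: nc_const_add algebra_simps)
  qed
  then show ?thesis using ann_L[of _ 1] by auto
qed

lemma minimal_polynomial:
  obtains m :: "'k poly" where "m \<noteq> 0" "pev m a \<in> ann" "\<And>r. pev r a \<in> ann \<Longrightarrow> degree r < degree m \<Longrightarrow> r = 0" "degree m > 0"
proof -
  let ?P = "\<lambda>m :: 'k poly. m \<noteq> 0 \<and> pev m a \<in> ann"
  obtain m0 where m0: "?P m0" using finite_dim by (auto simp: ann_def)
  define m where "m = arg_min degree ?P"
  have m: "?P m" and min: "\<And>r. ?P r \<Longrightarrow> degree m \<le> degree r"
    using arg_min_natI[of ?P m0 degree] arg_min_nat_le[of ?P _ degree] m0 by (auto simp: m_def)
  have "degree m > 0"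
  proof (rule ccontr)
    assume "\<not> degree m > 0"
    then obtain c where c: "m = [:c:]" using degree_eq_zeroE by blast
    then have "nc_scale c 1 \<in> L" using m ann_L[of "pev m a" 1] by (simp add: nc_scale_simps(1)[of c 1, symmetric])
    then show False using scale_in_L proper m c by fastforce
  qed
  moreover have "r = 0" if "pev r a \<in> ann" "degree r < degree m" for r using min[of r] that by (meson leD)
  ultimately show thesis using that m by blast
qed

text \<open>On the module \<open>z\<close> is the commutator, with \<open>z x = q x z\<close> and
  \<open>y z = q z y\<close>. If \<open>q \<noteq> 0\<close> and \<open>z\<close> is injective, its
  powers rescale the eigenvalues of \<open>x\<close>, so an eigenvector \<open>h\<close> of
  \<open>x\<close> has eigenvalue 0. Then the powers of \<open>y\<close> rescale the eigenvalue of
  \<open>z\<close> at \<open>h\<close>, and the last nonzero \<open>y ^ k * h\<close> makes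
  \<open>q\<close> a root of unity. For \<open>q = 0\<close> no rescaling is possible, and direct
  arguments take over.\<close>

lemma quantum_case:
  assumes gen: "affine_generators ann x y" and rho: "y * x - nc_scale q (x * y) - nc_const c \<in> ann"
    and q: "\<And>n. n > 0 \<Longrightarrow> q ^ n \<noteq> 1"
  shows "y * x - x * y \<in> ann"
proof -
  define rho where "rho = y * x - nc_scale q (x * y) - nc_const c"
  define z where "z = nc_scale (q - 1) (x * y) + nc_const c"
  have rA: "rho \<in> ann" using rho by (simp add: rho_def)
  have zx: "z * x - nc_scale q (x * z) = nc_scale (q - 1) (x * rho)"
    and yz: "y * z - nc_scale q (z * y) = nc_scale (q - 1) (rho * y)"
    and comm: "y * x - x * y = rho + z"
    by (simp_all add: rho_def z_def nc_scale_simps algebra_simps)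
  have sA: "nc_scale d r \<in> ann" if "r \<in> ann" for d r using AnnD(3)[OF that] by (simp add: nc_scale_def)
  have zxA: "z * x - nc_scale q (x * z) \<in> ann" unfolding zx by (intro sA AnnD(3) rA)
  have yzA: "y * z - nc_scale q (z * y) \<in> ann" unfolding yz by (intro sA AnnD(4) rA)
  show ?thesis
  proof (cases "q = 0")
    case q0: True
    show ?thesis
    proof (cases "c = 0")
      case True
      have yx: "y * x \<in> ann" using rA by (simp add: rho_def q0 True nc_scale_simps)
      show ?thesis
      proof (cases "\<exists>h. h \<notin> L \<and> y * h \<in> L")
        case True
        then obtain h where h: "h \<notin> L" "y * h \<in> L" by blast
        have "y \<in> ann" by (rule kernel_all[OF gen h]) (use ann_L[OF yx] LD(3) in \<open>auto simp: mult.assoc\<close>)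
        then show ?thesis using yx AnnD(3,6) by blast
      next
        case False
        \<comment> \<open>Here \<open>y\<close> is injective, and it kills \<open>x * y * f\<close>
          because \<open>y * x\<close> acts as zero.\<close>
        have "x * y * f \<in> L" for f
          using False ann_L[OF yx, of "y * f"] by (auto simp: mult.assoc)
        then have "x * y \<in> ann" by (simp add: ann_def)
        then show ?thesis using yx AnnD(6) by blast
      qed
    next
      case c0: False
      have yx: "y * x - nc_const c \<in> ann" using rA by (simp add: rho_def q0 nc_scale_simps)
      \<comment> \<open>As \<open>y * x\<close> acts as a nonzero scalar, \<open>x\<close> is
        injective; so its minimal polynomial has a nonzero constant term, and \<open>y\<close> acts
        as a polynomial in \<open>x\<close>.\<close>
      obtain m :: "'k poly" where m: "m \<noteq> 0" "pev m x \<in> ann" "\<And>r. pev r x \<in> ann \<Longrightarrow> degree r < degree m \<Longrightarrow> r = 0" "degree m > 0"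
        by (rule minimal_polynomial[of x]) (erule that, assumption+)
      obtain m0 m' where m': "m = pCons m0 m'" by (cases m)
      define w where "w = pev m' x"
      have w: "nc_const m0 + x * w \<in> ann" using m(2) by (simp add: m' w_def)
      have "(y * x - nc_const c) * w \<in> ann" by (rule AnnD(4)[OF yx])
      from AnnD(6)[OF AnnD(3)[OF w, of y] this] have yw: "nc_scale m0 y + nc_scale c w \<in> ann"
        by (simp add: nc_scale_simps algebra_simps)
      have "m0 \<noteq> 0"
      proof
        assume "m0 = 0"
        then have "nc_scale c w \<in> ann" using yw by (simp add: nc_scale_simps)
        from sA[OF this, of "1 / c"] have "pev m' x \<in> ann" using c0 by (simp add: nc_scale_simps w_def)
        moreover have m0': "m' \<noteq> 0" using m(1) m' \<open>m0 = 0\<close> by auto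
        moreover have "degree m' < degree m" unfolding m' using m0' by simp
        ultimately show False using m(3)[of m'] by blast
      qed
      have "x * w = w * x" using pev_commute[of x x m'] by (simp add: w_def)
      then have "nc_scale m0 (y * x - x * y) = (nc_scale m0 y + nc_scale c w) * x - x * (nc_scale m0 y + nc_scale c w)"
        by (simp add: nc_scale_simps algebra_simps)
      also have "\<dots> \<in> ann" by (intro AnnD(6) AnnD(4) AnnD(3) yw)
      finally show ?thesis using sA[of "nc_scale m0 (y * x - x * y)" "1 / m0"] \<open>m0 \<noteq> 0\<close> by (simp add: nc_scale_simps)
    qed
  next
    case q0: False
    have "z \<in> ann"
    proof (cases "\<exists>h. h \<notin> L \<and> z * h \<in> L")
      case True
      then obtain h where h: "h \<notin> L" "z * h \<in> L" by blast
      show ?thesis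
      proof (rule kernel_all[OF gen h])
        fix f assume f: "z * f \<in> L"
        have "(z * x - nc_scale q (x * z)) * f + nc_scale q (x * (z * f)) \<in> L"
          by (intro LD(2) ann_L zxA LD_scale LD(3) f)
        then show "z * (x * f) \<in> L" by (simp add: nc_scale_simps algebra_simps)
        have "y * (z * f) - (y * z - nc_scale q (z * y)) * f \<in> L"
          by (intro LD(5) LD(3) f ann_L yzA)
        then have "nc_scale q (z * (y * f)) \<in> L" by (simp add: nc_scale_simps algebra_simps)
        then show "z * (y * f) \<in> L" using scale_in_L q0 by blast
      qed
    next
      case inj: False
      have pw: "inj (\<lambda>k. s / q ^ k)" if "s \<noteq> 0" for s
      proof (rule linorder_injI)
        fix i j :: nat assume "i < j"
        then have "q ^ j = q ^ i * q ^ (j - i)" by (simp add: power_add[symmetric])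
        then show "s / q ^ i \<noteq> s / q ^ j" using q[of "j - i"] \<open>i < j\<close> that q0 by (auto simp: field_simps)
      qed
      obtain lam h where h: "h \<notin> L" "(x - nc_const lam) * h \<in> L" using eigenvector_exists by blast
      have "lam = 0"
      proof (rule ccontr)
        assume "lam \<noteq> 0"
        have "(x - nc_const (lam / q ^ k)) * (z ^ k * h) \<in> L" for k
        proof (induction k)
          case (Suc k)
          have "nc_scale (1 / q) (z * ((x - nc_const (lam / q ^ k)) * (z ^ k * h)) - (z * x - nc_scale q (x * z)) * (z ^ k * h)) \<in> L"
            by (intro LD_scale LD(5) LD(3) Suc ann_L zxA)
          then show ?case using q0 by (simp add: nc_scale_simps algebra_simps)
        qed (use h in simp)
        from eventually_zero[of x "\<lambda>k. lam / q ^ k" "\<lambda>k. z ^ k * h", OF this pw[OF \<open>lam \<noteq> 0\<close>]] h(1)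
        obtain k where "z ^ k * h \<notin> L" "z ^ Suc k * h \<in> L" by auto
        then show False using inj by (auto simp: mult.assoc)
      qed
      then have xh: "x * h \<in> L" using h(2) by simp
      \<comment> \<open>From \<open>x h = 0\<close> follows \<open>q x y h = - c h\<close>, hence
        \<open>z h = (c / q) h\<close>; every further factor \<open>y\<close> divides the eigenvalue
        by \<open>q\<close>.\<close>
      have ev: "(z - nc_const (c / q / q ^ k)) * (y ^ k * h) \<in> L" for k
      proof (induction k)
        case 0
        have "y * (x * h) - rho * h \<in> L" by (intro LD(5) LD(3) xh ann_L rA)
        then have 1: "nc_scale q (x * (y * h)) + nc_scale c h \<in> L" by (simp add: rho_def nc_scale_simps algebra_simps)
        have "nc_scale ((q - 1) / q) (nc_scale q (x * (y * h)) + nc_scale c h) \<in> L" by (rule LD_scale[OF 1])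
        moreover have "nc_scale ((q - 1) / q) (nc_scale q (x * (y * h)) + nc_scale c h) = (z - nc_const (c / q)) * h"
          using q0 by (simp add: z_def nc_scale_simps algebra_simps diff_divide_distrib)
        ultimately show ?case by simp
      next
        case (Suc k)
        have "nc_scale (1 / q) (y * ((z - nc_const (c / q / q ^ k)) * (y ^ k * h)) - (y * z - nc_scale q (z * y)) * (y ^ k * h)) \<in> L"
          by (intro LD_scale LD(5) LD(3) Suc ann_L yzA)
        then show ?case using q0 by (simp add: nc_scale_simps algebra_simps)
      qed
      have "c \<noteq> 0"
      proof
        assume "c = 0"
        then have "z * h \<in> L" using ev[of 0] by simp
        then show False using inj h(1) by blast
      qed
      then have "c / q \<noteq> 0" using q0 by simp
      from eventually_zero[of z "\<lambda>k. c / q / q ^ k" "\<lambda>k. y ^ k * h", OF ev pw[OF this]] h(1)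
      obtain k where k: "y ^ k * h \<notin> L" "y ^ Suc k * h \<in> L" by auto
      define u where "u = y ^ k * h"
      have yu: "y * u \<in> L" and u: "u \<notin> L" using k by (simp_all add: u_def mult.assoc)
      have ev': "(z - nc_const (c / q / q ^ k)) * u \<in> L" using ev[of k] by (simp add: u_def)
      \<comment> \<open>Since \<open>y * u\<close> is zero, the definition of \<open>z\<close> gives
        the eigenvalue \<open>c\<close> at \<open>u\<close>, to be compared with the one from
        \<open>ev\<close>.\<close>
      have "(z - nc_const (c / q / q ^ k)) * u - nc_scale (q - 1) (x * (y * u)) \<in> L"
        by (rule LD(5)[OF ev' LD_scale[OF LD(3)[OF yu]]])
      then have "nc_scale (c - c / q / q ^ k) u \<in> L" by (simp add: z_def nc_scale_simps algebra_simps)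
      then have "c = c / q / q ^ k" using scale_in_L u by fastforce
      then have "q ^ Suc k = 1" using \<open>c \<noteq> 0\<close> q0 by (simp add: field_simps)
      then show ?thesis using q[of "Suc k"] by simp
    qed
    then show ?thesis unfolding comm using rA AnnD(2) by blast
  qed
qed

text \<open>Let \<open>z\<close> be the commutator. If \<open>b \<noteq> 0\<close>, then
  \<open>z x = (x + b) z\<close>, so \<open>z\<close> shifts the eigenvalues of \<open>x\<close> by
  \<open>b\<close> and must have a kernel. If \<open>b = 0\<close>, then \<open>z = p(x)\<close>,
  and the commutator with \<open>y\<close> acts on polynomials in \<open>x\<close> as the derivation
  \<open>p d/dx\<close>; a root of the minimal polynomial of \<open>x\<close> turns out to be a root
  of \<open>p\<close>, which again yields a kernel.\<close>

lemma differential_case: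
  assumes gen: "affine_generators ann x y"
    and rho: "y * x - x * y - (nc_scale e (x * x) + nc_scale a x + nc_scale b y + nc_const c) \<in> ann"
  shows "y * x - x * y \<in> ann"
proof -
  define z where "z = nc_scale e (x * x) + nc_scale a x + nc_scale b y + nc_const c"
  define rho where "rho = y * x - x * y - z"
  have rA: "rho \<in> ann" using rho by (simp add: rho_def z_def)
  have "z \<in> ann"
  proof (cases "b = 0")
    case b0: False
    have zx: "z * x - x * z - nc_scale b z = nc_scale b rho"
      by (simp add: rho_def z_def nc_scale_simps algebra_simps)
    have zxA: "z * x - x * z - nc_scale b z \<in> ann"
      unfolding zx using AnnD(3)[OF rA] by (simp add: nc_scale_def)
    obtain lam h where h: "h \<notin> L" "(x - nc_const lam) * h \<in> L" using eigenvector_exists by blast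
    have ev: "(x - nc_const (lam - of_nat k * b)) * (z ^ k * h) \<in> L" for k
    proof (induction k)
      case (Suc k)
      have "z * ((x - nc_const (lam - of_nat k * b)) * (z ^ k * h)) - (z * x - x * z - nc_scale b z) * (z ^ k * h) \<in> L"
        by (intro LD(5) LD(3) Suc ann_L zxA)
      then show ?case by (simp add: nc_scale_simps nc_const_diff nc_const_add algebra_simps)
    qed (use h in simp)
    have inj: "inj (\<lambda>k. lam - of_nat k * b)" using b0 by (auto simp: inj_def)
    from eventually_zero[of x "\<lambda>k. lam - of_nat k * b" "\<lambda>k. z ^ k * h", OF ev inj] h(1)
    obtain k where k: "z ^ k * h \<notin> L" "z ^ Suc k * h \<in> L" by auto
    have xcl: "z * (x * f) \<in> L" if f: "z * f \<in> L" for f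
    proof -
      have "(z * x - x * z - nc_scale b z) * f + x * (z * f) + nc_scale b (z * f) \<in> L"
        by (intro LD(2) ann_L zxA LD(3) LD_scale f)
      then show ?thesis by (simp add: nc_scale_simps algebra_simps)
    qed
    show ?thesis
    proof (rule kernel_all[OF gen k(1)])
      show "z * (z ^ k * h) \<in> L" using k(2) by (simp add: mult.assoc)
      fix f assume f: "z * f \<in> L"
      then show "z * (x * f) \<in> L" by (rule xcl)
      \<comment> \<open>Since \<open>b \<noteq> 0\<close>, \<open>y\<close> is a combination of
        \<open>z\<close>, \<open>x * x\<close>, \<open>x\<close> and 1, all of which preserve the
        kernel of \<open>z\<close>.\<close>
      have "z * (z * f) - (nc_scale e (z * (x * (x * f))) + nc_scale a (z * (x * f)) + nc_scale c (z * f)) \<in> L"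
        by (intro LD(5) LD(2) LD(3) LD_scale xcl f)
      also have "z * (z * f) - (nc_scale e (z * (x * (x * f))) + nc_scale a (z * (x * f)) + nc_scale c (z * f)) = nc_scale b (z * (y * f))"
        by (subst (2) z_def) (simp add: nc_scale_simps algebra_simps)
      finally show "z * (y * f) \<in> L" using scale_in_L b0 by blast
    qed
  next
    case b0: True
    define p where "p = [:c, a, e:]"
    have zp: "z = pev p x" by (simp add: z_def p_def b0 nc_scale_simps algebra_simps)
    have xz: "x * z = z * x" using pev_commute[of x x p] by (simp add: zp)
    have deriv: "y * pev m x - pev m x * y - pev (pderiv m) x * z \<in> ann" for m
    proof (induction m)
      case 0
      then show ?case using AnnD(1) by simp
    next
      case (pCons d m)
      have wz: "pev m x * z = z * pev m x" by (rule pev_commute[OF xz])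
      have "rho * pev m x + x * (y * pev m x - pev m x * y - pev (pderiv m) x * z) \<in> ann"
        by (intro AnnD(2) AnnD(3) AnnD(4) rA pCons)
      moreover have "rho * pev m x + x * (y * pev m x - pev m x * y - pev (pderiv m) x * z)
        = y * pev (pCons d m) x - pev (pCons d m) x * y - pev (pderiv (pCons d m)) x * z"
        unfolding pderiv_pCons by (simp add: rho_def pev_add wz nc_scale_simps algebra_simps)
      ultimately show ?case by simp
    qed
    show ?thesis
    proof (cases "p = 0")
      case True
      then show ?thesis by (simp add: zp AnnD(1))
    next
      case p0: False
      obtain m :: "'k poly" where m: "m \<noteq> 0" "pev m x \<in> ann" "\<And>r. pev r x \<in> ann \<Longrightarrow> degree r < degree m \<Longrightarrow> r = 0" "degree m > 0"
        by (rule minimal_polynomial[of x]) (erule that, assumption+)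
      define D where "D = pderiv m * p"
      have "(y * pev m x - pev m x * y) - (y * pev m x - pev m x * y - pev (pderiv m) x * z) \<in> ann"
        by (intro AnnD(6) AnnD(3) AnnD(4) m(2) deriv)
      then have DA: "pev D x \<in> ann" by (simp add: D_def pev_mult zp)
      have "pev (D mod m) x \<in> ann"
      proof -
        have "pev D x = pev (D div m) x * pev m x + pev (D mod m) x"
          by (metis div_mult_mod_eq pev_add pev_mult)
        then have "pev (D mod m) x = pev D x - pev (D div m) x * pev m x" by simp
        then show ?thesis using AnnD(6)[OF DA AnnD(3)[OF m(2)]] by simp
      qed
      then have "D mod m = 0" using m(3)[of "D mod m"] degree_mod_less[OF m(1), of D] by blast
      then have mD: "m dvd D" by (simp add: mod_eq_0_iff_dvd)
      \<comment> \<open>\<open>m\<close> divides \<open>pderiv m * p\<close>. In characteristic zero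
        the order of \<open>pderiv m\<close> at a root of \<open>m\<close> is one too small, so
        \<open>p\<close> must contribute a zero there.\<close>
      obtain lam where lam: "poly m lam = 0" using alg_closed_imp_poly_has_root[of m] m(4) by auto
      have pd: "pderiv m \<noteq> 0" using m(4) by (simp add: pderiv_eq_0_iff)
      then have D0: "D \<noteq> 0" using p0 by (simp add: D_def)
      have "order lam m \<noteq> 0" using lam m(1) by (simp add: order_root)
      have "order lam m = Suc (order lam (pderiv m))" using m(1) lam by (rule order_pderiv)
      moreover have "order lam m \<le> order lam D" using mD D0 by (rule dvd_imp_order_le[rotated])
      moreover have "order lam D = order lam (pderiv m) + order lam p" using D0 unfolding D_def by (rule order_mult)
      ultimately have "order lam p \<noteq> 0" by simp
      then have plam: "poly p lam = 0" using order_root by blast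
      \<comment> \<open>By minimality \<open>pev m' x\<close> does not act as zero, and
        \<open>x - lam\<close> kills its image; this provides the eigenvector.\<close>
      obtain m' where m': "m = [:- lam, 1:] * m'" using lam by (metis dvdE poly_eq_0_iff_dvd)
      then have "m' \<noteq> 0" using m(1) by auto
      then have "degree m = Suc (degree m')" unfolding m' by (subst degree_mult_eq) auto
      then have "pev m' x \<notin> ann" using m(3)[of m'] \<open>m' \<noteq> 0\<close> by auto
      then obtain f where f: "pev m' x * f \<notin> L" by (auto simp: ann_def)
      have "pev m x * f \<in> L" by (rule ann_L[OF m(2)])
      then have "(x - nc_const lam) * (pev m' x * f) \<in> L"
        unfolding m' pev_mult by (simp add: nc_const_uminus mult.assoc)
      from pev_eigen[OF this, of p] have zf: "z * (pev m' x * f) \<in> L" by (simp add: plam zp nc_scale_simps)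
      show ?thesis
      proof (rule kernel_all[OF gen f zf])
        fix h assume h: "z * h \<in> L"
        have "x * (z * h) \<in> L" by (rule LD(3)[OF h])
        then show "z * (x * h) \<in> L" using xz by (metis mult.assoc)
        have "y * (z * h) - ((y * pev p x - pev p x * y - pev (pderiv p) x * z) * h + pev (pderiv p) x * (z * h)) \<in> L"
          by (intro LD(5) LD(2) LD(3) h ann_L deriv)
        then show "z * (y * h) \<in> L" by (simp add: zp algebra_simps)
      qed
    qed
  qed
  then have "rho + z \<in> ann" using rA AnnD(2) by blast
  then show ?thesis by (simp add: rho_def)
qed

end

section \<open>The standard identity\<close>

text \<open>Multilinear and alternating in its arguments, hence an identity of every algebra spanned
  over its centre by fewer than \<open>n\<close> elements.\<close>

definition standard_poly :: "nat \<Rightarrow> (nat, 'k :: field) nc_poly" where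
  "standard_poly n = (\<Sum>p | p permutes {..<n}. Poly_Mapping.single (NC_Word (map p [0..<n])) (of_int (sign p)))"

lemma standard_poly_nonzero: "standard_poly n \<noteq> (0 :: (nat, 'k :: field) nc_poly)"
proof -
  have "p = id" if "p permutes {..<n}" "map p [0..<n] = [0..<n]" for p
  proof
    fix i
    show "p i = id i"
    proof (cases "i < n")
      case True
      then show ?thesis using arg_cong[OF that(2), of "\<lambda>xs. xs ! i"] by simp
    next
      case False
      then show ?thesis using that(1) by (simp add: permutes_def)
    qed
  qed
  then have "Poly_Mapping.lookup (standard_poly n) (NC_Word [0..<n]) = (\<Sum>p | p permutes {..<n}. if p = id then 1 else (0 :: 'k))"
    unfolding standard_poly_def lookup_sum lookup_single by (intro sum.cong) (auto simp: when_def)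
  also have "\<dots> = 1" by (simp add: finite_permutations)
  finally show ?thesis by auto
qed

lemma nc_subst_standard_poly:
  "nc_subst f (standard_poly n) = (\<Sum>p | p permutes {..<n}. nc_const (of_int (sign p)) * prod_list (map (\<lambda>i. f (p i)) [0..<n]))"
  by (simp add: standard_poly_def nc_subst_single comp_def)

text \<open>Composition with the transposition of \<open>i\<close> and \<open>j\<close> permutes the
  summands and reverses their signs, so the value is its own negative; 2 is invertible.\<close>

lemma standard_poly_alternating:
  fixes f :: "nat \<Rightarrow> ('v, 'k :: field_char_0) nc_poly"
  assumes ij: "i < n" "j < n" "i \<noteq> j" "f i = f j"
  shows "nc_subst f (standard_poly n) = 0"
proof -
  let ?t = "\<lambda>p. nc_const (of_int (sign p)) * prod_list (map (\<lambda>i. f (p i)) [0..<n])"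
  let ?S = "\<Sum>p | p permutes {..<n}. ?t p"
  have tr: "Transposition.transpose i j permutes {..<n}" using ij by (intro permutes_swap_id) auto
  have "?t (Transposition.transpose i j \<circ> p) = - ?t p" if "p permutes {..<n}" for p
  proof -
    have "sign (Transposition.transpose i j \<circ> p) = - sign p"
      using that tr ij(3) by (subst sign_compose) (auto simp: sign_swap_id permutation_permutes)
    moreover have "f ((Transposition.transpose i j \<circ> p) k) = f (p k)" for k using ij(4) by (auto simp: Transposition.transpose_def)
    ultimately show ?thesis by (simp add: nc_const_uminus)
  qed
  then have "?S = - ?S" by (subst setum_permutations_compose_left[OF tr]) (simp add: sum_negf)
  then have "nc_const 2 * ?S = 0" by (simp add: nc_const_numeral mult_2 eq_neg_iff_add_eq_0)
  then have "nc_const (1 / 2) * (nc_const 2 * ?S) = 0" by simp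
  then have "?S = 0" by (simp only: mult.assoc[symmetric] nc_const_mult[symmetric]) simp
  then show ?thesis by (simp only: nc_subst_standard_poly)
qed

text \<open>The submodule of \<open>F/I\<close> generated by \<open>B\<close> over the centre, as a
  set of representatives; its induction rule matches the reduction of one argument in
  \<open>standard_identity\<close>.\<close>

inductive_set central_span :: "('v, 'k :: field) nc_poly set \<Rightarrow> ('v, 'k) nc_poly set \<Rightarrow> ('v, 'k) nc_poly set"
  for I B where
  base: "b \<in> B \<Longrightarrow> b \<in> central_span I B"
| ideal: "f \<in> I \<Longrightarrow> f \<in> central_span I B"
| add: "f \<in> central_span I B \<Longrightarrow> g \<in> central_span I B \<Longrightarrow> f + g \<in> central_span I B"
| scale: "(\<And>h. z * h - h * z \<in> I) \<Longrightarrow> f \<in> central_span I B \<Longrightarrow> z * f \<in> central_span I B"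

text \<open>The argument \<open>k\<close> occurs exactly once in each summand, which thus has the
  form \<open>a * g * b\<close> with \<open>a\<close> and \<open>b\<close> independent of
  \<open>g\<close>. A central factor of \<open>g\<close> moves to the front modulo
  \<open>I\<close>.\<close>

lemma standard_poly_slot:
  assumes I: "two_sided_ideal I" and k: "k < n"
  shows "g \<in> I \<Longrightarrow> nc_subst (f(k := g)) (standard_poly n) \<in> I"
    and "nc_subst (f(k := g)) (standard_poly n) \<in> I \<Longrightarrow> nc_subst (f(k := h)) (standard_poly n) \<in> I
      \<Longrightarrow> nc_subst (f(k := g + h)) (standard_poly n) \<in> I"
    and "(\<And>h. z * h - h * z \<in> I) \<Longrightarrow> nc_subst (f(k := g)) (standard_poly n) \<in> I
      \<Longrightarrow> nc_subst (f(k := z * g)) (standard_poly n) \<in> I"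
proof -
  note D = two_sided_idealD[OF I]
  have slot: "\<exists>a b. \<forall>g. prod_list (map (\<lambda>i. (f(k := g)) (p i)) [0..<n]) = a * g * b" if p: "p permutes {..<n}" for p
  proof -
    have "k \<in> set (map p [0..<n])" using permutes_image[OF p] k by (auto simp: atLeast0LessThan)
    then obtain us ws where s: "map p [0..<n] = us @ k # ws" by (meson split_list)
    have "inj_on p {0..<n}" using permutes_inj_on[OF p] .
    then have "distinct (map p [0..<n])" by (simp add: distinct_map)
    then have nk: "k \<notin> set us" "k \<notin> set ws" unfolding s by auto
    show ?thesis
    proof (intro exI allI)
      fix g
      have "map (\<lambda>i. (f(k := g)) (p i)) [0..<n] = map (f(k := g)) (map p [0..<n])" by simp
      also have "\<dots> = map f us @ g # map f ws" unfolding s using nk by (auto intro!: map_cong)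
      finally show "prod_list (map (\<lambda>i. (f(k := g)) (p i)) [0..<n]) = prod_list (map f us) * g * prod_list (map f ws)"
        by (simp add: mult.assoc)
    qed
  qed
  then obtain a b where ab: "\<And>p g. p permutes {..<n} \<Longrightarrow> prod_list (map (\<lambda>i. (f(k := g)) (p i)) [0..<n]) = a p * g * b p"
    by metis
  define s where "s g = (\<Sum>p | p permutes {..<n}. nc_const (of_int (sign p)) * (a p * g * b p))" for g
  have s: "nc_subst (f(k := g)) (standard_poly n) = s g" for g
    unfolding nc_subst_standard_poly s_def by (rule sum.cong) (simp_all only: ab mem_Collect_eq)
  show "g \<in> I \<Longrightarrow> nc_subst (f(k := g)) (standard_poly n) \<in> I"
    unfolding s s_def by (intro two_sided_ideal_sum[OF I] D(3) D(4))
  show "nc_subst (f(k := g)) (standard_poly n) \<in> I \<Longrightarrow> nc_subst (f(k := h)) (standard_poly n) \<in> I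
      \<Longrightarrow> nc_subst (f(k := g + h)) (standard_poly n) \<in> I"
    using D(2)[of "s g" "s h"] unfolding s by (simp add: s_def distrib_left distrib_right sum.distrib)
  have expand: "z * (nc_const c * (u * g * w)) - nc_const c * ((z * u - u * z) * g * w) = nc_const c * (u * (z * g) * w)" for c u w
    by (simp add: nc_scale_simps left_diff_distrib mult.assoc)
  assume z: "\<And>h. z * h - h * z \<in> I" and g: "nc_subst (f(k := g)) (standard_poly n) \<in> I"
  have 1: "(\<Sum>p | p permutes {..<n}. nc_const (of_int (sign p)) * ((z * a p - a p * z) * g * b p)) \<in> I" (is "?d \<in> I")
    by (intro two_sided_ideal_sum[OF I] D(3) D(4) z)
  have 2: "z * s g \<in> I" using g unfolding s by (rule D(3))
  have "z * s g - ?d = s (z * g)"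
    unfolding s_def sum_distrib_left sum_subtractf[symmetric] by (rule sum.cong[OF refl]) (rule expand)
  with D(6)[OF 2 1] show "nc_subst (f(k := z * g)) (standard_poly n) \<in> I" by (simp only: s)
qed

text \<open>By linearity modulo \<open>I\<close> the arguments can be moved into \<open>B\<close>
  one at a time; as there is one argument more than \<open>B\<close> has elements, two of them then
  coincide.\<close>

lemma standard_identity:
  fixes f :: "nat \<Rightarrow> ('v, 'k :: field_char_0) nc_poly"
  assumes I: "two_sided_ideal I" and B: "finite B" and span: "central_span I B = UNIV"
  shows "nc_subst f (standard_poly (Suc (card B))) \<in> I"
proof -
  let ?n = "Suc (card B)"
  \<comment> \<open>\<open>k\<close> is the number of leading arguments that are still
    arbitrary.\<close>
  have key: "nc_subst f (standard_poly ?n) \<in> I" if "k \<le> ?n" "\<And>i. k \<le> i \<Longrightarrow> i < ?n \<Longrightarrow> f i \<in> B" for k f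
    using that
  proof (induction k arbitrary: f)
    case 0
    then have "f ` {..<?n} \<subseteq> B" by auto
    then have "card (f ` {..<?n}) < card {..<?n}" using card_mono[OF B, of "f ` {..<?n}"] by simp
    then have "\<not> inj_on f {..<?n}" by (rule pigeonhole)
    then obtain i j where "i < ?n" "j < ?n" "i \<noteq> j" "f i = f j" by (auto simp: inj_on_def)
    then have "nc_subst f (standard_poly ?n) = 0" by (rule standard_poly_alternating)
    then show ?case by (simp add: two_sided_idealD(1)[OF I])
  next
    case (Suc k)
    then have k: "k < ?n" by simp
    have "f k \<in> central_span I B" using span by simp
    then have "nc_subst (f(k := f k)) (standard_poly ?n) \<in> I"
    proof induction
      case (base b)
      show ?case
      proof (rule Suc.IH)
        show "k \<le> ?n" using k by simp
        show "(f(k := b)) i \<in> B" if "k \<le> i" "i < ?n" for i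
          using that base Suc.prems(2)[of i] by (cases "i = k") auto
      qed
    next
      case (ideal g)
      then show ?case by (rule standard_poly_slot(1)[OF I k])
    next
      case (add g h)
      show ?case by (rule standard_poly_slot(2)[OF I k add.IH])
    next
      case (scale z g)
      show ?case by (rule standard_poly_slot(3)[OF I k scale.hyps(1) scale.IH])
    qed
    then show ?case by simp
  qed
  show ?thesis by (rule key[of ?n]) simp_all
qed

lemma PI_presented_algebra:
  fixes Rel :: "('v, 'k :: field_char_0) nc_poly set"
  assumes "finite B" "central_span (relation_ideal Rel) B = UNIV"
  shows "PI_algebra (presented_algebra Rel)"
  unfolding PI_algebra_def
proof (intro exI[of _ "standard_poly (Suc (card B))"] conjI allI impI standard_poly_nonzero)
  fix a :: "nat \<Rightarrow> ('v, 'k) nc_poly set"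
  let ?s = "standard_poly (Suc (card B)) :: (nat, 'k) nc_poly"
  assume "range a \<subseteq> carrier (presented_algebra Rel)"
  then have "\<forall>i. \<exists>g. a i = coset Rel g" by (auto simp: presented_algebra_simps(1))
  then obtain g where g: "\<forall>i. a i = coset Rel (g i)" by (rule choice[THEN exE])
  then have a: "a = (\<lambda>i. coset Rel (g i))" by auto
  have "nc_eval (presented_algebra Rel) a ?s = coset Rel (nc_subst g ?s)"
    unfolding nc_eval_def a list_prod_coset nc_subst_def by (simp add: presented_algebra_simps finsum_coset)
  also have "\<dots> = coset Rel 0"
    using standard_identity[OF two_sided_ideal_relation_ideal assms, of g] by (simp add: coset_eq_iff)
  finally show "nc_eval (presented_algebra Rel) a ?s = \<zero>\<^bsub>presented_algebra Rel\<^esub>"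
    by (simp add: presented_algebra_simps)
qed

section \<open>Quantum planes and Weyl algebras at roots of unity\<close>

text \<open>Moving \<open>y\<close> past \<open>x ^ k\<close> produces the factor
  \<open>q ^ k\<close> and an error with the q-integer \<open>1 + q + ... + q ^ (k - 1)\<close>. At
  \<open>k = l\<close> these are 1 and 0, so the powers \<open>x ^ l\<close> and
  \<open>y ^ l\<close> are central modulo \<open>I\<close>, and the monomials with smaller exponents
  span.\<close>

lemma root_of_unity_span:
  fixes x y :: "('v, 'k :: field) nc_poly"
  assumes I: "two_sided_ideal I"
    and gen: "affine_generators I x y"
    and rel: "y * x - nc_scale q (x * y) - nc_const c \<in> I" and q: "q \<noteq> 1" "q ^ l = 1" "l > 0"
  shows "\<exists>B. finite B \<and> central_span I B = UNIV"
proof -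
  note D = two_sided_idealD[OF I]
  have one: "nc_scale d 1 = (nc_const d :: ('v, 'k) nc_poly)" for d by (simp add: nc_scale_def)
  have xk: "x ^ k * (x * t) = x * (x ^ k * t)" for k t by (simp add: mult.assoc[symmetric] power_commutes)
  have comm_x: "y * x ^ Suc k - (nc_scale (q ^ Suc k) (x ^ Suc k * y) + nc_scale (c * (\<Sum>i<Suc k. q ^ i)) (x ^ k)) \<in> I" for k
  proof (induction k)
    case (Suc k)
    have "(y * x ^ Suc k - (nc_scale (q ^ Suc k) (x ^ Suc k * y) + nc_scale (c * (\<Sum>i<Suc k. q ^ i)) (x ^ k))) * x
      + nc_const (q ^ Suc k) * (x ^ Suc k * (y * x - nc_scale q (x * y) - nc_const c)) \<in> I"
      by (rule D(2)[OF D(4)[OF Suc] D(3)[OF D(3)[OF rel]]])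
    also have "(y * x ^ Suc k - (nc_scale (q ^ Suc k) (x ^ Suc k * y) + nc_scale (c * (\<Sum>i<Suc k. q ^ i)) (x ^ k))) * x
      + nc_const (q ^ Suc k) * (x ^ Suc k * (y * x - nc_scale q (x * y) - nc_const c))
      = y * x ^ Suc (Suc k) - (nc_scale (q ^ Suc (Suc k)) (x ^ Suc (Suc k) * y) + nc_scale (c * (\<Sum>i<Suc (Suc k). q ^ i)) (x ^ Suc k))"
      by (simp add: nc_scale_simps algebra_simps power_commutes xk)
    finally show ?case .
  qed (use rel in \<open>simp add: nc_scale_simps one algebra_simps\<close>)
  have comm_y: "y ^ Suc k * x - (nc_scale (q ^ Suc k) (x * y ^ Suc k) + nc_scale (c * (\<Sum>i<Suc k. q ^ i)) (y ^ k)) \<in> I" for k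
  proof (induction k)
    case (Suc k)
    have "y * (y ^ Suc k * x - (nc_scale (q ^ Suc k) (x * y ^ Suc k) + nc_scale (c * (\<Sum>i<Suc k. q ^ i)) (y ^ k)))
      + nc_const (q ^ Suc k) * ((y * x - nc_scale q (x * y) - nc_const c) * y ^ Suc k) \<in> I"
      by (rule D(2)[OF D(3)[OF Suc] D(3)[OF D(4)[OF rel]]])
    also have "y * (y ^ Suc k * x - (nc_scale (q ^ Suc k) (x * y ^ Suc k) + nc_scale (c * (\<Sum>i<Suc k. q ^ i)) (y ^ k)))
      + nc_const (q ^ Suc k) * ((y * x - nc_scale q (x * y) - nc_const c) * y ^ Suc k)
      = y ^ Suc (Suc k) * x - (nc_scale (q ^ Suc (Suc k)) (x * y ^ Suc (Suc k)) + nc_scale (c * (\<Sum>i<Suc (Suc k). q ^ i)) (y ^ Suc k))"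
      by (simp add: nc_scale_simps algebra_simps)
    finally show ?case .
  qed (use rel in \<open>simp add: nc_scale_simps one algebra_simps\<close>)
  obtain l' where l': "l = Suc l'" using q(3) by (cases l) auto
  \<comment> \<open>The geometric sum over all powers of a root of unity other than 1 is
    zero.\<close>
  have s0: "(\<Sum>i<Suc l'. q ^ i) = 0" and q1: "q ^ Suc l' = 1"
    using geometric_sum[OF q(1), of "Suc l'"] q(2) by (simp_all add: l')
  have xl: "x ^ l * y - y * x ^ l \<in> I"
    using D(5)[OF comm_x[of l', unfolded s0 q1]] unfolding l' by (simp only: nc_scale_simps mult_zero_right add_0_right minus_diff_eq)
  have yl: "y ^ l * x - x * y ^ l \<in> I"
    using comm_y[of l', unfolded s0 q1] unfolding l' by (simp only: nc_scale_simps mult_zero_right add_0_right)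
  have central: "z * g - g * z \<in> I" if zx: "z * x - x * z \<in> I" and zy: "z * y - y * z \<in> I" for z g
  proof (induction g rule: nc_poly_induct)
    case (const d)
    then show ?case using D(1) by (simp add: nc_scale_simps)
  next
    case (var f v)
    obtain a b d where v: "nc_var v - (nc_scale a x + nc_scale b y + nc_const d) \<in> I" (is "?e \<in> I") using gen unfolding affine_generators_def by blast
    have "(z * f - f * z) * nc_var v + f * (z * ?e - ?e * z + nc_const a * (z * x - x * z) + nc_const b * (z * y - y * z)) \<in> I"
      by (intro D(2) D(6) D(3,4) zx zy v var)
    also have "(z * f - f * z) * nc_var v + f * (z * ?e - ?e * z + nc_const a * (z * x - x * z) + nc_const b * (z * y - y * z))
      = z * (f * nc_var v) - (f * nc_var v) * z"
      by (simp add: nc_scale_simps algebra_simps)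
    finally show ?case .
  next
    case (add f g)
    from D(2)[OF this] show ?case by (simp add: algebra_simps)
  qed
  have xc: "x ^ l * h - h * x ^ l \<in> I" for h
    by (rule central) (use xl D(1) in \<open>simp_all add: power_commutes\<close>)
  have yc: "y ^ l * h - h * y ^ l \<in> I" for h
    by (rule central) (use yl D(1) in \<open>simp_all add: power_commutes\<close>)
  define B where "B = (\<lambda>(i, j). x ^ i * y ^ j) ` ({..<l} \<times> {..<l})"
  have B: "x ^ i * y ^ j \<in> B" if "i < l" "j < l" for i j using that by (force simp: B_def)
  let ?S = "central_span I B"
  have S_scale: "nc_scale d f \<in> ?S" if "f \<in> ?S" for d f
    using central_span.scale[of "nc_const d" I f B] that D(1) by (simp add: nc_scale_simps)
  have S_cong: "f \<in> ?S" if "g \<in> ?S" "f - g \<in> I" for f g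
    using central_span.add[OF that(1) central_span.ideal[OF that(2)]] by simp
  have S_x: "x ^ i * y ^ j \<in> ?S" if "i \<le> l" "j \<le> l" for i j
  proof -
    have y: "x ^ i * y ^ j \<in> ?S" if "i < l" "j \<le> l" for i j
    proof (cases "j = l")
      case True
      have "y ^ l * (x ^ i * y ^ 0) \<in> ?S" by (intro central_span.scale central_span.base B yc) (use that q in auto)
      moreover have "x ^ i * y ^ l - y ^ l * (x ^ i * y ^ 0) \<in> I" using D(5)[OF yc[of "x ^ i"]] by simp
      ultimately show ?thesis unfolding True by (rule S_cong)
    qed (rule central_span.base, rule B, use that in auto)
    show ?thesis
    proof (cases "i = l")
      case True
      have "x ^ l * (x ^ 0 * y ^ j) \<in> ?S" by (intro central_span.scale xc y) (use that q in auto)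
      then show ?thesis by (simp add: True)
    qed (use that y in auto)
  qed
  have mult_base: "x * b \<in> ?S" "y * b \<in> ?S" if b: "b \<in> B" for b
  proof -
    obtain i j where ij: "i < l" "j < l" "b = x ^ i * y ^ j" using b by (auto simp: B_def)
    show "x * b \<in> ?S" using S_x[of "Suc i" j] ij by (simp add: mult.assoc)
    show "y * b \<in> ?S"
    proof (cases i)
      case 0
      then show ?thesis using S_x[of 0 "Suc j"] ij by simp
    next
      case (Suc k)
      have "nc_scale (q ^ i) (x ^ i * y ^ Suc j) + nc_scale (c * (\<Sum>n<i. q ^ n)) (x ^ k * y ^ j) \<in> ?S"
        by (intro central_span.add S_scale S_x) (use ij Suc in auto)
      moreover have "y * b - (nc_scale (q ^ i) (x ^ i * y ^ Suc j) + nc_scale (c * (\<Sum>n<i. q ^ n)) (x ^ k * y ^ j)) \<in> I"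
        using D(4)[OF comm_x[of k], of "y ^ j"] unfolding Suc ij
        by (simp add: nc_scale_simps left_diff_distrib distrib_right mult.assoc del: power_Suc sum.lessThan_Suc) (simp add: mult.assoc power_commutes)
      ultimately show ?thesis by (rule S_cong)
    qed
  qed
  \<comment> \<open>It suffices to multiply the elements of \<open>B\<close>: central factors
    commute with \<open>t\<close> modulo \<open>I\<close>.\<close>
  have mult: "t * f \<in> ?S" if f: "f \<in> ?S" and t: "\<And>b. b \<in> B \<Longrightarrow> t * b \<in> ?S" for t f
    using f
  proof induction
    case (base b)
    then show ?case by (rule t)
  next
    case (ideal f)
    then show ?case by (intro central_span.ideal D(3))
  next
    case (add f g)
    then show ?case by (simp add: distrib_left central_span.add)
  next
    case (scale z f)
    have "t * (z * f) - z * (t * f) = - ((z * t - t * z) * f)" by (simp add: algebra_simps)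
    also have "\<dots> \<in> I" by (intro D(5) D(4) scale.hyps)
    finally show ?case using S_cong[OF central_span.scale[OF scale.hyps(1) scale.IH]] by blast
  qed
  have "f \<in> ?S" for f
  proof (induction f rule: nc_poly_induct_left)
    case (const d)
    have "1 \<in> ?S" using S_x[of 0 0] by simp
    from S_scale[OF this, of d] show ?case by (simp add: nc_scale_def)
  next
    case (var f v)
    obtain a b d where v: "nc_var v - (nc_scale a x + nc_scale b y + nc_const d) \<in> I" (is "?e \<in> I") using gen unfolding affine_generators_def by blast
    have "?e * f + (nc_scale a (x * f) + nc_scale b (y * f) + nc_scale d f) \<in> ?S"
      by (intro central_span.add central_span.ideal[OF D(4)[OF v]] S_scale var mult[OF var mult_base(1)] mult[OF var mult_base(2)])
    then show ?case by (simp add: nc_scale_simps algebra_simps)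
  next
    case (add f g)
    then show ?case by (rule central_span.add)
  qed
  then have "?S = UNIV" by blast
  moreover have "finite B" by (simp add: B_def)
  ultimately show ?thesis by blast
qed

section \<open>Modules over a presented algebra\<close>

lemma pev_monom: "pev (monom c i) a = nc_const c * a ^ i"
proof (induction i)
  case 0
  then show ?case by (simp add: monom_0)
next
  case (Suc i)
  then show ?case by (simp add: monom_Suc nc_scale_simps)
qed

lemma pev_sum: "pev (sum p S) a = (\<Sum>i\<in>S. pev (p i) a)"
  by (induction S rule: infinite_finite_induct) (simp_all add: pev_add)

text \<open>For a single vector, \<open>card S + 1\<close> successive powers of \<open>a\<close>
  give dependent vectors, hence an annihilating polynomial; the product over the spanning vectors
  works for all.\<close>

lemma annihilating_poly:
  fixes g :: "'s \<Rightarrow> ('v, 'k :: field) nc_poly"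
  assumes L: "left_ideal L" and S: "finite S" and span: "\<And>f. \<exists>c. f - (\<Sum>s\<in>S. nc_const (c s) * g s) \<in> L"
  shows "\<exists>m :: 'k poly. m \<noteq> 0 \<and> (\<forall>f. pev m a * f \<in> L)"
proof -
  note D = left_idealD[OF L]
  have single: "\<exists>m :: 'k poly. m \<noteq> 0 \<and> pev m a * f \<in> L" for f
  proof -
    let ?X = "{..card S}"
    have "\<forall>i. \<exists>c. a ^ i * f - (\<Sum>s\<in>S. nc_const (c s) * g s) \<in> L" using span by blast
    then obtain c where c: "\<forall>i. a ^ i * f - (\<Sum>s\<in>S. nc_const (c i s) * g s) \<in> L" by (rule choice[THEN exE])
    obtain d where d: "\<exists>i\<in>?X. d i \<noteq> 0" "\<forall>s\<in>S. (\<Sum>i\<in>?X. d i * c i s) = 0"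
      using nontrivial_kernel[OF S, of ?X c] by auto
    define m where "m = (\<Sum>i\<in>?X. monom (d i) i)"
    obtain i where i: "i \<in> ?X" "d i \<noteq> 0" using d(1) by blast
    have "coeff m i = d i" using i(1) by (simp add: m_def coeff_sum)
    then have "m \<noteq> 0" using i(2) by auto
    moreover have "pev m a * f \<in> L"
    proof -
      have "(\<Sum>i\<in>?X. nc_const (d i) * (a ^ i * f - (\<Sum>s\<in>S. nc_const (c i s) * g s))) \<in> L"
        using c by (intro left_ideal_sum[OF L] D(3)) blast
      also have "(\<Sum>i\<in>?X. nc_const (d i) * (a ^ i * f - (\<Sum>s\<in>S. nc_const (c i s) * g s)))
        = pev m a * f - (\<Sum>i\<in>?X. \<Sum>s\<in>S. nc_const (d i * c i s) * g s)"
        by (simp add: m_def pev_sum pev_monom right_diff_distrib sum_subtractf sum_distrib_left sum_distrib_right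
            mult.assoc[symmetric] nc_const_mult)
      also have "(\<Sum>i\<in>?X. \<Sum>s\<in>S. nc_const (d i * c i s) * g s) = (\<Sum>s\<in>S. nc_const (\<Sum>i\<in>?X. d i * c i s) * g s)"
        by (subst sum.swap) (simp add: sum_distrib_right nc_const_sum)
      also have "\<dots> = 0" using d(2) by simp
      finally show ?thesis by simp
    qed
    ultimately show ?thesis by blast
  qed
  have "\<exists>m :: 'k poly. m \<noteq> 0 \<and> (\<forall>s\<in>T. pev m a * g s \<in> L)" if "finite T" for T
    using that
  proof (induction T rule: finite_induct)
    case empty
    show ?case by (rule exI[of _ 1]) simp
  next
    case (insert s T)
    then obtain m :: "'k poly" where m: "m \<noteq> 0" "\<forall>s\<in>T. pev m a * g s \<in> L" by blast
    obtain m' :: "'k poly" where m': "m' \<noteq> 0" "pev m' a * (pev m a * g s) \<in> L" using single by blast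
    have "pev (m' * m) a * g t \<in> L" if "t \<in> insert s T" for t
      using that m m' D(3) by (auto simp: pev_mult mult.assoc)
    then show ?case using m(1) m'(1) by (intro exI[of _ "m' * m"]) auto
  qed
  then obtain m :: "'k poly" where m: "m \<noteq> 0" "\<forall>s\<in>S. pev m a * g s \<in> L" using S by blast
  have "pev m a * f \<in> L" for f
  proof -
    obtain c where c: "f - (\<Sum>s\<in>S. nc_const (c s) * g s) \<in> L" using span by blast
    have "pev m a * (f - (\<Sum>s\<in>S. nc_const (c s) * g s)) + (\<Sum>s\<in>S. nc_const (c s) * (pev m a * g s)) \<in> L"
      by (rule D(2)[OF D(3)[OF c] left_ideal_sum[OF L]], rule D(3)) (use m(2) in blast)
    moreover have "pev m a * (nc_const (c s) * g s) = nc_const (c s) * (pev m a * g s)" for s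
      by (simp add: nc_scale_simps)
    ultimately show ?thesis by (simp add: right_diff_distrib sum_distrib_left)
  qed
  then show ?thesis using m(1) by blast
qed

locale presented_module =
  fixes Rel :: "('v, 'k :: {alg_closed_field, field_char_0}) nc_poly set"
    and M :: "(('v, 'k) nc_poly set, 'm) module"
  assumes simple: "simple_module (presented_algebra Rel) M"
    and fin_dim: "vectorspace.fin_dim class_ring (restrict_scalars (presented_algebra Rel) M)"
begin

abbreviation "A \<equiv> presented_algebra Rel"
abbreviation "V \<equiv> restrict_scalars A M"

lemma M: "left_module A M" using simple by (simp add: simple_module_def)

text \<open>The action of the free algebra through the quotient, by which the module becomes
  \<open>F/L\<close>.\<close>

definition act :: "('v, 'k) nc_poly \<Rightarrow> 'm \<Rightarrow> 'm" where "act f m = coset Rel f \<odot>\<^bsub>M\<^esub> m"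

lemma coset_carrier: "coset Rel f \<in> carrier A" by (simp add: presented_algebra_simps)

lemma act_closed: "m \<in> carrier M \<Longrightarrow> act f m \<in> carrier M"
  unfolding act_def by (rule left_moduleD(3)[OF M coset_carrier])

lemma act_add: "m \<in> carrier M \<Longrightarrow> act (f + g) m = act f m \<oplus>\<^bsub>M\<^esub> act g m"
  unfolding act_def using left_moduleD(4)[OF M coset_carrier coset_carrier] by (simp add: presented_algebra_simps)

lemma act_mult: "m \<in> carrier M \<Longrightarrow> act (f * g) m = act f (act g m)"
  unfolding act_def using left_moduleD(6)[OF M coset_carrier coset_carrier] by (simp add: presented_algebra_simps)

lemma act_1: "m \<in> carrier M \<Longrightarrow> act 1 m = m"
  unfolding act_def using left_moduleD(7)[OF M] by (simp add: presented_algebra_simps)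

lemma act_0: "m \<in> carrier M \<Longrightarrow> act 0 m = \<zero>\<^bsub>M\<^esub>"
  unfolding act_def using left_module_zero_smult[OF M] by (simp add: presented_algebra_simps)

lemma act_right_add: "m \<in> carrier M \<Longrightarrow> m' \<in> carrier M \<Longrightarrow> act f (m \<oplus>\<^bsub>M\<^esub> m') = act f m \<oplus>\<^bsub>M\<^esub> act f m'"
  unfolding act_def by (rule left_moduleD(5)[OF M coset_carrier])

lemma abelian: "abelian_group M" by (rule left_moduleD(2)[OF M])

sublocale abelian_group M by (rule abelian)

lemma act_zero: "act f \<zero>\<^bsub>M\<^esub> = \<zero>\<^bsub>M\<^esub>"
  using act_mult[of "\<zero>\<^bsub>M\<^esub>" f 0] act_0[of "\<zero>\<^bsub>M\<^esub>"] by simp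

lemma act_relation: "f \<in> relation_ideal Rel \<Longrightarrow> m \<in> carrier M \<Longrightarrow> act f m = \<zero>\<^bsub>M\<^esub>"
  using coset_eq_iff[of Rel f 0] act_0[of m] by (simp add: act_def)

lemma act_diff_eq:
  assumes m: "m \<in> carrier M" shows "act (f - g) m = \<zero>\<^bsub>M\<^esub> \<longleftrightarrow> act f m = act g m"
proof -
  have "act f m = act (f - g) m \<oplus>\<^bsub>M\<^esub> act g m" using act_add[OF m, of "f - g" g] by simp
  then show ?thesis using act_closed[OF m] by (metis add.r_cancel_one')
qed

lemma act_neg: "m \<in> carrier M \<Longrightarrow> \<ominus>\<^bsub>M\<^esub> act f m = act (- f) m"
  by (rule minus_equality) (simp_all add: act_closed act_add[symmetric] act_0)

lemma finsum_act: "finite S \<Longrightarrow> m \<in> carrier M \<Longrightarrow> (\<Oplus>\<^bsub>M\<^esub>s\<in>S. act (h s) m) = act (\<Sum>s\<in>S. h s) m"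
  by (induction S rule: finite_induct) (simp_all add: act_0 act_add act_closed Pi_iff)

lemma V_simps: "carrier V = carrier M" "add V = add M" "zero V = zero M" "c \<odot>\<^bsub>V\<^esub> m = act (nc_const c) m"
  by (simp_all add: restrict_scalars_def act_def presented_algebra_simps)

lemma vs: "vectorspace class_ring V"
proof -
  have "abelian_group V"
  proof (rule abelian_groupI)
    fix x assume "x \<in> carrier V"
    then show "\<exists>y\<in>carrier V. y \<oplus>\<^bsub>V\<^esub> x = \<zero>\<^bsub>V\<^esub>" using l_neg by (auto simp: V_simps)
  qed (auto simp: V_simps a_ac)
  then have "Module.module class_ring V"
    by (intro Module.module.intro Module.module_axioms.intro)
      (auto simp: V_simps act_closed act_add act_mult act_right_add act_1 nc_const_add nc_const_mult class_ring_simps intro: fieldE(1)[OF class_field])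
  then show ?thesis by (simp add: vectorspace_def class_field)
qed

lemma dim_eq_1:
  assumes m: "m \<in> carrier M" "m \<noteq> \<zero>\<^bsub>M\<^esub>" and scalar: "\<And>w. w \<in> carrier M \<Longrightarrow> \<exists>c. w = act (nc_const c) m"
  shows "vectorspace.dim class_ring V = 1"
proof -
  interpret V: vectorspace class_ring V by (rule vs)
  have lc: "V.lincomb a {m} = act (nc_const (a m)) m" for a
    using m(1) V.finsum_insert[of "{}" m "\<lambda>v. a v \<odot>\<^bsub>V\<^esub> v"] by (simp add: V.lincomb_def V_simps act_closed)
  have "\<not> V.lin_dep {m}"
  proof (rule V.finite_lin_indpt2)
    fix a assume "V.lincomb a {m} = \<zero>\<^bsub>V\<^esub>"
    then have z: "act (nc_const (a m)) m = \<zero>\<^bsub>M\<^esub>" by (simp add: lc V_simps)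
    have "a m = 0"
    proof (rule ccontr)
      assume "a m \<noteq> 0"
      then have "m = act (nc_const (1 / a m) * nc_const (a m)) m" using m(1) by (simp add: nc_const_mult[symmetric] act_1)
      also have "\<dots> = \<zero>\<^bsub>M\<^esub>" using m(1) by (simp only: act_mult z act_zero)
      finally show False using m(2) by simp
    qed
    then show "\<forall>v\<in>{m}. a v = \<zero>\<^bsub>class_ring\<^esub>" by (simp add: class_ring_simps)
  qed (use m(1) in \<open>simp_all add: V_simps\<close>)
  moreover have "V.gen_set {m}"
  proof -
    have "w \<in> V.span {m}" if "w \<in> carrier M" for w
    proof -
      obtain c where "w = act (nc_const c) m" using scalar \<open>w \<in> carrier M\<close> by blast
      then show ?thesis using m(1) by (subst V.finite_span) (auto simp: V_simps lc class_ring_simps intro!: exI[of _ "\<lambda>_. c"])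
    qed
    then show ?thesis using V.span_is_subset2[of "{m}"] m(1) by (auto simp: V_simps)
  qed
  ultimately have "V.basis {m}" using m(1) by (simp add: V.basis_def V_simps)
  then show ?thesis using V.dim_basis[of "{m}"] by simp
qed

lemma submodule_image:
  assumes m: "m \<in> carrier M" and N: "left_ideal N"
  shows "Module.submodule ((\<lambda>f. act f m) ` N) A M"
proof (intro Module.submodule.intro subgroup.intro)
  note D = left_idealD[OF N]
  show "inv\<^bsub>add_monoid M\<^esub> x \<in> (\<lambda>f. act f m) ` N" if "x \<in> (\<lambda>f. act f m) ` N" for x
    using that act_neg[OF m] D(4) by (auto simp: a_inv_def)
  show "Module.submodule_axioms ((\<lambda>f. act f m) ` N) A M"
  proof
    fix a x assume "a \<in> carrier A" "x \<in> (\<lambda>f. act f m) ` N"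
    then obtain r f where "a = coset Rel r" "x = act f m" "f \<in> N" by (auto simp: presented_algebra_simps)
    then have "a \<odot>\<^bsub>M\<^esub> x = act (r * f) m" "r * f \<in> N" using act_mult[OF m] D(3) by (simp_all add: act_def)
    then show "a \<odot>\<^bsub>M\<^esub> x \<in> (\<lambda>f. act f m) ` N" by blast
  qed
qed (use left_idealD[OF N] m act_closed act_0[OF m] act_add[OF m, symmetric] in \<open>auto simp: image_iff intro!: bexI\<close>)

text \<open>\<open>L\<close> is the annihilator of a nonzero vector \<open>m\<close>. Simplicity
  makes \<open>m\<close> a generator and \<open>L\<close> maximal; if every polynomial is a scalar
  modulo \<open>L\<close>, the multiples of \<open>m\<close> exhaust the module.\<close>

lemma dim_eq_1_of_scalars:
  assumes "\<And>L. simple_quotient L \<Longrightarrow> relation_ideal Rel \<subseteq> simple_quotient.ann L \<Longrightarrow> (\<forall>f. \<exists>c. f - nc_const c \<in> L)"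
  shows "vectorspace.dim class_ring V = 1"
proof -
  obtain m where m: "m \<in> carrier M" "m \<noteq> \<zero>\<^bsub>M\<^esub>"
    using simple by (auto simp: simple_module_def zero_module_def)
  define L where "L = {f. act f m = \<zero>\<^bsub>M\<^esub>}"
  have L: "left_ideal L"
    unfolding left_ideal_def L_def using m(1) by (auto simp: act_0 act_add act_mult act_zero)
  have images: "(\<lambda>f. act f m) ` N = {\<zero>\<^bsub>M\<^esub>} \<or> (\<lambda>f. act f m) ` N = carrier M" if "left_ideal N" for N
    using simple submodule_image[OF m(1) that] by (simp add: simple_module_def)
  have proper: "1 \<notin> L" using m by (simp add: L_def act_1)
  have "left_ideal (UNIV :: ('v, 'k) nc_poly set)" by (simp add: left_ideal_def)
  from images[OF this] have cyclic: "range (\<lambda>f. act f m) = carrier M"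
    using act_1[OF m(1)] m(2) by (metis rangeI singletonD)
  have maximal: "N = L \<or> N = UNIV" if N: "left_ideal N" "L \<subseteq> N" for N
    using images[OF N(1)]
  proof
    assume "(\<lambda>f. act f m) ` N = {\<zero>\<^bsub>M\<^esub>}"
    then have "N \<subseteq> L" by (auto simp: L_def)
    then show ?thesis using N(2) by blast
  next
    assume "(\<lambda>f. act f m) ` N = carrier M"
    then obtain f where f: "f \<in> N" "act f m = act 1 m" using m(1) act_1[OF m(1)] by force
    then have "f - 1 \<in> N" using N(2) act_diff_eq[OF m(1)] by (auto simp: L_def)
    then have "1 \<in> N" using left_idealD(5)[OF N(1) f(1)] by fastforce
    then have "N = UNIV" using left_idealD(3)[OF N(1), of 1] by auto
    then show ?thesis ..
  qed
  interpret V: vectorspace class_ring V by (rule vs)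
  obtain S where S: "finite S" "S \<subseteq> carrier M" "V.gen_set S" using fin_dim unfolding V.fin_dim_def V_simps by blast
  have "\<forall>s. \<exists>g. s \<in> carrier M \<longrightarrow> s = act g m" using cyclic by blast
  then obtain g where g: "\<forall>s. s \<in> carrier M \<longrightarrow> s = act (g s) m" by (rule choice[THEN exE])
  have span: "\<exists>c. f - (\<Sum>s\<in>S. nc_const (c s) * g s) \<in> L" for f
  proof -
    have "act f m \<in> V.span S" using S(3) act_closed[OF m(1)] by (simp add: V_simps)
    then obtain c where c: "act f m = V.lincomb c S" using V.finite_span[OF S(1)] S(2) by (auto simp: V_simps)
    have "V.lincomb c S = (\<Oplus>\<^bsub>V\<^esub>s\<in>S. act (nc_const (c s) * g s) m)"
      unfolding V.lincomb_def
    proof (rule V.finsum_cong')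
      show "c s \<odot>\<^bsub>V\<^esub> s = act (nc_const (c s) * g s) m" if "s \<in> S" for s
        using that S(2) g m(1) by (auto simp: V_simps act_mult)
    qed (auto simp: V_simps act_closed m(1))
    also have "\<dots> = (\<Oplus>\<^bsub>M\<^esub>s\<in>S. act (nc_const (c s) * g s) m)"
      by (simp add: finsum_def finprod_def restrict_scalars_def)
    also have "\<dots> = act (\<Sum>s\<in>S. nc_const (c s) * g s) m" by (rule finsum_act[OF S(1) m(1)])
    finally have "f - (\<Sum>s\<in>S. nc_const (c s) * g s) \<in> L" using c act_diff_eq[OF m(1)] by (simp add: L_def)
    then show ?thesis by blast
  qed
  have sq: "simple_quotient L"
    by (intro simple_quotient.intro L proper maximal annihilating_poly[OF L S(1) span])
  have "relation_ideal Rel \<subseteq> simple_quotient.ann L"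
  proof
    fix r assume "r \<in> relation_ideal Rel"
    then have "r * f \<in> L" for f using act_relation[OF relation_idealD(4) m(1)] by (simp add: L_def)
    then show "r \<in> simple_quotient.ann L" by (simp add: simple_quotient.ann_def[OF sq])
  qed
  from assms[OF sq this] have scalar: "\<exists>c. f - nc_const c \<in> L" for f by blast
  show ?thesis
  proof (rule dim_eq_1[OF m])
    fix w assume "w \<in> carrier M"
    then obtain f where f: "w = act f m" using cyclic by blast
    obtain c where "f - nc_const c \<in> L" using scalar by blast
    then show "\<exists>c. w = act (nc_const c) m" unfolding f using act_diff_eq[OF m(1)] by (auto simp: L_def)
  qed
qed

end

section \<open>Choice of minimal relations, and the conclusion\<close>

lemma (in central_homogenization) exists_minimal_relations: "\<exists>R. minimal_relations fs R"
proof -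
  note JD = two_sided_idealD[OF ideal_J]
  note JP = ideal_plus_closed[OF ideal_J]
  define gen where "gen R \<longleftrightarrow> R \<subseteq> set fs \<and> (\<forall>j\<in>J. \<exists>b. j - (\<Sum>f\<in>R. b f * top_part f) \<in> ideal_plus J)" for R
  have top: "top_part f \<in> J" if "f \<in> set fs" for f
    unfolding J_def using that by (intro relation_ideal_base) blast
  \<comment> \<open>\<open>?N\<close> is a two-sided ideal between the top parts and
    \<open>J\<close>, hence equal to \<open>J\<close>. So all of \<open>fs\<close> is a generating
    set, and one of least size admits no removal.\<close>
  let ?N = "{y. \<exists>b. y - (\<Sum>f\<in>set fs. b f * top_part f) \<in> ideal_plus J}"
  have plus: "z \<in> ?N" if "z \<in> ideal_plus J" for z using that by (intro CollectI exI[of _ "\<lambda>_. 0"]) simp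
  have "two_sided_ideal ?N"
  proof (rule two_sided_idealI_left[OF _ _ _ ideal_J])
    show "0 \<in> ?N" using JP(1) by (rule plus)
    show "a + b \<in> ?N" if ab: "a \<in> ?N" "b \<in> ?N" for a b
    proof -
      obtain c d where "a - (\<Sum>f\<in>set fs. c f * top_part f) \<in> ideal_plus J" "b - (\<Sum>f\<in>set fs. d f * top_part f) \<in> ideal_plus J"
        using ab by blast
      from JP(2)[OF this] show ?thesis
        by (intro CollectI exI[of _ "\<lambda>f. c f + d f"]) (simp add: distrib_right sum.distrib algebra_simps)
    qed
    show "r * a \<in> ?N" if a: "a \<in> ?N" for r a
    proof -
      obtain c where "a - (\<Sum>f\<in>set fs. c f * top_part f) \<in> ideal_plus J" using a by blast
      from JP(4)[OF this, of r] show ?thesis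
        by (intro CollectI exI[of _ "\<lambda>f. r * c f"]) (simp add: right_diff_distrib sum_distrib_left mult.assoc)
    qed
    show "?N \<subseteq> J"
    proof
      fix y assume "y \<in> ?N"
      then obtain c where "y - (\<Sum>f\<in>set fs. c f * top_part f) \<in> ideal_plus J" by blast
      then have "y - (\<Sum>f\<in>set fs. c f * top_part f) \<in> J" using ideal_plus_subset[OF ideal_J] by blast
      moreover have "(\<Sum>f\<in>set fs. c f * top_part f) \<in> J" by (intro two_sided_ideal_sum[OF ideal_J] JD(3) top)
      ultimately show "y \<in> J" using JD(2) by fastforce
    qed
    show "i * nc_var w \<in> ?N" if "i \<in> J" for i w by (rule plus, rule JP(5)[OF that]) simp
  qed
  moreover have "top_part ` set fs \<subseteq> ?N"
  proof safe
    fix f assume f: "f \<in> set fs"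
    have "(\<Sum>g\<in>set fs. (if g = f then 1 else 0) * top_part g) = (\<Sum>g\<in>set fs. if g = f then top_part g else 0)"
      by (rule sum.cong) auto
    then have "(\<Sum>g\<in>set fs. (if g = f then 1 else 0) * top_part g) = top_part f" using f by simp
    then show "\<exists>b. top_part f - (\<Sum>g\<in>set fs. b g * top_part g) \<in> ideal_plus J"
      using JP(1) by (intro exI[of _ "\<lambda>g. if g = f then 1 else 0"]) simp
  qed
  ultimately have "J \<subseteq> ?N" unfolding J_def[symmetric] using relation_ideal_least[of ?N] by (simp add: J_def)
  then have gen0: "gen (set fs)" unfolding gen_def by blast
  define R where "R = arg_min card gen"
  have R: "gen R" and min: "\<And>S. gen S \<Longrightarrow> card R \<le> card S"
    using arg_min_natI[of gen _ card, OF gen0] arg_min_nat_le[of gen _ card] by (auto simp: R_def)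
  have fin: "finite R" using R finite_subset unfolding gen_def by blast
  have "minimal_relations fs R"
  proof (intro minimal_relations.intro minimal_relations_axioms.intro)
    show "central_homogenization fs" by (rule central_homogenization_axioms)
    show "R \<subseteq> set fs" using R by (simp add: gen_def)
    show "\<exists>b. j - (\<Sum>f\<in>R. b f * top_part f) \<in> ideal_plus J" if "j \<in> J" for j
      using R that unfolding gen_def by blast
    show "\<not> (\<forall>j\<in>J. \<exists>b. j - (\<Sum>f\<in>R - {g}. b f * top_part f) \<in> ideal_plus J)" if g: "g \<in> R" for g
    proof
      assume "\<forall>j\<in>J. \<exists>b. j - (\<Sum>f\<in>R - {g}. b f * top_part f) \<in> ideal_plus J"
      then have "gen (R - {g})" using R unfolding gen_def by blast
      then show False using min[of "R - {g}"] card_Diff1_less[OF fin g] by simp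
    qed
  qed
  then show ?thesis by blast
qed

theorem theorem4p9:
  fixes fs :: "('v :: finite, 'k :: {alg_closed_field, field_char_0}) nc_poly list"
    and A :: "('k, ('v, 'k) nc_poly set) module"
    and M :: "(('v, 'k) nc_poly set, 'm) module"
  assumes A: "A = presented_algebra (set fs)"
    and ess_regular: "essentially_regular 2 fs"
    and x0_regular: "non_zero_divisor (homogenization fs) (hom_x0 fs)"
    and not_PI: "\<not> PI_algebra A"
    and simple: "simple_module A M"
    and fin_dim: "vectorspace.fin_dim class_ring (restrict_scalars A M)"
  shows "vectorspace.dim class_ring (restrict_scalars A M) = 1"
proof -
  let ?B = "homogenization fs"
  have reg: "connected_graded ?B (degree_part (hom_relations fs))" "left_gldim ?B = enat 3" "GKdim ?B < \<infinity>"
    using ess_regular by (simp_all add: essentially_regular_def AS_regular_def)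
  then have kalg: "k_algebra ?B" and "\<one>\<^bsub>?B\<^esub> \<noteq> \<zero>\<^bsub>?B\<^esub>" by (simp_all add: connected_graded_def)
  then have one: "1 \<notin> relation_ideal (hom_relations fs)"
    using coset_eq_iff[of "hom_relations fs" 1 0] by (simp add: homogenization_simps presented_algebra_simps)
  interpret H: central_homogenization fs
  proof
    show "left_gldim ?B \<le> enat 3" by (simp add: reg)
    show "1 \<notin> relation_ideal (hom_relations fs)" by (rule one)
    fix a assume "nc_var None * a \<in> relation_ideal (hom_relations fs)"
    then have "coset (hom_relations fs) (nc_var None * a) = coset (hom_relations fs) 0" by (simp add: coset_eq_iff)
    then have zero: "hom_x0 fs \<otimes>\<^bsub>?B\<^esub> coset (hom_relations fs) a = \<zero>\<^bsub>?B\<^esub>"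
      by (simp only: homogenization_simps presented_algebra_simps)
    have "coset (hom_relations fs) a \<in> carrier ?B" by (simp only: homogenization_simps presented_algebra_simps rangeI)
    with zero have "coset (hom_relations fs) a = \<zero>\<^bsub>?B\<^esub>"
      using x0_regular unfolding non_zero_divisor_def by blast
    then have "coset (hom_relations fs) a = coset (hom_relations fs) 0" by (simp only: homogenization_simps presented_algebra_simps)
    then show "a \<in> relation_ideal (hom_relations fs)" by (simp add: coset_eq_iff)
  qed
  obtain R where "minimal_relations fs R" using H.exists_minimal_relations by blast
  then interpret minimal_relations fs R .
  interpret P: presented_module "set fs" M
    using simple fin_dim unfolding A by unfold_locales
  show ?thesis unfolding A
  proof (rule P.dim_eq_1_of_scalars)
    fix L assume "simple_quotient L" and sub: "relation_ideal (set fs) \<subseteq> simple_quotient.ann L"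
    interpret simple_quotient L by fact
    have sub: "IA \<subseteq> ann" using sub by (simp add: IA_def)
    have gens: "affine_generators ann x y" if "affine_generators IA x y" for x y
      using that sub unfolding affine_generators_def by blast
    show "\<forall>f. \<exists>c. f - nc_const c \<in> L"
      using hilbert_dichotomy[OF kalg reg(3)]
    proof (elim disjE conjE bexE)
      assume "hilbert 1 \<le> 1"
      then obtain y where y: "\<And>v. \<exists>a c. nc_var v - (nc_const a * y + nc_const c) \<in> IA" by (rule linear_case) blast
      \<comment> \<open>A single generator is treated as two equal ones, which commute.\<close>
      have "affine_generators IA y y"
        unfolding affine_generators_def
      proof
        fix v
        obtain a c where "nc_var v - (nc_const a * y + nc_const c) \<in> IA" using y by blast
        then show "\<exists>a b c. nc_var v - (nc_scale a y + nc_scale b y + nc_const c) \<in> IA"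
          by (intro exI[of _ a] exI[of _ 0] exI[of _ c]) (simp add: nc_scale_simps)
      qed
      from commuting_imp_scalar[OF gens[OF this]] show ?thesis using AnnD(1) by simp
    next
      fix g assume g: "hilbert 1 = 2" "g \<in> R" "nc_degree g = 2" "\<forall>f\<in>R. f \<noteq> g \<longrightarrow> nc_degree f = 1"
      have "skew_normal_form IA"
      proof (rule quadratic_case[OF g(1-3)])
        show "nc_degree f = 1" if "f \<in> R" "f \<noteq> g" for f using g(4) that by blast
      next
        fix x y :: "('v, 'k) nc_poly" and \<alpha> \<beta> \<gamma> \<delta> l m c
        assume gen: "\<And>v. \<exists>a b c. nc_var v - (nc_scale a x + nc_scale b y + nc_const c) \<in> IA"
          and rel: "nc_scale \<alpha> (x * x) + nc_scale \<beta> (x * y) + nc_scale \<gamma> (y * x) + nc_scale \<delta> (y * y)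
            + (nc_scale l x + nc_scale m y + nc_const c) \<in> IA"
          and nonsquare: "\<not> (\<exists>s t. \<alpha> = s * s \<and> \<beta> = s * t \<and> \<gamma> = t * s \<and> \<delta> = t * t)"
        have "affine_generators IA x y" unfolding affine_generators_def using gen by blast
        then show "skew_normal_form IA" by (rule normal_form[OF ideal_IA _ rel nonsquare])
      qed
      then obtain x y where gen: "affine_generators IA x y"
        and cases: "(\<exists>q c. q \<noteq> 1 \<and> y * x - nc_scale q (x * y) - nc_const c \<in> IA) \<or>
          (\<exists>e a b c. y * x - x * y - (nc_scale e (x * x) + nc_scale a x + nc_scale b y + nc_const c) \<in> IA)"
        unfolding skew_normal_form_def by blast
      have "y * x - x * y \<in> ann" using cases
      proof (elim disjE exE conjE)
        fix q c assume q: "q \<noteq> 1" and rel: "y * x - nc_scale q (x * y) - nc_const c \<in> IA"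
        have "q ^ n \<noteq> 1" if "n > 0" for n
        proof
          assume "q ^ n = 1"
          from root_of_unity_span[OF ideal_IA gen rel q this that] have "PI_algebra A"
            unfolding A IA_def using PI_presented_algebra by blast
          then show False using not_PI by contradiction
        qed
        then show ?thesis using sub rel by (intro quantum_case[OF gens[OF gen]]) blast+
      next
        fix e a b c assume "y * x - x * y - (nc_scale e (x * x) + nc_scale a x + nc_scale b y + nc_const c) \<in> IA"
        then show ?thesis using sub by (intro differential_case[OF gens[OF gen]]) blast
      qed
      from commuting_imp_scalar[OF gens[OF gen] this] show ?thesis by blast
    qed
  qed
qed

end
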